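(* Fix $k\ge1$. In the dynamic Poisson multigraph model described in the context, the following hold as $n\to\infty$. (i) There exists a continuous increasing function $\rho_k:[0,\infty)\to[0,1]$ such that $C_1(G_k(t))/n\to\rho_k(t)$ in probability uniformly in $t\in[0,\infty)$; that is, for every $\varepsilon>0$, with probability tending to $1$, $\rho_k(t)-\varepsilon\le C_1(G_k(t))/n\le\rho_k(t)+\varepsilon$ for all $t\ge0$. (ii) $\sup_{t\ge0}C_2(G_k(t))/n\to0$ in probability. (iii) There exists a threshold $\sigma_k>0$ such that $\rho_k(t)=0$ for $t\le\sigma_k$ and $\rho_k(t)>0$ for $t>\sigma_k$; moreover $\rho_k$ is strictly increasing on $[\sigma_k,\infty)$. (iv) There exist constants $b_k,B_k>0$ such that $1-\rho_k(t)\le B_k e^{-b_k t}$ for all $t\ge0$; in particular $\rho_k(t)\to1$ as $t\to\infty$. (v) If $t>\sigma_k$, then with probability tending to $1$, $G_k(t)$ has a non-empty permanent giant. Hence, for every $t\ge0$, $|\mathcal C^*_k(t)|/n\to\rho_k(t)$ in probability, where $\mathcal C^*_k(t)$ is the permanent giant of $G_k(t)$.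
   Context: Model: vertex set $[n]$. For each unordered pair $\{i,j\}$ of distinct vertices, edges between $i$ and $j$ arrive at the points of a Poisson process of rate $1/n$ on $(0,\infty)$, independently over pairs; an edge arriving at time $t$ has cost $t/n$. $G_1(t)$ is the multigraph of all edges arrived by time $t$. Recursively for $k\ge1$: $F_k(t)$ is the subgraph of $G_k(t)$ consisting of those edges which, at their arrival time $s\le t$, joined two different components of $G_k(s)$; and $G_{k+1}(t):=G_k(t)\setminus F_k(t)$ (the edges of $G_k(t)$ not in $F_k(t)$). Each $F_k(t)$ is a forest with the same components (as vertex sets) as $G_k(t)$. For a graph $G$, $C_1(G)\ge C_2(G)\ge\cdots$ are the numbers of vertices of its components in decreasing order ($C_i(G)=0$ if there are fewer than $i$ components). A component of $G$ is the unique giant if it is strictly larger than every other component (if the maximum size is tied, the unique giant is $\emptyset$). A component of $G_k(t)$ is the permanent giant if it is the unique giant of $G_k(t)$ and, for every $u>t$, it is contained in the unique giant of $G_k(u)$; otherwise the permanent giant is $\emptyset$. *)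

theory Defs
  imports "HOL-Probability.Probability" "HOL-Library.Multiset"
begin

text \<open>An edge label ((i,j),m) with i < j denotes the m-th arrival (counting from 0)
  of the Poisson process attached to the vertex pair {i,j}.\<close>
type_synonym edge = "(nat \<times> nat) \<times> nat"

text \<open>Probability space for size n: i.i.d. exponential inter-arrival times of rate 1/n,
  one for every label. Only labels in all_edges n are used.\<close>
definition poisson_model :: "nat \<Rightarrow> (edge \<Rightarrow> real) measure" where
  "poisson_model n = (\<Pi>\<^sub>M e\<in>(UNIV::edge set). density lborel (exponential_density (1 / real n)))"

definition arr :: "(edge \<Rightarrow> real) \<Rightarrow> edge \<Rightarrow> real" where
  "arr \<omega> e = (\<Sum>l\<le>snd e. \<omega> (fst e, l))"

definition all_edges :: "nat \<Rightarrow> edge set" where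
  "all_edges n = {((i,j),m). i < j \<and> j < n}"

definition adj :: "edge set \<Rightarrow> nat rel" where
  "adj E = {(fst (fst e), snd (fst e)) | e. e \<in> E} \<union> {(snd (fst e), fst (fst e)) | e. e \<in> E}"

definition connected_in :: "edge set \<Rightarrow> nat \<Rightarrow> nat \<Rightarrow> bool" where
  "connected_in E u v \<longleftrightarrow> (u, v) \<in> (adj E)\<^sup>*"

text \<open>Gall k tau A: all edges (over all times) of G_k, given arrival times tau and
  the set A of all edge labels. An edge of G_k lies in F_k iff at its arrival its endpoints
  were in different components of G_k (just before its arrival); G_(k+1) keeps the others.\<close>
fun Gall :: "nat \<Rightarrow> (edge \<Rightarrow> real) \<Rightarrow> edge set \<Rightarrow> edge set" where
  "Gall 0 \<tau> A = A"
| "Gall (Suc 0) \<tau> A = A"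
| "Gall (Suc (Suc k)) \<tau> A =
     {e \<in> Gall (Suc k) \<tau> A.
        connected_in {e' \<in> Gall (Suc k) \<tau> A. \<tau> e' < \<tau> e} (fst (fst e)) (snd (fst e))}"

definition Gt :: "nat \<Rightarrow> nat \<Rightarrow> (edge \<Rightarrow> real) \<Rightarrow> real \<Rightarrow> edge set" where
  "Gt k n \<omega> t = {e \<in> Gall k (arr \<omega>) (all_edges n). arr \<omega> e \<le> t}"

definition component :: "nat set \<Rightarrow> edge set \<Rightarrow> nat \<Rightarrow> nat set" where
  "component V E v = {u \<in> V. connected_in E v u}"

definition components :: "nat set \<Rightarrow> edge set \<Rightarrow> nat set set" where
  "components V E = component V E ` V"

definition Csize :: "nat \<Rightarrow> nat set \<Rightarrow> edge set \<Rightarrow> nat" where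
  "Csize i V E = (let xs = rev (sorted_list_of_multiset (image_mset card (mset_set (components V E))))
                  in if 1 \<le> i \<and> i \<le> length xs then xs ! (i - 1) else 0)"

definition is_ugiant :: "nat set \<Rightarrow> edge set \<Rightarrow> nat set \<Rightarrow> bool" where
  "is_ugiant V E C \<longleftrightarrow> C \<in> components V E \<and> (\<forall>D \<in> components V E. D \<noteq> C \<longrightarrow> card D < card C)"

definition ugiant :: "nat set \<Rightarrow> edge set \<Rightarrow> nat set" where
  "ugiant V E = (if \<exists>C. is_ugiant V E C then (THE C. is_ugiant V E C) else {})"

definition perm_giant :: "(real \<Rightarrow> edge set) \<Rightarrow> nat set \<Rightarrow> real \<Rightarrow> nat set" where
  "perm_giant G V t = (let C = ugiant V (G t) in
      if C \<noteq> {} \<and> (\<forall>u>t. C \<subseteq> ugiant V (G u)) then C else {})"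

text \<open>With probability tending to 1 (inner probability, robust to measurability issues).\<close>
definition whp :: "(nat \<Rightarrow> 'a measure) \<Rightarrow> (nat \<Rightarrow> 'a \<Rightarrow> bool) \<Rightarrow> bool" where
  "whp M P \<longleftrightarrow> (\<exists>B. (\<forall>n. B n \<in> sets (M n) \<and> B n \<subseteq> {\<omega> \<in> space (M n). P n \<omega>})
                     \<and> (\<lambda>n. measure (M n) (B n)) \<longlonglongrightarrow> 1)"

end

theory Submission
  imports Defs
begin

text \<open>
  By induction over the layers. An edge of \<open>G_k\<close> that arrives inside a component of \<open>G_k\<close> does not
  influence the components of \<open>G_k\<close>. Hence, conditionally on the evolution of these components,
  \<open>G_(k+1)\<close> consists of independent Poisson arrivals on every pair, started when the pair becomes
  connected in \<open>G_k\<close>. Up to few pairs this happens when both vertices have joined the giant of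
  \<open>G_k\<close>, and so \<open>G_(k+1)(t)\<close> is close to an inhomogeneous random graph with kernel
  \<open>(t - max x y)^+\<close> on the joining times, whose distribution function is \<open>\<rho>_k\<close>. The number \<open>\<rho>_(k+1)(t)\<close>
  is the survival probability of the corresponding branching process, i.e. the integral of the
  largest solution of \<open>f x = 1 - exp (- \<integral> (t - max x y)^+ f y)\<close>.

  In the graph, survival for \<open>r\<close> generations is replaced by the existence of a self-avoiding walk
  of length \<open>r\<close>. Its probability satisfies the recursion of the branching process up to an error
  that is controlled by the variance of the number of such starting points, which in turn is
  bounded by recursion on \<open>r\<close>. This bounds the giant from above; adding the edges that arrive in a
  short time interval (sprinkling) shows that almost all starting points of long walks lie in one
  component.

  The conditional independence is proved for a discretised model in which every pair has independent
  Bernoulli arrivals in small time slots; there it is an exchange of two independent samples.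
\<close>

section \<open>Random subsets of a finite set\<close>

text \<open>Up to the coupling all probabilities are finite weighted sums over subsets, with
  inclusion probability 1 - exp(-\<theta>). Avoiding a set Q then costs exactly exp(-\<theta> |Q|),
  so that exploring the graph produces the exponentials of the branching recursion without error; it
  is also the law that rounded exponential waiting times produce. The obstacle is that a layer is an
  inhomogeneous graph known only through finitely many observations of its predecessor. The
  estimates for walks therefore use nothing but a uniform bound t/n on the edge rates, and the
  kernel enters only through a comparison on average. Two analytic facts about \<rho> carry the
  induction. Left continuity pays for the short time reserved for sprinkling; it needs an argument
  of its own, since an infimum of continuous functions of time is in general only upper
  semicontinuous. The exponential tail makes \<rho> a distribution function, so that the joining
  times seen by the next layer have a law. The slot length n^(-3) is short enough that, with high
  probability, rounding to slots does not alter the order of the arrivals up to a fixed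
  time.\<close>

lemma exp_minus_lipschitz:
  fixes x y :: real
  assumes "0 \<le> x" "0 \<le> y"
  shows "\<bar>exp (-x) - exp (-y)\<bar> \<le> \<bar>x - y\<bar>"
proof -
  have *: "exp (-a) - exp (-b) \<le> b - a" if "0 \<le> a" "a \<le> b" for a b :: real
  proof -
    have "exp (-a) - exp (-b) = exp (-a) * (1 - exp (-(b-a)))"
      by (simp add: algebra_simps flip: exp_add)
    also have "\<dots> \<le> 1 * (b - a)"
      using that exp_ge_add_one_self[of "-(b-a)"] by (intro mult_mono) (auto simp: algebra_simps)
    finally show ?thesis by simp
  qed
  have "exp (-max x y) \<le> exp (-min x y)" by simp
  then show ?thesis
    using *[of x y] *[of y x] assms by (auto simp: abs_if min_def max_def split: if_splits)
qed

locale random_subset =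
  fixes \<theta> :: real
  assumes theta_nonneg: "0 \<le> \<theta>"
begin

text \<open>Expectation of \<open>f\<close> over a random subset of \<open>A\<close> that contains
  each element independently with probability 1 - exp(-\<theta>). As a finite sum it raises no
  measurability questions and can be nested freely.\<close>

definition rex :: "'a set \<Rightarrow> ('a set \<Rightarrow> real) \<Rightarrow> real" where
  "rex A f = (\<Sum>H\<in>Pow A. (1 - exp (-\<theta>)) ^ card H * exp (-\<theta>) ^ card (A - H) * f H)"

lemma rex_empty [simp]: "rex {} f = f {}"
  by (simp add: rex_def)

lemma rex_insert:
  assumes "finite A" "a \<notin> A"
  shows "rex (insert a A) f = exp (-\<theta>) * rex A f + (1 - exp (-\<theta>)) * rex A (\<lambda>H. f (insert a H))"
proof -
  let ?p = "1 - exp (-\<theta>)" and ?q = "exp (-\<theta>)"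
  have inj: "inj_on (insert a) (Pow A)"
    using assms by (auto simp: inj_on_def)
  have disj: "Pow A \<inter> insert a ` Pow A = {}" using assms by auto
  have "rex (insert a A) f =
    (\<Sum>H\<in>Pow A. ?p ^ card H * ?q ^ card (insert a A - H) * f H) +
    (\<Sum>H\<in>insert a ` Pow A. ?p ^ card H * ?q ^ card (insert a A - H) * f H)"
    unfolding rex_def Pow_insert using assms disj by (subst sum.union_disjoint) auto
  also have "(\<Sum>H\<in>Pow A. ?p ^ card H * ?q ^ card (insert a A - H) * f H) = ?q * rex A f"
    unfolding rex_def sum_distrib_left
  proof (rule sum.cong)
    fix H assume "H \<in> Pow A"
    then have "insert a A - H = insert a (A - H)" "a \<notin> A - H" "finite (A - H)"
      using assms by auto
    then show "?p ^ card H * ?q ^ card (insert a A - H) * f H =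
        ?q * (?p ^ card H * ?q ^ card (A - H) * f H)"
      by simp
  qed simp
  also have "(\<Sum>H\<in>insert a ` Pow A. ?p ^ card H * ?q ^ card (insert a A - H) * f H)
    = ?p * rex A (\<lambda>H. f (insert a H))"
    unfolding rex_def sum_distrib_left sum.reindex[OF inj] o_def
  proof (rule sum.cong)
    fix H assume "H \<in> Pow A"
    then have "insert a A - insert a H = A - H" "card (insert a H) = Suc (card H)"
      using assms finite_subset[of H A] by (auto simp: card_insert_if)
    then show "?p ^ card (insert a H) * ?q ^ card (insert a A - insert a H) * f (insert a H) =
        ?p * (?p ^ card H * ?q ^ card (A - H) * f (insert a H))"
      by simp
  qed simp
  finally show ?thesis .
qed

lemma rex_const [simp]: "finite A \<Longrightarrow> rex A (\<lambda>_. c) = c"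
  by (induction A rule: finite_induct) (auto simp: rex_insert algebra_simps)

lemma rex_cong: "(\<And>H. H \<subseteq> A \<Longrightarrow> f H = g H) \<Longrightarrow> rex A f = rex A g"
  unfolding rex_def by (rule sum.cong) auto

lemma rex_mono: "(\<And>H. H \<subseteq> A \<Longrightarrow> f H \<le> g H) \<Longrightarrow> rex A f \<le> rex A g"
  unfolding rex_def using theta_nonneg by (intro sum_mono mult_left_mono) auto

lemma rex_add: "rex A (\<lambda>H. f H + g H) = rex A f + rex A g"
  unfolding rex_def by (simp add: sum.distrib algebra_simps)

lemma rex_diff: "rex A (\<lambda>H. f H - g H) = rex A f - rex A g"
  unfolding rex_def by (simp add: sum_subtractf algebra_simps)

lemma rex_cmult: "rex A (\<lambda>H. c * f H) = c * rex A f"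
  unfolding rex_def sum_distrib_left by (rule sum.cong) (auto simp: mult.left_commute)

lemma rex_cmult_right: "rex A (\<lambda>H. f H * c) = rex A f * c"
  unfolding rex_def sum_distrib_right by (simp add: mult.assoc)

lemma rex_divide: "rex A (\<lambda>H. f H / c) = rex A f / c"
  using rex_cmult_right[of A f "1 / c"] by simp

lemma rex_sum: "rex A (\<lambda>H. \<Sum>i\<in>I. f i H) = (\<Sum>i\<in>I. rex A (f i))"
  unfolding rex_def sum_distrib_left by (rule sum.swap)

lemma rex_nonneg: "(\<And>H. H \<subseteq> A \<Longrightarrow> 0 \<le> f H) \<Longrightarrow> 0 \<le> rex A f"
  unfolding rex_def using theta_nonneg by (intro sum_nonneg mult_nonneg_nonneg) auto

lemma rex_le_const: "finite A \<Longrightarrow> (\<And>H. H \<subseteq> A \<Longrightarrow> f H \<le> c) \<Longrightarrow> rex A f \<le> c"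
  using rex_mono[of A f "\<lambda>_. c"] by simp

lemma abs_rex_le: "\<bar>rex A f\<bar> \<le> rex A (\<lambda>H. \<bar>f H\<bar>)"
proof -
  have "rex A f \<le> rex A (\<lambda>H. \<bar>f H\<bar>)" by (rule rex_mono) auto
  moreover have "- rex A (\<lambda>H. \<bar>f H\<bar>) \<le> rex A f"
    using rex_mono[of A "\<lambda>H. - \<bar>f H\<bar>" f] rex_cmult[of A "-1" "\<lambda>H. \<bar>f H\<bar>"] by auto
  ultimately show ?thesis by auto
qed

lemma rex_Un:
  assumes "finite A" "finite B" "A \<inter> B = {}"
  shows "rex (A \<union> B) f = rex A (\<lambda>H. rex B (\<lambda>K. f (H \<union> K)))"
  using assms(2,3)
proof (induction B arbitrary: f rule: finite_induct)
  case empty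
  then show ?case by simp
next
  case (insert b B)
  then have "rex (A \<union> insert b B) f
      = exp (-\<theta>) * rex (A \<union> B) f + (1 - exp (-\<theta>)) * rex (A \<union> B) (\<lambda>H. f (insert b H))"
    using assms(1) rex_insert[of "A \<union> B" b f] by simp
  with insert show ?case
    by (simp add: rex_insert rex_add rex_cmult)
qed

lemma rex_restrict:
  assumes "finite A" "B \<subseteq> A"
  shows "rex A (\<lambda>H. f (H \<inter> B)) = rex B f"
proof -
  have fin: "finite B" "finite (A - B)" using assms finite_subset by auto
  have "rex A (\<lambda>H. f (H \<inter> B)) = rex (B \<union> (A - B)) (\<lambda>H. f (H \<inter> B))"
    using assms by (simp add: Un_absorb1)
  also have "\<dots> = rex B (\<lambda>H. rex (A - B) (\<lambda>K. f ((H \<union> K) \<inter> B)))"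
    by (rule rex_Un) (use fin in auto)
  also have "\<dots> = rex B (\<lambda>H. rex (A - B) (\<lambda>K. f H))"
  proof (intro rex_cong)
    fix H K assume "H \<subseteq> B" "K \<subseteq> A - B"
    then have "(H \<union> K) \<inter> B = H" by auto
    then show "f ((H \<union> K) \<inter> B) = f H" by simp
  qed
  also have "\<dots> = rex B f" using fin by simp
  finally show ?thesis .
qed

lemma rex_avoid:
  assumes "finite A" "Q \<subseteq> A"
  shows "rex A (\<lambda>H. of_bool (H \<inter> Q = {})) = exp (- \<theta> * card Q)"
proof -
  have fin: "finite Q" using assms finite_subset by auto
  have "rex A (\<lambda>H. of_bool (H \<inter> Q = {})) = rex Q (\<lambda>H. of_bool (H = {}))"
    using rex_restrict[OF assms, of "\<lambda>H. of_bool (H = {})"] .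
  also have "\<dots> = exp (- \<theta> * card Q)"
    using fin
  proof (induction Q rule: finite_induct)
    case (insert a Q)
    have "rex Q (\<lambda>H. of_bool (insert a H = {})) = 0"
      using insert.hyps rex_const[of Q 0] by simp
    with insert show ?case
      by (simp add: rex_insert algebra_simps flip: exp_add)
  qed simp
  finally show ?thesis .
qed

text \<open>Given \<open>H - B\<close>, the set \<open>Q H\<close> is fixed and lies in the still
  unexplored part \<open>B\<close>, so avoiding it has conditional probability exp(-\<theta> |Q H|).
  This is the exact step from one generation of an exploration to the next.\<close>

lemma rex_peel:
  assumes "finite A" "B \<subseteq> A" and dep: "\<And>H. H \<subseteq> A \<Longrightarrow> Q H = Q (H - B)"
    and sub: "\<And>H. H \<subseteq> A \<Longrightarrow> Q H \<subseteq> B"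
  shows "rex A (\<lambda>H. of_bool (H \<inter> Q H = {})) = rex A (\<lambda>H. exp (- \<theta> * card (Q H)))"
proof -
  have fin: "finite B" "finite (A - B)" using assms finite_subset by auto
  have A: "A = (A - B) \<union> B" using assms by auto
  have dep': "Q (H \<union> K) = Q H" if "H \<subseteq> A - B" "K \<subseteq> B" for H K
  proof -
    have "H \<union> K - B = H" using that by auto
    moreover have "H \<union> K \<subseteq> A" using that assms(2) by auto
    ultimately show ?thesis using dep[of "H \<union> K"] by simp
  qed
  have "rex A (\<lambda>H. of_bool (H \<inter> Q H = {}))
      = rex (A - B) (\<lambda>H. rex B (\<lambda>K. of_bool ((H \<union> K) \<inter> Q (H \<union> K) = {})))"
    by (subst A, rule rex_Un) (use fin in auto)
  also have "\<dots> = rex (A - B) (\<lambda>H. rex B (\<lambda>K. of_bool (K \<inter> Q H = {})))"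
  proof (intro rex_cong)
    fix H K assume HK: "H \<subseteq> A - B" "K \<subseteq> B"
    have "H \<inter> Q H = {}" using sub[of H] HK by auto
    then show "(of_bool ((H \<union> K) \<inter> Q (H \<union> K) = {}) :: real) = of_bool (K \<inter> Q H = {})"
      using dep'[OF HK] by (auto simp: Int_Un_distrib2)
  qed
  also have "\<dots> = rex (A - B) (\<lambda>H. exp (- \<theta> * card (Q H)))"
    by (intro rex_cong rex_avoid) (use fin sub in auto)
  also have "\<dots> = rex (A - B) (\<lambda>H. rex B (\<lambda>K. exp (- \<theta> * card (Q (H \<union> K)))))"
    using fin dep' by (intro rex_cong) (simp cong: rex_cong)
  also have "\<dots> = rex A (\<lambda>H. exp (- \<theta> * card (Q H)))"
    by (subst (2) A, rule rex_Un[symmetric]) (use fin in auto)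
  finally show ?thesis .
qed

lemma rex_indep:
  assumes "finite A" "B \<subseteq> A" and "\<And>H. H \<subseteq> A \<Longrightarrow> f H = f (H - B)"
    and "\<And>H. H \<subseteq> A \<Longrightarrow> g H = g (H \<inter> B)"
  shows "rex A (\<lambda>H. f H * g H) = rex A f * rex A g"
proof -
  have fin: "finite B" "finite (A - B)" using assms finite_subset by auto
  have A: "A = (A - B) \<union> B" using assms by auto
  have f': "f (H \<union> K) = f H" if "H \<subseteq> A - B" "K \<subseteq> B" for H K
  proof -
    have "H \<union> K - B = H" "H \<union> K \<subseteq> A" using that assms(2) by auto
    then show ?thesis using assms(3)[of "H \<union> K"] by simp
  qed
  have g': "g (H \<union> K) = g K" if "H \<subseteq> A - B" "K \<subseteq> B" for H K
  proof -
    have "(H \<union> K) \<inter> B = K" "H \<union> K \<subseteq> A" using that assms(2) by auto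
    then show ?thesis using assms(4)[of "H \<union> K"] by simp
  qed
  have "rex A (\<lambda>H. f H * g H) = rex (A - B) (\<lambda>H. rex B (\<lambda>K. f (H \<union> K) * g (H \<union> K)))"
    by (subst A, rule rex_Un) (use fin in auto)
  also have "\<dots> = rex (A - B) (\<lambda>H. f H * rex B g)"
    using f' g' by (intro rex_cong) (simp add: rex_cmult cong: rex_cong)
  also have "\<dots> = rex (A - B) f * rex B g" by (rule rex_cmult_right)
  also have "rex (A - B) f = rex A f"
  proof -
    have "rex A f = rex A (\<lambda>H. f (H \<inter> (A - B)))"
    proof (rule rex_cong)
      fix H assume "H \<subseteq> A"
      then have "H \<inter> (A - B) = H - B" by auto
      with assms(3)[OF \<open>H \<subseteq> A\<close>] show "f H = f (H \<inter> (A - B))" by simp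
    qed
    then show ?thesis using rex_restrict[OF assms(1), of "A - B" f] by simp
  qed
  also have "rex B g = rex A g"
    unfolding rex_restrict[OF assms(1,2), of g, symmetric]
    by (rule rex_cong, rule assms(4)[symmetric])
  finally show ?thesis .
qed

lemma rex_markov:
  assumes "0 < c" and "\<And>H. H \<subseteq> A \<Longrightarrow> 0 \<le> f H"
  shows "rex A (\<lambda>H. of_bool (c \<le> f H)) \<le> rex A f / c"
  unfolding rex_divide[symmetric]
  by (rule rex_mono) (use assms in \<open>auto simp: field_simps\<close>)

section \<open>Variance and covariance of functions of a random subset\<close>

definition rvar :: "'a set \<Rightarrow> ('a set \<Rightarrow> real) \<Rightarrow> real" where
  "rvar A f = rex A (\<lambda>H. (f H - rex A f)\<^sup>2)"

definition rcov :: "'a set \<Rightarrow> ('a set \<Rightarrow> real) \<Rightarrow> ('a set \<Rightarrow> real) \<Rightarrow> real" where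
  "rcov A f g = rex A (\<lambda>H. (f H - rex A f) * (g H - rex A g))"

lemma rcov_eq: "finite A \<Longrightarrow> rcov A f g = rex A (\<lambda>H. f H * g H) - rex A f * rex A g"
proof -
  assume fin: "finite A"
  let ?a = "rex A f" and ?b = "rex A g"
  have "rcov A f g = rex A (\<lambda>H. (f H * g H - ?b * f H) + (?a * ?b - ?a * g H))"
    unfolding rcov_def by (rule rex_cong) (simp add: algebra_simps)
  also have "\<dots> = rex A (\<lambda>H. f H * g H) - ?b * ?a + (?a * ?b - ?a * ?b)"
    using fin by (simp only: rex_add rex_diff rex_cmult rex_const)
  finally show ?thesis by simp
qed

lemma rvar_le:
  assumes "finite A"
  shows "rvar A f \<le> rex A (\<lambda>H. (f H - c)\<^sup>2)"
proof -
  let ?m = "rex A f"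
  have "rex A (\<lambda>H. (f H - c)\<^sup>2)
      = rex A (\<lambda>H. (f H - ?m)\<^sup>2 + ((2 * (?m - c)) * f H + (c\<^sup>2 - ?m\<^sup>2)))"
    by (rule rex_cong) (simp add: power2_eq_square algebra_simps)
  also have "\<dots> = rvar A f + ((2 * (?m - c)) * ?m + (c\<^sup>2 - ?m\<^sup>2))"
    using assms by (simp only: rvar_def rex_add rex_cmult rex_const)
  also have "\<dots> = rvar A f + (?m - c)\<^sup>2"
    by (simp add: power2_eq_square algebra_simps)
  finally show ?thesis by simp
qed

lemma abs_rcov_le: "\<bar>rcov A f g\<bar> \<le> (rvar A f + rvar A g) / 2"
proof -
  have *: "\<bar>x * y\<bar> \<le> (x\<^sup>2 + y\<^sup>2) / 2" for x y :: real
    using sum_squares_bound[of "\<bar>x\<bar>" "\<bar>y\<bar>"] by (simp add: abs_mult)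
  have "\<bar>rcov A f g\<bar> \<le> rex A (\<lambda>H. \<bar>(f H - rex A f) * (g H - rex A g)\<bar>)"
    unfolding rcov_def by (rule abs_rex_le)
  also have "\<dots> \<le> rex A (\<lambda>H. ((f H - rex A f)\<^sup>2 + (g H - rex A g)\<^sup>2) / 2)"
    by (rule rex_mono) (rule *)
  also have "\<dots> = (rvar A f + rvar A g) / 2"
    by (simp add: rvar_def rex_divide rex_add)
  finally show ?thesis .
qed

text \<open>Cauchy-Schwarz, in the form that |f - E f| has non-negative variance.\<close>

lemma rex_abs_dev: "finite A \<Longrightarrow> (rex A (\<lambda>H. \<bar>f H - rex A f\<bar>))\<^sup>2 \<le> rvar A f"
proof -
  assume fin: "finite A"
  let ?g = "\<lambda>H. \<bar>f H - rex A f\<bar>"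
  have "0 \<le> rcov A ?g ?g" unfolding rcov_def by (rule rex_nonneg) auto
  also have "\<dots> = rvar A f - (rex A ?g)\<^sup>2"
    unfolding rcov_eq[OF fin] by (simp add: rvar_def power2_eq_square)
  finally show "(rex A ?g)\<^sup>2 \<le> rvar A f" by simp
qed

text \<open>x -> exp(-x) is 1-Lipschitz on the non-negative reals, and \<open>rvar_le\<close>
  permits centring at exp(-E X) instead of the mean of exp(-X). The second part bounds the error of
  pulling the expectation into the exponent by a standard deviation.\<close>

lemma rvar_exp_le:
  assumes "finite A" and "\<And>H. H \<subseteq> A \<Longrightarrow> 0 \<le> X H"
  shows "rvar A (\<lambda>H. exp (- X H)) \<le> rvar A X"
    and "\<bar>rex A (\<lambda>H. exp (- X H)) - exp (- rex A X)\<bar> \<le> sqrt (rvar A X)"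
proof -
  note lip = exp_minus_lipschitz
  have E0: "0 \<le> rex A X" by (rule rex_nonneg) (use assms in auto)
  have "rvar A (\<lambda>H. exp (- X H)) \<le> rex A (\<lambda>H. (exp (- X H) - exp (- rex A X))\<^sup>2)"
    by (rule rvar_le) fact
  also have "\<dots> \<le> rvar A X"
    unfolding rvar_def
    by (rule rex_mono) (use lip assms E0 in \<open>simp add: abs_le_square_iff[symmetric]\<close>)
  finally show "rvar A (\<lambda>H. exp (- X H)) \<le> rvar A X" .
  have "\<bar>rex A (\<lambda>H. exp (- X H)) - exp (- rex A X)\<bar> = \<bar>rex A (\<lambda>H. exp (- X H) - exp (- rex A X))\<bar>"
    using assms by (simp add: rex_diff)
  also have "\<dots> \<le> rex A (\<lambda>H. \<bar>exp (- X H) - exp (- rex A X)\<bar>)" by (rule abs_rex_le)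
  also have "\<dots> \<le> rex A (\<lambda>H. \<bar>X H - rex A X\<bar>)"
    by (rule rex_mono) (use lip assms E0 in auto)
  also have "\<dots> \<le> sqrt (rvar A X)"
    using rex_abs_dev[OF assms(1), of X] by (rule real_le_rsqrt)
  finally show "\<bar>rex A (\<lambda>H. exp (- X H)) - exp (- rex A X)\<bar> \<le> sqrt (rvar A X)" .
qed

lemma rvar_cmult: "rvar A (\<lambda>H. c * f H) = c\<^sup>2 * rvar A f"
proof -
  have "(c * f H - c * rex A f)\<^sup>2 = c\<^sup>2 * (f H - rex A f)\<^sup>2" for H
    by (metis power_mult_distrib right_diff_distrib)
  then show ?thesis by (simp only: rvar_def rex_cmult)
qed

lemma rcov_cmult: "rcov A (\<lambda>H. c * f H) (\<lambda>H. d * g H) = c * d * rcov A f g"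
proof -
  have "rcov A (\<lambda>H. c * f H) (\<lambda>H. d * g H)
      = rex A (\<lambda>H. (c * f H - c * rex A f) * (d * g H - d * rex A g))"
    unfolding rcov_def by (simp only: rex_cmult)
  also have "\<dots> = rex A (\<lambda>H. (c * d) * ((f H - rex A f) * (g H - rex A g)))"
    by (rule rex_cong) (simp add: right_diff_distrib left_diff_distrib mult_ac)
  also have "\<dots> = c * d * rcov A f g" unfolding rcov_def by (rule rex_cmult)
  finally show ?thesis .
qed

lemma rvar_sum:
  "rvar A (\<lambda>H. \<Sum>i\<in>I. f i H) = (\<Sum>i\<in>I. \<Sum>j\<in>I. rcov A (f i) (f j))"
proof -
  have "rvar A (\<lambda>H. \<Sum>i\<in>I. f i H)
    = rex A (\<lambda>H. (\<Sum>i\<in>I. f i H - rex A (f i)) * (\<Sum>j\<in>I. f j H - rex A (f j)))"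
    by (simp add: rvar_def rex_sum sum_subtractf power2_eq_square)
  also have "\<dots> = (\<Sum>i\<in>I. \<Sum>j\<in>I. rcov A (f i) (f j))"
    unfolding sum_product rcov_def by (simp only: rex_sum)
  finally show ?thesis .
qed

text \<open>Lets two indicators be replaced by nearby ones whose joint law is known exactly; only L1
  distances enter.\<close>

lemma rcov_perturb:
  assumes "finite A" and "\<And>H. H \<subseteq> A \<Longrightarrow> f H \<in> {0..1}" "\<And>H. H \<subseteq> A \<Longrightarrow> g H \<in> {0..1}"
    "\<And>H. H \<subseteq> A \<Longrightarrow> f' H \<in> {0..1}" "\<And>H. H \<subseteq> A \<Longrightarrow> g' H \<in> {0..1}"
  shows "\<bar>rcov A f g - rcov A f' g'\<bar>
     \<le> 2 * rex A (\<lambda>H. \<bar>f H - f' H\<bar>) + 2 * rex A (\<lambda>H. \<bar>g H - g' H\<bar>)"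
proof -
  let ?a = "rex A (\<lambda>H. \<bar>f H - f' H\<bar>)" and ?b = "rex A (\<lambda>H. \<bar>g H - g' H\<bar>)"
  have p: "\<bar>x * y - x' * y'\<bar> \<le> \<bar>x - x'\<bar> + \<bar>y - y'\<bar>"
    if "x \<in> {0..1}" "y \<in> {0..1}" "x' \<in> {0..1}" "y' \<in> {0..1}" for x y x' y' :: real
  proof -
    have "x * y - x' * y' = (x - x') * y + x' * (y - y')" by (simp add: algebra_simps)
    also have "\<bar>\<dots>\<bar> \<le> \<bar>x - x'\<bar> * \<bar>y\<bar> + \<bar>x'\<bar> * \<bar>y - y'\<bar>" by (metis abs_mult abs_triangle_ineq)
    also have "\<dots> \<le> \<bar>x - x'\<bar> * 1 + 1 * \<bar>y - y'\<bar>"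
      using that by (intro add_mono mult_left_mono mult_right_mono) auto
    finally show ?thesis by simp
  qed
  have E: "rex A u \<in> {0..1}" if "\<And>H. H \<subseteq> A \<Longrightarrow> u H \<in> {0..1}" for u
    using that rex_nonneg[of A u] rex_le_const[OF assms(1), of u 1] by auto
  have 1: "\<bar>rex A (\<lambda>H. f H * g H) - rex A (\<lambda>H. f' H * g' H)\<bar> \<le> ?a + ?b"
  proof -
    have "\<bar>rex A (\<lambda>H. f H * g H) - rex A (\<lambda>H. f' H * g' H)\<bar>
        \<le> rex A (\<lambda>H. \<bar>f H * g H - f' H * g' H\<bar>)"
      using abs_rex_le[of A "\<lambda>H. f H * g H - f' H * g' H"] by (simp add: rex_diff)
    also have "\<dots> \<le> rex A (\<lambda>H. \<bar>f H - f' H\<bar> + \<bar>g H - g' H\<bar>)"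
      by (rule rex_mono) (use p assms in auto)
    finally show ?thesis by (simp add: rex_add)
  qed
  have 2: "\<bar>rex A f * rex A g - rex A f' * rex A g'\<bar> \<le> \<bar>rex A f - rex A f'\<bar> + \<bar>rex A g - rex A g'\<bar>"
    using E assms by (intro p) auto
  have 3: "\<bar>rex A f - rex A f'\<bar> \<le> ?a" "\<bar>rex A g - rex A g'\<bar> \<le> ?b"
    using abs_rex_le[of A "\<lambda>H. f H - f' H"] abs_rex_le[of A "\<lambda>H. g H - g' H"]
    by (auto simp: rex_diff)
  show ?thesis
    using 1 2 3 unfolding rcov_eq[OF assms(1)] by linarith
qed

end

section \<open>Walks in random graphs with independent edges\<close>

definition ebetween :: "nat \<Rightarrow> nat \<Rightarrow> edge set" where
  "ebetween v w = {e. (fst (fst e) = v \<and> snd (fst e) = w) \<or> (fst (fst e) = w \<and> snd (fst e) = v)}"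

definition incident :: "nat \<Rightarrow> edge set" where
  "incident v = {e. fst (fst e) = v \<or> snd (fst e) = v}"

lemma adj_iff: "(v, w) \<in> adj H \<longleftrightarrow> H \<inter> ebetween v w \<noteq> {}"
  unfolding adj_def ebetween_def by (auto simp: disjoint_iff)

lemma ebetween_commute: "ebetween v w = ebetween w v"
  unfolding ebetween_def by auto

lemma adj_sym: "(v, w) \<in> adj H \<longleftrightarrow> (w, v) \<in> adj H"
  unfolding adj_iff by (simp add: ebetween_commute)

lemma adj_mono: "H \<subseteq> K \<Longrightarrow> adj H \<subseteq> adj K"
  unfolding adj_def by blast

text \<open>A self-avoiding walk with exactly \<open>r\<close> steps from \<open>v\<close> whose
  later vertices lie in \<open>U\<close>. Each vertex that is left is deleted from \<open>U\<close>,
  so the continuation never looks at edges of \<open>v\<close>; this is the source of the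
  independence used for walks.\<close>

fun sawalk :: "edge set \<Rightarrow> nat \<Rightarrow> nat \<Rightarrow> nat set \<Rightarrow> bool" where
  "sawalk H 0 v U = True"
| "sawalk H (Suc r) v U = (\<exists>w\<in>U - {v}. (v, w) \<in> adj H \<and> sawalk H r w (U - {v}))"

text \<open>In contrast to \<open>sawalk\<close>, the number \<open>r\<close> only bounds the number
  of steps, and the walk ends in \<open>x\<close>.\<close>

fun hits :: "edge set \<Rightarrow> nat \<Rightarrow> nat \<Rightarrow> nat \<Rightarrow> nat set \<Rightarrow> bool" where
  "hits H 0 v x U = False"
| "hits H (Suc r) v x U = (\<exists>w\<in>U - {v}. (v, w) \<in> adj H \<and> (w = x \<or> hits H r w x (U - {v})))"

lemma sawalk_cong:
  assumes "w \<in> U" "\<And>u v. u \<in> U \<Longrightarrow> v \<in> U \<Longrightarrow> u \<noteq> v \<Longrightarrow> (u, v) \<in> adj H \<longleftrightarrow> (u, v) \<in> adj H'"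
  shows "sawalk H r w U = sawalk H' r w U"
  using assms
proof (induction r arbitrary: w U)
  case (Suc r)
  have "sawalk H r u (U - {w}) = sawalk H' r u (U - {w})" if "u \<in> U - {w}" for u
    using that Suc.prems by (intro Suc.IH) auto
  moreover have "(w, u) \<in> adj H \<longleftrightarrow> (w, u) \<in> adj H'" if "u \<in> U - {w}" for u
    using that Suc.prems(1) Suc.prems(2)[of w u] by auto
  ultimately show ?case by simp
qed simp

lemma hits_cong:
  assumes "w \<in> U" "\<And>u v. u \<in> U \<Longrightarrow> v \<in> U \<Longrightarrow> u \<noteq> v \<Longrightarrow> (u, v) \<in> adj H \<longleftrightarrow> (u, v) \<in> adj H'"
  shows "hits H r w x U = hits H' r w x U"
  using assms
proof (induction r arbitrary: w U)
  case (Suc r)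
  have "hits H r u x (U - {w}) = hits H' r u x (U - {w})" if "u \<in> U - {w}" for u
    using that Suc.prems by (intro Suc.IH) auto
  moreover have "(w, u) \<in> adj H \<longleftrightarrow> (w, u) \<in> adj H'" if "u \<in> U - {w}" for u
    using that Suc.prems(1) Suc.prems(2)[of w u] by auto
  ultimately show ?case by simp
qed simp

lemma sawalk_mono: "U \<subseteq> U' \<Longrightarrow> sawalk H r v U \<Longrightarrow> sawalk H r v U'"
proof (induction r arbitrary: v U U')
  case (Suc r)
  then obtain w where w: "w \<in> U - {v}" "(v, w) \<in> adj H" "sawalk H r w (U - {v})" by auto
  have "sawalk H r w (U' - {v})"
    by (rule Suc.IH[OF _ w(3)]) (use Suc.prems in auto)
  then show ?case using w Suc.prems by auto
qed simp

text \<open>The walk that exists in \<open>U\<close> must visit \<open>x\<close> after its start, as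
  there is none without \<open>x\<close>; cut it there.\<close>

lemma sawalk_blocked_hits:
  "sawalk H r w U \<Longrightarrow> \<not> sawalk H r w (U - {x}) \<Longrightarrow> hits H r w x U"
proof (induction r arbitrary: w U)
  case (Suc r)
  then obtain u where u: "u \<in> U - {w}" "(w, u) \<in> adj H" "sawalk H r u (U - {w})" by auto
  show ?case
  proof (cases "u = x")
    case False
    then have "\<not> sawalk H r u (U - {x} - {w})" using Suc.prems(2) u by auto
    then have "hits H r u x (U - {w})"
      using Suc.IH[OF u(3)] by (metis Diff_insert Diff_insert2)
    then show ?thesis using u by auto
  qed (use u in auto)
qed simp

text \<open>Cut the path at its last visit to \<open>v\<close>.\<close>

lemma rtrancl_last_exit:
  assumes "(v, x) \<in> R\<^sup>*" "x \<noteq> v"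
  shows "\<exists>u. (v, u) \<in> R \<and> u \<noteq> v \<and> (u, x) \<in> (R \<inter> (- {v}) \<times> (- {v}))\<^sup>*"
  using assms
proof (induction rule: rtrancl_induct)
  case (step y z)
  show ?case
  proof (cases "y = v")
    case False
    then obtain u where "(v, u) \<in> R" "u \<noteq> v" "(u, y) \<in> (R \<inter> (- {v}) \<times> (- {v}))\<^sup>*"
      using step by blast
    moreover have "(y, z) \<in> R \<inter> (- {v}) \<times> (- {v})" using step False by auto
    ultimately show ?thesis by (meson rtrancl.rtrancl_into_rtrancl)
  qed (use step in auto)
qed simp

text \<open>Cutting at last exits makes the path self-avoiding. Either it arrives at
  \<open>x\<close> within \<open>r\<close> steps, or its first \<open>r\<close> steps form a
  walk.\<close>

lemma reach_sawalk_or_hits: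
  assumes "(v, x) \<in> (adj H \<inter> U \<times> U)\<^sup>*" "x \<noteq> v"
  shows "sawalk H r v U \<or> hits H r v x U"
  using assms
proof (induction r arbitrary: v U)
  case (Suc r)
  obtain u where u: "(v, u) \<in> adj H \<inter> U \<times> U" "u \<noteq> v"
    "(u, x) \<in> (adj H \<inter> U \<times> U \<inter> (- {v}) \<times> (- {v}))\<^sup>*"
    using rtrancl_last_exit[OF Suc.prems] by auto
  have eq: "adj H \<inter> U \<times> U \<inter> (- {v}) \<times> (- {v}) = adj H \<inter> (U - {v}) \<times> (U - {v})" by auto
  show ?case
  proof (cases "u = x")
    case False
    then have "sawalk H r u (U - {v}) \<or> hits H r u x (U - {v})"
      using Suc.IH[of u "U - {v}"] u(3) unfolding eq by auto
    then show ?thesis using u by auto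
  qed (use u in auto)
qed simp

lemma sawalk_card:
  assumes "sawalk H r v U"
  shows "\<exists>X\<subseteq>insert v U. finite X \<and> card X = Suc r \<and> (\<forall>x\<in>X. connected_in H v x)"
  using assms
proof (induction r arbitrary: v U)
  case 0
  show ?case by (rule exI[of _ "{v}"]) (auto simp: connected_in_def)
next
  case (Suc r)
  then obtain w where w: "w \<in> U - {v}" "(v, w) \<in> adj H" "sawalk H r w (U - {v})" by auto
  obtain X where X: "X \<subseteq> insert w (U - {v})" "finite X" "card X = Suc r"
    "\<forall>x\<in>X. connected_in H w x"
    using Suc.IH[OF w(3)] by auto
  have "v \<notin> X" using X w by auto
  moreover have "\<forall>x\<in>X. connected_in H v x"
    using X(4) w(2) unfolding connected_in_def by (meson converse_rtrancl_into_rtrancl)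
  ultimately show ?case using X w
    by (intro exI[of _ "insert v X"]) (auto simp: connected_in_def)
qed

text \<open>This is t + ... + t^r, a bound for the expected number of self-avoiding walks with 1 to
  \<open>r\<close> steps from a vertex when every pair has rate at most t/n.\<close>

primrec hitc :: "real \<Rightarrow> nat \<Rightarrow> real" where
  "hitc t 0 = 0"
| "hitc t (Suc r) = t * (1 + hitc t r)"

text \<open>Bounds the variance of the number of starting points, divided by n. The summands: 1 for
  the diagonal covariances, \<open>t\<^sup>2 * varc t r\<close> for the fluctuation of the offspring
  means one generation later, and four hitting probabilities for keeping two walks away from each
  other's root.\<close>

primrec varc :: "real \<Rightarrow> nat \<Rightarrow> real" where
  "varc t 0 = 0"
| "varc t (Suc r) = 1 + t\<^sup>2 * varc t r + 4 * hitc t (Suc r)"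

text \<open>Errors of one generation: the deviation of the offspring mean, the prohibition to return
  to the root, and the inherited error of the children, each multiplied by the total rate t.\<close>

primrec biasc :: "real \<Rightarrow> nat \<Rightarrow> real" where
  "biasc t 0 = 0"
| "biasc t (Suc r) = t * sqrt (varc t r) + t * hitc t r + t * biasc t r"

lemma hitc_nonneg: "0 \<le> t \<Longrightarrow> 0 \<le> hitc t r"
  by (induction r) auto

lemma varc_nonneg: "0 \<le> t \<Longrightarrow> 0 \<le> varc t r"
  by (induction r) (auto intro!: add_nonneg_nonneg mult_nonneg_nonneg simp: hitc_nonneg)

lemma biasc_nonneg: "0 \<le> t \<Longrightarrow> 0 \<le> biasc t r"
  by (induction r) (auto intro!: add_nonneg_nonneg mult_nonneg_nonneg simp: hitc_nonneg varc_nonneg)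

locale random_graph = random_subset +
  fixes A :: "edge set" and n :: nat and t :: real
  assumes finA: "finite A" and n_pos: "0 < n" and t_nonneg: "0 \<le> t"
    and A_sub: "\<And>e. e \<in> A \<Longrightarrow> fst (fst e) < n \<and> snd (fst e) < n"
    and rate_le: "\<And>v w. v \<noteq> w \<Longrightarrow> \<theta> * card (A \<inter> ebetween v w) \<le> t / n"
begin

definition lam :: "nat \<Rightarrow> nat \<Rightarrow> real" where
  "lam v w = \<theta> * card (A \<inter> ebetween v w)"

text \<open>Survival for \<open>r\<close> generations of the branching process in which an
  individual \<open>v\<close> has, for each other vertex w, a Poisson number of children of type w
  with mean \<open>lam v w\<close>.\<close>

primrec surv :: "nat \<Rightarrow> nat \<Rightarrow> real" where
  "surv 0 v = 1"
| "surv (Suc r) v = 1 - exp (- (\<Sum>w\<in>{..<n} - {v}. lam v w * surv r w))"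

lemma lam_nonneg: "0 \<le> lam v w"
  unfolding lam_def using theta_nonneg by simp

lemma lam_le: "v \<noteq> w \<Longrightarrow> lam v w \<le> t / n"
  unfolding lam_def by (rule rate_le)

lemma prob_adj_le: "rex A (\<lambda>H. of_bool ((v, w) \<in> adj H)) \<le> lam v w"
proof -
  have "rex A (\<lambda>H. of_bool ((v, w) \<in> adj H)) = rex A (\<lambda>H. 1 - of_bool (H \<inter> (A \<inter> ebetween v w) = {}))"
    by (rule rex_cong) (auto simp: adj_iff)
  also have "\<dots> = 1 - exp (- \<theta> * card (A \<inter> ebetween v w))"
    using finA by (simp add: rex_diff rex_avoid)
  also have "\<dots> \<le> lam v w"
    unfolding lam_def using exp_ge_add_one_self[of "- (\<theta> * card (A \<inter> ebetween v w))"] by simp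
  finally show ?thesis .
qed

lemma adj_Diff_incident:
  "u \<noteq> v \<Longrightarrow> w \<noteq> v \<Longrightarrow> (u, w) \<in> adj (H - A \<inter> incident v) \<longleftrightarrow> (u, w) \<in> adj H"
  unfolding adj_iff ebetween_def incident_def by auto

text \<open>Union bound over the first step. The continuation lives in \<open>U - {v}\<close> and is
  therefore independent of the edge used for that step.\<close>

lemma prob_hits_le:
  assumes "U \<subseteq> {..<n}" "v \<in> U" "x \<in> U" "x \<noteq> v"
  shows "rex A (\<lambda>H. of_bool (hits H r v x U)) \<le> hitc t r / n"
  using assms
proof (induction r arbitrary: v U)
  case 0
  then show ?case using finA by simp
next
  case (Suc r)
  have finU: "finite U" using Suc.prems finite_subset by auto
  let ?f = "\<lambda>w H. of_bool (w = x \<or> hits H r w x (U - {v})) :: real"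
  have bd: "rex A (?f w) \<le> of_bool (w = x) + hitc t r / n" if w: "w \<in> U - {v}" for w
  proof (cases "w = x")
    case True
    then show ?thesis using finA hitc_nonneg[OF t_nonneg] by simp
  next
    case False
    then have "rex A (\<lambda>H. of_bool (hits H r w x (U - {v}))) \<le> hitc t r / n"
      using Suc.prems w by (intro Suc.IH) auto
    then show ?thesis using False by simp
  qed
  have "rex A (\<lambda>H. of_bool (hits H (Suc r) v x U))
    \<le> rex A (\<lambda>H. \<Sum>w\<in>U - {v}. ?f w H * of_bool ((v, w) \<in> adj H))"
  proof (rule rex_mono)
    fix H
    show "of_bool (hits H (Suc r) v x U) \<le> (\<Sum>w\<in>U - {v}. ?f w H * of_bool ((v, w) \<in> adj H))"
    proof (cases "hits H (Suc r) v x U")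
      case True
      then obtain w where w: "w \<in> U - {v}" "(v, w) \<in> adj H" "w = x \<or> hits H r w x (U - {v})"
        by auto
      have "?f w H * of_bool ((v, w) \<in> adj H) \<le> (\<Sum>w\<in>U - {v}. ?f w H * of_bool ((v, w) \<in> adj H))"
        using finU w by (intro member_le_sum) auto
      then show ?thesis using w True by simp
    qed (auto intro!: sum_nonneg)
  qed
  also have "\<dots> = (\<Sum>w\<in>U - {v}. rex A (?f w) * rex A (\<lambda>H. of_bool ((v, w) \<in> adj H)))"
    unfolding rex_sum
  proof (rule sum.cong)
    fix w assume w: "w \<in> U - {v}"
    show "rex A (\<lambda>H. ?f w H * of_bool ((v, w) \<in> adj H)) = rex A (?f w) * rex A (\<lambda>H. of_bool ((v, w) \<in> adj H))"
    proof (rule rex_indep[OF finA, of "A \<inter> incident v"])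
      fix H
      have "hits H r w x (U - {v}) = hits (H - A \<inter> incident v) r w x (U - {v})"
        by (rule hits_cong) (use w adj_Diff_incident in auto)
      then show "?f w H = ?f w (H - A \<inter> incident v)" by simp
    next
      fix H assume "H \<subseteq> A"
      then have "(v, w) \<in> adj H \<longleftrightarrow> (v, w) \<in> adj (H \<inter> (A \<inter> incident v))"
        unfolding adj_iff ebetween_def incident_def by auto
      then show "(of_bool ((v, w) \<in> adj H) :: real) = of_bool ((v, w) \<in> adj (H \<inter> (A \<inter> incident v)))"
        by simp
    qed simp
  qed simp
  also have "\<dots> \<le> (\<Sum>w\<in>U - {v}. (of_bool (w = x) + hitc t r / n) * (t / n))"
  proof (rule sum_mono)
    fix w assume w: "w \<in> U - {v}"
    then have "rex A (\<lambda>H. of_bool ((v, w) \<in> adj H)) \<le> t / n"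
      using prob_adj_le[of v w] lam_le[of v w] by auto
    then show "rex A (?f w) * rex A (\<lambda>H. of_bool ((v, w) \<in> adj H))
        \<le> (of_bool (w = x) + hitc t r / n) * (t / n)"
      using bd[OF w] by (intro mult_mono rex_nonneg) (use hitc_nonneg[OF t_nonneg] in auto)
  qed
  also have "\<dots> = (1 + card (U - {v}) * (hitc t r / n)) * (t / n)"
    unfolding sum_distrib_right[symmetric] sum.distrib using finU Suc.prems
    by (simp add: of_bool_def if_distrib sum.delta)
  also have "\<dots> \<le> (1 + n * (hitc t r / n)) * (t / n)"
  proof -
    have "card (U - {v}) \<le> n" using card_mono[of "{..<n}" "U - {v}"] Suc.prems by auto
    then show ?thesis using hitc_nonneg[OF t_nonneg] t_nonneg
      by (intro mult_right_mono add_left_mono) auto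
  qed
  also have "\<dots> = hitc t (Suc r) / n" using n_pos by simp
  finally show ?case .
qed

text \<open>For \<open>v\<close> outside \<open>U\<close>: the mean number of edges from
  \<open>v\<close> to starting points of \<open>r\<close>-walks, given the graph inside
  \<open>U\<close>.\<close>

definition offspring :: "nat \<Rightarrow> nat set \<Rightarrow> nat \<Rightarrow> edge set \<Rightarrow> real" where
  "offspring v U r H = (\<Sum>u\<in>U. lam v u * of_bool (sawalk H r u U))"

lemma offspring_nonneg: "0 \<le> offspring v U r H"
  unfolding offspring_def by (intro sum_nonneg) (use lam_nonneg in auto)

text \<open>The walks live inside \<open>U\<close>, while the edges between \<open>D\<close> and
  \<open>U\<close> are unexplored, so \<open>rex_peel\<close> applies to the potential edges from
  \<open>D\<close> to starting points. A set \<open>D\<close> with two roots gives the joint law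
  needed for covariances, with exponents that simply add.\<close>

lemma prob_no_walk:
  assumes "U \<subseteq> {..<n}" "finite D" "D \<inter> U = {}"
  shows "rex A (\<lambda>H. of_bool (\<forall>v\<in>D. \<forall>u\<in>U. (v, u) \<in> adj H \<longrightarrow> \<not> sawalk H r u U))
      = rex A (\<lambda>H. exp (- (\<Sum>v\<in>D. offspring v U r H)))"
proof -
  have finU: "finite U" using assms finite_subset by auto
  define B where "B = A \<inter> (\<Union>v\<in>D. incident v)"
  define S where "S H = {u \<in> U. sawalk H r u U}" for H
  define Q where "Q H = (\<Union>(v,u)\<in>D \<times> S H. A \<inter> ebetween v u)" for H
  have "rex A (\<lambda>H. of_bool (\<forall>v\<in>D. \<forall>u\<in>U. (v, u) \<in> adj H \<longrightarrow> \<not> sawalk H r u U))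
      = rex A (\<lambda>H. of_bool (H \<inter> Q H = {}))"
  proof (rule rex_cong)
    fix H assume "H \<subseteq> A"
    then have "(\<forall>v\<in>D. \<forall>u\<in>U. (v, u) \<in> adj H \<longrightarrow> \<not> sawalk H r u U) \<longleftrightarrow> H \<inter> Q H = {}"
      unfolding Q_def S_def adj_iff by blast
    then show "(of_bool (\<forall>v\<in>D. \<forall>u\<in>U. (v, u) \<in> adj H \<longrightarrow> \<not> sawalk H r u U) :: real)
       = of_bool (H \<inter> Q H = {})" by simp
  qed
  also have "\<dots> = rex A (\<lambda>H. exp (- \<theta> * card (Q H)))"
  proof (rule rex_peel[OF finA, of B])
    fix H
    have "sawalk H r u U = sawalk (H - B) r u U" if "u \<in> U" for u
    proof (rule sawalk_cong[OF that])
      fix x y assume "x \<in> U" "y \<in> U"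
      then show "(x, y) \<in> adj H \<longleftrightarrow> (x, y) \<in> adj (H - B)"
        using assms(3) unfolding adj_iff ebetween_def B_def incident_def by blast
    qed
    then have "S H = S (H - B)" unfolding S_def by auto
    then show "Q H = Q (H - B)" unfolding Q_def by simp
    show "Q H \<subseteq> B" unfolding Q_def B_def ebetween_def incident_def by auto
  qed (auto simp: B_def)
  also have "\<dots> = rex A (\<lambda>H. exp (- (\<Sum>v\<in>D. offspring v U r H)))"
  proof (rule rex_cong)
    fix H
    have fS: "finite (S H)" unfolding S_def using finU by auto
    have "card (Q H) = (\<Sum>(v,u)\<in>D \<times> S H. card (A \<inter> ebetween v u))"
    proof -
      have "card (Q H) = (\<Sum>p\<in>D \<times> S H. card (case p of (v,u) \<Rightarrow> A \<inter> ebetween v u))"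
        unfolding Q_def
      proof (rule card_UN_disjoint)
        show "\<forall>p\<in>D \<times> S H. \<forall>p'\<in>D \<times> S H. p \<noteq> p' \<longrightarrow>
          (case p of (v,u) \<Rightarrow> A \<inter> ebetween v u) \<inter> (case p' of (v,u) \<Rightarrow> A \<inter> ebetween v u) = {}"
          using assms(3) unfolding S_def ebetween_def by (auto simp: disjoint_iff)
      qed (use fS assms finA in auto)
      then show ?thesis by (simp add: case_prod_unfold)
    qed
    also have "\<dots> = (\<Sum>v\<in>D. \<Sum>u\<in>S H. card (A \<inter> ebetween v u))"
      by (rule sum.cartesian_product[symmetric])
    finally have "\<theta> * card (Q H) = (\<Sum>v\<in>D. \<Sum>u\<in>S H. lam v u)"
      unfolding lam_def by (simp add: sum_distrib_left)
    also have "\<dots> = (\<Sum>v\<in>D. offspring v U r H)"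
      unfolding offspring_def S_def using finU
      by (intro sum.cong sum.mono_neutral_cong_left) auto
    finally show "exp (- \<theta> * card (Q H)) = exp (- (\<Sum>v\<in>D. offspring v U r H))" by simp
  qed
  finally show ?thesis .
qed

text \<open>The rates are t/n times numbers in [0,1], which is why variances are bounded for
  weighted counts. The bound enters as a premise because inside \<open>rvar_sawalk_le\<close> it is
  the induction hypothesis.\<close>

lemma rvar_offspring_aux:
  assumes "x \<notin> W"
    and bound: "\<And>d. (\<And>u. u \<in> W \<Longrightarrow> d u \<in> {0..1}) \<Longrightarrow>
      rvar A (\<lambda>H. \<Sum>u\<in>W. d u * of_bool (sawalk H r u W)) \<le> varc t r * n"
  shows "rvar A (offspring x W r) \<le> t\<^sup>2 * varc t r / n"
proof -
  \<comment> \<open>For t = 0 the quotient is 0 by convention, and the rate vanishes as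
    well.\<close>
  define d where "d u = lam x u * n / t" for u
  have d: "lam x u = t / n * d u" "d u \<in> {0..1}" if "u \<in> W" for u
  proof -
    have "x \<noteq> u" using that \<open>x \<notin> W\<close> by auto
    then have "lam x u \<le> t / n" "0 \<le> lam x u" using lam_le lam_nonneg by auto
    then show "lam x u = t / n * d u" "d u \<in> {0..1}"
      using n_pos t_nonneg unfolding d_def by (cases "t = 0"; simp add: field_simps)+
  qed
  have "offspring x W r = (\<lambda>H. t / n * (\<Sum>u\<in>W. d u * of_bool (sawalk H r u W)))"
    unfolding offspring_def sum_distrib_left by (intro ext sum.cong) (auto simp: d(1))
  then have "rvar A (offspring x W r) = (t / n)\<^sup>2 * rvar A (\<lambda>H. \<Sum>u\<in>W. d u * of_bool (sawalk H r u W))"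
    by (simp only: rvar_cmult)
  also have "\<dots> \<le> (t / n)\<^sup>2 * (varc t r * n)"
    by (intro mult_left_mono bound) (use d in auto)
  also have "\<dots> = t\<^sup>2 * varc t r / n"
    using n_pos by (simp add: power2_eq_square field_simps)
  finally show ?thesis .
qed

text \<open>Induction on \<open>r\<close>. The diagonal covariances contribute at most n. For two
  roots, each walk is first forbidden to meet the other root, at the price of hitting probabilities.
  Then both explore the same set, and their covariance is exactly that of two exponentials of
  offspring means, whose variances the induction hypothesis controls.\<close>

lemma rvar_sawalk_le:
  assumes "U \<subseteq> {..<n}" "\<And>w. w \<in> U \<Longrightarrow> c w \<in> {0..1}"
  shows "rvar A (\<lambda>H. \<Sum>w\<in>U. c w * of_bool (sawalk H r w U)) \<le> varc t r * n"
  using assms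
proof (induction r arbitrary: U c)
  case 0
  then show ?case using finA by (simp add: rvar_def)
next
  case (Suc r)
  note U = Suc.prems(1)
  have finU: "finite U" using U finite_subset by auto
  let ?f = "\<lambda>w H. of_bool (sawalk H (Suc r) w U) :: real"
  let ?b = "t\<^sup>2 * varc t r + 4 * hitc t (Suc r)"
  have b0: "0 \<le> ?b" using varc_nonneg hitc_nonneg t_nonneg by (intro add_nonneg_nonneg) auto
  have diag: "\<bar>rcov A (?f w) (?f w)\<bar> \<le> 1" for w
  proof -
    have "rvar A (?f w) \<le> rex A (\<lambda>H. (?f w H - 0)\<^sup>2)" by (rule rvar_le[OF finA])
    also have "\<dots> \<le> 1" by (rule rex_le_const[OF finA]) (auto simp: of_bool_def)
    finally show ?thesis using abs_rcov_le[of A "?f w" "?f w"] by simp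
  qed
  have off: "\<bar>rcov A (?f w) (?f w')\<bar> \<le> ?b / n" if w: "w \<in> U" "w' \<in> U" "w \<noteq> w'" for w w'
  proof -
    define W where "W = U - {w, w'}"
    have W: "W \<subseteq> {..<n}" "w \<notin> W" "w' \<notin> W" using U unfolding W_def by auto
    let ?g = "\<lambda>H. of_bool (sawalk H (Suc r) w (U - {w'})) :: real"
    let ?g' = "\<lambda>H. of_bool (sawalk H (Suc r) w' (U - {w})) :: real"
    have pert: "rex A (\<lambda>H. \<bar>of_bool (sawalk H (Suc r) x U) - of_bool (sawalk H (Suc r) x (U - {y}))\<bar>)
        \<le> hitc t (Suc r) / n" if "x \<in> U" "y \<in> U" "y \<noteq> x" for x y
    proof -
      have "rex A (\<lambda>H. \<bar>of_bool (sawalk H (Suc r) x U) - of_bool (sawalk H (Suc r) x (U - {y}))\<bar>)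
        \<le> rex A (\<lambda>H. of_bool (hits H (Suc r) x y U))"
      proof (rule rex_mono)
        fix H
        show "\<bar>of_bool (sawalk H (Suc r) x U) - of_bool (sawalk H (Suc r) x (U - {y})) :: real\<bar>
          \<le> of_bool (hits H (Suc r) x y U)"
          using sawalk_blocked_hits[of H "Suc r" x U y] sawalk_mono[of "U - {y}" U H "Suc r" x]
          by (cases "sawalk H (Suc r) x U"; cases "sawalk H (Suc r) x (U - {y})")
             (simp_all del: sawalk.simps hits.simps)
      qed
      also have "\<dots> \<le> hitc t (Suc r) / n"
        by (rule prob_hits_le) (use U that in auto)
      finally show ?thesis .
    qed
    have "\<bar>rcov A (?f w) (?f w') - rcov A ?g ?g'\<bar>
      \<le> 2 * rex A (\<lambda>H. \<bar>?f w H - ?g H\<bar>) + 2 * rex A (\<lambda>H. \<bar>?f w' H - ?g' H\<bar>)"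
      by (rule rcov_perturb[OF finA]) auto
    also have "\<dots> \<le> 2 * (hitc t (Suc r) / n) + 2 * (hitc t (Suc r) / n)"
      using pert[of w w'] pert[of w' w] w by (intro add_mono mult_left_mono) auto
    finally have 1: "\<bar>rcov A (?f w) (?f w') - rcov A ?g ?g'\<bar> \<le> 4 * hitc t (Suc r) / n" by simp
    let ?X = "offspring w W r" and ?X' = "offspring w' W r"
    have g: "?g = (\<lambda>H. 1 - of_bool (\<forall>v\<in>{w}. \<forall>u\<in>W. (v, u) \<in> adj H \<longrightarrow> \<not> sawalk H r u W))"
      unfolding W_def by (auto simp: fun_eq_iff Diff_insert[symmetric] insert_commute)
    have g': "?g' = (\<lambda>H. 1 - of_bool (\<forall>v\<in>{w'}. \<forall>u\<in>W. (v, u) \<in> adj H \<longrightarrow> \<not> sawalk H r u W))"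
      unfolding W_def by (auto simp: fun_eq_iff Diff_insert[symmetric] insert_commute)
    define a where "a H = (of_bool (\<forall>v\<in>{w}. \<forall>u\<in>W. (v, u) \<in> adj H \<longrightarrow> \<not> sawalk H r u W) :: real)" for H
    define a' where "a' H = (of_bool (\<forall>v\<in>{w'}. \<forall>u\<in>W. (v, u) \<in> adj H \<longrightarrow> \<not> sawalk H r u W) :: real)" for H
    have ea: "rex A a = rex A (\<lambda>H. exp (- ?X H))"
      unfolding a_def using prob_no_walk[OF W(1), of "{w}" r] W by simp
    have ea': "rex A a' = rex A (\<lambda>H. exp (- ?X' H))"
      unfolding a'_def using prob_no_walk[OF W(1), of "{w'}" r] W by simp
    \<comment> \<open>With both roots in \<open>D\<close> the joint probability is an exact
      expectation of exponentials too, so passing from indicators to exponentials does not change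
      the covariance.\<close>
    have "rex A (\<lambda>H. a H * a' H)
       = rex A (\<lambda>H. of_bool (\<forall>v\<in>{w,w'}. \<forall>u\<in>W. (v, u) \<in> adj H \<longrightarrow> \<not> sawalk H r u W))"
      unfolding a_def a'_def by (rule rex_cong) auto
    also have "\<dots> = rex A (\<lambda>H. exp (- ?X H) * exp (- ?X' H))"
      using prob_no_walk[OF W(1), of "{w,w'}" r] W w(3) by (simp add: exp_add[symmetric] algebra_simps)
    finally have eaa: "rex A (\<lambda>H. a H * a' H) = rex A (\<lambda>H. exp (- ?X H) * exp (- ?X' H))" .
    have "rcov A ?g ?g' = rcov A (\<lambda>H. 1 - a H) (\<lambda>H. 1 - a' H)"
      unfolding g g' a_def a'_def ..
    also have "\<dots> = rcov A a a'"
    proof -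
      have "(1 - a H - rex A (\<lambda>H. 1 - a H)) * (1 - a' H - rex A (\<lambda>H. 1 - a' H))
          = (a H - rex A a) * (a' H - rex A a')" for H
        using finA by (simp add: rex_diff algebra_simps)
      then show ?thesis unfolding rcov_def by simp
    qed
    also have "\<dots> = rcov A (\<lambda>H. exp (- ?X H)) (\<lambda>H. exp (- ?X' H))"
      unfolding rcov_eq[OF finA] ea ea' eaa ..
    finally have 2: "rcov A ?g ?g' = rcov A (\<lambda>H. exp (- ?X H)) (\<lambda>H. exp (- ?X' H))" .
    have var: "rvar A (\<lambda>H. exp (- offspring x W r H)) \<le> t\<^sup>2 * varc t r / n" if "x \<notin> W" for x
    proof -
      have "rvar A (\<lambda>H. exp (- offspring x W r H)) \<le> rvar A (offspring x W r)"
        by (rule rvar_exp_le(1)[OF finA offspring_nonneg])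
      also have "\<dots> \<le> t\<^sup>2 * varc t r / n"
        by (rule rvar_offspring_aux[OF that]) (use Suc.IH[OF W(1)] in auto)
      finally show ?thesis .
    qed
    have "\<bar>rcov A ?g ?g'\<bar> \<le> t\<^sup>2 * varc t r / n"
      unfolding 2
    proof (rule order_trans[OF abs_rcov_le])
      have half: "(a + b) / 2 \<le> c" if "a \<le> c" "b \<le> c" for a b c :: real
        using that by simp
      show "(rvar A (\<lambda>H. exp (- ?X H)) + rvar A (\<lambda>H. exp (- ?X' H))) / 2 \<le> t\<^sup>2 * varc t r / n"
        by (rule half[OF var[OF W(2)] var[OF W(3)]])
    qed
    with 1 show ?thesis by (simp add: add_divide_distrib del: hitc.simps)
  qed
  have "rvar A (\<lambda>H. \<Sum>w\<in>U. c w * ?f w H)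
      = (\<Sum>i\<in>U. \<Sum>j\<in>U. rcov A (\<lambda>H. c i * ?f i H) (\<lambda>H. c j * ?f j H))"
    by (rule rvar_sum)
  also have "\<dots> = (\<Sum>i\<in>U. \<Sum>j\<in>U. c i * c j * rcov A (?f i) (?f j))"
    by (simp only: rcov_cmult)
  also have "\<dots> \<le> (\<Sum>i\<in>U. \<Sum>j\<in>U. (if i = j then 1 else 0) + ?b / n)"
  proof (intro sum_mono)
    fix i j assume ij: "i \<in> U" "j \<in> U"
    have "c i * c j * rcov A (?f i) (?f j) \<le> \<bar>c i * c j\<bar> * \<bar>rcov A (?f i) (?f j)\<bar>"
      unfolding abs_mult[symmetric] by (rule abs_ge_self)
    also have "\<dots> \<le> 1 * \<bar>rcov A (?f i) (?f j)\<bar>"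
      using Suc.prems(2)[OF ij(1)] Suc.prems(2)[OF ij(2)]
      by (intro mult_right_mono) (auto simp: abs_mult intro: mult_le_one)
    also have "\<dots> \<le> (if i = j then 1 else 0) + ?b / n"
    proof (cases "i = j")
      case True
      have "0 \<le> ?b / n" by (rule divide_nonneg_nonneg[OF b0]) simp
      then have "1 \<le> (if i = j then 1 else 0) + ?b / n" using True by simp
      then show ?thesis using order_trans[OF diag[of i]] True by simp
    qed (use off[OF ij] in simp)
    finally show "c i * c j * rcov A (?f i) (?f j) \<le> (if i = j then 1 else 0) + ?b / n" .
  qed
  also have "\<dots> = card U + card U * (card U * (?b / n))"
    using finU by (simp add: sum.distrib sum.delta distrib_left del: hitc.simps)
  also have "\<dots> \<le> n + n * (n * (?b / n))"
  proof -
    have "card U \<le> n" using card_mono[of "{..<n}" U] U by auto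
    then show ?thesis using b0 by (intro add_mono mult_mono) (auto simp del: hitc.simps)
  qed
  also have "\<dots> = varc t (Suc r) * n" using n_pos by (simp add: field_simps del: hitc.simps)
  finally show ?case .
qed

lemma rvar_offspring_le:
  assumes "W \<subseteq> {..<n}" "x \<notin> W"
  shows "rvar A (offspring x W r) \<le> t\<^sup>2 * varc t r / n"
  using assms by (intro rvar_offspring_aux rvar_sawalk_le) auto

lemma surv_bounds: "0 \<le> surv r v \<and> surv r v \<le> 1"
proof (induction r arbitrary: v)
  case (Suc r)
  have "0 \<le> (\<Sum>w\<in>{..<n} - {v}. lam v w * surv r w)"
    using Suc lam_nonneg by (intro sum_nonneg mult_nonneg_nonneg) auto
  then show ?case by simp
qed simp

lemma prob_sawalk_Suc:
  assumes "U \<subseteq> {..<n}"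
  shows "rex A (\<lambda>H. of_bool (sawalk H (Suc r) v U)) = 1 - rex A (\<lambda>H. exp (- offspring v (U - {v}) r H))"
proof -
  have "rex A (\<lambda>H. of_bool (sawalk H (Suc r) v U))
    = rex A (\<lambda>H. 1 - of_bool (\<forall>x\<in>{v}. \<forall>u\<in>U - {v}. (x, u) \<in> adj H \<longrightarrow> \<not> sawalk H r u (U - {v})))"
    by (rule rex_cong) auto
  also have "\<dots> = 1 - rex A (\<lambda>H. of_bool (\<forall>x\<in>{v}. \<forall>u\<in>U - {v}. (x, u) \<in> adj H \<longrightarrow> \<not> sawalk H r u (U - {v})))"
    by (simp only: rex_diff rex_const[OF finA])
  also have "rex A (\<lambda>H. of_bool (\<forall>x\<in>{v}. \<forall>u\<in>U - {v}. (x, u) \<in> adj H \<longrightarrow> \<not> sawalk H r u (U - {v})))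
     = rex A (\<lambda>H. exp (- (\<Sum>x\<in>{v}. offspring x (U - {v}) r H)))"
    by (rule prob_no_walk) (use assms in auto)
  finally show ?thesis by simp
qed

lemma prob_sawalk_approx:
  assumes "v < n"
  shows "\<bar>rex A (\<lambda>H. of_bool (sawalk H r v {..<n})) - surv r v\<bar> \<le> biasc t r / sqrt n"
  using assms
proof (induction r arbitrary: v)
  case 0
  then show ?case using finA by simp
next
  case (Suc r)
  let ?W = "{..<n} - {v}"
  let ?X = "offspring v ?W r"
  let ?q = "\<lambda>w U. rex A (\<lambda>H. of_bool (sawalk H r w U))"
  have sn: "0 < sqrt n" "1 / n \<le> 1 / sqrt n"
    using n_pos by (auto intro!: divide_left_mono simp: real_sqrt_le_iff' real_le_lsqrt
        power2_eq_square mult_le_cancel_left1)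
  have EX: "rex A ?X = (\<Sum>w\<in>?W. lam v w * ?q w ?W)"
    unfolding offspring_def by (simp only: rex_sum rex_cmult)
  have 1: "\<bar>rex A (\<lambda>H. exp (- ?X H)) - exp (- rex A ?X)\<bar> \<le> t * sqrt (varc t r) / sqrt n"
  proof -
    have "\<bar>rex A (\<lambda>H. exp (- ?X H)) - exp (- rex A ?X)\<bar> \<le> sqrt (rvar A ?X)"
      by (rule rvar_exp_le(2)[OF finA offspring_nonneg])
    also have "\<dots> \<le> sqrt (t\<^sup>2 * varc t r / n)"
      using rvar_offspring_le[of ?W v r] by simp
    also have "\<dots> = t * sqrt (varc t r) / sqrt n"
      using t_nonneg by (simp add: real_sqrt_divide real_sqrt_mult)
    finally show ?thesis .
  qed
  have trm: "\<bar>?q w ?W - surv r w\<bar> \<le> (hitc t r + biasc t r) / sqrt n" if w: "w \<in> ?W" for w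
  proof -
    have "\<bar>?q w {..<n} - ?q w ?W\<bar> \<le> rex A (\<lambda>H. \<bar>of_bool (sawalk H r w {..<n}) - of_bool (sawalk H r w ?W)\<bar>)"
      unfolding rex_diff[symmetric] by (rule abs_rex_le)
    also have "\<dots> \<le> rex A (\<lambda>H. of_bool (hits H r w v {..<n}))"
    proof (rule rex_mono)
      fix H
      show "\<bar>of_bool (sawalk H r w {..<n}) - of_bool (sawalk H r w ?W) :: real\<bar>
          \<le> of_bool (hits H r w v {..<n})"
        using sawalk_blocked_hits[of H r w "{..<n}" v] sawalk_mono[of ?W "{..<n}" H r w]
        by (cases "sawalk H r w {..<n}"; cases "sawalk H r w ?W") auto
    qed
    also have "\<dots> \<le> hitc t r / n"
      by (rule prob_hits_le) (use w Suc.prems in auto)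
    also have "\<dots> \<le> hitc t r / sqrt n"
      using mult_left_mono[OF sn(2) hitc_nonneg[OF t_nonneg, of r]] by simp
    finally have "\<bar>?q w {..<n} - ?q w ?W\<bar> \<le> hitc t r / sqrt n" .
    moreover have "\<bar>?q w {..<n} - surv r w\<bar> \<le> biasc t r / sqrt n" using Suc.IH w by auto
    ultimately show ?thesis unfolding add_divide_distrib by linarith
  qed
  have 2: "\<bar>exp (- rex A ?X) - exp (- (\<Sum>w\<in>?W. lam v w * surv r w))\<bar>
      \<le> \<bar>rex A ?X - (\<Sum>w\<in>?W. lam v w * surv r w)\<bar>"
  proof -
    show ?thesis
      by (rule exp_minus_lipschitz) (use lam_nonneg surv_bounds offspring_nonneg in \<open>auto intro!: sum_nonneg rex_nonneg\<close>)
  qed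
  also have "\<dots> = \<bar>\<Sum>w\<in>?W. lam v w * (?q w ?W - surv r w)\<bar>"
    unfolding EX by (simp add: sum_subtractf algebra_simps)
  also have "\<dots> \<le> (\<Sum>w\<in>?W. \<bar>lam v w * (?q w ?W - surv r w)\<bar>)" by (rule sum_abs)
  also have "\<dots> \<le> (\<Sum>w\<in>?W. t / n * ((hitc t r + biasc t r) / sqrt n))"
  proof (rule sum_mono)
    fix w assume w: "w \<in> ?W"
    then have "lam v w \<le> t / n" using lam_le[of v w] by auto
    then show "\<bar>lam v w * (?q w ?W - surv r w)\<bar> \<le> t / n * ((hitc t r + biasc t r) / sqrt n)"
      unfolding abs_mult using trm[OF w] lam_nonneg[of v w] t_nonneg
      by (intro mult_mono) auto
  qed
  also have "\<dots> = card ?W * (t / n * ((hitc t r + biasc t r) / sqrt n))" by simp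
  also have "\<dots> \<le> n * (t / n * ((hitc t r + biasc t r) / sqrt n))"
  proof (rule mult_right_mono)
    show "real (card ?W) \<le> n" using card_mono[of "{..<n}" ?W] by auto
    show "0 \<le> t / n * ((hitc t r + biasc t r) / sqrt n)"
      using t_nonneg hitc_nonneg biasc_nonneg by (intro mult_nonneg_nonneg divide_nonneg_nonneg add_nonneg_nonneg) auto
  qed
  also have "\<dots> = (t * hitc t r + t * biasc t r) / sqrt n"
    using n_pos by (simp add: field_simps)
  finally have 3: "\<bar>exp (- rex A ?X) - exp (- (\<Sum>w\<in>?W. lam v w * surv r w))\<bar>
      \<le> (t * hitc t r + t * biasc t r) / sqrt n" .
  have "rex A (\<lambda>H. of_bool (sawalk H (Suc r) v {..<n})) = 1 - rex A (\<lambda>H. exp (- ?X H))"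
    by (rule prob_sawalk_Suc) simp
  then have "\<bar>rex A (\<lambda>H. of_bool (sawalk H (Suc r) v {..<n})) - surv (Suc r) v\<bar>
     \<le> t * sqrt (varc t r) / sqrt n + (t * hitc t r + t * biasc t r) / sqrt n"
    using 1 3 by (simp del: sawalk.simps)
  also have "\<dots> = biasc t (Suc r) / sqrt n" by (simp add: add_divide_distrib)
  finally show ?case .
qed

lemma sawalk_count_approx:
  "rex A (\<lambda>H. \<bar>card {v\<in>{..<n}. sawalk H r v {..<n}} / n - (\<Sum>v<n. surv r v) / n\<bar>)
    \<le> (sqrt (varc t r) + biasc t r) / sqrt n"
proof -
  let ?Z = "\<lambda>H. \<Sum>w\<in>{..<n}. 1 * of_bool (sawalk H r w {..<n}) :: real"
  have Z: "real (card {v\<in>{..<n}. sawalk H r v {..<n}}) = ?Z H" for H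
    by (simp add: of_bool_def sum.If_cases Int_def)
  let ?s = "\<Sum>v<n. surv r v"
  have "rex A (\<lambda>H. \<bar>?Z H / n - ?s / n\<bar>) \<le> rex A (\<lambda>H. \<bar>?Z H - rex A ?Z\<bar> / n + \<bar>rex A ?Z - ?s\<bar> / n)"
  proof (rule rex_mono)
    fix H
    have "\<bar>?Z H / n - ?s / n\<bar> = \<bar>?Z H - ?s\<bar> / n"
      by (simp add: diff_divide_distrib[symmetric])
    also have "\<dots> \<le> (\<bar>?Z H - rex A ?Z\<bar> + \<bar>rex A ?Z - ?s\<bar>) / n"
      by (intro divide_right_mono) auto
    finally show "\<bar>?Z H / n - ?s / n\<bar> \<le> \<bar>?Z H - rex A ?Z\<bar> / n + \<bar>rex A ?Z - ?s\<bar> / n"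
      by (simp add: add_divide_distrib)
  qed
  also have "\<dots> = rex A (\<lambda>H. \<bar>?Z H - rex A ?Z\<bar>) / n + \<bar>rex A ?Z - ?s\<bar> / n"
    by (simp only: rex_add rex_divide rex_const[OF finA])
  also have "\<dots> \<le> sqrt (varc t r * n) / n + n * (biasc t r / sqrt n) / n"
  proof (intro add_mono divide_right_mono)
    have "(rex A (\<lambda>H. \<bar>?Z H - rex A ?Z\<bar>))\<^sup>2 \<le> rvar A ?Z" by (rule rex_abs_dev[OF finA])
    also have "\<dots> \<le> varc t r * n" by (rule rvar_sawalk_le) auto
    finally show "rex A (\<lambda>H. \<bar>?Z H - rex A ?Z\<bar>) \<le> sqrt (varc t r * n)" by (rule real_le_rsqrt)
    have "\<bar>rex A ?Z - ?s\<bar> = \<bar>\<Sum>v<n. rex A (\<lambda>H. of_bool (sawalk H r v {..<n})) - surv r v\<bar>"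
      by (simp only: mult_1 rex_sum sum_subtractf)
    also have "\<dots> \<le> (\<Sum>v<n. \<bar>rex A (\<lambda>H. of_bool (sawalk H r v {..<n})) - surv r v\<bar>)" by (rule sum_abs)
    also have "\<dots> \<le> (\<Sum>v<n. biasc t r / sqrt n)" by (intro sum_mono prob_sawalk_approx) auto
    finally show "\<bar>rex A ?Z - ?s\<bar> \<le> n * (biasc t r / sqrt n)" by simp
  qed auto
  also have "\<dots> = (sqrt (varc t r) + biasc t r) / sqrt n"
  proof -
    have "sqrt (varc t r * n) / n = sqrt (varc t r) / sqrt n"
      using n_pos real_sqrt_mult_self[of "real n"]
      by (simp add: real_sqrt_mult field_simps)
    then show ?thesis using n_pos by (simp add: add_divide_distrib)
  qed
  finally show ?thesis unfolding Z .
qed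

lemma expected_hits_le:
  "rex A (\<lambda>H. \<Sum>v<n. card {x\<in>{..<n} - {v}. hits H r v x {..<n}}) \<le> n * hitc t r"
proof -
  have c: "real (card {x\<in>{..<n} - {v}. hits H r v x {..<n}}) = (\<Sum>x\<in>{..<n} - {v}. of_bool (hits H r v x {..<n}))" for v H
    by (simp add: of_bool_def sum.If_cases Int_def)
  have "rex A (\<lambda>H. \<Sum>v<n. card {x\<in>{..<n} - {v}. hits H r v x {..<n}})
     = (\<Sum>v<n. \<Sum>x\<in>{..<n} - {v}. rex A (\<lambda>H. of_bool (hits H r v x {..<n})))"
    unfolding of_nat_sum c by (simp only: rex_sum)
  also have "\<dots> \<le> (\<Sum>v<n. \<Sum>x\<in>{..<n} - {v}. hitc t r / n)"
    by (intro sum_mono prob_hits_le) auto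
  also have "\<dots> \<le> (\<Sum>v<n. n * (hitc t r / n))"
  proof (rule sum_mono)
    fix v
    have "(\<Sum>x\<in>{..<n} - {v}. hitc t r / n) \<le> (\<Sum>x\<in>{..<n}. hitc t r / n)"
      by (rule sum_mono2) (use hitc_nonneg[OF t_nonneg] in auto)
    then show "(\<Sum>x\<in>{..<n} - {v}. hitc t r / n) \<le> n * (hitc t r / n)" by simp
  qed
  also have "\<dots> = n * hitc t r" using n_pos by simp
  finally show ?thesis .
qed

lemma adj_sub: "H \<subseteq> A \<Longrightarrow> adj H \<subseteq> {..<n} \<times> {..<n}"
  unfolding adj_def using A_sub by fastforce

text \<open>Without an \<open>r\<close>-walk from \<open>v\<close> every other vertex of its
  component is hit within \<open>r\<close> steps, and on average only boundedly many vertices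
  are.\<close>

lemma large_component_no_walk:
  assumes "H \<subseteq> A" "v < n" "\<not> sawalk H r v {..<n}"
  shows "card (component {..<n} H v) \<le> Suc (card {x\<in>{..<n} - {v}. hits H r v x {..<n}})"
proof -
  have "component {..<n} H v \<subseteq> insert v {x\<in>{..<n} - {v}. hits H r v x {..<n}}"
  proof
    fix x assume "x \<in> component {..<n} H v"
    then have x: "x < n" "(v, x) \<in> (adj H)\<^sup>*" unfolding component_def connected_in_def by auto
    have "adj H \<inter> {..<n} \<times> {..<n} = adj H" using adj_sub[OF assms(1)] by auto
    then show "x \<in> insert v {x\<in>{..<n} - {v}. hits H r v x {..<n}}"
      using reach_sawalk_or_hits[of v x H "{..<n}" r] assms x by auto
  qed
  then have "card (component {..<n} H v) \<le> card (insert v {x\<in>{..<n} - {v}. hits H r v x {..<n}})"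
    by (intro card_mono) auto
  also have "\<dots> \<le> Suc (card {x\<in>{..<n} - {v}. hits H r v x {..<n}})"
    by (simp add: card_insert_if)
  finally show ?thesis .
qed

end

section \<open>Sprinkling and large components\<close>

lemma connected_in_refl [simp]: "connected_in E u u"
  by (simp add: connected_in_def)

lemma connected_in_sym: "connected_in E u v \<Longrightarrow> connected_in E v u"
proof -
  have "sym (adj E)" by (auto simp: sym_def adj_sym)
  then show "connected_in E u v \<Longrightarrow> connected_in E v u"
    unfolding connected_in_def by (metis sym_rtrancl symD)
qed

lemma connected_in_trans: "connected_in E u v \<Longrightarrow> connected_in E v w \<Longrightarrow> connected_in E u w"
  unfolding connected_in_def by (rule rtrancl_trans)

lemma connected_in_mono: "E \<subseteq> F \<Longrightarrow> connected_in E u v \<Longrightarrow> connected_in F u v"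
  unfolding connected_in_def using rtrancl_mono[OF adj_mono, of E F] by auto

lemma equivp_connected_in: "equivp (connected_in E)"
  by (intro equivpI reflpI sympI transpI) (auto intro: connected_in_sym connected_in_trans)

text \<open>Take a single heavy element if there is one. Otherwise take a subfamily of least
  cardinality among those that reach \<open>x\<close>: without any one of its elements it falls
  below \<open>x\<close>, and that element is lighter than \<open>x\<close>, so its weight stays
  below 2x.\<close>

lemma ex_balanced_subfamily:
  fixes a :: "'a \<Rightarrow> real"
  assumes "finite I" "0 < x" "3 * x \<le> sum a I" "\<And>i. i \<in> I \<Longrightarrow> a i \<le> sum a I - x"
  shows "\<exists>J\<subseteq>I. x \<le> sum a J \<and> sum a J \<le> sum a I - x"
proof (cases "\<exists>i\<in>I. x \<le> a i")
  case True
  then obtain i where "i \<in> I" "x \<le> a i" by auto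
  then show ?thesis using assms(4)[of i] by (intro exI[of _ "{i}"]) auto
next
  case False
  have "I \<subseteq> I \<and> x \<le> sum a I" using assms by auto
  then obtain J where J: "J \<subseteq> I" "x \<le> sum a J"
    "\<And>J'. J' \<subseteq> I \<Longrightarrow> x \<le> sum a J' \<Longrightarrow> card J \<le> card J'"
    using ex_has_least_nat[of "\<lambda>J. J \<subseteq> I \<and> x \<le> sum a J" I card] by auto
  have fJ: "finite J" using J assms finite_subset by auto
  have "J \<noteq> {}" using J assms by auto
  then obtain i where i: "i \<in> J" by auto
  have "\<not> x \<le> sum a (J - {i})"
  proof
    assume "x \<le> sum a (J - {i})"
    then have "card J \<le> card (J - {i})" using J by (intro J(3)) auto
    then show False using i fJ by (metis card_Diff1_less leD)
  qed
  moreover have "sum a J = a i + sum a (J - {i})" using fJ i by (rule sum.remove)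
  moreover have "a i < x" using False i J(1) by (meson linorder_not_le subset_iff)
  ultimately have "sum a J \<le> sum a I - x" using assms by linarith
  then show ?thesis using J by auto
qed

lemma component_subset: "component V E v \<subseteq> V"
  by (auto simp: component_def)

lemma component_eq_iff:
  "u \<in> V \<Longrightarrow> v \<in> V \<Longrightarrow> component V E u = component V E v \<longleftrightarrow> connected_in E u v"
proof
  assume "u \<in> V" "v \<in> V" "component V E u = component V E v"
  then have "v \<in> component V E u" by (auto simp: component_def)
  then show "connected_in E u v" by (auto simp: component_def)
next
  assume "connected_in E u v"
  then have "connected_in E u = connected_in E v" using equivp_connected_in by (simp add: equivp_def)
  then show "component V E u = component V E v" by (simp add: component_def)
qed

lemma component_disjoint:
  assumes "C \<in> component V E ` V" "D \<in> component V E ` V" "C \<noteq> D"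
  shows "C \<inter> D = {}"
proof (rule ccontr)
  assume "C \<inter> D \<noteq> {}"
  then obtain w where w: "w \<in> C" "w \<in> D" by auto
  obtain u v where uv: "u \<in> V" "v \<in> V" "C = component V E u" "D = component V E v"
    using assms by auto
  have "connected_in E u w" "connected_in E v w" using w uv by (auto simp: component_def)
  then have "connected_in E u v" by (metis connected_in_sym connected_in_trans)
  then show False using uv assms(3) component_eq_iff by metis
qed

text \<open>Sprinkling: adding the random edges \<open>H2\<close> merges almost all of the components of \<open>H1\<close>
  that have at least \<open>K\<close> vertices. Otherwise the union \<open>W\<close> of these components is split into two
  large parts, each a union of components of \<open>H1\<close>, without edges of \<open>H2\<close> in between; there are
  at most \<open>2 powr (n / K)\<close> such splits.\<close>

lemma (in random_subset) sprinkling: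
  fixes H1 B :: "edge set" and L :: "nat set" and n K :: nat and d \<eta> :: real
  assumes finB: "finite B" and n: "0 < n" and K: "0 < K" and L: "L \<subseteq> {..<n}"
    and closed: "\<And>u v. u \<in> L \<Longrightarrow> v < n \<Longrightarrow> connected_in H1 u v \<Longrightarrow> v \<in> L"
    and rate: "\<And>u v. u \<in> L \<Longrightarrow> v \<in> L \<Longrightarrow> u \<noteq> v \<Longrightarrow> d / n \<le> \<theta> * card (B \<inter> ebetween u v)"
    and d: "0 \<le> d" and \<eta>: "0 < \<eta>"
  defines "W \<equiv> {v \<in> L. K \<le> card (component {..<n} H1 v)}"
  shows "rex B (\<lambda>H2. of_bool (\<forall>v<n. card (component {..<n} (H1 \<union> H2) v) < card W - 3 * \<eta> * n))
    \<le> 2 powr (n / K) * exp (- d * \<eta>\<^sup>2 * n)"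
proof -
  let ?V = "{..<n}" and ?x = "\<eta> * n"
  define \<C> where "\<C> = component ?V H1 ` W"
  have WV: "W \<subseteq> ?V" using L by (auto simp: W_def)
  have finW: "finite W" using WV finite_subset by auto
  have finC: "finite \<C>" using finW by (simp add: \<C>_def)
  have selfC: "v \<in> component ?V H1 v" if "v \<in> W" for v using that WV by (auto simp: component_def)
  have CW: "component ?V H1 v \<subseteq> W" if v: "v \<in> W" for v
  proof
    fix u assume u: "u \<in> component ?V H1 v"
    then have "u < n" "connected_in H1 v u" by (auto simp: component_def)
    moreover have "component ?V H1 v = component ?V H1 u"
      using calculation v WV by (subst component_eq_iff) auto
    ultimately show "u \<in> W" using v closed by (auto simp: W_def)
  qed
  have disjC: "disjoint \<C>"
  proof (rule disjointI)
    fix C D assume "C \<in> \<C>" "D \<in> \<C>" "C \<noteq> D"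
    then show "C \<inter> D = {}"
      using WV by (intro component_disjoint[of C ?V H1 D]) (auto simp: \<C>_def)
  qed
  have UC: "\<Union>\<C> = W" using CW selfC by (auto simp: \<C>_def)
  have cardC: "card \<C> * K \<le> n"
  proof -
    have "card \<C> * K = (\<Sum>C\<in>\<C>. K)" by simp
    also have "\<dots> \<le> (\<Sum>C\<in>\<C>. card C)"
      by (intro sum_mono) (auto simp: \<C>_def W_def)
    also have "\<dots> = card (\<Union>\<C>)"
      using disjC finC by (intro card_Union_disjoint[symmetric])
        (auto simp: \<C>_def component_def disjoint_def pairwise_def disjnt_def)
    also have "\<dots> \<le> card ?V" unfolding UC using WV by (intro card_mono) auto
    finally show ?thesis by simp
  qed
  define X where "X = {\<D>. \<D> \<subseteq> \<C> \<and> ?x \<le> card (\<Union>\<D>) \<and> ?x \<le> card (W - \<Union>\<D>)}"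
  define cut where "cut \<D> = (\<Union>(u,v)\<in>\<Union>\<D> \<times> (W - \<Union>\<D>). B \<inter> ebetween u v)" for \<D>
  have finX: "finite X" unfolding X_def using finC by auto
  have cutB: "cut \<D> \<subseteq> B" for \<D> by (auto simp: cut_def)
  have key: "\<exists>\<D>\<in>X. H2 \<inter> cut \<D> = {}"
    if H2: "H2 \<subseteq> B" and bad: "\<forall>v<n. card (component ?V (H1 \<union> H2) v) < card W - 3 * \<eta> * n" for H2
  proof -
    let ?H = "H1 \<union> H2"
    \<comment> \<open>Components of the union graph, weighted by their share of \<open>W\<close>.
      None has more than |W| - 3 \<eta> n vertices, so some subfamily collects between \<eta> n and
      |W| - \<eta> n vertices of \<open>W\<close>.\<close>
    define I where "I = component ?V ?H ` W"
    define a where "a C = real (card (C \<inter> W))" for C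
    have w3: "3 * ?x \<le> card W" using bad[rule_format, OF n] by (simp add: mult.assoc)
    have sumI: "sum a J = card (\<Union>C\<in>J. C \<inter> W)" if "J \<subseteq> I" for J
    proof -
      have "finite J" using that finite_subset[of J I] finW by (auto simp: I_def)
      moreover have "(C \<inter> W) \<inter> (D \<inter> W) = {}" if "C \<in> J" "D \<in> J" "C \<noteq> D" for C D
      proof -
        have "C \<in> component ?V ?H ` ?V" "D \<in> component ?V ?H ` ?V"
          using that \<open>J \<subseteq> I\<close> WV by (auto simp: I_def)
        then have "C \<inter> D = {}" using that(3) by (rule component_disjoint)
        then show ?thesis by auto
      qed
      ultimately have "card (\<Union>C\<in>J. C \<inter> W) = (\<Sum>C\<in>J. card (C \<inter> W))"
        using finW by (intro card_UN_disjoint) auto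
      then show ?thesis by (simp add: a_def)
    qed
    have "(\<Union>C\<in>I. C \<inter> W) = W" using WV by (auto simp: I_def component_def)
    then have sI: "sum a I = card W" using sumI[of I] by simp
    obtain J where J: "J \<subseteq> I" "?x \<le> sum a J" "sum a J \<le> card W - ?x"
    proof -
      have "\<exists>J\<subseteq>I. ?x \<le> sum a J \<and> sum a J \<le> sum a I - ?x"
      proof (rule ex_balanced_subfamily)
        show "finite I" using finW by (simp add: I_def)
        show "0 < ?x" using \<eta> n by simp
        show "3 * ?x \<le> sum a I" using w3 sI by simp
        fix C assume "C \<in> I"
        then obtain v where v: "v \<in> W" "C = component ?V ?H v" by (auto simp: I_def)
        then have "v < n" using WV by auto
        have "a C \<le> card C" unfolding a_def v
          using component_subset[of ?V ?H v] by (auto intro!: card_mono finite_subset[OF component_subset])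
        also have "\<dots> \<le> card W - 3 * \<eta> * n" using bad[rule_format, OF \<open>v < n\<close>] v by simp
        also have "\<dots> \<le> sum a I - ?x" using sI \<eta> by simp
        finally show "a C \<le> sum a I - ?x" .
      qed
      then show ?thesis using that sI by auto
    qed
    define D where "D = (\<Union>C\<in>J. C \<inter> W)"
    have cardD: "card D = sum a J" using sumI[OF J(1)] by (simp add: D_def)
    have closedD: "u \<in> D" if v: "v \<in> D" and "u \<in> W" "connected_in ?H v u" for u v
    proof -
      obtain C z where C: "C \<in> J" "v \<in> C" "C = component ?V ?H z" using v J(1) by (auto simp: D_def I_def)
      then have "connected_in ?H z u" using that by (auto simp: component_def intro: connected_in_trans)
      then have "u \<in> C" using C WV that by (auto simp: component_def)
      then show ?thesis using C that by (auto simp: D_def)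
    qed
    \<comment> \<open>Within \<open>W\<close>, the set \<open>D\<close> is closed under connection
      in the union graph, hence in \<open>H1\<close>. It is therefore a union of members of
      \<open>\<C>\<close>, and the split is encoded by a subset of \<open>\<C>\<close>.\<close>
    define \<D> where "\<D> = {C \<in> \<C>. C \<subseteq> D}"
    have UD: "\<Union>\<D> = D"
    proof
      show "\<Union>\<D> \<subseteq> D" by (auto simp: \<D>_def)
      show "D \<subseteq> \<Union>\<D>"
      proof
        fix v assume v: "v \<in> D"
        then have vW: "v \<in> W" by (auto simp: D_def)
        have "component ?V H1 v \<subseteq> D"
        proof
          fix u assume u: "u \<in> component ?V H1 v"
          then have "u \<in> W" using CW[OF vW] by auto
          moreover have "connected_in ?H v u" using u by (auto simp: component_def intro: connected_in_mono[of H1])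
          ultimately show "u \<in> D" using closedD v by auto
        qed
        then show "v \<in> \<Union>\<D>" using selfC[OF vW] vW by (auto simp: \<D>_def \<C>_def)
      qed
    qed
    have DW: "D \<subseteq> W" by (auto simp: D_def)
    have "real (card (W - D)) = card W - card D"
      using DW finW finite_subset[OF DW] by (simp add: card_Diff_subset card_mono of_nat_diff)
    moreover have "\<D> \<subseteq> \<C>" by (auto simp: \<D>_def)
    ultimately have "\<D> \<in> X" unfolding X_def mem_Collect_eq UD using J cardD by linarith
    moreover have "H2 \<inter> cut \<D> = {}"
    proof (rule ccontr)
      assume "H2 \<inter> cut \<D> \<noteq> {}"
      then obtain e where eH: "e \<in> H2" and ec: "e \<in> cut \<D>" by auto
      from ec obtain p where "p \<in> D \<times> (W - D)" "e \<in> ebetween (fst p) (snd p)"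
        unfolding cut_def UD by (metis (no_types, lifting) IntD2 UN_E case_prod_beta)
      then obtain u v where e: "u \<in> D" "v \<in> W - D" "e \<in> H2" "e \<in> ebetween u v"
        using eH by auto
      then have "(u, v) \<in> adj ?H" by (auto simp: adj_iff)
      then have "connected_in ?H u v" by (simp add: connected_in_def)
      then show False using closedD[of u v] e by auto
    qed
    ultimately show ?thesis by blast
  qed
  have "rex B (\<lambda>H2. of_bool (\<forall>v<n. card (component ?V (H1 \<union> H2) v) < card W - 3 * \<eta> * n))
      \<le> rex B (\<lambda>H2. \<Sum>\<D>\<in>X. of_bool (H2 \<inter> cut \<D> = {}))"
  proof (rule rex_mono)
    fix H2 assume H2: "H2 \<subseteq> B"
    show "of_bool (\<forall>v<n. card (component ?V (H1 \<union> H2) v) < card W - 3 * \<eta> * n)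
      \<le> (\<Sum>\<D>\<in>X. of_bool (H2 \<inter> cut \<D> = {}) :: real)"
    proof (cases "\<forall>v<n. card (component ?V (H1 \<union> H2) v) < card W - 3 * \<eta> * n")
      case True
      then obtain \<D> where \<D>: "\<D> \<in> X" "H2 \<inter> cut \<D> = {}" using key[OF H2] by blast
      then have "(of_bool (H2 \<inter> cut \<D> = {}) :: real) \<le> (\<Sum>\<D>\<in>X. of_bool (H2 \<inter> cut \<D> = {}))"
        using finX by (intro member_le_sum) auto
      then show ?thesis using \<D> by (simp add: True)
    next
      case False
      have "0 \<le> (\<Sum>\<D>\<in>X. of_bool (H2 \<inter> cut \<D> = {}) :: real)" by (intro sum_nonneg) auto
      then show ?thesis using False by (simp only: of_bool_eq)
    qed
  qed
  also have "\<dots> = (\<Sum>\<D>\<in>X. exp (- \<theta> * card (cut \<D>)))"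
    unfolding rex_sum by (intro sum.cong refl rex_avoid finB cutB)
  also have "\<dots> \<le> (\<Sum>\<D>\<in>X. exp (- d * \<eta>\<^sup>2 * n))"
  proof (rule sum_mono)
    fix \<D> assume \<D>: "\<D> \<in> X"
    let ?D = "\<Union>\<D>" and ?E = "W - \<Union>\<D>"
    have DW: "?D \<subseteq> W" using \<D> UC by (auto simp: X_def)
    have finD: "finite ?D" "finite ?E" using DW finW finite_subset by auto
    have "card (cut \<D>) = (\<Sum>p\<in>?D \<times> ?E. card (case p of (u,v) \<Rightarrow> B \<inter> ebetween u v))"
      unfolding cut_def
    proof (rule card_UN_disjoint)
      show "\<forall>p\<in>?D \<times> ?E. \<forall>p'\<in>?D \<times> ?E. p \<noteq> p' \<longrightarrow>
        (case p of (u,v) \<Rightarrow> B \<inter> ebetween u v) \<inter> (case p' of (u,v) \<Rightarrow> B \<inter> ebetween u v) = {}"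
        unfolding ebetween_def by (auto simp: disjoint_iff)
    qed (use finD finB in auto)
    then have "\<theta> * card (cut \<D>) = (\<Sum>p\<in>?D \<times> ?E. \<theta> * card (B \<inter> ebetween (fst p) (snd p)))"
      by (simp add: case_prod_unfold sum_distrib_left)
    also have "\<dots> \<ge> (\<Sum>p\<in>?D \<times> ?E. d / n)"
      by (rule sum_mono) (use DW in \<open>auto intro!: rate simp: W_def\<close>)
    also have "(\<Sum>p\<in>?D \<times> ?E. d / n) = card ?D * card ?E * (d / n)" using finD by simp
    \<comment> \<open>Both sides of a split have at least \<eta> n vertices, so at least \<eta>^2
      n^2 pairs cross it, each at rate at least d/n.\<close>
    also have "card ?D * card ?E * (d / n) \<ge> ?x * ?x * (d / n)"
    proof (rule mult_right_mono)
      have "?x \<le> card ?D" "?x \<le> card ?E" "0 \<le> ?x" using \<D> \<eta> by (simp_all add: X_def)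
      then show "?x * ?x \<le> real (card ?D * card ?E)" unfolding of_nat_mult by (intro mult_mono) auto
    qed (use d in simp)
    also have "?x * ?x * (d / n) = d * \<eta>\<^sup>2 * n" using n by (simp add: power2_eq_square)
    finally show "exp (- \<theta> * card (cut \<D>)) \<le> exp (- d * \<eta>\<^sup>2 * n)" by simp
  qed
  also have "\<dots> = card X * exp (- d * \<eta>\<^sup>2 * n)" by simp
  also have "\<dots> \<le> 2 powr (n / K) * exp (- d * \<eta>\<^sup>2 * n)"
  proof (rule mult_right_mono)
    have "card X \<le> card (Pow \<C>)" using finC by (intro card_mono) (auto simp: X_def)
    then have "real (card X) \<le> 2 ^ card \<C>" using finC by (simp add: card_Pow)
    also have "\<dots> = 2 powr (card \<C>)" by (simp add: powr_realpow)
    also have "\<dots> \<le> 2 powr (n / K)"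
    proof (rule powr_mono)
      have "real (card \<C>) * K \<le> n" using cardC by (metis of_nat_le_iff of_nat_mult)
      then show "real (card \<C>) \<le> n / K" using K by (simp add: field_simps)
    qed simp
    finally show "real (card X) \<le> 2 powr (n / K)" .
  qed simp
  finally show ?thesis .
qed

section \<open>Relations with at most one large class\<close>

definition bigset :: "real \<Rightarrow> nat \<Rightarrow> (nat \<Rightarrow> nat \<Rightarrow> bool) \<Rightarrow> nat set" where
  "bigset \<epsilon> n R = {v \<in> {..<n}. \<epsilon> * n < card {u \<in> {..<n}. R v u}}"

text \<open>For an equivalence this says that all classes with more than \<epsilon> n elements
  coincide and have about r n elements. It also covers the absence of a giant: then the large set is
  empty and r is at most 2 \<epsilon>.\<close>

definition giant_like :: "real \<Rightarrow> nat \<Rightarrow> real \<Rightarrow> (nat \<Rightarrow> nat \<Rightarrow> bool) \<Rightarrow> bool" where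
  "giant_like \<epsilon> n r R \<longleftrightarrow> (\<forall>u\<in>bigset \<epsilon> n R. \<forall>v\<in>bigset \<epsilon> n R. R u v) \<and>
     \<bar>card (bigset \<epsilon> n R) / n - r\<bar> \<le> 2 * \<epsilon>"

text \<open>Suppose that two large classes differ. Either the class of \<open>v\<close> is large and
  differs from one of them, or it is small and r - b \<le> \<epsilon>. In both cases more than (r -
  b + \<epsilon>) n vertices lie in large classes, which contradicts the upper bound because a + b <
  \<epsilon>.\<close>

lemma giant_likeI:
  fixes r a b \<epsilon> :: real
  assumes R: "equivp R" and n: "0 < n"
    and up: "card (bigset \<epsilon> n R) \<le> (r + a) * n"
    and v: "v < n" and low: "(r - b) * n \<le> card {u \<in> {..<n}. R v u}"
    and ab: "a + b < \<epsilon>" "0 \<le> a" "0 \<le> b"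
  shows "giant_like \<epsilon> n r R"
proof -
  let ?V = "{..<n}" and ?B = "bigset \<epsilon> n R"
  define cl where "cl v = {u \<in> ?V. R v u}" for v
  have fin: "finite ?B" "finite (cl v)" for v by (auto simp: bigset_def cl_def)
  have cl_eq: "cl u = cl w" if "R u w" for u w
    using that R unfolding cl_def by (metis equivp_def)
  have cl_disj: "cl u \<inter> cl w = {}" if "\<not> R u w" for u w
    using that R unfolding cl_def by (auto dest: equivp_symp equivp_transp)
  have cl_sub: "cl u \<subseteq> ?B" if "\<epsilon> * n < card (cl u)" for u
  proof
    fix w assume w: "w \<in> cl u"
    then have "cl u = cl w" by (intro cl_eq) (auto simp: cl_def)
    then show "w \<in> ?B" using w that unfolding bigset_def cl_def by auto
  qed
  have big: "u \<in> ?B \<Longrightarrow> \<epsilon> * n < card (cl u)" for u by (auto simp: bigset_def cl_def)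
  have rel: "R u w" if uw: "u \<in> ?B" "w \<in> ?B" for u w
  proof (rule ccontr)
    assume nR: "\<not> R u w"
    have two: "card (cl p) + card (cl q) \<le> card ?B"
      if "\<not> R p q" "\<epsilon> * n < card (cl p)" "\<epsilon> * n < card (cl q)" for p q
      using card_mono[OF fin(1), of "cl p \<union> cl q"] cl_sub[OF that(2)] cl_sub[OF that(3)]
        cl_disj[OF that(1)] fin by (simp add: card_Un_disjoint)
    have "(r - b + \<epsilon>) * n < card ?B"
    proof (cases "\<epsilon> * n < card (cl v)")
      case True
      have "\<not> R v u \<or> \<not> R v w" using nR R by (metis equivp_symp equivp_transp)
      then obtain p where p: "p \<in> {u, w}" "\<not> R v p" by auto
      then have "\<epsilon> * n < card (cl p)" using big uw by auto
      then have "(r - b) * n + \<epsilon> * n < card (cl v) + card (cl p)"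
        using low by (simp add: cl_def)
      also have "\<dots> \<le> card ?B"
        using two[OF p(2) True \<open>\<epsilon> * n < card (cl p)\<close>] by linarith
      finally show ?thesis by (simp add: algebra_simps)
    next
      case False
      then have "(r - b) * n \<le> \<epsilon> * n" using low by (simp add: cl_def)
      then have "(r - b + \<epsilon>) * n < card (cl u) + card (cl w)"
        using big[OF uw(1)] big[OF uw(2)] by (simp add: algebra_simps)
      also have "\<dots> \<le> card ?B" using two[OF nR big[OF uw(1)] big[OF uw(2)]] by linarith
      finally show ?thesis .
    qed
    also have "\<dots> \<le> (r + a) * n" by (rule up)
    finally have "r - b + \<epsilon> < r + a" using n by simp
    then show False using ab by simp
  qed
  have "card ?B / n \<le> r + a" using up n by (simp add: field_simps)
  moreover have "r - 2 * \<epsilon> \<le> card ?B / n"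
  proof (cases "\<epsilon> * n < card (cl v)")
    case True
    then have "card (cl v) \<le> card ?B" using cl_sub fin by (intro card_mono) auto
    then have "(r - b) * n \<le> card ?B" using low by (simp add: cl_def)
    then have "r - b \<le> card ?B / n" using n by (simp add: field_simps)
    then show ?thesis using ab by simp
  next
    case False
    then have "(r - b) * n \<le> \<epsilon> * n" using low by (simp add: cl_def)
    then have "r - b \<le> \<epsilon>" using n by simp
    moreover have "0 \<le> card ?B / real n" by simp
    ultimately show ?thesis using ab by linarith
  qed
  ultimately show ?thesis unfolding giant_like_def using rel ab by auto
qed

context random_graph
begin

text \<open>Markov's inequality for the number of pairs (v, x) such that \<open>x\<close> is hit
  from \<open>v\<close>: a vertex of a large component without an \<open>r\<close>-walk contributes
  more than \<epsilon> n - 1, hence at least \<epsilon> n / 2 such pairs.\<close>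

lemma prob_large_component_no_walk:
  fixes \<epsilon> \<eta> :: real
  assumes \<epsilon>: "0 < \<epsilon>" "2 \<le> \<epsilon> * n" and \<eta>: "0 < \<eta>"
  shows "rex A (\<lambda>H. of_bool (\<eta> * n \<le> card {v \<in> bigset \<epsilon> n (connected_in H). \<not> sawalk H r v {..<n}}))
    \<le> 2 * hitc t r / (\<epsilon> * \<eta> * n)"
proof -
  let ?S = "\<lambda>H. {v \<in> bigset \<epsilon> n (connected_in H). \<not> sawalk H r v {..<n}}"
  let ?f = "\<lambda>H. real (\<Sum>v<n. card {x\<in>{..<n} - {v}. hits H r v x {..<n}})"
  have pos: "0 < \<epsilon> * n / 2 * (\<eta> * n)" using \<epsilon> \<eta> n_pos by simp
  have "rex A (\<lambda>H. of_bool (\<eta> * n \<le> card (?S H))) \<le> rex A (\<lambda>H. of_bool (\<epsilon> * n / 2 * (\<eta> * n) \<le> ?f H))"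
  proof (rule rex_mono)
    fix H assume H: "H \<subseteq> A"
    have "\<epsilon> * n / 2 * card (?S H) = (\<Sum>v\<in>?S H. \<epsilon> * n / 2)" by simp
    also have "\<dots> \<le> (\<Sum>v\<in>?S H. real (card {x\<in>{..<n} - {v}. hits H r v x {..<n}}))"
    proof (rule sum_mono)
      fix v assume v: "v \<in> ?S H"
      then have "card (component {..<n} H v) \<le> Suc (card {x\<in>{..<n} - {v}. hits H r v x {..<n}})"
        by (intro large_component_no_walk H) (auto simp: bigset_def)
      then have "real (card (component {..<n} H v)) \<le> 1 + card {x\<in>{..<n} - {v}. hits H r v x {..<n}}"
        by linarith
      moreover have "\<epsilon> * n < card (component {..<n} H v)" using v by (auto simp: bigset_def component_def)
      ultimately show "\<epsilon> * n / 2 \<le> card {x\<in>{..<n} - {v}. hits H r v x {..<n}}" using \<epsilon> by linarith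
    qed
    also have "\<dots> \<le> ?f H" unfolding of_nat_sum by (rule sum_mono2) (auto simp: bigset_def)
    finally have *: "\<epsilon> * n / 2 * card (?S H) \<le> ?f H" .
    have "\<epsilon> * n / 2 * (\<eta> * n) \<le> ?f H" if "\<eta> * n \<le> card (?S H)"
    proof -
      have "\<epsilon> * n / 2 * (\<eta> * n) \<le> \<epsilon> * n / 2 * card (?S H)"
        using that \<epsilon> by (intro mult_left_mono) auto
      with * show ?thesis by linarith
    qed
    then show "(of_bool (\<eta> * n \<le> card (?S H)) :: real) \<le> of_bool (\<epsilon> * n / 2 * (\<eta> * n) \<le> ?f H)"
      by auto
  qed
  also have "\<dots> \<le> rex A ?f / (\<epsilon> * n / 2 * (\<eta> * n))" by (rule rex_markov[OF pos]) (simp only: of_nat_0_le_iff)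
  also have "\<dots> \<le> n * hitc t r / (\<epsilon> * n / 2 * (\<eta> * n))"
    by (rule divide_right_mono[OF expected_hits_le]) (use pos in simp)
  also have "\<dots> = 2 * hitc t r / (\<epsilon> * \<eta> * n)" using n_pos by (simp add: field_simps)
  finally show ?thesis .
qed

end

section \<open>The branching process and its survival probability\<close>

text \<open>\<open>ker t x y / n\<close> is the expected number of edges of the next layer that arrive by time \<open>t\<close>
  between two vertices which joined the giant of the current layer at times \<open>x\<close> and \<open>y\<close>.\<close>

definition ker :: "real \<Rightarrow> real \<Rightarrow> real \<Rightarrow> real" where
  "ker t x y = max 0 (t - max 0 (max x y))"

lemma ker_nonneg: "0 \<le> ker t x y"
  by (simp add: ker_def)

lemma ker_le: "ker t x y \<le> max 0 t"
  by (auto simp: ker_def max_def)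

lemma ker_lipschitz: "\<bar>ker t x y - ker t x' y'\<bar> \<le> max \<bar>x - x'\<bar> \<bar>y - y'\<bar>"
  by (auto simp: ker_def max_def)

lemma ker_lipschitz_time: "\<bar>ker t x y - ker t' x y\<bar> \<le> \<bar>t - t'\<bar>"
  by (auto simp: ker_def max_def)

lemma ker_mono_time: "t \<le> t' \<Longrightarrow> ker t x y \<le> ker t' x y"
  by (auto simp: ker_def max_def)

lemma ker_measurable [measurable]: "ker t x \<in> borel_measurable borel"
  unfolding ker_def by measurable

lemma Lipschitz_borel_measurable:
  fixes f :: "real \<Rightarrow> real"
  assumes "\<And>x y. \<bar>f x - f y\<bar> \<le> C * \<bar>x - y\<bar>"
  shows "f \<in> borel_measurable borel"
proof (rule borel_measurable_continuous_onI)
  have "0 \<le> C" using assms[of 0 1] by simp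
  then have "C-lipschitz_on UNIV f"
    using assms by (auto simp: lipschitz_on_def dist_real_def)
  then show "continuous_on UNIV f" by (rule lipschitz_on_continuous_on)
qed

definition fuzzy :: "(real \<Rightarrow> real) \<Rightarrow> bool" where
  "fuzzy g \<longleftrightarrow> g \<in> borel_measurable borel \<and> (\<forall>x. 0 \<le> g x \<and> g x \<le> 1)"

lemma fuzzyD: assumes "fuzzy g" shows "g \<in> borel_measurable borel" "0 \<le> g x" "g x \<le> 1"
  using assms by (auto simp: fuzzy_def)

context real_distribution
begin

lemma integrable_bounded:
  assumes "f \<in> borel_measurable borel" "\<And>x. \<bar>f x\<bar> \<le> (B::real)"
  shows "integrable M f"
  by (rule integrable_const_bound[of _ B]) (use assms in auto)

lemma prob_UNIV [simp]: "measure M UNIV = 1"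
  using prob_space by simp

lemma integrable_ind [simp]: "S \<in> sets borel \<Longrightarrow> integrable M (indicator S :: real \<Rightarrow> real)"
  by (rule integrable_bounded[of _ 1]) (auto simp: indicator_def)

lemma integrable_fuzzy: "fuzzy g \<Longrightarrow> integrable M g"
  by (rule integrable_bounded[of _ 1]) (auto simp: fuzzy_def)

text \<open>Mean number of surviving children of an individual of type \<open>x\<close> if a child
  of type \<open>y\<close> survives with probability \<open>g y\<close>; the types have law
  \<open>M\<close>.\<close>

definition Top :: "real \<Rightarrow> (real \<Rightarrow> real) \<Rightarrow> real \<Rightarrow> real" where
  "Top t g x = (\<integral>y. ker t x y * g y \<partial>M)"

lemma Top_integrable: "fuzzy g \<Longrightarrow> integrable M (\<lambda>y. ker t x y * g y)"
proof (rule integrable_bounded[of _ "max 0 t * 1"])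
  assume g: "fuzzy g"
  note [measurable] = fuzzyD(1)[OF g]
  show "(\<lambda>y. ker t x y * g y) \<in> borel_measurable borel" by measurable
  show "\<bar>ker t x y * g y\<bar> \<le> max 0 t * 1" for y
    unfolding abs_mult using fuzzyD[OF g] ker_nonneg[of t x y] ker_le[of t x y]
    by (intro mult_mono) auto
qed

lemma Top_nonneg: "fuzzy g \<Longrightarrow> 0 \<le> Top t g x"
  unfolding Top_def by (rule Bochner_Integration.integral_nonneg) (simp add: ker_nonneg fuzzyD)

lemma integral_le_bound:
  assumes "integrable M f" "\<And>x. f x \<le> (c::real)"
  shows "(\<integral>x. f x \<partial>M) \<le> c"
  using integral_mono[OF assms(1), of "\<lambda>_. c"] assms(2) by simp

lemma abs_integral_le_bound:
  assumes "integrable M f" "\<And>x. \<bar>f x\<bar> \<le> (c::real)"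
  shows "\<bar>\<integral>x. f x \<partial>M\<bar> \<le> c"
proof -
  have "\<bar>\<integral>x. f x \<partial>M\<bar> \<le> (\<integral>x. \<bar>f x\<bar> \<partial>M)"
    using integral_norm_bound[of M f] by simp
  also have "\<dots> \<le> c" by (rule integral_le_bound) (use assms in auto)
  finally show ?thesis .
qed

lemma Top_le: "fuzzy g \<Longrightarrow> Top t g x \<le> max 0 t"
  unfolding Top_def
proof (rule integral_le_bound[OF Top_integrable])
  fix y assume g: "fuzzy g"
  show "ker t x y * g y \<le> max 0 t"
    using mult_mono[OF ker_le[of t x y] fuzzyD(3)[OF g]] fuzzyD(2)[OF g] by (metis max.cobounded1 mult.right_neutral)
qed

lemma Top_mono:
  assumes "fuzzy g" "fuzzy g'" "\<And>y. g y \<le> g' y"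
  shows "Top t g x \<le> Top t g' x"
  unfolding Top_def using assms
  by (intro integral_mono Top_integrable mult_left_mono) (auto simp: ker_nonneg)

lemma Top_mono_time:
  assumes "fuzzy g" "t \<le> t'"
  shows "Top t g x \<le> Top t' g x"
  unfolding Top_def using assms
  by (intro integral_mono Top_integrable mult_right_mono) (auto simp: ker_mono_time fuzzyD)

lemma Top_diff_le:
  assumes g: "fuzzy g" "fuzzy g'" and d: "\<And>y. \<bar>ker t x y * g y - ker t' x' y * g' y\<bar> \<le> d"
  shows "\<bar>Top t g x - Top t' g' x'\<bar> \<le> d"
proof -
  have "Top t g x - Top t' g' x' = (\<integral>y. ker t x y * g y - ker t' x' y * g' y \<partial>M)"
    unfolding Top_def using g by (simp add: Bochner_Integration.integral_diff Top_integrable)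
  then show ?thesis
    using abs_integral_le_bound[of "\<lambda>y. ker t x y * g y - ker t' x' y * g' y" d] d g
    by (simp add: Top_integrable)
qed

lemma Top_lipschitz:
  assumes "fuzzy g"
  shows "\<bar>Top t g x - Top t g x'\<bar> \<le> \<bar>x - x'\<bar>"
proof (rule Top_diff_le[OF assms assms])
  fix y
  have "\<bar>ker t x y * g y - ker t x' y * g y\<bar> = \<bar>ker t x y - ker t x' y\<bar> * g y"
    using fuzzyD[OF assms] by (simp add: abs_mult left_diff_distrib[symmetric])
  also have "\<dots> \<le> \<bar>x - x'\<bar> * 1"
    using ker_lipschitz[of t x y x' y] fuzzyD[OF assms] by (intro mult_mono) auto
  finally show "\<bar>ker t x y * g y - ker t x' y * g y\<bar> \<le> \<bar>x - x'\<bar>" by simp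
qed

lemma Top_time_diff:
  assumes g: "fuzzy g" "fuzzy g'" and d: "\<And>y. \<bar>g y - g' y\<bar> \<le> d"
  shows "\<bar>Top t g x - Top t' g' x\<bar> \<le> \<bar>t - t'\<bar> + max 0 t' * d"
proof (rule Top_diff_le[OF g])
  fix y
  have "ker t x y * g y - ker t' x y * g' y = (ker t x y - ker t' x y) * g y + ker t' x y * (g y - g' y)"
    by (simp add: algebra_simps)
  also have "\<bar>\<dots>\<bar> \<le> \<bar>ker t x y - ker t' x y\<bar> * \<bar>g y\<bar> + \<bar>ker t' x y\<bar> * \<bar>g y - g' y\<bar>"
    unfolding abs_mult[symmetric] by (rule abs_triangle_ineq)
  also have "\<dots> \<le> \<bar>t - t'\<bar> * 1 + max 0 t' * d"
    using ker_lipschitz_time[of t x y t'] ker_nonneg[of t' x y] ker_le[of t' x y] fuzzyD[OF g(1)] d[of y]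
    by (intro add_mono mult_mono) auto
  finally show "\<bar>ker t x y * g y - ker t' x y * g' y\<bar> \<le> \<bar>t - t'\<bar> + max 0 t' * d" by simp
qed

definition Phi :: "real \<Rightarrow> (real \<Rightarrow> real) \<Rightarrow> real \<Rightarrow> real" where
  "Phi t g x = 1 - exp (- Top t g x)"

lemma Phi_lipschitz: "fuzzy g \<Longrightarrow> \<bar>Phi t g x - Phi t g x'\<bar> \<le> \<bar>x - x'\<bar>"
  using exp_minus_lipschitz[of "Top t g x" "Top t g x'"] Top_nonneg[of g t] Top_lipschitz[of g t x x']
  by (simp add: Phi_def) 

lemma fuzzy_Phi:
  assumes "fuzzy g"
  shows "fuzzy (Phi t g)"
proof -
  have "Phi t g \<in> borel_measurable borel"
    by (rule Lipschitz_borel_measurable[of _ 1]) (use Phi_lipschitz[OF assms] in auto)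
  then show ?thesis using Top_nonneg[OF assms, of t] by (auto simp: fuzzy_def Phi_def)
qed

lemma Phi_mono:
  assumes "fuzzy g" "fuzzy g'" "\<And>y. g y \<le> g' y" "t \<le> t'"
  shows "Phi t g x \<le> Phi t' g' x"
  using Top_mono[OF assms(1-3), of t x] Top_mono_time[OF assms(2,4), of x] by (simp add: Phi_def)

lemma Phi_zero:
  assumes "t \<le> x \<or> t \<le> 0" 
  shows "Phi t g x = 0"
proof -
  have "ker t x y = 0" for y using assms by (auto simp: ker_def)
  then show ?thesis by (simp add: Phi_def Top_def)
qed

text \<open>Probability that an individual of type \<open>x\<close> has descendants in generation
  \<open>r\<close>; the type is the joining time.\<close>

primrec surF :: "real \<Rightarrow> nat \<Rightarrow> real \<Rightarrow> real" where
  "surF t 0 = (\<lambda>_. 1)"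
| "surF t (Suc r) = Phi t (surF t r)"

lemma fuzzy_surF: "fuzzy (surF t r)"
  by (induction r) (simp_all add: fuzzy_Phi, simp add: fuzzy_def)

lemma surF_Suc_le: "surF t (Suc r) x \<le> surF t r x"
proof (induction r arbitrary: x)
  case 0
  show ?case using fuzzyD(3)[OF fuzzy_surF[of t "Suc 0"]] by simp
next
  case (Suc r)
  have "Phi t (surF t (Suc r)) x \<le> Phi t (surF t r) x"
    by (rule Phi_mono[OF fuzzy_surF fuzzy_surF Suc.IH order_refl])
  then show ?case by (simp only: surF.simps)
qed

lemma decseq_surF: "decseq (\<lambda>r. surF t r x)"
  by (rule decseq_SucI) (rule surF_Suc_le)

lemma surF_lipschitz: "\<bar>surF t r x - surF t r x'\<bar> \<le> \<bar>x - x'\<bar>"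
  by (cases r) (auto intro: Phi_lipschitz fuzzy_surF)

definition sinf :: "real \<Rightarrow> real \<Rightarrow> real" where
  "sinf t x = (INF r. surF t r x)"

lemma sinf_LIMSEQ: "(\<lambda>r. surF t r x) \<longlonglongrightarrow> sinf t x"
  unfolding sinf_def
  by (rule LIMSEQ_decseq_INF[OF bdd_belowI2[of _ 0] decseq_surF]) (simp add: fuzzyD[OF fuzzy_surF])

lemma sinf_le_surF: "sinf t x \<le> surF t r x"
  using decseq_ge[OF decseq_surF sinf_LIMSEQ] .

lemma fuzzy_sinf: "fuzzy (sinf t)"
proof -
  have "sinf t \<in> borel_measurable borel"
    by (rule borel_measurable_LIMSEQ_real[OF sinf_LIMSEQ fuzzyD(1)[OF fuzzy_surF]])
  moreover have "0 \<le> sinf t x" for x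
    by (rule LIMSEQ_le_const[OF sinf_LIMSEQ]) (use fuzzyD[OF fuzzy_surF] in auto)
  moreover have "sinf t x \<le> 1" for x using sinf_le_surF[of t x 0] by simp
  ultimately show ?thesis by (auto simp: fuzzy_def)
qed

lemma sinf_fixpoint: "sinf t x = Phi t (sinf t) x"
proof -
  have "(\<lambda>r. Top t (surF t r) x) \<longlonglongrightarrow> Top t (sinf t) x"
    unfolding Top_def
  proof (rule integral_dominated_convergence[where w = "\<lambda>_. max 0 t * 1"])
    show "(\<lambda>y. ker t x y * sinf t y) \<in> borel_measurable M"
      using fuzzyD(1)[OF fuzzy_sinf] by measurable
    show "(\<lambda>y. ker t x y * surF t r y) \<in> borel_measurable M" for r
      using fuzzyD(1)[OF fuzzy_surF] by measurable
    show "AE y in M. (\<lambda>r. ker t x y * surF t r y) \<longlonglongrightarrow> ker t x y * sinf t y"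
      by (intro AE_I2 tendsto_mult_left sinf_LIMSEQ)
    show "AE y in M. norm (ker t x y * surF t r y) \<le> max 0 t * 1" for r
    proof (rule AE_I2)
      fix y
      show "norm (ker t x y * surF t r y) \<le> max 0 t * 1"
        unfolding real_norm_def abs_mult
        using fuzzyD(2,3)[OF fuzzy_surF, of t r y] ker_nonneg[of t x y] ker_le[of t x y]
        by (intro mult_mono) auto
    qed
  qed simp
  then have "(\<lambda>r. surF t (Suc r) x) \<longlonglongrightarrow> Phi t (sinf t) x"
    unfolding surF.simps Phi_def by (intro tendsto_intros)
  moreover have "(\<lambda>r. surF t (Suc r) x) \<longlonglongrightarrow> sinf t x"
    by (rule LIMSEQ_Suc[OF sinf_LIMSEQ])
  ultimately show ?thesis using LIMSEQ_unique by blast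
qed

text \<open>Monotonicity keeps a subsolution below every iterate started from 1. Lower bounds on
  survival can thus be proved by exhibiting a subsolution, as in \<open>sinf_ge_half\<close> and
  \<open>rho_left\<close>.\<close>

lemma sinf_maximal:
  assumes "fuzzy g" "\<And>x. g x \<le> Phi t g x"
  shows "g x \<le> sinf t x"
proof -
  have "g x \<le> surF t r x" for r x
  proof (induction r arbitrary: x)
    case 0
    then show ?case using fuzzyD[OF assms(1)] by simp
  next
    case (Suc r)
    have "g x \<le> Phi t g x" by (rule assms)
    also have "\<dots> \<le> Phi t (surF t r) x"
      by (rule Phi_mono[OF assms(1) fuzzy_surF Suc.IH order_refl])
    finally show ?case by simp
  qed
  then show ?thesis using LIMSEQ_le_const[OF sinf_LIMSEQ] by blast
qed

lemma sinf_mono: "t \<le> t' \<Longrightarrow> sinf t x \<le> sinf t' x"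
  by (rule sinf_maximal[OF fuzzy_sinf])
    (metis sinf_fixpoint Phi_mono fuzzy_sinf order_refl)

lemma sinf_zero: "t \<le> x \<or> t \<le> 0 \<Longrightarrow> sinf t x = 0"
  using sinf_fixpoint[of t x] Phi_zero[of t x "sinf t"] by simp

section \<open>The limit function: subcritical phase and tail\<close>

definition beta :: "real \<Rightarrow> nat \<Rightarrow> real" where
  "beta t r = (\<integral>x. surF t r x \<partial>M)"

definition rho :: "real \<Rightarrow> real" where
  "rho t = (\<integral>x. sinf t x \<partial>M)"

lemma rho_bounds: "0 \<le> rho t" "rho t \<le> 1"
  unfolding rho_def
  by (auto intro!: Bochner_Integration.integral_nonneg integral_le_bound integrable_fuzzy fuzzy_sinf simp: fuzzyD[OF fuzzy_sinf])

lemma rho_mono: "t \<le> t' \<Longrightarrow> rho t \<le> rho t'"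
  unfolding rho_def by (intro integral_mono integrable_fuzzy fuzzy_sinf sinf_mono)

lemma rho_zero: "t \<le> 0 \<Longrightarrow> rho t = 0"
proof -
  assume "t \<le> 0"
  then have "sinf t = (\<lambda>_. 0)" by (auto simp: sinf_zero)
  then show ?thesis by (simp add: rho_def)
qed

lemma rho_le_beta: "rho t \<le> beta t r"
  unfolding rho_def beta_def
  by (intro integral_mono integrable_fuzzy fuzzy_sinf fuzzy_surF sinf_le_surF)

lemma beta_LIMSEQ: "beta t \<longlonglongrightarrow> rho t"
  unfolding beta_def rho_def
proof (rule integral_dominated_convergence[where w = "\<lambda>_. 1"])
  show "sinf t \<in> borel_measurable M" using fuzzyD(1)[OF fuzzy_sinf] by simp
  show "surF t r \<in> borel_measurable M" for r using fuzzyD(1)[OF fuzzy_surF] by simp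
qed (auto simp: sinf_LIMSEQ fuzzyD[OF fuzzy_surF])

text \<open>The kernel is at most t, so the expected size of generation \<open>r\<close> is at most
  t^r. For t < 1 this forces extinction and later makes the threshold positive.\<close>

lemma beta_le_power: "0 \<le> t \<Longrightarrow> beta t r \<le> t ^ r"
proof -
  assume t: "0 \<le> t"
  have "surF t r x \<le> t ^ r" for x
  proof (induction r arbitrary: x)
    case (Suc r)
    have "surF t (Suc r) x \<le> Top t (surF t r) x"
      using exp_ge_add_one_self[of "- Top t (surF t r) x"] by (simp add: Phi_def)
    also have "\<dots> \<le> t * t ^ r" unfolding Top_def
    proof (rule integral_le_bound[OF Top_integrable[OF fuzzy_surF]])
      fix y show "ker t x y * surF t r y \<le> t * t ^ r"
        using Suc.IH[of y] ker_le[of t x y] t fuzzyD(2,3)[OF fuzzy_surF, of t r y] by (intro mult_mono) auto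
    qed
    finally show ?case by simp
  qed simp
  then show ?thesis unfolding beta_def by (intro integral_le_bound integrable_fuzzy fuzzy_surF)
qed

lemma rho_subcritical: "t < 1 \<Longrightarrow> rho t = 0"
proof (cases "t \<le> 0")
  case False
  assume "t < 1"
  then have "(\<lambda>r. t ^ r) \<longlonglongrightarrow> 0" using False by (intro LIMSEQ_power_zero) auto
  then have "rho t \<le> 0"
    by (rule LIMSEQ_le[OF beta_LIMSEQ]) (use beta_le_power False in auto)
  then show ?thesis using rho_bounds[of t] by simp
qed (simp add: rho_zero)

lemma cdf_ge_half: "\<exists>a>0. 1 / 2 \<le> measure M {..a}"
proof -
  have "\<forall>\<^sub>F i in sequentially. 1 / 2 < cdf M (real i)"
    using cdf_lim_infty_prob by (rule order_tendstoD) simp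
  then obtain i where "1 / 2 < cdf M (real i)" by (auto simp: eventually_sequentially)
  also have "\<dots> \<le> cdf M (real i + 1)" by (rule cdf_nondecreasing) simp
  finally show ?thesis unfolding cdf_def by (intro exI[of _ "real i + 1"]) auto
qed

lemma fuzzy_indicator: "a \<in> sets borel \<Longrightarrow> fuzzy g \<Longrightarrow> 0 \<le> c \<Longrightarrow> c \<le> 1 \<Longrightarrow>
    fuzzy (\<lambda>x. c * g x * indicator a x)"
  unfolding fuzzy_def by (auto simp: indicator_def mult_le_one)

text \<open>The value 1/2 on \<open>{..a}\<close> is a subsolution: for t \<ge> a + 4 the kernel is
  at least 4 there, the mean number of surviving children is at least 4 times 1/2 times 1/2, and 1 -
  exp(-1) \<ge> 1/2.\<close>

lemma sinf_ge_half:
  assumes a: "0 < a" "1 / 2 \<le> measure M {..a}" and t: "a + 4 \<le> t" and x: "x \<le> a"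
  shows "1 / 2 \<le> sinf t x"
proof -
  define g where "g = (\<lambda>x. (1 / 2) * 1 * indicator {..a} x :: real)"
  have g: "fuzzy g" unfolding g_def by (rule fuzzy_indicator) (auto simp: fuzzy_def)
  have "g y \<le> Phi t g y" for y
  proof (cases "y \<le> a")
    case True
    have "1 \<le> 2 * measure M {..a}" using a by simp
    also have "\<dots> = (\<integral>z. 2 * indicator {..a} z \<partial>M)" by simp
    also have "\<dots> \<le> Top t g y" unfolding Top_def
    proof (rule integral_mono[OF _ Top_integrable[OF g]])
      fix z show "2 * indicator {..a} z \<le> ker t y z * g z"
        using True t a(1) by (auto simp: g_def ker_def indicator_def max_def)
    qed simp
    finally have "1 \<le> Top t g y" .
    moreover have "2 \<le> exp (1::real)" using exp_ge_add_one_self[of "1::real"] by simp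
    ultimately have "2 \<le> exp (Top t g y)" by (metis exp_le_cancel_iff order_trans)
    then show ?thesis using True by (simp add: Phi_def g_def exp_minus field_simps)
  next
    case False
    then show ?thesis using fuzzyD(2)[OF fuzzy_Phi[OF g]] by (simp add: g_def)
  qed
  then have "g x \<le> sinf t x" by (rule sinf_maximal[OF g])
  then show ?thesis using x by (simp add: g_def)
qed

lemma rho_eventually_pos: "\<exists>t>0. rho t > 0"
proof -
  obtain a where a: "0 < a" "1 / 2 \<le> measure M {..a}" using cdf_ge_half by auto
  have "0 < 1 / 2 * measure M {..a}" using a by auto
  also have "\<dots> = (\<integral>x. 1 / 2 * indicator {..a} x \<partial>M)" by simp
  also have "\<dots> \<le> rho (a + 4)" unfolding rho_def
  proof (rule integral_mono[OF _ integrable_fuzzy[OF fuzzy_sinf]])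
    fix x show "1 / 2 * indicator {..a} x \<le> sinf (a + 4) x"
      using sinf_ge_half[OF a, of "a + 4" x] fuzzyD(2,3)[OF fuzzy_sinf, of "a + 4" x]
      by (auto simp: indicator_def)
  qed simp
  finally show ?thesis using a by (intro exI[of _ "a + 4"]) auto
qed

text \<open>For large \<open>t\<close>, a type x \<le> t/2 has kernel at least t/2 against all types
  up to t/2, and these carry survival mass at least 1/4; so it dies out with probability at most
  exp(-t/8). Later types are rare by the tail of \<open>M\<close>.\<close>

lemma rho_exp_tail:
  assumes b: "0 < b" "0 \<le> B" and tail: "\<And>t. 0 \<le> t \<Longrightarrow> 1 - cdf M t \<le> B * exp (- b * t)"
  shows "\<exists>b'>0. \<exists>B'>0. \<forall>t\<ge>0. 1 - rho t \<le> B' * exp (- b' * t)"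
proof -
  obtain a where a: "0 < a" "1 / 2 \<le> measure M {..a}" using cdf_ge_half by auto
  \<comment> \<open>Ensures a \<le> t/2 and a + 4 \<le> t for t \<ge> t1. Before t1 the summand
    exp(b' t1) of \<open>B'\<close> makes the bound trivial.\<close>
  define t1 where "t1 = 2 * a + 4"
  define b' where "b' = min (1 / 8) (b / 2)"
  define B' where "B' = 1 + B + exp (b' * t1)"
  have b': "0 < b'" "b' \<le> 1 / 8" "b' \<le> b / 2" using b by (auto simp: b'_def)
  have B': "0 < B'" using b by (auto simp: B'_def intro: add_pos_nonneg)
  have "1 - rho t \<le> B' * exp (- b' * t)" if t: "0 \<le> t" for t
  proof (cases "t < t1")
    case True
    have "1 - rho t \<le> 1" using rho_bounds by simp
    also have "1 \<le> exp (b' * t1) * exp (- b' * t)"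
      using True b' by (simp add: exp_add[symmetric] mult_left_mono)
    also have "\<dots> \<le> B' * exp (- b' * t)" using b by (intro mult_right_mono) (auto simp: B'_def)
    finally show ?thesis .
  next
    case False
    have big: "1 / 4 \<le> (\<integral>y. sinf t y * indicator {..t/2} y \<partial>M)"
    proof -
      have "1 / 4 \<le> 1 / 2 * measure M {..a}" using a by auto
      also have "\<dots> = (\<integral>x. 1 / 2 * indicator {..a} x \<partial>M)" by simp
      also have "\<dots> \<le> (\<integral>y. sinf t y * indicator {..t/2} y \<partial>M)"
      proof (rule integral_mono)
        show "integrable M (\<lambda>y. sinf t y * indicator {..t/2} y)"
          using integrable_fuzzy[OF fuzzy_indicator[OF _ fuzzy_sinf, of "{..t/2}" 1]] by simp
        fix x show "1 / 2 * indicator {..a} x \<le> sinf t x * indicator {..t/2} x"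
          using sinf_ge_half[OF a, of t x] fuzzyD(2,3)[OF fuzzy_sinf, of t x] False a
          by (auto simp: indicator_def t1_def)
      qed simp
      finally show ?thesis .
    qed
    have low: "1 - sinf t x \<le> exp (- t / 8)" if x: "x \<le> t / 2" for x
    proof -
      have "t / 8 = t / 2 * (1 / 4)" by simp
      also have "\<dots> \<le> t / 2 * (\<integral>y. sinf t y * indicator {..t/2} y \<partial>M)"
        using big t by (intro mult_left_mono) auto
      also have "\<dots> = (\<integral>y. t / 2 * (sinf t y * indicator {..t/2} y) \<partial>M)" by simp
      also have "\<dots> \<le> Top t (sinf t) x" unfolding Top_def
      proof (rule integral_mono[OF _ Top_integrable[OF fuzzy_sinf]])
        show "integrable M (\<lambda>y. t / 2 * (sinf t y * indicator {..t/2} y))"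
          using integrable_fuzzy[OF fuzzy_indicator[OF _ fuzzy_sinf, of "{..t/2}" 1]] by simp
        fix y
        have "t / 2 \<le> ker t x y" if "y \<le> t / 2" using that x t by (auto simp: ker_def max_def)
        then show "t / 2 * (sinf t y * indicator {..t/2} y) \<le> ker t x y * sinf t y"
          using fuzzyD(2,3)[OF fuzzy_sinf, of t y] ker_nonneg[of t x y]
            mult_right_mono[of "t / 2" "ker t x y" "sinf t y"]
          by (auto simp: indicator_def)
      qed
      finally have "exp (- Top t (sinf t) x) \<le> exp (- t / 8)" by simp
      then show ?thesis by (subst sinf_fixpoint) (simp add: Phi_def)
    qed
    have "1 - rho t = (\<integral>x. 1 - sinf t x \<partial>M)"
      unfolding rho_def using integrable_fuzzy[OF fuzzy_sinf, of t] by simp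
    also have "\<dots> \<le> (\<integral>x. exp (- t / 8) + indicator {t/2<..} x \<partial>M)"
    proof (rule integral_mono)
      show "integrable M (\<lambda>x. 1 - sinf t x)" using integrable_fuzzy[OF fuzzy_sinf, of t] by simp
      show "integrable M (\<lambda>x. exp (- t / 8) + indicator {t/2<..} x)"
        by (rule integrable_bounded[of _ "exp (- t / 8) + 1"]) (auto simp: indicator_def)
      fix x show "1 - sinf t x \<le> exp (- t / 8) + indicator {t/2<..} x"
        using low[of x] fuzzyD(2,3)[OF fuzzy_sinf, of t x] by (auto simp: indicator_def add_increasing)
    qed
    also have "\<dots> = exp (- t / 8) + measure M {t/2<..}"
      by (subst Bochner_Integration.integral_add) auto
    also have "measure M {t/2<..} = 1 - cdf M (t / 2)"
    proof -
      have "{t/2<..} = space M - {..t/2}" by auto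
      then show ?thesis unfolding cdf_def using prob_compl[of "{..t/2}"] by simp
    qed
    also have "exp (- t / 8) + (1 - cdf M (t / 2)) \<le> exp (- b' * t) + B * exp (- b' * t)"
    proof (rule add_mono)
      have "b' * t \<le> 1 / 8 * t" using b' t by (intro mult_right_mono) auto
      then show "exp (- t / 8) \<le> exp (- b' * t)" by simp
      have "1 - cdf M (t / 2) \<le> B * exp (- b * (t / 2))" using tail[of "t / 2"] t by simp
      also have "b' * t \<le> b / 2 * t" using b' t by (intro mult_right_mono) auto
      then have "B * exp (- b * (t / 2)) \<le> B * exp (- b' * t)" using b by (intro mult_left_mono) auto
      finally show "1 - cdf M (t / 2) \<le> B * exp (- b' * t)" by simp
    qed
    also have "\<dots> = (1 + B) * exp (- b' * t)" by (simp add: algebra_simps)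
    also have "\<dots> \<le> B' * exp (- b' * t)" by (intro mult_right_mono) (auto simp: B'_def)
    finally show ?thesis .
  qed
  then show ?thesis using b' B' by blast
qed

section \<open>Continuity and strict growth of the limit function\<close>

lemma surF_time_lipschitz:
  "\<exists>L\<ge>0. \<forall>t t' x. t \<le> T \<longrightarrow> t' \<le> T \<longrightarrow> \<bar>surF t r x - surF t' r x\<bar> \<le> L * \<bar>t - t'\<bar>"
proof (induction r)
  case 0
  show ?case by (rule exI[of _ 0]) simp
next
  case (Suc r)
  then obtain L where L: "0 \<le> L"
    "\<And>t t' x. t \<le> T \<Longrightarrow> t' \<le> T \<Longrightarrow> \<bar>surF t r x - surF t' r x\<bar> \<le> L * \<bar>t - t'\<bar>" by blast
  have "\<bar>surF t (Suc r) x - surF t' (Suc r) x\<bar> \<le> (1 + max 0 T * L) * \<bar>t - t'\<bar>"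
    if t: "t \<le> T" "t' \<le> T" for t t' x
  proof -
    have "\<bar>surF t (Suc r) x - surF t' (Suc r) x\<bar> \<le> \<bar>Top t (surF t r) x - Top t' (surF t' r) x\<bar>"
      using exp_minus_lipschitz[OF Top_nonneg[OF fuzzy_surF[of t r], of t x] Top_nonneg[OF fuzzy_surF[of t' r], of t' x]]
      by (simp add: Phi_def)
    also have "\<dots> \<le> \<bar>t - t'\<bar> + max 0 t' * (L * \<bar>t - t'\<bar>)"
      by (rule Top_time_diff[OF fuzzy_surF fuzzy_surF L(2)[OF t]])
    also have "\<dots> \<le> \<bar>t - t'\<bar> + max 0 T * (L * \<bar>t - t'\<bar>)"
      using t L(1) by (intro add_left_mono mult_right_mono) auto
    finally show ?thesis by (simp add: algebra_simps)
  qed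
  then show ?case using L(1) by (intro exI[of _ "1 + max 0 T * L"]) auto
qed

text \<open>For fixed \<open>r\<close> the survival function is Lipschitz in time near
  \<open>t\<close>, with a constant that depends on \<open>r\<close>. As the decreasing limit of
  these continuous bounds \<open>rho\<close> is upper semicontinuous, which for a monotone function
  is right continuity.\<close>

lemma rho_right:
  assumes "0 < \<epsilon>"
  shows "\<exists>\<delta>>0. \<forall>t'. t \<le> t' \<longrightarrow> t' < t + \<delta> \<longrightarrow> rho t' \<le> rho t + \<epsilon>"
proof -
  have "\<forall>\<^sub>F r in sequentially. beta t r < rho t + \<epsilon> / 2"
    using beta_LIMSEQ[of t] by (rule order_tendstoD) (use assms in simp)
  then obtain r where r: "beta t r < rho t + \<epsilon> / 2" by (auto simp: eventually_sequentially)
  obtain L where L: "0 \<le> L"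
    "\<And>s s' x. s \<le> t + 1 \<Longrightarrow> s' \<le> t + 1 \<Longrightarrow> \<bar>surF s r x - surF s' r x\<bar> \<le> L * \<bar>s - s'\<bar>"
    using surF_time_lipschitz[of "t + 1" r] by blast
  define \<delta> where "\<delta> = min 1 (\<epsilon> / (2 * (L + 1)))"
  have \<delta>: "0 < \<delta>" using assms L by (simp add: \<delta>_def)
  have L\<delta>: "L * \<delta> \<le> \<epsilon> / 2"
  proof -
    have "L * \<delta> \<le> (L + 1) * (\<epsilon> / (2 * (L + 1)))"
      using L assms \<delta> by (intro mult_mono) (auto simp: \<delta>_def)
    also have "(L + 1) * (\<epsilon> / (2 * (L + 1))) = \<epsilon> / 2"
      using L(1) by (simp add: divide_simps)
    finally show ?thesis .
  qed
  have "rho t' \<le> rho t + \<epsilon>" if t': "t \<le> t'" "t' < t + \<delta>" for t'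
  proof -
    have "\<delta> \<le> 1" by (simp add: \<delta>_def)
    have "rho t' \<le> beta t' r" by (rule rho_le_beta)
    also have "\<dots> \<le> (\<integral>x. surF t r x + L * \<delta> \<partial>M)"
      unfolding beta_def
    proof (rule integral_mono)
      fix x
      have "surF t' r x - surF t r x \<le> L * \<bar>t' - t\<bar>" using L(2)[of t' t x] t' \<open>\<delta> \<le> 1\<close> by auto
      also have "\<dots> \<le> L * \<delta>" using t' L by (intro mult_left_mono) auto
      finally show "surF t' r x \<le> surF t r x + L * \<delta>" by simp
    qed (use integrable_fuzzy[OF fuzzy_surF] in auto)
    also have "\<dots> = beta t r + L * \<delta>"
      unfolding beta_def by (subst Bochner_Integration.integral_add) (auto intro: integrable_fuzzy fuzzy_surF)
    finally show ?thesis using r L\<delta> by simp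
  qed
  with \<delta> show ?thesis by blast
qed

text \<open>The open interval leaves out a possible atom of \<open>M\<close> at \<open>t\<close>.
  Such an atom is harmless, because \<open>sinf t\<close> vanishes at \<open>t\<close>.\<close>

lemma measure_left_small:
  assumes "0 < \<eta>"
  shows "\<exists>a0>0. \<forall>a. a \<le> a0 \<longrightarrow> measure M {t - a<..<t} \<le> \<eta>"
proof -
  have "\<forall>\<^sub>F y in at_left t. measure M {..<t} - \<eta> < cdf M y"
    using cdf_at_left[of t] by (rule order_tendstoD) (use assms in simp)
  then obtain b where b: "b < t" "\<And>y. b < y \<Longrightarrow> y < t \<Longrightarrow> measure M {..<t} - \<eta> < cdf M y"
    unfolding eventually_at_left_field by blast
  define a0 where "a0 = (t - b) / 2"
  have "measure M {t - a<..<t} \<le> \<eta>" if "a \<le> a0" for a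
  proof -
    have m: "measure M {t - a<..<t} \<le> measure M {t - a0<..<t}"
      using that by (intro finite_measure_mono) auto
    have "{t - a0<..<t} = {..<t} - {..t - a0}" by auto
    then have "measure M {t - a0<..<t} = measure M {..<t} - cdf M (t - a0)"
    proof -
      assume eq: "{t - a0<..<t} = {..<t} - {..t - a0}"
      have "{..t - a0} \<subseteq> {..<t}" using b(1) by (auto simp: a0_def field_simps)
      then show ?thesis
        unfolding cdf_def eq by (intro finite_measure_Diff) auto
    qed
    moreover have "b < t - a0" "t - a0 < t" using b(1) by (auto simp: a0_def field_simps)
    ultimately show ?thesis using b(2)[of "t - a0"] m by simp
  qed
  then show ?thesis using b by (intro exI[of _ a0]) (auto simp: a0_def)
qed

definition mass :: "real \<Rightarrow> real \<Rightarrow> real" where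
  "mass t a = (\<integral>x. sinf t x * indicator {..t - a} x \<partial>M)"

lemma fuzzy_trunc: "0 \<le> c \<Longrightarrow> c \<le> 1 \<Longrightarrow> fuzzy (\<lambda>x. c * sinf t x * indicator {..s} x)"
  by (rule fuzzy_indicator[OF _ fuzzy_sinf]) auto

lemma integrable_trunc: "integrable M (\<lambda>x. sinf t x * indicator {..s} x)"
  using integrable_fuzzy[OF fuzzy_trunc[of 1 t s]] by simp

lemma mass_ge: "rho t - measure M {t - a<..<t} \<le> mass t a"
proof -
  have "rho t \<le> (\<integral>x. sinf t x * indicator {..t - a} x + indicator {t - a<..<t} x \<partial>M)"
    unfolding rho_def
  proof (rule integral_mono[OF integrable_fuzzy[OF fuzzy_sinf]])
    show "integrable M (\<lambda>x. sinf t x * indicator {..t - a} x + indicator {t - a<..<t} x)"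
      by (intro Bochner_Integration.integrable_add integrable_trunc) auto
    fix x show "sinf t x \<le> sinf t x * indicator {..t - a} x + indicator {t - a<..<t} x"
      using fuzzyD(2,3)[OF fuzzy_sinf, of t x] sinf_zero[of t x] by (auto simp: indicator_def)
  qed
  also have "\<dots> = mass t a + measure M {t - a<..<t}"
    unfolding mass_def by (subst Bochner_Integration.integral_add[OF integrable_trunc]) auto
  finally show ?thesis by simp
qed

lemma mass_le: "mass t a \<le> measure M {..t - a}"
proof -
  have "mass t a \<le> (\<integral>x. indicator {..t - a} x \<partial>M)"
    unfolding mass_def
  proof (rule integral_mono[OF integrable_trunc])
    fix x show "sinf t x * indicator {..t - a} x \<le> indicator {..t - a} x"
      using fuzzyD(2,3)[OF fuzzy_sinf, of t x] by (auto simp: indicator_def)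
  qed simp
  then show ?thesis by simp
qed

lemma ex_mass_pos:
  assumes "0 < rho t"
  shows "\<exists>a. 0 < a \<and> a \<le> 1 \<and> a \<le> t \<and> 0 < mass t a"
proof -
  have t: "0 < t" using assms rho_zero[of t] by (cases "t \<le> 0") auto
  obtain a0 where a0: "0 < a0" "\<And>a. a \<le> a0 \<Longrightarrow> measure M {t - a<..<t} \<le> rho t / 2"
    using measure_left_small[of "rho t / 2" t] assms by auto
  define a where "a = min a0 (min 1 t)"
  have "rho t - rho t / 2 \<le> mass t a" using mass_ge[of t a] a0(2)[of a] by (simp add: a_def)
  then have "0 < mass t a" using assms by simp
  then show ?thesis using a0 t by (intro exI[of _ a]) (auto simp: a_def)
qed

lemma one_minus_exp_ge: "0 \<le> v \<Longrightarrow> v \<le> 1 \<Longrightarrow> v / 2 \<le> 1 - exp (- v)" for v :: real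
proof -
  assume v: "0 \<le> v" "v \<le> 1"
  have "exp (- v) \<le> 1 / (1 + v)"
    using exp_ge_add_one_self[of v] v by (simp add: exp_minus field_simps)
  also have "\<dots> \<le> 1 - v / 2"
  proof -
    have "v * v \<le> v" using v by (simp add: mult_left_le)
    then have "1 \<le> (1 - v / 2) * (1 + v)" by (simp add: algebra_simps)
    then show ?thesis using v by (simp add: divide_le_eq)
  qed
  finally show ?thesis by simp
qed

text \<open>Such a type meets the types up to t - a0 with kernel at least \<open>a\<close>, so its
  survival is at least linear in \<open>a\<close>. Squared, this is the order of the concavity gain
  in \<open>rho_left\<close>.\<close>

lemma sinf_lower:
  assumes "0 < a" "a \<le> a0" "a0 \<le> 1" "a0 \<le> t" "x \<le> t - a" "0 \<le> mass t a0"
  shows "a * mass t a0 / 2 \<le> sinf t x"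
proof -
  have m1: "mass t a0 \<le> 1" using mass_le[of t a0] by (meson order_trans prob_le_1)
  have "a * mass t a0 = (\<integral>y. a * (sinf t y * indicator {..t - a0} y) \<partial>M)" by (simp add: mass_def)
  also have "\<dots> \<le> Top t (sinf t) x" unfolding Top_def
  proof (rule integral_mono[OF _ Top_integrable[OF fuzzy_sinf]])
    show "integrable M (\<lambda>y. a * (sinf t y * indicator {..t - a0} y))"
      using integrable_trunc by simp
    fix y
    have "a \<le> ker t x y" if "y \<le> t - a0" using that assms by (auto simp: ker_def max_def)
    then show "a * (sinf t y * indicator {..t - a0} y) \<le> ker t x y * sinf t y"
      using fuzzyD(2,3)[OF fuzzy_sinf, of t y] ker_nonneg[of t x y]
        mult_right_mono[of a "ker t x y" "sinf t y"]
      by (auto simp: indicator_def)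
  qed
  finally have "1 - exp (- (a * mass t a0)) \<le> Phi t (sinf t) x" by (simp add: Phi_def)
  moreover have "a * mass t a0 / 2 \<le> 1 - exp (- (a * mass t a0))"
    by (rule one_minus_exp_ge) (use assms m1 in \<open>auto intro: mult_le_one\<close>)
  ultimately show ?thesis using sinf_fixpoint[of t x] by simp
qed

text \<open>Multiplying the mean number of children by c costs less than a factor c of the survival
  probability, by an amount of second order. The derivative of the difference is non-negative by two
  applications of 1 + y \<le> exp y.\<close>

lemma exp_concavity_gain:
  fixes u c :: real
  assumes "0 \<le> u" "0 \<le> c" "c \<le> 1"
  shows "c * (1 - exp (- u)) + c * (1 - c) * (1 - exp (- u))\<^sup>2 / 2 \<le> 1 - exp (- (c * u))"
proof -
  define G where "G u = 1 - exp (- (c * u)) - c * (1 - exp (- u)) - c * (1 - c) * (1 - exp (- u))\<^sup>2 / 2" for u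
  have "G 0 \<le> G u"
  proof (rule DERIV_nonneg_imp_nondecreasing[OF assms(1)])
    fix x :: real assume x: "0 \<le> x" "x \<le> u"
    let ?d = "c * exp (- (c * x)) - c * exp (- x) - c * (1 - c) * (1 - exp (- x)) * exp (- x)"
    have "(G has_real_derivative ?d) (at x)"
      unfolding G_def by (auto intro!: derivative_eq_intros simp: field_simps)
    moreover have "0 \<le> ?d"
    proof -
      have "1 + (1 - c) * (1 - exp (- x)) \<le> 1 + (1 - c) * x"
        using assms exp_ge_add_one_self[of "- x"] by (intro add_left_mono mult_left_mono) auto
      also have "\<dots> \<le> exp ((1 - c) * x)" by (rule exp_ge_add_one_self)
      finally have "0 \<le> c * exp (- x) * (exp ((1 - c) * x) - 1 - (1 - c) * (1 - exp (- x)))"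
        using assms by (intro mult_nonneg_nonneg) auto
      also have "\<dots> = c * (exp (- x) * exp ((1 - c) * x)) - c * exp (- x) - c * (1 - c) * (1 - exp (- x)) * exp (- x)"
        by (simp add: algebra_simps)
      also have "exp (- x) * exp ((1 - c) * x) = exp (- (c * x))"
        by (simp add: exp_add[symmetric] algebra_simps)
      finally show ?thesis .
    qed
    ultimately show "\<exists>y. (G has_real_derivative y) (at x) \<and> 0 \<le> y" by blast
  qed
  then show ?thesis by (simp add: G_def)
qed

lemma sinf_le_dist: "0 \<le> x \<Longrightarrow> x \<le> t \<Longrightarrow> sinf t x \<le> t - x"
proof -
  assume x: "0 \<le> x" "x \<le> t"
  have "sinf t x \<le> Top t (sinf t) x"
    using sinf_fixpoint[of t x] exp_ge_add_one_self[of "- Top t (sinf t) x"] by (simp add: Phi_def)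
  also have "\<dots> \<le> t - x" unfolding Top_def
  proof (rule integral_le_bound[OF Top_integrable[OF fuzzy_sinf]])
    fix y
    have "ker t x y \<le> t - x" using x by (auto simp: ker_def max_def)
    then show "ker t x y * sinf t y \<le> t - x"
      using fuzzyD(2,3)[OF fuzzy_sinf, of t y] ker_nonneg[of t x y]
        mult_mono[of "ker t x y" "t - x" "sinf t y" 1] x by auto
  qed
  finally show ?thesis .
qed

text \<open>The truncated and rescaled fixed point \<open>c * sinf t\<close> on \<open>{..t - a}\<close> is a subsolution
  at slightly earlier times: the loss caused by truncation is of smaller order than \<open>a\<^sup>2\<close>, while
  the concavity gain is at least of order \<open>a\<^sup>2\<close>.\<close>

lemma rho_left:
  assumes \<epsilon>: "0 < \<epsilon>"
  shows "\<exists>\<delta>>0. \<forall>t'. t - \<delta> < t' \<longrightarrow> t' \<le> t \<longrightarrow> rho t - \<epsilon> \<le> rho t'"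
proof (cases "0 < rho t")
  case False
  then have "rho t - \<epsilon> \<le> rho t'" for t' using rho_bounds[of t] rho_bounds[of t'] \<epsilon> by simp
  then show ?thesis by (intro exI[of _ 1]) auto
next
  case True
  obtain a0 where a0: "0 < a0" "a0 \<le> 1" "a0 \<le> t" "0 < mass t a0" using ex_mass_pos[OF True] by auto
  define m0 where "m0 = mass t a0"
  \<comment> \<open>The rescaling loses at most \<epsilon>/2 of \<open>rho t\<close>; the other
    \<epsilon>/2 is left for the truncation.\<close>
  define c where "c = 1 - min \<epsilon> 1 / 2"
  have c: "0 < c" "c < 1" "1 - c \<le> \<epsilon> / 2" using \<epsilon> by (auto simp: c_def min_def)
  \<comment> \<open>The admissible loss is (1 - c) a^2 m0^2 / 16. One half of it is granted to the
    truncation here, the other half to the shift of time in \<open>\<delta>\<close>.\<close>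
  define \<eta> where "\<eta> = min (\<epsilon> / 2) ((1 - c) * m0\<^sup>2 / 32)"
  have m0: "0 < m0" using a0 by (simp add: m0_def)
  have \<eta>: "0 < \<eta>" using \<epsilon> c m0 by (simp add: \<eta>_def)
  obtain a1 where a1: "0 < a1" "\<And>a. a \<le> a1 \<Longrightarrow> measure M {t - a<..<t} \<le> \<eta>"
    using measure_left_small[OF \<eta>, of t] by auto
  define a where "a = min a0 a1"
  have a: "0 < a" "a \<le> a0" "a \<le> t" "a \<le> 1" using a0 a1 by (auto simp: a_def)
  define ma where "ma = measure M {t - a<..<t}"
  have ma: "ma \<le> \<eta>" "0 \<le> ma" "ma \<le> 1" using a1(2)[of a] by (auto simp: ma_def a_def)
  define \<delta> where "\<delta> = (1 - c) * a\<^sup>2 * m0\<^sup>2 / 32"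
  have \<delta>: "0 < \<delta>" using c a m0 by (simp add: \<delta>_def)
  have "rho t - \<epsilon> \<le> rho t'" if t': "t - \<delta> < t'" "t' \<le> t" for t'
  proof -
    define g where "g = (\<lambda>x. c * sinf t x * indicator {..t - a} x)"
    have g: "fuzzy g" unfolding g_def using c by (intro fuzzy_trunc) auto
    \<comment> \<open>Loss in the mean number of surviving children: the kernel drops by at most t -
      t', and on the removed types before \<open>t\<close> kernel and survival are both at most
      \<open>a\<close>.\<close>
    define l where "l = (t - t') + a\<^sup>2 * ma"
    have l0: "0 \<le> l" using t' ma by (simp add: l_def)
    have l: "l \<le> (1 - c) * (a * m0 / 2)\<^sup>2 / 4"
    proof -
      have "a\<^sup>2 * ma \<le> a\<^sup>2 * ((1 - c) * m0\<^sup>2 / 32)" using ma by (intro mult_left_mono) (auto simp: \<eta>_def)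
      then have "l \<le> (1 - c) * a\<^sup>2 * m0\<^sup>2 / 32 + a\<^sup>2 * ((1 - c) * m0\<^sup>2 / 32)"
        using t' unfolding l_def \<delta>_def by linarith
      also have "\<dots> = (1 - c) * (a * m0 / 2)\<^sup>2 / 4"
        by (simp add: power_mult_distrib power_divide algebra_simps)
      finally show ?thesis .
    qed
    have "g x \<le> Phi t' g x" for x
    proof (cases "x \<le> t - a")
      case True
      let ?u = "Top t (sinf t) x"
      have fx: "sinf t x = 1 - exp (- ?u)" using sinf_fixpoint[of t x] by (simp add: Phi_def)
      have u0: "0 \<le> ?u" by (rule Top_nonneg[OF fuzzy_sinf])
      have "c * (?u - l) = (\<integral>y. c * (ker t x y * sinf t y - (t - t') - a\<^sup>2 * indicator {t - a<..<t} y) \<partial>M)"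
        unfolding Top_def l_def ma_def using Top_integrable[OF fuzzy_sinf, of t x t]
        by (simp add: algebra_simps)
      also have "\<dots> \<le> Top t' g x" unfolding Top_def
      proof (rule integral_mono[OF _ Top_integrable[OF g]])
        show "integrable M (\<lambda>y. c * (ker t x y * sinf t y - (t - t') - a\<^sup>2 * indicator {t - a<..<t} y))"
          using Top_integrable[OF fuzzy_sinf, of t x t] by simp
        fix y
        have k: "ker t x y - (t - t') \<le> ker t' x y"
          using ker_lipschitz_time[of t x y t'] t' by simp
        have f01: "0 \<le> sinf t y" "sinf t y \<le> 1" using fuzzyD[OF fuzzy_sinf] by auto
        consider "y \<le> t - a" | "t - a < y" "y < t" | "t \<le> y" by linarith
        then have "ker t x y * sinf t y - (t - t') - a\<^sup>2 * indicator {t - a<..<t} y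
            \<le> ker t' x y * (sinf t y * indicator {..t - a} y)"
        proof cases
          case 1
          have "(t - t') * sinf t y \<le> (t - t') * 1" using f01 t' by (intro mult_left_mono) auto
          moreover have "(ker t x y - (t - t')) * sinf t y \<le> ker t' x y * sinf t y"
            using k f01 by (intro mult_right_mono) auto
          ultimately show ?thesis using 1 a by (simp add: algebra_simps)
        next
          case 2
          have "ker t x y \<le> a" using 2 a by (auto simp: ker_def max_def)
          moreover have "sinf t y \<le> a" using sinf_le_dist[of y t] 2 a by auto
          ultimately have "ker t x y * sinf t y \<le> a * a"
            using f01 a by (intro mult_mono) auto
          then show ?thesis using 2 t' by (simp add: power2_eq_square)
        next
          case 3
          then show ?thesis using sinf_zero[of t y] t' a by simp
        qed
        then show "c * (ker t x y * sinf t y - (t - t') - a\<^sup>2 * indicator {t - a<..<t} y) \<le> ker t' x y * g y"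
          unfolding g_def using c by (simp add: mult.assoc mult.left_commute)
      qed
      finally have T: "c * (?u - l) \<le> Top t' g x" .
      have cl: "0 \<le> c * l" "c * l \<le> 1"
      proof -
        show "0 \<le> c * l" using c l0 by simp
        have "m0 \<le> 1" unfolding m0_def using mass_le[of t a0] by (meson order_trans prob_le_1)
        then have "a * m0 / 2 \<le> 1" "0 \<le> a * m0 / 2" using a m0 mult_le_one[of a m0] by auto
        then have "(a * m0 / 2)\<^sup>2 \<le> 1" by (simp add: power_le_one)
        then have "(1 - c) * (a * m0 / 2)\<^sup>2 \<le> 1" using c by (intro mult_le_one) auto
        then have "l \<le> 1" using l by simp
        then show "c * l \<le> 1" using c l0 by (intro mult_le_one) auto
      qed
      have "exp (- (c * (?u - l))) = exp (- (c * ?u)) * exp (c * l)"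
        by (simp add: exp_add[symmetric] algebra_simps)
      also have "\<dots> \<le> exp (- (c * ?u)) * (1 + 2 * (c * l))"
      proof (rule mult_left_mono)
        have "exp (c * l) \<le> 1 + c * l + (c * l)\<^sup>2" using cl by (intro exp_bound) auto
        also have "(c * l)\<^sup>2 \<le> c * l" using cl by (simp add: power2_eq_square mult_left_le)
        finally show "exp (c * l) \<le> 1 + 2 * (c * l)" by simp
      qed simp
      also have "\<dots> \<le> exp (- (c * ?u)) + 2 * (c * l)"
      proof -
        have "exp (- (c * ?u)) * (2 * (c * l)) \<le> 1 * (2 * (c * l))"
          using c u0 cl by (intro mult_right_mono) auto
        then show ?thesis by (simp add: distrib_left)
      qed
      finally have 1: "exp (- (c * (?u - l))) \<le> exp (- (c * ?u)) + 2 * (c * l)" .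
      have 2: "c * sinf t x + c * (1 - c) * (sinf t x)\<^sup>2 / 2 \<le> 1 - exp (- (c * ?u))"
        unfolding fx using exp_concavity_gain[OF u0, of c] c by simp
      have 3: "2 * (c * l) \<le> c * (1 - c) * (sinf t x)\<^sup>2 / 2"
      proof -
        have "(a * m0 / 2)\<^sup>2 \<le> (sinf t x)\<^sup>2"
          using sinf_lower[of a a0 t x] a a0 True m0 unfolding m0_def[symmetric] by (intro power_mono) auto
        then have "(1 - c) * (a * m0 / 2)\<^sup>2 \<le> (1 - c) * (sinf t x)\<^sup>2" using c by (intro mult_left_mono) auto
        then have "4 * l \<le> (1 - c) * (sinf t x)\<^sup>2" using l by simp
        then have "c * (4 * l) \<le> c * ((1 - c) * (sinf t x)\<^sup>2)" using c by (intro mult_left_mono) auto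
        then show ?thesis by simp
      qed
      have "exp (- Top t' g x) \<le> exp (- (c * (?u - l)))" using T by simp
      then have "c * sinf t x \<le> 1 - exp (- Top t' g x)" using 1 2 3 by linarith
      then show ?thesis using True by (simp add: g_def Phi_def)
    next
      case False
      then show ?thesis using fuzzyD(2)[OF fuzzy_Phi[OF g]] by (simp add: g_def)
    qed
    then have "g x \<le> sinf t' x" for x by (rule sinf_maximal[OF g])
    then have "(\<integral>x. g x \<partial>M) \<le> rho t'" unfolding rho_def
      by (intro integral_mono integrable_fuzzy g fuzzy_sinf)
    moreover have "(\<integral>x. g x \<partial>M) = c * mass t a"
      unfolding g_def mass_def by (simp add: mult.assoc)
    moreover have "rho t - ma \<le> mass t a" using mass_ge[of t a] by (simp add: ma_def)
    ultimately have "c * (rho t - ma) \<le> rho t'" using c by (smt (verit) mult_left_mono)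
    moreover have "rho t - \<epsilon> \<le> c * (rho t - ma)"
    proof -
      have "(1 - c) * rho t \<le> (\<epsilon> / 2) * 1" using c rho_bounds[of t] by (intro mult_mono) auto
      moreover have "c * ma \<le> 1 * (\<epsilon> / 2)" using c ma \<epsilon> by (intro mult_mono) (auto simp: \<eta>_def)
      ultimately show ?thesis by (simp add: algebra_simps)
    qed
    ultimately show ?thesis by simp
  qed
  with \<delta> show ?thesis by blast
qed

lemma isCont_rho: "isCont rho t"
  unfolding continuous_at_eps_delta
proof (intro allI impI)
  fix \<epsilon> :: real assume "0 < \<epsilon>"
  then have h: "0 < \<epsilon> / 2" by simp
  obtain d1 where d1: "0 < d1" "\<And>t'. t \<le> t' \<Longrightarrow> t' < t + d1 \<Longrightarrow> rho t' \<le> rho t + \<epsilon> / 2"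
    using rho_right[OF h, of t] by blast
  obtain d2 where d2: "0 < d2" "\<And>t'. t - d2 < t' \<Longrightarrow> t' \<le> t \<Longrightarrow> rho t - \<epsilon> / 2 \<le> rho t'"
    using rho_left[OF h, of t] by blast
  have "\<bar>rho t' - rho t\<bar> < \<epsilon>" if "\<bar>t' - t\<bar> < min d1 d2" for t'
    using d1(2)[of t'] d2(2)[of t'] rho_mono[of t t'] rho_mono[of t' t] that h
    by (cases "t \<le> t'") auto
  then show "\<exists>d>0. \<forall>x'. dist x' t < d \<longrightarrow> dist (rho x') (rho t) < \<epsilon>"
    using d1(1) d2(1) by (intro exI[of _ "min d1 d2"]) (auto simp: dist_real_def)
qed

text \<open>Between types up to t - a the kernel grows by t' - t, so the mean number of surviving
  children of such a type rises by at least \<open>d\<close>. As the old mean is at most t, survival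
  gains at least \<open>k\<close>, on a set of types of positive measure.\<close>

lemma rho_strict:
  assumes "t < t'" "0 < rho t"
  shows "rho t < rho t'"
proof -
  obtain a where a: "0 < a" "a \<le> 1" "a \<le> t" "0 < mass t a" using ex_mass_pos[OF assms(2)] by auto
  define d where "d = (t' - t) * mass t a"
  have d: "0 < d" using a assms by (simp add: d_def)
  define k where "k = exp (- t) * (1 - exp (- d))"
  have k: "0 < k" using d by (simp add: k_def)
  have t0: "0 \<le> t" using a by simp
  have gain: "sinf t x + k \<le> sinf t' x" if x: "x \<le> t - a" for x
  proof -
    let ?u = "Top t (sinf t) x"
    have u: "0 \<le> ?u" "?u \<le> t" using Top_nonneg[OF fuzzy_sinf] Top_le[OF fuzzy_sinf, of t t x] t0 by auto
    have "?u + d = (\<integral>y. ker t x y * sinf t y + (t' - t) * (sinf t y * indicator {..t - a} y) \<partial>M)"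
      unfolding Top_def d_def mass_def
      using Top_integrable[OF fuzzy_sinf, of t x t] integrable_trunc[of t "t - a"] by simp
    also have "\<dots> \<le> Top t' (sinf t) x" unfolding Top_def
    proof (rule integral_mono[OF _ Top_integrable[OF fuzzy_sinf]])
      show "integrable M (\<lambda>y. ker t x y * sinf t y + (t' - t) * (sinf t y * indicator {..t - a} y))"
        using Top_integrable[OF fuzzy_sinf, of t x t] integrable_trunc[of t "t - a"] by simp
      fix y
      have "ker t x y + (t' - t) * indicator {..t - a} y \<le> ker t' x y"
        using x a assms by (auto simp: ker_def max_def indicator_def)
      then have "(ker t x y + (t' - t) * indicator {..t - a} y) * sinf t y \<le> ker t' x y * sinf t y"
        using fuzzyD[OF fuzzy_sinf] by (intro mult_right_mono)
      then show "ker t x y * sinf t y + (t' - t) * (sinf t y * indicator {..t - a} y) \<le> ker t' x y * sinf t y"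
        by (simp add: algebra_simps)
    qed
    also have "\<dots> \<le> Top t' (sinf t') x"
      by (rule Top_mono[OF fuzzy_sinf fuzzy_sinf sinf_mono]) (use assms in simp)
    finally have "1 - exp (- (?u + d)) \<le> sinf t' x"
      using sinf_fixpoint[of t' x] by (simp add: Phi_def)
    moreover have "1 - exp (- (?u + d)) = sinf t x + exp (- ?u) * (1 - exp (- d))"
      using sinf_fixpoint[of t x] by (simp add: Phi_def exp_add[symmetric] algebra_simps)
    moreover have "k \<le> exp (- ?u) * (1 - exp (- d))"
      unfolding k_def using u d by (intro mult_right_mono) auto
    ultimately show ?thesis by simp
  qed
  have "rho t + k * measure M {..t - a} = (\<integral>x. sinf t x + k * indicator {..t - a} x \<partial>M)"
    unfolding rho_def using integrable_fuzzy[OF fuzzy_sinf, of t] by simp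
  also have "\<dots> \<le> rho t'" unfolding rho_def
  proof (rule integral_mono[OF _ integrable_fuzzy[OF fuzzy_sinf]])
    show "integrable M (\<lambda>x. sinf t x + k * indicator {..t - a} x)"
      using integrable_fuzzy[OF fuzzy_sinf, of t] by simp
    fix x show "sinf t x + k * indicator {..t - a} x \<le> sinf t' x"
      using gain[of x] sinf_mono[of t t' x] assms by (auto simp: indicator_def)
  qed
  finally show ?thesis using k a mass_le[of t a] by (smt (verit) mult_pos_pos)
qed

text \<open>By continuity the zero set of \<open>rho\<close> is closed, so it contains its supremum;
  this is at least 1/2 by \<open>rho_subcritical\<close>.\<close>

lemma ex_threshold: "\<exists>\<sigma>>0. (\<forall>t\<le>\<sigma>. rho t = 0) \<and> (\<forall>t>\<sigma>. 0 < rho t)"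
proof -
  let ?Z = "{t. rho t = 0}"
  obtain t1 where t1: "0 < rho t1" using rho_eventually_pos by auto
  have bdd: "bdd_above ?Z"
    using rho_mono t1 by (intro bdd_aboveI[of _ t1]) (metis (mono_tags, lifting) leD linorder_le_less_linear mem_Collect_eq nle_le)
  have half: "1 / 2 \<in> ?Z" using rho_subcritical[of "1 / 2"] by simp
  have closed: "closed ?Z"
    using continuous_closed_vimage[of "{0}" rho] isCont_rho by (simp add: vimage_def)
  have S: "Sup ?Z \<in> ?Z" by (rule closed_contains_Sup[OF _ bdd closed]) (use half in auto)
  have "1 / 2 \<le> Sup ?Z" by (rule cSup_upper[OF half bdd])
  moreover have "rho t = 0" if "t \<le> Sup ?Z" for t
    using rho_mono[OF that] S rho_bounds[of t] by simp
  moreover have "0 < rho t" if "Sup ?Z < t" for t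
  proof (rule ccontr)
    assume "\<not> 0 < rho t"
    then have "t \<in> ?Z" using rho_bounds[of t] by simp
    then have "t \<le> Sup ?Z" by (rule cSup_upper[OF _ bdd])
    with that show False by simp
  qed
  ultimately show ?thesis by (intro exI[of _ "Sup ?Z"]) auto
qed

text \<open>In the limit \<open>rho\<close> is the distribution function of the time at which a
  vertex joins the giant of the next layer. The tail bound ensures that no mass escapes to
  infinity.\<close>

lemma ex_next_distribution:
  assumes b: "0 < b" "0 \<le> B" and tail: "\<And>t. 0 \<le> t \<Longrightarrow> 1 - cdf M t \<le> B * exp (- b * t)"
  shows "\<exists>N. real_distribution N \<and> cdf N = rho \<and> (rho \<longlongrightarrow> 1) at_top"
proof -
  obtain b' B' where b': "0 < b'" "0 < B'" "\<And>t. 0 \<le> t \<Longrightarrow> 1 - rho t \<le> B' * exp (- b' * t)"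
    using rho_exp_tail[OF assms] by blast
  have lim0: "((\<lambda>t. 1 - B' * exp (- b' * t)) \<longlongrightarrow> 1 - B' * 0) at_top"
  proof (intro tendsto_intros)
    have "filterlim (\<lambda>t. - b' * t) at_bot at_top"
      using b' by (intro filterlim_tendsto_neg_mult_at_bot[OF tendsto_const]) (auto simp: filterlim_ident)
    then show "((\<lambda>t. exp (- b' * t)) \<longlongrightarrow> 0) at_top"
      by (rule filterlim_compose[OF exp_at_bot])
  qed
  have lim: "(rho \<longlongrightarrow> 1) at_top"
  proof (rule tendsto_sandwich[of "\<lambda>t. 1 - B' * exp (- b' * t)" _ _ "\<lambda>_. 1"])
    show "\<forall>\<^sub>F t in at_top. 1 - B' * exp (- b' * t) \<le> rho t"
      using eventually_ge_at_top[of 0]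
    proof eventually_elim
      case (elim t)
      then show ?case using b'(3)[of t] by simp
    qed
  qed (use lim0 rho_bounds in auto)
  have bot: "(rho \<longlongrightarrow> 0) at_bot"
    by (rule tendsto_eventually) (use eventually_le_at_bot[of 0] in eventually_elim, use rho_zero in auto)
  have rc: "continuous (at_right a) rho" for a
    using isCont_rho[of a] by (simp add: continuous_at_imp_continuous_at_within)
  have "real_distribution (interval_measure rho)"
    by (rule real_distribution_interval_measure) (use rho_mono rc bot lim in auto)
  moreover have "cdf (interval_measure rho) = rho"
    by (rule cdf_interval_measure) (use rho_mono rc bot lim in auto)
  ultimately show ?thesis using lim by blast
qed

end

section \<open>Comparison of finite graphs with the branching process\<close>

lemma abs_mult_diff_le:
  fixes c s k f t :: real
  assumes "0 \<le> s" "s \<le> 1" "0 \<le> k" "k \<le> t"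
  shows "\<bar>c * s - k * f\<bar> \<le> \<bar>c - k\<bar> + t * \<bar>s - f\<bar>"
proof -
  have "c * s - k * f = (c - k) * s + k * (s - f)" by (simp add: algebra_simps)
  also have "\<bar>\<dots>\<bar> \<le> \<bar>c - k\<bar> * \<bar>s\<bar> + \<bar>k\<bar> * \<bar>s - f\<bar>"
    unfolding abs_mult[symmetric] by (rule abs_triangle_ineq)
  also have "\<dots> \<le> \<bar>c - k\<bar> * 1 + t * \<bar>s - f\<bar>"
    using assms by (intro add_mono mult_mono) auto
  finally show ?thesis by simp
qed

context real_distribution
begin

text \<open>Abel summation: \<open>g\<close> is replaced by a combination of indicators of
  half-lines ending at grid points, for which average and integral differ only by the error of the
  empirical distribution function. Since \<open>g\<close> is constant left of 0 and zero right of t,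
  the grid on [0, t] suffices.\<close>

lemma quadrature:
  fixes idx :: "nat \<Rightarrow> nat" and C e t :: real and n J :: nat
  assumes C: "0 \<le> C" and lip: "\<And>x y. \<bar>g x - g y\<bar> \<le> C * \<bar>x - y\<bar>"
    and const: "\<And>x. x \<le> 0 \<Longrightarrow> g x = g 0" and zero: "\<And>x. t \<le> x \<Longrightarrow> g x = 0"
    and t: "0 \<le> t" and J: "0 < J" and n: "0 < n"
    and cdf: "\<And>m. m \<le> J \<Longrightarrow> \<bar>card {i \<in> {..<n}. idx i \<le> m} / n - cdf M (m * t / J)\<bar> \<le> e"
  shows "\<bar>(\<Sum>i<n. g (idx i * t / J)) / n - (\<integral>x. g x \<partial>M)\<bar> \<le> C * t / J + C * t * e"
proof -
  define s where "s m = real m * t / J" for m :: nat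
  define D where "D m = g (s m) - g (s (Suc m))" for m
  define G where "G y = (\<Sum>m<J. D m * indicator {..s m} y)" for y
  have sS: "s (Suc m) - s m = t / J" for m by (simp add: s_def diff_divide_distrib[symmetric] left_diff_distrib[symmetric])
  have smono: "s m \<le> s m'" if "m \<le> m'" for m m'
    using that t unfolding s_def by (intro divide_right_mono mult_right_mono) auto
  have sJ: "s J = t" using J by (simp add: s_def)
  have D: "\<bar>D m\<bar> \<le> C * (t / J)" for m
  proof -
    have "\<bar>s m - s (Suc m)\<bar> = t / J"
      unfolding abs_minus_commute[of "s m"] sS using t by simp
    then show ?thesis using lip[of "s m" "s (Suc m)"] by (simp only: D_def)
  qed
  \<comment> \<open>An index beyond \<open>J\<close> stands for a type after \<open>t\<close>, where
    both sides vanish.\<close>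
  have tele: "(\<Sum>m<J. if k \<le> m then D m else 0) = g (s k)" for k
  proof (cases "k \<le> J")
    case True
    have "(\<Sum>m<J. if k \<le> m then D m else 0) = (\<Sum>m\<in>{k..<J}. D m)"
      by (rule sum.mono_neutral_cong_right) auto
    also have "\<dots> = - (\<Sum>m\<in>{k..<J}. g (s (Suc m)) - g (s m))"
      by (simp add: D_def sum_negf[symmetric])
    also have "\<dots> = g (s k) - g (s J)" using True by (subst sum_Suc_diff') auto
    finally show ?thesis using zero sJ by simp
  next
    case False
    then have "(\<Sum>m<J. if k \<le> m then D m else 0) = 0" by (intro sum.neutral) auto
    moreover have "g (s k) = 0" using False sJ smono[of J k] by (intro zero) auto
    ultimately show ?thesis by simp
  qed
  have avg: "(\<Sum>i<n. g (idx i * t / J)) / n = (\<Sum>m<J. D m * (card {i \<in> {..<n}. idx i \<le> m} / n))"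
  proof -
    have "(\<Sum>i<n. g (idx i * t / J)) = (\<Sum>i<n. \<Sum>m<J. if idx i \<le> m then D m else 0)"
      unfolding tele by (simp add: s_def)
    also have "\<dots> = (\<Sum>m<J. \<Sum>i<n. if idx i \<le> m then D m else 0)" by (rule sum.swap)
    also have "\<dots> = (\<Sum>m<J. D m * card {i \<in> {..<n}. idx i \<le> m})"
      by (intro sum.cong refl) (simp add: sum.If_cases Int_def mult.commute)
    finally show ?thesis by (simp add: sum_divide_distrib)
  qed
  have Gint: "(\<integral>y. G y \<partial>M) = (\<Sum>m<J. D m * cdf M (m * t / J))"
    unfolding G_def by (subst Bochner_Integration.integral_sum) (auto simp: cdf_def s_def)
  have GI: "integrable M G" unfolding G_def by (intro Bochner_Integration.integrable_sum) auto
  have Gg: "\<bar>G y - g y\<bar> \<le> C * t / J" for y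
  proof (cases "y \<le> 0")
    case True
    then have "G y = (\<Sum>m<J. if 0 \<le> m then D m else 0)"
    proof -
      have "y \<le> s m" for m using smono[of 0 m] True by (simp add: s_def)
      then show ?thesis unfolding G_def by (intro sum.cong) auto
    qed
    then have "G y = g y" using True const[of y] unfolding tele by (simp add: s_def)
    then show ?thesis using C t by simp
  next
    case False
    show ?thesis
    proof (cases "t \<le> y \<and> s (J - 1) < y")
      case True
      have "G y = 0" unfolding G_def
      proof (rule sum.neutral, rule ballI)
        fix m assume "m \<in> {..<J}"
        then have "s m \<le> s (J - 1)" by (intro smono) auto
        then show "D m * indicator {..s m} y = 0" using True by auto
      qed
      then show ?thesis using zero[of y] True C t by simp
    next
      case nge: False
      have tpos: "0 < t"
      proof (rule ccontr)
        assume "\<not> 0 < t"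
        then have "t = 0" using t by simp
        then have "s (J - 1) = 0" by (simp add: s_def)
        then show False using nge False \<open>t = 0\<close> by auto
      qed
      have "s (J - 1) < t"
      proof -
        have "t - s (J - 1) = t / J" using sS[of "J - 1"] J sJ by simp
        moreover have "0 < t / J" using J tpos by simp
        ultimately show ?thesis by linarith
      qed
      then have yt: "y \<le> t" using nge by auto
      define k where "k = (LEAST m. y \<le> s m)"
      have "y \<le> s J" using yt sJ by simp
      then have k: "y \<le> s k" "k \<le> J" unfolding k_def by (auto intro: LeastI Least_le)
      have kleast: "s m < y" if "m < k" for m
        using not_less_Least[of m "\<lambda>m. y \<le> s m"] that unfolding k_def by auto
      have "k \<noteq> 0" using k False by (auto simp: s_def intro: ccontr)
      then obtain k' where k': "k = Suc k'" by (cases k) auto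
      have "s k' < y" using kleast k' by auto
      have "G y = (\<Sum>m<J. if k \<le> m then D m else 0)"
        unfolding G_def
      proof (intro sum.cong refl)
        fix m
        show "D m * indicator {..s m} y = (if k \<le> m then D m else 0)"
          using kleast[of m] k(1) smono[of k m] by (cases "k \<le> m") (auto simp: indicator_def)
      qed
      then have "G y = g (s k)" unfolding tele .
      then have "\<bar>G y - g y\<bar> \<le> C * \<bar>s k - y\<bar>" using lip by simp
      also have "\<dots> \<le> C * (t / J)"
        using k(1) \<open>s k' < y\<close> sS[of k'] k' C by (intro mult_left_mono) auto
      finally show ?thesis by simp
    qed
  qed
  have gI: "integrable M g"
  proof (rule integrable_bounded)
    show "g \<in> borel_measurable borel" by (rule Lipschitz_borel_measurable[OF lip])
    fix x show "\<bar>g x\<bar> \<le> C * t"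
    proof (cases "x \<le> t")
      case True
      have "\<bar>g (max 0 x) - g t\<bar> \<le> C * \<bar>max 0 x - t\<bar>" by (rule lip)
      also have "\<dots> \<le> C * t" using C t True by (intro mult_left_mono) auto
      finally show ?thesis using zero[of t] const[of x]
        by (cases "x \<le> 0") (simp_all add: max_absorb1 max_absorb2)
    next
      case False
      then show ?thesis using zero[of x] C t by simp
    qed
  qed
  have "\<bar>(\<integral>y. G y \<partial>M) - (\<integral>y. g y \<partial>M)\<bar> \<le> C * t / J"
    using abs_integral_le_bound[of "\<lambda>y. G y - g y" "C * t / J"] GI gI Gg by simp
  moreover have "\<bar>(\<Sum>i<n. g (idx i * t / J)) / n - (\<integral>y. G y \<partial>M)\<bar> \<le> C * t * e"
  proof -
    have "(\<Sum>i<n. g (idx i * t / J)) / n - (\<integral>y. G y \<partial>M)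
        = (\<Sum>m<J. D m * (card {i \<in> {..<n}. idx i \<le> m} / n - cdf M (m * t / J)))"
      unfolding avg Gint by (simp add: sum_subtractf right_diff_distrib)
    also have "\<bar>\<dots>\<bar> \<le> (\<Sum>m<J. \<bar>D m * (card {i \<in> {..<n}. idx i \<le> m} / n - cdf M (m * t / J))\<bar>)"
      by (rule sum_abs)
    also have "\<dots> \<le> (\<Sum>m<J. C * (t / J) * e)"
    proof (rule sum_mono)
      fix m assume "m \<in> {..<J}"
      then show "\<bar>D m * (card {i \<in> {..<n}. idx i \<le> m} / n - cdf M (m * t / J))\<bar> \<le> C * (t / J) * e"
        unfolding abs_mult using D[of m] cdf[of m] C t by (intro mult_mono) auto
    qed
    also have "\<dots> = C * t * e" using J by simp
    finally show ?thesis .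
  qed
  ultimately show ?thesis by linarith
qed

lemma surF_const: "x \<le> 0 \<Longrightarrow> surF t r x = surF t r 0"
proof (cases r)
  case (Suc k)
  assume "x \<le> 0"
  then have "ker t x = ker t 0" by (auto simp: ker_def fun_eq_iff max_def)
  then show ?thesis using Suc by (simp add: Phi_def Top_def)
qed simp

lemma ker_surF_lipschitz:
  assumes "0 \<le> t"
  shows "\<bar>ker t x y * surF t r y - ker t x y' * surF t r y'\<bar> \<le> (1 + t) * \<bar>y - y'\<bar>"
proof -
  have "ker t x y * surF t r y - ker t x y' * surF t r y'
      = (ker t x y - ker t x y') * surF t r y + ker t x y' * (surF t r y - surF t r y')"
    by (simp add: algebra_simps)
  also have "\<bar>\<dots>\<bar> \<le> \<bar>ker t x y - ker t x y'\<bar> * \<bar>surF t r y\<bar> + \<bar>ker t x y'\<bar> * \<bar>surF t r y - surF t r y'\<bar>"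
    unfolding abs_mult[symmetric] by (rule abs_triangle_ineq)
  also have "\<dots> \<le> \<bar>y - y'\<bar> * 1 + t * \<bar>y - y'\<bar>"
    using ker_lipschitz[of t x y x y'] fuzzyD(2,3)[OF fuzzy_surF, of t r y] surF_lipschitz[of t r y y']
      ker_nonneg[of t x y'] ker_le[of t x y'] assms
    by (intro add_mono mult_mono) auto
  finally show ?thesis by (simp add: algebra_simps)
qed

end

text \<open>\<open>R l i j\<close> stands for: \<open>i\<close> and \<open>j\<close> lie in the same component of the previous layer before
  time slot \<open>l\<close>. Time is divided into slots of length \<open>h\<close>, and \<open>J\<close> is the number of observation
  times at which the previous layer is known to look like its limit.\<close>

locale related_slots =
  fixes h t \<epsilon> :: real and n J :: nat and R :: "nat \<Rightarrow> nat \<Rightarrow> nat \<Rightarrow> bool" and M :: "real measure"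
  assumes h: "0 < h" and t: "0 \<le> t" and n: "0 < n" and J: "0 < J" and eps: "0 \<le> \<epsilon>"
    and R_equivp: "\<And>l. equivp (R l)" and R_mono: "\<And>l l' i j. l \<le> l' \<Longrightarrow> R l i j \<Longrightarrow> R l' i j"
    and M: "real_distribution M"
    and giant: "\<And>m. m \<le> J \<Longrightarrow> giant_like \<epsilon> n (cdf M (m * t / J)) (R (nat \<lfloor>m * t / J / h\<rfloor>))"
begin

sublocale M: real_distribution M by (rule M)

definition slot :: "nat \<Rightarrow> nat" where
  "slot m = nat \<lfloor>m * t / J / h\<rfloor>"

definition kept :: "edge set" where
  "kept = {e. fst (fst e) < snd (fst e) \<and> snd (fst e) < n \<and> snd e < slot J \<and>
     R (snd e) (fst (fst e)) (snd (fst e))}"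

definition L :: "nat \<Rightarrow> nat set" where
  "L m = bigset \<epsilon> n (R (slot m))"

text \<open>The large sets only grow, so this is the index of the first observation with
  \<open>i\<close> in the large set, and J + 1 if there is none.\<close>

definition idx :: "nat \<Rightarrow> nat" where
  "idx i = card {m \<in> {..J}. i \<notin> L m}"

lemma R_sym: "R l i j \<longleftrightarrow> R l j i"
  using R_equivp[of l] by (metis equivp_symp)

lemma finite_kept: "finite kept"
proof (rule finite_subset)
  show "kept \<subseteq> ({..<n} \<times> {..<n}) \<times> {..<slot J}" by (auto simp: kept_def)
qed simp

lemma card_kept:
  assumes "i < n" "j < n" "i \<noteq> j"
  shows "card (kept \<inter> ebetween i j) = card {l \<in> {..<slot J}. R l i j}"
proof -
  have "kept \<inter> ebetween i j = Pair (min i j, max i j) ` {l \<in> {..<slot J}. R l i j}"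
    using assms R_sym by (auto simp: kept_def ebetween_def image_iff min_def max_def)
  then show ?thesis by (simp add: card_image inj_on_def)
qed

lemma slot_mono: "m \<le> m' \<Longrightarrow> slot m \<le> slot m'"
  unfolding slot_def using h t
  by (intro nat_mono floor_mono divide_right_mono mult_right_mono) auto

lemma slot_bounds: "real (slot m) \<le> m * t / J / h" "m * t / J / h - 1 < real (slot m)"
proof -
  have "0 \<le> m * t / J / h" using h t by simp
  then show "real (slot m) \<le> m * t / J / h" "m * t / J / h - 1 < real (slot m)"
    unfolding slot_def by linarith+
qed

lemma card_slots_le: "h * card {l \<in> {..<slot J}. R l i j} \<le> t"
proof -
  have "card {l \<in> {..<slot J}. R l i j} \<le> card {..<slot J}" by (intro card_mono) auto
  then have "h * card {l \<in> {..<slot J}. R l i j} \<le> h * slot J" using h by simp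
  also have "\<dots> \<le> h * (J * t / J / h)" using slot_bounds(1)[of J] h by (intro mult_left_mono) auto
  also have "\<dots> = t" using J h by simp
  finally show ?thesis .
qed

lemma card_slots_ge:
  assumes "R (slot m) i j"
  shows "t - m * t / J - h \<le> h * card {l \<in> {..<slot J}. R l i j}"
proof -
  have "{slot m..<slot J} \<subseteq> {l \<in> {..<slot J}. R l i j}" using R_mono assms by auto
  then have "card {slot m..<slot J} \<le> card {l \<in> {..<slot J}. R l i j}" by (intro card_mono) auto
  then have "real (slot J) - slot m \<le> card {l \<in> {..<slot J}. R l i j}" by simp
  moreover have "J * t / J / h - 1 - m * t / J / h \<le> real (slot J) - slot m"
    using slot_bounds[of J] slot_bounds[of m] by linarith
  ultimately have "J * t / J / h - 1 - m * t / J / h \<le> card {l \<in> {..<slot J}. R l i j}" by linarith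
  then have "h * (J * t / J / h - 1 - m * t / J / h) \<le> h * card {l \<in> {..<slot J}. R l i j}"
    using h by (intro mult_left_mono) auto
  moreover have "h * (J * t / J / h - 1 - m * t / J / h) = t - h - m * t / J"
    using h J by (simp add: right_diff_distrib)
  ultimately show ?thesis by linarith
qed

lemma card_slots_lt:
  assumes "\<not> R (slot m) i j" "m \<le> J"
  shows "h * card {l \<in> {..<slot J}. R l i j} \<le> t - m * t / J + h"
proof -
  have "{l \<in> {..<slot J}. R l i j} \<subseteq> {slot m..<slot J}"
  proof
    fix l assume l: "l \<in> {l \<in> {..<slot J}. R l i j}"
    have "\<not> l \<le> slot m" using R_mono[of l "slot m" i j] l assms(1) by blast
    then show "l \<in> {slot m..<slot J}" using l by simp
  qed
  then have "card {l \<in> {..<slot J}. R l i j} \<le> card {slot m..<slot J}" by (intro card_mono) auto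
  also have "\<dots> = slot J - slot m" by simp
  finally have "real (card {l \<in> {..<slot J}. R l i j}) \<le> real (slot J) - slot m"
    using slot_mono[OF assms(2)] by linarith
  also have "\<dots> \<le> J * t / J / h - m * t / J / h + 1"
    using slot_bounds[of J] slot_bounds[of m] by linarith
  finally have "h * card {l \<in> {..<slot J}. R l i j} \<le> h * (J * t / J / h - m * t / J / h + 1)"
    using h by (intro mult_left_mono) auto
  moreover have "h * (J * t / J / h - m * t / J / h + 1) = t + h - m * t / J"
    using h J by (simp add: right_diff_distrib distrib_left)
  ultimately show ?thesis by linarith
qed

lemma class_mono: "l \<le> l' \<Longrightarrow> bigset \<epsilon> n (R l) \<subseteq> bigset \<epsilon> n (R l')"
proof
  fix v assume l: "l \<le> l'" and v: "v \<in> bigset \<epsilon> n (R l)"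
  have "card {u \<in> {..<n}. R l v u} \<le> card {u \<in> {..<n}. R l' v u}"
    using R_mono[OF l] by (intro card_mono) auto
  then have "real (card {u \<in> {..<n}. R l v u}) \<le> card {u \<in> {..<n}. R l' v u}" by simp
  then show "v \<in> bigset \<epsilon> n (R l')" using v unfolding bigset_def by auto
qed

lemma L_iff: "m \<le> J \<Longrightarrow> i \<in> L m \<longleftrightarrow> idx i \<le> m"
proof
  have Lm: "i \<in> L a \<Longrightarrow> a \<le> b \<Longrightarrow> i \<in> L b" for a b
    unfolding L_def using class_mono[OF slot_mono] by blast
  assume m: "m \<le> J"
  show "idx i \<le> m" if "i \<in> L m"
  proof -
    have "{m' \<in> {..J}. i \<notin> L m'} \<subseteq> {..<m}" using Lm[OF that] by (auto simp: not_le[symmetric])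
    then have "idx i \<le> card {..<m}" unfolding idx_def by (intro card_mono) auto
    then show ?thesis by simp
  qed
  show "i \<in> L m" if "idx i \<le> m"
  proof (rule ccontr)
    assume "i \<notin> L m"
    then have "{..m} \<subseteq> {m' \<in> {..J}. i \<notin> L m'}" using Lm m by auto
    then have "card {..m} \<le> idx i" unfolding idx_def by (intro card_mono) auto
    then show False using that by simp
  qed
qed

lemma L_sub: "L m \<subseteq> {..<n}"
  by (auto simp: L_def bigset_def)

lemma idx_le: "idx i \<le> Suc J"
proof -
  have "idx i \<le> card {..J}" unfolding idx_def by (intro card_mono) auto
  then show ?thesis by simp
qed

lemma cdf_approx:
  assumes "m \<le> J"
  shows "\<bar>card {i \<in> {..<n}. idx i \<le> m} / n - cdf M (m * t / J)\<bar> \<le> 2 * \<epsilon>"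
proof -
  have "{i \<in> {..<n}. idx i \<le> m} = L m" using L_iff[OF assms] L_sub[of m] by auto
  then show ?thesis using giant[OF assms] by (simp add: giant_like_def L_def slot_def)
qed

text \<open>Pairs that are related outside the giant. The kernel takes no account of them; each
  vertex outside the large set has at most \<epsilon> n of them per observation.\<close>

definition bad :: "nat \<Rightarrow> (nat \<times> nat) set" where
  "bad m = {(i, j). i < n \<and> j < n \<and> R (slot m) i j \<and> i \<notin> L m}"

lemma card_bad: "card (bad m) \<le> \<epsilon> * n\<^sup>2"
proof -
  have "bad m = (SIGMA i:{..<n} - L m. {j \<in> {..<n}. R (slot m) i j})" by (auto simp: bad_def)
  then have "real (card (bad m)) = (\<Sum>i\<in>{..<n} - L m. real (card {j \<in> {..<n}. R (slot m) i j}))"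
    by simp
  also have "\<dots> \<le> (\<Sum>i\<in>{..<n} - L m. \<epsilon> * n)"
    by (rule sum_mono) (auto simp: L_def bigset_def)
  also have "\<dots> \<le> (\<Sum>i\<in>{..<n}. \<epsilon> * n)" by (rule sum_mono2) (use eps in auto)
  also have "\<dots> = \<epsilon> * n\<^sup>2" by (simp add: power2_eq_square)
  finally show ?thesis .
qed

definition tau :: "nat \<Rightarrow> real" where
  "tau i = idx i * t / J"

text \<open>Let \<open>m\<close> be the larger of the two indices. At observation \<open>m\<close>
  both vertices are in the one large class and hence related; at m - 1 one of them is outside, and
  they are not related because the pair is not bad. This fixes the related slots up to one
  observation step and one slot.\<close>

lemma slots_vs_ker:
  assumes ij: "i < n" "j < n" and nb: "\<And>m. m \<le> J \<Longrightarrow> (i, j) \<notin> bad m"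
  shows "\<bar>h * card {l \<in> {..<slot J}. R l i j} - ker t (tau i) (tau j)\<bar> \<le> t / J + h"
proof -
  define m where "m = max (idx i) (idx j)"
  have tau0: "0 \<le> tau i" "0 \<le> tau j" using t by (auto simp: tau_def)
  have mx: "max (tau i) (tau j) = m * t / J"
  proof -
    have tm: "real a * t / J \<le> real b * t / J" if "a \<le> b" for a b :: nat
      using that t by (intro divide_right_mono mult_right_mono) auto
    show ?thesis
      using tm[of "idx i" "idx j"] tm[of "idx j" "idx i"]
      by (cases "idx i \<le> idx j") (simp_all add: m_def tau_def max_absorb1 max_absorb2)
  qed
  have k: "ker t (tau i) (tau j) = max 0 (t - m * t / J)"
    unfolding ker_def mx[symmetric] using tau0 by (auto simp: max_def)
  have Jt: "0 \<le> t / J" using t by simp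
  have up: "h * card {l \<in> {..<slot J}. R l i j} \<le> max 0 (t - m * t / J) + t / J + h"
  proof (cases m)
    case 0
    then have "max 0 (t - m * t / J) = t" using t by simp
    then show ?thesis using card_slots_le[of i j] Jt h by linarith
  next
    case (Suc m')
    have m': "m' \<le> J" using Suc idx_le[of i] idx_le[of j] by (auto simp: m_def)
    have "i \<notin> L m' \<or> j \<notin> L m'" using L_iff[OF m'] Suc by (auto simp: m_def max_def split: if_splits)
    moreover have "(i, j) \<notin> bad m'" by (rule nb[OF m'])
    ultimately have "\<not> R (slot m') i j"
    proof (elim disjE)
      assume a: "i \<notin> L m'" "(i, j) \<notin> bad m'"
      then show ?thesis using ij by (auto simp: bad_def)
    next
      assume a: "j \<notin> L m'" "(i, j) \<notin> bad m'"
      show ?thesis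
      proof
        assume r: "R (slot m') i j"
        then have "R (slot m') i = R (slot m') j" using R_equivp[of "slot m'"] by (simp add: equivp_def)
        then have "i \<notin> L m'" using a(1) ij by (auto simp: L_def bigset_def)
        then show False using a(2) r ij by (auto simp: bad_def)
      qed
    qed
    then have "h * card {l \<in> {..<slot J}. R l i j} \<le> t - m' * t / J + h"
      using m' by (rule card_slots_lt)
    also have "t - m' * t / J = (t - m * t / J) + t / J"
      using Suc by (simp add: add_divide_distrib algebra_simps)
    finally show ?thesis by linarith
  qed
  have low: "max 0 (t - m * t / J) - h \<le> h * card {l \<in> {..<slot J}. R l i j}"
  proof (cases "m \<le> J")
    case True
    then have "i \<in> L m" "j \<in> L m" using L_iff[OF True] by (auto simp: m_def)
    then have "R (slot m) i j" using giant[OF True] by (auto simp: giant_like_def L_def slot_def)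
    then have "t - m * t / J - h \<le> h * card {l \<in> {..<slot J}. R l i j}" by (rule card_slots_ge)
    moreover have "0 \<le> h * card {l \<in> {..<slot J}. R l i j}" using h by simp
    moreover have "max 0 (t - m * t / J) = 0 \<or> max 0 (t - m * t / J) = t - m * t / J"
      by (simp only: max_def split: if_split) blast
    ultimately show ?thesis using h by linarith
  next
    case False
    then have "t * J \<le> m * t" using t by (metis mult.commute mult_left_mono nat_le_linear of_nat_mono)
    then have "t \<le> m * t / J" using J by (simp add: field_simps)
    moreover have "0 \<le> h * card {l \<in> {..<slot J}. R l i j}" using h by simp
    moreover have "max 0 (t - m * t / J) = 0" using calculation(1) by simp
    ultimately show ?thesis using h by linarith
  qed
  show ?thesis unfolding k using up low Jt h by linarith
qed

text \<open>A bad pair costs at most t, and each of the J + 1 observations has at most \<epsilon>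
  n^2 bad pairs.\<close>

lemma sum_slots_vs_ker:
  "(\<Sum>i<n. \<Sum>j<n. \<bar>h * card {l \<in> {..<slot J}. R l i j} - ker t (tau i) (tau j)\<bar>)
    \<le> (t / J + h + (J + 1) * \<epsilon> * t) * n\<^sup>2"
proof -
  let ?d = "\<lambda>i j. \<bar>h * card {l \<in> {..<slot J}. R l i j} - ker t (tau i) (tau j)\<bar>"
  have pt: "?d i j \<le> (t / J + h) + (\<Sum>m\<le>J. t * of_bool ((i, j) \<in> bad m))" if ij: "i < n" "j < n" for i j
  proof (cases "\<exists>m\<le>J. (i, j) \<in> bad m")
    case True
    then obtain m where m: "m \<le> J" "(i, j) \<in> bad m" by auto
    have "?d i j \<le> t"
    proof -
      have "0 \<le> h * card {l \<in> {..<slot J}. R l i j}" using h by simp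
      moreover have "ker t (tau i) (tau j) \<le> t" using ker_le[of t "tau i" "tau j"] t by simp
      ultimately show ?thesis
        using card_slots_le[of i j] ker_nonneg[of t "tau i" "tau j"] by linarith
    qed
    also have "t = t * of_bool ((i, j) \<in> bad m)" using m by simp
    also have "\<dots> \<le> (\<Sum>m\<le>J. t * of_bool ((i, j) \<in> bad m))"
      using m t by (intro member_le_sum) auto
    finally show ?thesis using t h by (simp add: add_increasing)
  next
    case False
    have "0 \<le> (\<Sum>m\<le>J. t * of_bool ((i, j) \<in> bad m))" using t by (intro sum_nonneg) auto
    then show ?thesis using slots_vs_ker[OF ij] False by force
  qed
  have cb: "(\<Sum>i<n. \<Sum>j<n. of_bool ((i, j) \<in> bad m)) = real (card (bad m))" for m
  proof -
    have "(\<Sum>i<n. \<Sum>j<n. of_bool ((i, j) \<in> bad m)) = (\<Sum>p\<in>{..<n} \<times> {..<n}. of_bool (p \<in> bad m) :: real)"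
      unfolding sum.cartesian_product by (simp only: case_prod_unfold prod.collapse)
    also have "\<dots> = card (({..<n} \<times> {..<n}) \<inter> bad m)"
      by (simp add: of_bool_def sum.If_cases)
    also have "({..<n} \<times> {..<n}) \<inter> bad m = bad m" by (auto simp: bad_def)
    finally show ?thesis .
  qed
  have "(\<Sum>i<n. \<Sum>j<n. ?d i j) \<le> (\<Sum>i<n. \<Sum>j<n. (t / J + h) + (\<Sum>m\<le>J. t * of_bool ((i, j) \<in> bad m)))"
    by (intro sum_mono pt) auto
  also have "\<dots> = (t / J + h) * n\<^sup>2 + (\<Sum>i<n. \<Sum>j<n. \<Sum>m\<le>J. t * of_bool ((i, j) \<in> bad m))"
    by (simp add: sum.distrib power2_eq_square algebra_simps)
  also have "(\<Sum>i<n. \<Sum>j<n. \<Sum>m\<le>J. t * of_bool ((i, j) \<in> bad m)) = (\<Sum>i<n. \<Sum>m\<le>J. \<Sum>j<n. t * of_bool ((i, j) \<in> bad m))"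
    by (intro sum.cong refl sum.swap)
  also have "\<dots> = (\<Sum>m\<le>J. \<Sum>i<n. \<Sum>j<n. t * of_bool ((i, j) \<in> bad m))" by (rule sum.swap)
  also have "\<dots> = (\<Sum>m\<le>J. t * card (bad m))"
    by (simp only: cb[symmetric] sum_distrib_left)
  also have "\<dots> \<le> (\<Sum>m\<le>J. t * (\<epsilon> * n\<^sup>2))"
    by (intro sum_mono mult_left_mono card_bad t)
  also have "\<dots> = (J + 1) * \<epsilon> * t * n\<^sup>2" by simp
  finally show ?thesis by (simp add: algebra_simps)
qed

end

text \<open>h/n is the mean number of Poisson arrivals of one pair during one slot.\<close>

locale kept_graph = related_slots + random_subset \<theta> for \<theta> +
  assumes theta: "\<theta> = h / n"
begin

lemma kept_rate_le: "v \<noteq> w \<Longrightarrow> \<theta> * card (kept \<inter> ebetween v w) \<le> t / n"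
proof (cases "v < n \<and> w < n")
  case True
  assume "v \<noteq> w"
  then have "\<theta> * card (kept \<inter> ebetween v w) = h * card {l \<in> {..<slot J}. R l v w} / n"
    using True by (simp add: card_kept theta)
  also have "\<dots> \<le> t / n" by (intro divide_right_mono card_slots_le) simp
  finally show ?thesis .
next
  case False
  then have "kept \<inter> ebetween v w = {}" by (auto simp: kept_def ebetween_def)
  then show ?thesis using t by simp
qed

sublocale random_graph \<theta> kept n t
  by unfold_locales (use finite_kept n t kept_rate_le in \<open>auto simp: kept_def\<close>)

text \<open>t/J + h comes from \<open>slots_vs_ker\<close>, (J + 1) \<epsilon> t from the bad pairs,
  t/n from the missing diagonal term, and the last summand from \<open>quadrature\<close>.\<close>

definition err :: real where
  "err = t / J + h + (J + 1) * \<epsilon> * t + t / n + (1 + t) * t * (1 / J + 2 * \<epsilon>)"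

lemma lam_eq: "i < n \<Longrightarrow> j < n \<Longrightarrow> i \<noteq> j \<Longrightarrow> lam i j = h * card {l \<in> {..<slot J}. R l i j} / n"
proof -
  assume "i < n" "j < n" "i \<noteq> j"
  then have c: "card (kept \<inter> ebetween i j) = card {l \<in> {..<slot J}. R l i j}" by (rule card_kept)
  show ?thesis unfolding lam_def c using theta by simp
qed

text \<open>An L1 error over the vertices: one generation multiplies the inherited error by at most
  t and adds \<open>err\<close>, which gives the geometric sum.\<close>

lemma surv_vs_surF:
  "(\<Sum>i<n. \<bar>surv r i - M.surF t r (tau i)\<bar>) / n \<le> err * (\<Sum>k<r. t ^ k)"
proof (induction r)
  case 0
  show ?case by simp
next
  case (Suc r)
  let ?F = "M.surF t r"
  let ?k = "\<lambda>i j. ker t (tau i) (tau j)"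
  let ?c = "\<lambda>i j. h * card {l \<in> {..<slot J}. R l i j}"
  define D where "D = (\<Sum>j<n. \<bar>surv r j - ?F (tau j)\<bar>) / n"
  have D0: "0 \<le> D" unfolding D_def by (intro divide_nonneg_nonneg sum_nonneg) auto
  have F01: "0 \<le> ?F x" "?F x \<le> 1" for x using fuzzyD[OF M.fuzzy_surF] by auto
  have k0: "0 \<le> ?k i j" "?k i j \<le> t" for i j
    using ker_nonneg ker_le[of t "tau i" "tau j"] t by (auto simp: max_def)
  have quad: "\<bar>(\<Sum>j<n. ?k i j * ?F (tau j)) / n - M.Top t ?F (tau i)\<bar>
      \<le> (1 + t) * t * (1 / J + 2 * \<epsilon>)" for i
  proof -
    have "\<bar>(\<Sum>j<n. ker t (tau i) (idx j * t / J) * ?F (idx j * t / J)) / n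
        - (\<integral>y. ker t (tau i) y * ?F y \<partial>M)\<bar> \<le> (1 + t) * t / J + (1 + t) * t * (2 * \<epsilon>)"
    proof (rule M.quadrature[OF _ _ _ _ t J n cdf_approx])
      show "\<bar>ker t (tau i) x * ?F x - ker t (tau i) y * ?F y\<bar> \<le> (1 + t) * \<bar>x - y\<bar>" for x y
        by (rule M.ker_surF_lipschitz[OF t])
      show "ker t (tau i) x * ?F x = ker t (tau i) 0 * ?F 0" if "x \<le> 0" for x
        using M.surF_const[OF that, of t r] that by (auto simp: ker_def max_def)
      show "ker t (tau i) x * ?F x = 0" if "t \<le> x" for x
        using that by (auto simp: ker_def)
    qed (use t in auto)
    then show ?thesis unfolding M.Top_def tau_def by (simp add: distrib_left)
  qed
  have step: "\<bar>surv (Suc r) i - M.surF t (Suc r) (tau i)\<bar>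
      \<le> (\<Sum>j<n. \<bar>?c i j - ?k i j\<bar>) / n + t * D + t / n + (1 + t) * t * (1 / J + 2 * \<epsilon>)"
    if i: "i < n" for i
  proof -
    let ?V = "{..<n} - {i}"
    let ?S = "\<Sum>j\<in>?V. lam i j * surv r j"
    have S0: "0 \<le> ?S" using lam_nonneg surv_bounds by (intro sum_nonneg mult_nonneg_nonneg) auto
    have "\<bar>surv (Suc r) i - M.surF t (Suc r) (tau i)\<bar> = \<bar>exp (- ?S) - exp (- M.Top t ?F (tau i))\<bar>"
      by (simp add: M.Phi_def abs_minus_commute)
    also have "\<dots> \<le> \<bar>?S - M.Top t ?F (tau i)\<bar>"
      by (rule exp_minus_lipschitz[OF S0 M.Top_nonneg[OF M.fuzzy_surF]])
    also have "\<dots> \<le> \<bar>?S - (\<Sum>j\<in>?V. ?k i j * ?F (tau j)) / n\<bar>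
        + \<bar>(\<Sum>j\<in>?V. ?k i j * ?F (tau j)) / n - (\<Sum>j<n. ?k i j * ?F (tau j)) / n\<bar>
        + (1 + t) * t * (1 / J + 2 * \<epsilon>)"
      using quad[of i] by linarith
    also have "\<bar>?S - (\<Sum>j\<in>?V. ?k i j * ?F (tau j)) / n\<bar> \<le> (\<Sum>j<n. \<bar>?c i j - ?k i j\<bar>) / n + t * D"
    proof -
      have eq: "?S - (\<Sum>j\<in>?V. ?k i j * ?F (tau j)) / n = (\<Sum>j\<in>?V. (?c i j * surv r j - ?k i j * ?F (tau j)) / n)"
        using lam_eq i by (simp add: sum_divide_distrib sum_subtractf diff_divide_distrib)
      have "\<bar>?S - (\<Sum>j\<in>?V. ?k i j * ?F (tau j)) / n\<bar>
          \<le> (\<Sum>j\<in>?V. \<bar>(?c i j * surv r j - ?k i j * ?F (tau j)) / n\<bar>)"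
        unfolding eq by (rule sum_abs)
      also have "\<dots> \<le> (\<Sum>j\<in>?V. (\<bar>?c i j - ?k i j\<bar> + t * \<bar>surv r j - ?F (tau j)\<bar>) / n)"
      proof (rule sum_mono)
        fix j
        have "\<bar>?c i j * surv r j - ?k i j * ?F (tau j)\<bar> \<le> \<bar>?c i j - ?k i j\<bar> + t * \<bar>surv r j - ?F (tau j)\<bar>"
          using surv_bounds[of r j] k0[of i j] by (intro abs_mult_diff_le) auto
        then show "\<bar>(?c i j * surv r j - ?k i j * ?F (tau j)) / n\<bar>
            \<le> (\<bar>?c i j - ?k i j\<bar> + t * \<bar>surv r j - ?F (tau j)\<bar>) / n"
          unfolding abs_divide abs_of_nat by (rule divide_right_mono) simp
      qed
      also have "\<dots> \<le> (\<Sum>j<n. (\<bar>?c i j - ?k i j\<bar> + t * \<bar>surv r j - ?F (tau j)\<bar>) / n)"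
        using t by (intro sum_mono2) auto
      also have "\<dots> = (\<Sum>j<n. \<bar>?c i j - ?k i j\<bar>) / n + t * D"
        unfolding D_def by (simp add: sum_divide_distrib sum.distrib add_divide_distrib sum_distrib_left)
      finally show ?thesis .
    qed
    also have "\<bar>(\<Sum>j\<in>?V. ?k i j * ?F (tau j)) / n - (\<Sum>j<n. ?k i j * ?F (tau j)) / n\<bar> \<le> t / n"
    proof -
      have "(\<Sum>j<n. ?k i j * ?F (tau j)) = ?k i i * ?F (tau i) + (\<Sum>j\<in>?V. ?k i j * ?F (tau j))"
        using i by (intro sum.remove) auto
      then have "\<bar>(\<Sum>j\<in>?V. ?k i j * ?F (tau j)) / n - (\<Sum>j<n. ?k i j * ?F (tau j)) / n\<bar>
          = ?k i i * ?F (tau i) / n"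
        using k0[of i i] F01[of "tau i"] by (simp add: add_divide_distrib)
      also have "\<dots> \<le> t * 1 / n"
        using k0[of i i] F01[of "tau i"] t by (intro divide_right_mono mult_mono) auto
      finally show ?thesis by simp
    qed
    finally show ?thesis by linarith
  qed
  have "(\<Sum>i<n. \<bar>surv (Suc r) i - M.surF t (Suc r) (tau i)\<bar>)
      \<le> (\<Sum>i<n. (\<Sum>j<n. \<bar>?c i j - ?k i j\<bar>) / n + t * D + t / n + (1 + t) * t * (1 / J + 2 * \<epsilon>))"
    by (intro sum_mono step) auto
  also have "\<dots> = (\<Sum>i<n. \<Sum>j<n. \<bar>?c i j - ?k i j\<bar>) / n + n * (t * D + t / n + (1 + t) * t * (1 / J + 2 * \<epsilon>))"
    by (simp add: sum.distrib sum_divide_distrib distrib_left)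
  also have "\<dots> \<le> (t / J + h + (J + 1) * \<epsilon> * t) * n\<^sup>2 / n + n * (t * D + t / n + (1 + t) * t * (1 / J + 2 * \<epsilon>))"
    by (intro add_right_mono divide_right_mono sum_slots_vs_ker) simp
  also have "\<dots> = n * (err + t * D)"
  proof -
    have q: "x * real (n\<^sup>2) / real n = real n * x" for x :: real
      using n by (simp add: power2_eq_square)
    have alg: "m * a + m * (b + c + d) = m * (a + c + d + b)" for m a b c d :: real
      by (simp add: algebra_simps)
    show ?thesis unfolding q err_def by (rule alg)
  qed
  finally have "(\<Sum>i<n. \<bar>surv (Suc r) i - M.surF t (Suc r) (tau i)\<bar>) / n \<le> err + t * D"
    using n by (simp add: field_simps)
  also have "\<dots> \<le> err + t * (err * (\<Sum>k<r. t ^ k))"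
    using Suc.IH t unfolding D_def by (intro add_left_mono mult_left_mono)
  also have "\<dots> = err * (\<Sum>k<Suc r. t ^ k)"
    unfolding sum.lessThan_Suc_shift by (simp add: distrib_left sum_distrib_left mult.left_commute)
  finally show ?case .
qed

lemma surv_vs_beta:
  assumes "0 < r"
  shows "\<bar>(\<Sum>i<n. surv r i) / n - M.beta t r\<bar> \<le> err * ((\<Sum>k<r. t ^ k) + 1)"
proof -
  \<comment> \<open>For r = 0 the function \<open>surF\<close> is constantly 1 and does not vanish
    to the right of \<open>t\<close>, as \<open>quadrature\<close> demands.\<close>
  obtain r' where r': "r = Suc r'" using assms by (cases r) auto
  have "\<bar>(\<Sum>i<n. M.surF t r (idx i * t / J)) / n - (\<integral>y. M.surF t r y \<partial>M)\<bar> \<le> 1 * t / J + 1 * t * (2 * \<epsilon>)"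
  proof (rule M.quadrature[OF _ _ _ _ t J n cdf_approx])
    show "M.surF t r x = 0" if "t \<le> x" for x
      unfolding r' using M.Phi_zero that by simp
    show "\<bar>M.surF t r x - M.surF t r y\<bar> \<le> 1 * \<bar>x - y\<bar>" for x y
      using M.surF_lipschitz by simp
    show "M.surF t r x = M.surF t r 0" if "x \<le> 0" for x
      by (rule M.surF_const[OF that])
  qed simp
  also have "\<dots> \<le> err"
  proof -
    have "1 * (t * (1 / J + 2 * \<epsilon>)) \<le> (1 + t) * (t * (1 / J + 2 * \<epsilon>))"
      using t eps by (intro mult_right_mono mult_nonneg_nonneg) auto
    then have "1 * t / J + 1 * t * (2 * \<epsilon>) \<le> (1 + t) * t * (1 / J + 2 * \<epsilon>)"
      by (simp add: mult.assoc distrib_left[of t])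
    moreover have "0 \<le> t / J" "0 \<le> (J + 1) * \<epsilon> * t" "0 \<le> t / n" using t eps by auto
    ultimately show ?thesis unfolding err_def using h by linarith
  qed
  finally have q: "\<bar>(\<Sum>i<n. M.surF t r (tau i)) / n - M.beta t r\<bar> \<le> err"
    unfolding M.beta_def tau_def .
  have "\<bar>(\<Sum>i<n. surv r i) / n - (\<Sum>i<n. M.surF t r (tau i)) / n\<bar>
      = \<bar>\<Sum>i<n. surv r i - M.surF t r (tau i)\<bar> / n"
    by (simp add: sum_subtractf diff_divide_distrib[symmetric])
  also have "\<dots> \<le> (\<Sum>i<n. \<bar>surv r i - M.surF t r (tau i)\<bar>) / n"
    by (intro divide_right_mono sum_abs) simp
  also have "\<dots> \<le> err * (\<Sum>k<r. t ^ k)" by (rule surv_vs_surF)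
  finally have "\<bar>(\<Sum>i<n. surv r i) / n - M.beta t r\<bar> \<le> err * (\<Sum>k<r. t ^ k) + err"
    using q by linarith
  then show ?thesis by (simp add: distrib_left)
qed

end

section \<open>The giant component of a kept graph\<close>

context kept_graph
begin

lemma prob_walk_count_dev:
  fixes \<kappa> \<gamma> :: real
  assumes "0 < r" "0 < \<kappa>" "err * ((\<Sum>k<r. t ^ k) + 1) \<le> \<gamma>"
  shows "rex kept (\<lambda>H. of_bool (\<kappa> + \<gamma> \<le> \<bar>card {v\<in>{..<n}. sawalk H r v {..<n}} / n - M.beta t r\<bar>))
    \<le> (sqrt (varc t r) + biasc t r) / (sqrt n * \<kappa>)"
proof -
  let ?Z = "\<lambda>H. card {v\<in>{..<n}. sawalk H r v {..<n}} / n" and ?s = "(\<Sum>v<n. surv r v) / n"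
  have "rex kept (\<lambda>H. of_bool (\<kappa> + \<gamma> \<le> \<bar>?Z H - M.beta t r\<bar>)) \<le> rex kept (\<lambda>H. of_bool (\<kappa> \<le> \<bar>?Z H - ?s\<bar>))"
  proof (rule rex_mono)
    fix H
    have "\<kappa> \<le> \<bar>?Z H - ?s\<bar>" if "\<kappa> + \<gamma> \<le> \<bar>?Z H - M.beta t r\<bar>"
      using surv_vs_beta[OF assms(1)] assms(3) that by linarith
    then show "(of_bool (\<kappa> + \<gamma> \<le> \<bar>?Z H - M.beta t r\<bar>) :: real) \<le> of_bool (\<kappa> \<le> \<bar>?Z H - ?s\<bar>)"
      by auto
  qed
  also have "\<dots> \<le> rex kept (\<lambda>H. \<bar>?Z H - ?s\<bar>) / \<kappa>"
    by (rule rex_markov[OF assms(2)]) simp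
  also have "\<dots> \<le> (sqrt (varc t r) + biasc t r) / sqrt n / \<kappa>"
    by (intro divide_right_mono sawalk_count_approx) (use assms in simp)
  finally show ?thesis by simp
qed

text \<open>A vertex of a large component either starts an \<open>r\<close>-walk, and the number of
  such starting points is close to n times \<open>beta t r\<close>, or it belongs to the few
  vertices of \<open>prob_large_component_no_walk\<close>.\<close>

lemma prob_bigset_large:
  fixes \<kappa> \<gamma> \<delta> :: real
  assumes "0 < r" "0 < \<kappa>" "err * ((\<Sum>k<r. t ^ k) + 1) \<le> \<gamma>" and \<delta>: "0 < \<delta>" "2 \<le> \<delta> * n"
  shows "rex kept (\<lambda>H. of_bool ((M.beta t r + \<gamma> + 2 * \<kappa>) * n < card (bigset \<delta> n (connected_in H))))
    \<le> (sqrt (varc t r) + biasc t r) / (sqrt n * \<kappa>) + 2 * hitc t r / (\<delta> * \<kappa> * n)"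
proof -
  let ?Z = "\<lambda>H. card {v\<in>{..<n}. sawalk H r v {..<n}}"
  let ?N = "\<lambda>H. card {v \<in> bigset \<delta> n (connected_in H). \<not> sawalk H r v {..<n}}"
  have "rex kept (\<lambda>H. of_bool ((M.beta t r + \<gamma> + 2 * \<kappa>) * n < card (bigset \<delta> n (connected_in H))))
    \<le> rex kept (\<lambda>H. of_bool (\<kappa> + \<gamma> \<le> \<bar>?Z H / n - M.beta t r\<bar>) + of_bool (\<kappa> * n \<le> ?N H))"
  proof (rule rex_mono)
    fix H
    let ?B = "bigset \<delta> n (connected_in H)"
    have "?B \<subseteq> {v\<in>{..<n}. sawalk H r v {..<n}} \<union> {v \<in> ?B. \<not> sawalk H r v {..<n}}"
      by (auto simp: bigset_def)
    then have "card ?B \<le> card ({v\<in>{..<n}. sawalk H r v {..<n}} \<union> {v \<in> ?B. \<not> sawalk H r v {..<n}})"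
      by (intro card_mono) (auto simp: bigset_def)
    also have "\<dots> \<le> ?Z H + ?N H" by (rule card_Un_le)
    finally have le: "real (card ?B) \<le> real (?Z H) + real (?N H)" by linarith
    have "\<kappa> + \<gamma> \<le> \<bar>?Z H / n - M.beta t r\<bar> \<or> \<kappa> * n \<le> ?N H"
      if big: "(M.beta t r + \<gamma> + 2 * \<kappa>) * n < card ?B"
    proof (rule ccontr)
      assume "\<not> ?thesis"
      then have "?Z H / n < M.beta t r + \<kappa> + \<gamma>" "?N H < \<kappa> * n" by auto
      then have "?Z H < (M.beta t r + \<kappa> + \<gamma>) * n" "?N H < \<kappa> * n"
        using n by (simp_all add: divide_less_eq)
      then show False using le big by (simp add: algebra_simps)
    qed
    then show "(of_bool ((M.beta t r + \<gamma> + 2 * \<kappa>) * n < card ?B) :: real)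
       \<le> of_bool (\<kappa> + \<gamma> \<le> \<bar>?Z H / n - M.beta t r\<bar>) + of_bool (\<kappa> * n \<le> ?N H)"
      by auto
  qed
  also have "\<dots> \<le> (sqrt (varc t r) + biasc t r) / (sqrt n * \<kappa>) + 2 * hitc t r / (\<delta> * \<kappa> * n)"
    unfolding rex_add
    by (intro add_mono prob_walk_count_dev assms prob_large_component_no_walk)
  finally show ?thesis .
qed

lemma kept_adj_related: "H \<subseteq> kept \<Longrightarrow> (u, v) \<in> adj H \<Longrightarrow> R (slot J) u v"
proof -
  assume H: "H \<subseteq> kept" and uv: "(u, v) \<in> adj H"
  obtain e where e: "e \<in> H" "e \<in> ebetween u v" using uv by (auto simp: adj_iff)
  then have "snd e \<le> slot J" "R (snd e) (fst (fst e)) (snd (fst e))" using H by (auto simp: kept_def)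
  then have "R (slot J) (fst (fst e)) (snd (fst e))" by (rule R_mono)
  then show ?thesis using e(2) R_sym by (auto simp: ebetween_def)
qed

lemma kept_connected_related:
  assumes "H \<subseteq> kept" "connected_in H u v"
  shows "R (slot J) u v"
proof -
  have "(u, v) \<in> (adj H)\<^sup>*" using assms by (simp add: connected_in_def)
  then show ?thesis
  proof (induction rule: rtrancl_induct)
    case base
    show ?case using R_equivp[of "slot J"] by (rule equivp_reflp)
  next
    case (step y z)
    then show ?case using kept_adj_related[OF assms(1)] R_equivp[of "slot J"] by (meson equivp_transp)
  qed
qed

lemma L_closed: "u \<in> L J \<Longrightarrow> v < n \<Longrightarrow> R (slot J) u v \<Longrightarrow> v \<in> L J"
proof -
  assume a: "u \<in> L J" "v < n" "R (slot J) u v"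
  then have "R (slot J) u = R (slot J) v" using R_equivp[of "slot J"] by (simp add: equivp_def)
  then show ?thesis using a by (auto simp: L_def bigset_def)
qed

text \<open>A walk with at least one step needs an edge to a related vertex. A vertex outside the
  large set has at most \<epsilon> n of these, each adjacent with probability at most t/n.\<close>

lemma prob_walk_outside:
  fixes \<kappa> :: real
  assumes "0 < r" "0 < \<kappa>"
  shows "rex kept (\<lambda>H. of_bool (\<kappa> * n \<le> card {v \<in> {..<n} - L J. sawalk H r v {..<n}})) \<le> \<epsilon> * t / \<kappa>"
proof -
  let ?f = "\<lambda>H. \<Sum>v\<in>{..<n} - L J. \<Sum>w\<in>{w\<in>{..<n} - {v}. R (slot J) v w}. of_bool ((v, w) \<in> adj H) :: real"
  have pos: "0 < \<kappa> * n" using assms n by simp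
  have le: "real (card {v \<in> {..<n} - L J. sawalk H r v {..<n}}) \<le> ?f H" if H: "H \<subseteq> kept" for H
  proof -
    have "real (card {v \<in> {..<n} - L J. sawalk H r v {..<n}})
        = (\<Sum>v\<in>{..<n} - L J. of_bool (sawalk H r v {..<n}))"
      by (simp add: of_bool_def sum.If_cases Int_def)
    also have "\<dots> \<le> ?f H"
    proof (rule sum_mono)
      fix v
      show "of_bool (sawalk H r v {..<n}) \<le> (\<Sum>w\<in>{w\<in>{..<n} - {v}. R (slot J) v w}. of_bool ((v, w) \<in> adj H) :: real)"
      proof (cases "sawalk H r v {..<n}")
        case True
        obtain r' where "r = Suc r'" using assms by (cases r) auto
        then obtain w where w: "w \<in> {..<n} - {v}" "(v, w) \<in> adj H" using True by auto
        then have "R (slot J) v w" using kept_adj_related[OF H] by auto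
        then have "of_bool ((v, w) \<in> adj H) \<le> (\<Sum>w\<in>{w\<in>{..<n} - {v}. R (slot J) v w}. of_bool ((v, w) \<in> adj H) :: real)"
          using w by (intro member_le_sum) auto
        then show ?thesis using w by simp
      next
        case False
        then show ?thesis by (simp only: of_bool_eq) (intro sum_nonneg, simp)
      qed
    qed
    finally show ?thesis .
  qed
  have "rex kept (\<lambda>H. of_bool (\<kappa> * n \<le> card {v \<in> {..<n} - L J. sawalk H r v {..<n}}))
      \<le> rex kept (\<lambda>H. of_bool (\<kappa> * n \<le> ?f H))"
  proof (rule rex_mono)
    fix H assume "H \<subseteq> kept"
    from le[OF this] have "\<kappa> * n \<le> ?f H" if "\<kappa> * n \<le> card {v \<in> {..<n} - L J. sawalk H r v {..<n}}"
      using that by linarith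
    then show "(of_bool (\<kappa> * n \<le> card {v \<in> {..<n} - L J. sawalk H r v {..<n}}) :: real) \<le> of_bool (\<kappa> * n \<le> ?f H)"
      by auto
  qed
  also have "\<dots> \<le> rex kept ?f / (\<kappa> * n)"
    by (rule rex_markov[OF pos]) (intro sum_nonneg, simp)
  also have "rex kept ?f = (\<Sum>v\<in>{..<n} - L J. \<Sum>w\<in>{w\<in>{..<n} - {v}. R (slot J) v w}. rex kept (\<lambda>H. of_bool ((v, w) \<in> adj H)))"
    by (simp only: rex_sum)
  also have "\<dots> / (\<kappa> * n) \<le> (\<Sum>v\<in>{..<n}. \<epsilon> * t) / (\<kappa> * n)"
  proof (rule divide_right_mono)
    have "(\<Sum>v\<in>{..<n} - L J. \<Sum>w\<in>{w\<in>{..<n} - {v}. R (slot J) v w}. rex kept (\<lambda>H. of_bool ((v, w) \<in> adj H)))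
        \<le> (\<Sum>v\<in>{..<n} - L J. \<epsilon> * t)"
    proof (rule sum_mono)
      fix v assume v: "v \<in> {..<n} - L J"
      let ?W = "{w\<in>{..<n} - {v}. R (slot J) v w}"
      have "(\<Sum>w\<in>?W. rex kept (\<lambda>H. of_bool ((v, w) \<in> adj H))) \<le> (\<Sum>w\<in>?W. t / n)"
        by (intro sum_mono order_trans[OF prob_adj_le lam_le]) auto
      also have "\<dots> = card ?W * (t / n)" by simp
      also have "\<dots> \<le> (\<epsilon> * n) * (t / n)"
      proof (rule mult_right_mono)
        have "card ?W \<le> card {u\<in>{..<n}. R (slot J) v u}" by (intro card_mono) auto
        moreover have "card {u\<in>{..<n}. R (slot J) v u} \<le> \<epsilon> * n"
          using v by (auto simp: L_def bigset_def)
        ultimately show "real (card ?W) \<le> \<epsilon> * n" by linarith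
      qed (use t in simp)
      also have "\<dots> = \<epsilon> * t" using n by simp
      finally show "(\<Sum>w\<in>?W. rex kept (\<lambda>H. of_bool ((v, w) \<in> adj H))) \<le> \<epsilon> * t" .
    qed
    also have "\<dots> \<le> (\<Sum>v\<in>{..<n}. \<epsilon> * t)"
      by (rule sum_mono2) (use eps t in auto)
    finally show "(\<Sum>v\<in>{..<n} - L J. \<Sum>w\<in>{w\<in>{..<n} - {v}. R (slot J) v w}. rex kept (\<lambda>H. of_bool ((v, w) \<in> adj H)))
        \<le> (\<Sum>v\<in>{..<n}. \<epsilon> * t)" .
  qed (use pos in simp)
  also have "\<dots> = \<epsilon> * t / \<kappa>" using n by simp
  finally show ?thesis .
qed

text \<open>A starting point of an \<open>r\<close>-walk has more than \<open>r\<close> vertices in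
  its \<open>H1\<close>-component, so sprinkling with K = r + 1 unites almost all starting points in
  \<open>L J\<close>, at a loss of \<kappa> n. The other two \<kappa> n pay for the deviation of the
  number of starting points and for those outside \<open>L J\<close>; \<gamma> is the systematic
  error.\<close>

lemma prob_no_giant:
  fixes \<kappa> \<gamma> d :: real
  assumes r: "0 < r" and \<kappa>: "0 < \<kappa>" and err: "err * ((\<Sum>k<r. t ^ k) + 1) \<le> \<gamma>"
    and finB: "finite B" and d: "0 \<le> d"
    and rate: "\<And>u v. u \<in> L J \<Longrightarrow> v \<in> L J \<Longrightarrow> u \<noteq> v \<Longrightarrow> d / n \<le> \<theta> * card (B \<inter> ebetween u v)"
  shows "rex kept (\<lambda>H1. rex B (\<lambda>H2. of_bool
      (\<forall>v<n. card (component {..<n} (H1 \<union> H2) v) < (M.beta t r - \<gamma> - 3 * \<kappa>) * n)))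
    \<le> (sqrt (varc t r) + biasc t r) / (sqrt n * \<kappa>) + \<epsilon> * t / \<kappa>
      + 2 powr (n / Suc r) * exp (- d * (\<kappa> / 3)\<^sup>2 * n)"
proof -
  let ?sp = "2 powr (n / Suc r) * exp (- d * (\<kappa> / 3)\<^sup>2 * n)"
  let ?Z = "\<lambda>H. card {v\<in>{..<n}. sawalk H r v {..<n}}"
  let ?O = "\<lambda>H. card {v \<in> {..<n} - L J. sawalk H r v {..<n}}"
  have "rex kept (\<lambda>H1. rex B (\<lambda>H2. of_bool
      (\<forall>v<n. card (component {..<n} (H1 \<union> H2) v) < (M.beta t r - \<gamma> - 3 * \<kappa>) * n)))
    \<le> rex kept (\<lambda>H1. of_bool (\<kappa> + \<gamma> \<le> \<bar>?Z H1 / n - M.beta t r\<bar>) + of_bool (\<kappa> * n \<le> ?O H1) + ?sp)"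
  proof (rule rex_mono)
    fix H1 assume H1: "H1 \<subseteq> kept"
    let ?I = "rex B (\<lambda>H2. of_bool (\<forall>v<n. card (component {..<n} (H1 \<union> H2) v) < (M.beta t r - \<gamma> - 3 * \<kappa>) * n))"
    have I1: "?I \<le> 1" by (rule rex_le_const[OF finB]) simp
    show "?I \<le> of_bool (\<kappa> + \<gamma> \<le> \<bar>?Z H1 / n - M.beta t r\<bar>) + of_bool (\<kappa> * n \<le> ?O H1) + ?sp"
    proof (cases "\<kappa> + \<gamma> \<le> \<bar>?Z H1 / n - M.beta t r\<bar> \<or> \<kappa> * n \<le> ?O H1")
      case True
      then have "1 \<le> of_bool (\<kappa> + \<gamma> \<le> \<bar>?Z H1 / n - M.beta t r\<bar>) + (of_bool (\<kappa> * n \<le> ?O H1) :: real)"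
        by auto
      moreover have "0 \<le> ?sp" by simp
      ultimately show ?thesis using I1 by linarith
    next
      case False
      define W where "W = {v \<in> L J. Suc r \<le> card (component {..<n} H1 v)}"
      have "{v\<in>{..<n}. sawalk H1 r v {..<n}} \<subseteq> W \<union> {v \<in> {..<n} - L J. sawalk H1 r v {..<n}}"
      proof
        fix v assume v: "v \<in> {v\<in>{..<n}. sawalk H1 r v {..<n}}"
        then obtain X where X: "X \<subseteq> insert v {..<n}" "finite X" "card X = Suc r" "\<forall>x\<in>X. connected_in H1 v x"
          using sawalk_card[of H1 r v "{..<n}"] by auto
        then have "X \<subseteq> component {..<n} H1 v" using v by (auto simp: component_def)
        then have "Suc r \<le> card (component {..<n} H1 v)"
          using X(3) card_mono[of "component {..<n} H1 v" X] by (auto simp: component_def)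
        then show "v \<in> W \<union> {v \<in> {..<n} - L J. sawalk H1 r v {..<n}}" using v by (auto simp: W_def)
      qed
      moreover have finW: "finite W"
        unfolding W_def using finite_subset[OF L_sub[of J]] by simp
      ultimately have "?Z H1 \<le> card (W \<union> {v \<in> {..<n} - L J. sawalk H1 r v {..<n}})"
        by (intro card_mono) auto
      also have "\<dots> \<le> card W + ?O H1" by (rule card_Un_le)
      finally have "real (?Z H1) \<le> card W + real (?O H1)" by linarith
      moreover have "(M.beta t r - \<kappa> - \<gamma>) * n < ?Z H1"
      proof -
        have "M.beta t r - \<kappa> - \<gamma> < ?Z H1 / n" using False by linarith
        then show ?thesis using n by (simp add: less_divide_eq)
      qed
      moreover have "?O H1 < \<kappa> * n" using False by auto
      ultimately have W: "(M.beta t r - \<gamma> - 3 * \<kappa>) * n \<le> card W - 3 * (\<kappa> / 3) * n"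
        by (simp add: algebra_simps)
      have "?I \<le> rex B (\<lambda>H2. of_bool (\<forall>v<n. card (component {..<n} (H1 \<union> H2) v) < card W - 3 * (\<kappa> / 3) * n))"
      proof (rule rex_mono)
        fix H2
        have "\<forall>v<n. card (component {..<n} (H1 \<union> H2) v) < card W - 3 * (\<kappa> / 3) * n"
          if "\<forall>v<n. card (component {..<n} (H1 \<union> H2) v) < (M.beta t r - \<gamma> - 3 * \<kappa>) * n"
          using that W by fastforce
        then show "(of_bool (\<forall>v<n. card (component {..<n} (H1 \<union> H2) v) < (M.beta t r - \<gamma> - 3 * \<kappa>) * n) :: real)
          \<le> of_bool (\<forall>v<n. card (component {..<n} (H1 \<union> H2) v) < card W - 3 * (\<kappa> / 3) * n)"
          by (simp only: of_bool_def split: if_split) auto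
      qed
      also have "\<dots> \<le> ?sp"
        unfolding W_def
      proof (rule sprinkling[OF finB n _ L_sub _ _ d])
        show "v \<in> L J" if "u \<in> L J" "v < n" "connected_in H1 u v" for u v
          using L_closed[OF that(1,2)] kept_connected_related[OF H1 that(3)] .
      qed (use rate \<kappa> in auto)
      finally show ?thesis by (simp add: add_increasing)
    qed
  qed
  also have "\<dots> \<le> (sqrt (varc t r) + biasc t r) / (sqrt n * \<kappa>) + \<epsilon> * t / \<kappa> + ?sp"
    unfolding rex_add rex_const[OF finite_kept]
    by (intro add_mono prob_walk_count_dev prob_walk_outside r \<kappa> err order_refl)
  finally show ?thesis .
qed

end

section \<open>The layers as functions of the occupied slots\<close>

text \<open>\<open>level k S l\<close> is the relation of being in the same component of \<open>G_k\<close> just before slot \<open>l\<close>,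
  if \<open>S\<close> is the set of arrivals; layer \<open>0\<close> is connected from the start, so that \<open>G_1\<close> contains all
  arrivals. An arrival is passed on to \<open>G_(k+1)\<close> iff it is in \<open>active k S\<close>.\<close>

primrec level :: "nat \<Rightarrow> edge set \<Rightarrow> nat \<Rightarrow> nat \<Rightarrow> nat \<Rightarrow> bool" where
  "level 0 S l = (\<lambda>i j. True)"
| "level (Suc k) S l =
    connected_in {e \<in> S. snd e < l \<and> level k S (snd e) (fst (fst e)) (snd (fst e))}"

definition active :: "nat \<Rightarrow> edge set \<Rightarrow> edge set" where
  "active k S = {e. level k S (snd e) (fst (fst e)) (snd (fst e))}"

lemma level_Suc: "level (Suc k) S l = connected_in {e \<in> S \<inter> active k S. snd e < l}"
proof -
  have "{e \<in> S. snd e < l \<and> level k S (snd e) (fst (fst e)) (snd (fst e))} = {e \<in> S \<inter> active k S. snd e < l}"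
    by (auto simp: active_def)
  then show ?thesis by simp
qed

lemma equivp_level: "equivp (level k S l)"
proof (cases k)
  case 0
  then show ?thesis by (auto intro: equivpI reflpI sympI transpI)
next
  case (Suc k')
  then show ?thesis by (simp only: level_Suc equivp_connected_in)
qed

lemma level_mono: "l \<le> l' \<Longrightarrow> level k S l i j \<Longrightarrow> level k S l' i j"
proof (cases k)
  case (Suc k')
  assume l: "l \<le> l'" "level k S l i j"
  have "{e \<in> S \<inter> active k' S. snd e < l} \<subseteq> {e \<in> S \<inter> active k' S. snd e < l'}" using l by auto
  then show ?thesis using l(2) unfolding Suc level_Suc by (rule connected_in_mono)
qed simp

lemma level_Suc_imp: "level (Suc k) S l i j \<Longrightarrow> level k S l i j"
proof (induction k arbitrary: l i j)
  case (Suc k)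
  have "active (Suc k) S \<subseteq> active k S" unfolding active_def using Suc.IH by blast
  then have "{e \<in> S \<inter> active (Suc k) S. snd e < l} \<subseteq> {e \<in> S \<inter> active k S. snd e < l}" by blast
  then show ?case using Suc.prems unfolding level_Suc by (rule connected_in_mono)
qed simp

lemma active_Suc_subset: "active (Suc k) S \<subseteq> active k S"
  unfolding active_def using level_Suc_imp by blast

lemma edge_connected_in: "e \<in> E \<Longrightarrow> connected_in E (fst (fst e)) (snd (fst e))"
  unfolding connected_in_def adj_def by blast

lemma connected_in_least:
  assumes "\<And>e. e \<in> E \<Longrightarrow> connected_in F (fst (fst e)) (snd (fst e))" "connected_in E u v"
  shows "connected_in F u v"
proof -
  have adjF: "connected_in F y z" if "(y, z) \<in> adj E" for y z
    using that assms(1) unfolding adj_def by (auto intro: connected_in_sym)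
  have "(u, v) \<in> (adj E)\<^sup>*" using assms(2) by (simp add: connected_in_def)
  then show ?thesis
  proof (induction rule: rtrancl_induct)
    case (step y z)
    show ?case by (rule connected_in_trans[OF step.IH adjF[OF step.hyps(2)]])
  qed simp
qed

text \<open>Level \<open>k\<close> is determined by the arrivals outside the active set of level \<open>k\<close>: the arrival of
  an active edge does not change the components.\<close>

lemma level_cong:
  assumes "S - active k S = S' - active k S"
  shows "level k S' = level k S"
  using assms
proof (induction k)
  case 0
  show ?case by (auto simp: fun_eq_iff)
next
  case (Suc k)
  let ?A = "active k S" and ?A1 = "active (Suc k) S"
  have sub: "?A1 \<subseteq> ?A" by (rule active_Suc_subset)
  have "S - ?A = S' - ?A" using Suc.prems sub by blast
  then have "level k S' = level k S" by (rule Suc.IH)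
  then have A: "active k S' = ?A" by (simp add: active_def)
  define E where "E T l = {e \<in> T \<inter> ?A. snd e < l}" for T :: "edge set" and l :: nat
  have lev: "level (Suc k) S l = connected_in (E S l)" "level (Suc k) S' l = connected_in (E S' l)" for l
    unfolding level_Suc A E_def by simp_all
  have eq: "connected_in (E S' l) = connected_in (E S l)" for l
  \<comment> \<open>Slot by slot: an arrival in slot l on which \<open>S\<close> and
    \<open>S'\<close> differ is active at level k + 1, so its endpoints are connected before slot l
    already and it changes no component.\<close>
  proof (induction l)
    case 0
    show ?case by (simp add: E_def)
  next
    case (Suc l)
    have half: "connected_in (E T' (Suc l)) u v"
      if TT': "\<And>e. e \<in> T \<Longrightarrow> e \<notin> ?A1 \<Longrightarrow> e \<in> T'"
        and l: "connected_in (E T l) = connected_in (E S l)" "connected_in (E T' l) = connected_in (E S l)"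
        and c: "connected_in (E T (Suc l)) u v" for T T' u v
    proof (rule connected_in_least[OF _ c])
      fix e assume e: "e \<in> E T (Suc l)"
      have mono: "E T' l \<subseteq> E T' (Suc l)" by (auto simp: E_def)
      show "connected_in (E T' (Suc l)) (fst (fst e)) (snd (fst e))"
      proof (cases "snd e < l \<or> e \<in> ?A1")
        case True
        have "connected_in (E S l) (fst (fst e)) (snd (fst e))"
        proof (cases "snd e < l")
          case True
          then have "e \<in> E T l" using e by (auto simp: E_def)
          then show ?thesis unfolding l(1)[symmetric] by (rule edge_connected_in)
        next
          case False
          then have "snd e = l" "e \<in> ?A1" using True e by (auto simp: E_def)
          then show ?thesis unfolding active_def lev by auto
        qed
        then show ?thesis unfolding l(2)[symmetric] by (rule connected_in_mono[OF mono])
      next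
        case False
        then have "e \<in> E T' (Suc l)" using e TT' by (auto simp: E_def)
        then show ?thesis by (rule edge_connected_in)
      qed
    qed
    show ?case
    proof (intro ext iffI)
      fix u v
      show "connected_in (E S (Suc l)) u v" if "connected_in (E S' (Suc l)) u v"
        by (rule half[of S' S, OF _ Suc.IH refl that]) (use Suc.prems \<open>S - ?A1 = S' - ?A1\<close> in blast)
      show "connected_in (E S' (Suc l)) u v" if "connected_in (E S (Suc l)) u v"
        by (rule half[of S S', OF _ refl Suc.IH that]) (use \<open>S - ?A1 = S' - ?A1\<close> in blast)
    qed
  qed
  show ?case by (rule ext) (simp only: lev eq)
qed

text \<open>By \<open>level_cong\<close> replacing the arrivals on the active set leaves the
  components of level \<open>k\<close> unchanged at all times. This makes the exchange of two
  samples an involution.\<close>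

lemma active_swap:
  fixes S Y :: "edge set" and k :: nat
  defines "S' \<equiv> (S - active k S) \<union> (Y \<inter> active k S)"
  shows "active k S' = active k S"
proof -
  have "S - active k S = S' - active k S" by (auto simp: S'_def)
  then have "level k S' = level k S" by (rule level_cong)
  then show ?thesis by (simp add: active_def)
qed

context random_subset
begin

text \<open>Exchanging the two independent samples \<open>S\<close> and \<open>Y\<close> on \<open>A S\<close> is a weight preserving
  involution.\<close>

lemma rex_resample:
  fixes A :: "'a set \<Rightarrow> 'a set"
  assumes fin: "finite I"
    and inv: "\<And>S Y. S \<subseteq> I \<Longrightarrow> Y \<subseteq> I \<Longrightarrow> A ((S - A S) \<union> (Y \<inter> A S)) = A S"
  shows "rex I f = rex I (\<lambda>S. rex I (\<lambda>Y. f ((S - A S) \<union> (Y \<inter> A S))))"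
proof -
  let ?p = "1 - exp (-\<theta>)" and ?q = "exp (-\<theta>)"
  define w where "w S = ?p ^ card S * ?q ^ card (I - S)" for S :: "'a set"
  define \<phi> where "\<phi> = (\<lambda>(S, Y). ((S - A S) \<union> (Y \<inter> A S), (Y - A S) \<union> (S \<inter> A S)))"
  have rex: "rex I g = (\<Sum>S\<in>Pow I. w S * g S)" for g
    by (simp add: rex_def w_def)
  have \<phi>P: "\<phi> P \<in> Pow I \<times> Pow I" "\<phi> (\<phi> P) = P" "w (fst (\<phi> P)) * w (snd (\<phi> P)) = w (fst P) * w (snd P)"
    if P: "P \<in> Pow I \<times> Pow I" for P
  proof -
    obtain S Y where SY: "P = (S, Y)" "S \<subseteq> I" "Y \<subseteq> I" using P by auto
    let ?S = "(S - A S) \<union> (Y \<inter> A S)" and ?Y = "(Y - A S) \<union> (S \<inter> A S)"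
    have \<phi>: "\<phi> P = (?S, ?Y)" by (simp add: \<phi>_def SY)
    show "\<phi> P \<in> Pow I \<times> Pow I" using SY \<phi> by auto
    have "\<phi> (?S, ?Y) = ((?S - A S) \<union> (?Y \<inter> A S), (?Y - A S) \<union> (?S \<inter> A S))"
      using inv[OF SY(2,3)] by (simp only: \<phi>_def prod.case)
    also have "\<dots> = (S, Y)" by auto
    finally show "\<phi> (\<phi> P) = P" using \<phi> SY by simp
    have f: "finite S" "finite Y" using SY fin finite_subset by auto
    have c: "card ?S + card ?Y = card S + card Y"
    proof -
      have "card ?S = card (S - A S) + card (Y \<inter> A S)" "card ?Y = card (Y - A S) + card (S \<inter> A S)"
        using f by (auto intro!: card_Un_disjoint)
      moreover have "card S = card (S - A S) + card (S \<inter> A S)" "card Y = card (Y - A S) + card (Y \<inter> A S)"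
        using f card_Int_Diff[of S "A S"] card_Int_Diff[of Y "A S"] by simp_all
      ultimately show ?thesis by simp
    qed
    \<comment> \<open>The product of the two weights depends only on |U| + |V|, which the exchange
      preserves.\<close>
    have w2: "w U * w V = ?p ^ (card U + card V) * ?q ^ (2 * card I - (card U + card V))"
      if "U \<subseteq> I" "V \<subseteq> I" for U V
    proof -
      have "card (I - U) = card I - card U" "card U \<le> card I" "card (I - V) = card I - card V" "card V \<le> card I"
        using that fin by (auto intro: card_mono card_Diff_subset finite_subset)
      then have "card (I - U) + card (I - V) = 2 * card I - (card U + card V)" by simp
      then show ?thesis by (simp add: w_def power_add[symmetric] mult_ac)
    qed
    show "w (fst (\<phi> P)) * w (snd (\<phi> P)) = w (fst P) * w (snd P)"
      using w2[of ?S ?Y] w2[of S Y] SY c \<phi> by auto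
  qed
  have one: "(\<Sum>Y\<in>Pow I. w Y) = 1" using rex_const[OF fin, of 1] unfolding rex by simp
  have "rex I (\<lambda>S. rex I (\<lambda>Y. f ((S - A S) \<union> (Y \<inter> A S))))
      = (\<Sum>S\<in>Pow I. \<Sum>Y\<in>Pow I. w S * w Y * f (fst (\<phi> (S, Y))))"
    unfolding rex by (simp add: sum_distrib_left mult.assoc \<phi>_def)
  also have "\<dots> = (\<Sum>P\<in>Pow I \<times> Pow I. w (fst P) * w (snd P) * f (fst (\<phi> P)))"
    unfolding sum.cartesian_product by (simp add: case_prod_unfold)
  also have "\<dots> = (\<Sum>P\<in>Pow I \<times> Pow I. w (fst P) * w (snd P) * f (fst P))"
    by (rule sum.reindex_bij_witness[of _ \<phi> \<phi>]) (use \<phi>P in auto)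
  also have "\<dots> = (\<Sum>S\<in>Pow I. \<Sum>Y\<in>Pow I. w S * w Y * f S)"
    unfolding sum.cartesian_product by (simp add: case_prod_unfold)
  also have "\<dots> = (\<Sum>S\<in>Pow I. w S * f S * (\<Sum>Y\<in>Pow I. w Y))"
    unfolding sum_distrib_left by (intro sum.cong refl) (simp add: mult_ac)
  also have "\<dots> = rex I f" unfolding one rex by simp
  finally show ?thesis by simp
qed

text \<open>The conditional independence: given the components of layer \<open>k\<close>, the
  arrivals on the active set are a fresh Bernoulli sample, although the active set itself depends on
  \<open>S\<close>.\<close>

lemma rex_active:
  assumes "finite I"
  shows "rex I (\<lambda>S. F (S \<inter> active k S)) = rex I (\<lambda>S. rex (I \<inter> active k S) F)"
proof -
  have "rex I (\<lambda>S. F (S \<inter> active k S)) = rex I (\<lambda>S. rex I (\<lambda>Y.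
      F (((S - active k S) \<union> (Y \<inter> active k S)) \<inter> active k ((S - active k S) \<union> (Y \<inter> active k S)))))"
    by (rule rex_resample[OF assms, where A = "active k" and f = "\<lambda>S. F (S \<inter> active k S)"])
      (rule active_swap)
  also have "\<dots> = rex I (\<lambda>S. rex I (\<lambda>Y. F (Y \<inter> (I \<inter> active k S))))"
  proof (intro rex_cong)
    fix S Y assume "Y \<subseteq> I"
    then have "((S - active k S) \<union> (Y \<inter> active k S)) \<inter> active k S = Y \<inter> (I \<inter> active k S)" by auto
    then show "F (((S - active k S) \<union> (Y \<inter> active k S)) \<inter> active k ((S - active k S) \<union> (Y \<inter> active k S)))
       = F (Y \<inter> (I \<inter> active k S))"
      unfolding active_swap by simp
  qed
  also have "\<dots> = rex I (\<lambda>S. rex (I \<inter> active k S) F)"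
    by (intro rex_cong rex_restrict assms) auto
  finally show ?thesis .
qed

end

section \<open>Induction over the layers\<close>

text \<open>The exponent: a slot of a pair is occupied with probability about n^(-4), and there are
  of order n^4 couples of vertex pairs and n^3 slots. So the expected number of couples of arrivals
  within boundedly many slots has order n^4 n^3 n^(-8) = 1/n.\<close>

definition mesh :: "nat \<Rightarrow> real" where "mesh n = 1 / real n ^ 3"

definition slotn :: "nat \<Rightarrow> real \<Rightarrow> nat" where "slotn n t = nat \<lfloor>t / mesh n\<rfloor>"

definition rate :: "nat \<Rightarrow> real" where "rate n = mesh n / n"

definition slots :: "nat \<Rightarrow> nat \<Rightarrow> edge set" where
  "slots n N = {e. fst (fst e) < snd (fst e) \<and> snd (fst e) < n \<and> snd e < N}"

definition kept_set :: "nat \<Rightarrow> real \<Rightarrow> (nat \<Rightarrow> nat \<Rightarrow> nat \<Rightarrow> bool) \<Rightarrow> edge set" where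
  "kept_set n t R = {e \<in> slots n (slotn n t). R (snd e) (fst (fst e)) (snd (fst e))}"

text \<open>The horizon N is free, so that several times, and a margin beyond \<open>t\<close>, can
  be treated with one and the same sample.\<close>

definition evolves :: "nat \<Rightarrow> (real \<Rightarrow> real) \<Rightarrow> bool" where
  "evolves k \<rho> \<longleftrightarrow> (\<forall>t\<ge>0. \<forall>\<epsilon>>0. \<forall>\<eta>>0. \<forall>\<^sub>F n in sequentially. \<forall>N\<ge>slotn n t.
     random_subset.rex (rate n) (slots n N)
       (\<lambda>S. of_bool (\<not> giant_like \<epsilon> n (\<rho> t) (level k S (slotn n t)))) \<le> \<eta>)"

lemma random_subset_rate: "random_subset (rate n)"
  by unfold_locales (simp add: rate_def mesh_def)

lemma finite_slots: "finite (slots n N)"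
proof (rule finite_subset)
  show "slots n N \<subseteq> ({..<n} \<times> {..<n}) \<times> {..<N}" by (auto simp: slots_def)
qed simp

lemma finite_kept_set: "finite (kept_set n t R)"
  by (rule finite_subset[OF _ finite_slots]) (auto simp: kept_set_def)

lemma mesh_tendsto: "mesh \<longlonglongrightarrow> 0"
proof (rule tendsto_sandwich[of "\<lambda>_. 0" _ _ "\<lambda>n. 1 / real n"])
  show "\<forall>\<^sub>F n in sequentially. mesh n \<le> 1 / real n"
    using eventually_gt_at_top[of 0]
  proof eventually_elim
    case (elim n)
    have "real n * 1 \<le> real n * (real n)\<^sup>2" using elim by (intro mult_left_mono) auto
    then have "real n \<le> real n ^ 3" by (simp add: power3_eq_cube power2_eq_square)
    then show ?case unfolding mesh_def using elim by (intro divide_left_mono) auto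
  qed
qed (auto simp: mesh_def lim_1_over_n)

lemma kept_graph_kept:
  "kept_graph (mesh n) t e n J R M (rate n) \<Longrightarrow> related_slots.kept (mesh n) t n J R = kept_set n t R"
proof -
  assume "kept_graph (mesh n) t e n J R M (rate n)"
  then interpret kept_graph "mesh n" t e n J R M "rate n" .
  have "slot J = slotn n t" using J by (simp add: slot_def slotn_def)
  then show ?thesis unfolding kept_def kept_set_def slots_def by auto
qed

text \<open>The order of the choices matters: first \<open>J\<close>, then \<open>e\<close> small
  compared with 1/J, because the bad pairs of all J + 1 observations add up, and n last.\<close>

lemma err_small:
  fixes t \<gamma> :: real
  assumes t: "0 \<le> t" and \<gamma>: "0 < \<gamma>"
  shows "\<exists>J e. 0 < J \<and> 0 < e \<and> (\<forall>\<^sub>F n in sequentially.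
    t / real J + mesh n + real (J + 1) * e * t + t / real n + (1 + t) * t * (1 / real J + 2 * e) \<le> \<gamma>)"
proof -
  define c where "c = t + (1 + t) * t"
  have c: "0 \<le> c" using t by (simp add: c_def)
  obtain J :: nat where J: "4 * c / \<gamma> < J" using reals_Archimedean2 by blast
  have "0 \<le> 4 * c / \<gamma>" using c \<gamma> by simp
  then have J0: "0 < real J" using J by linarith
  define D where "D = real (J + 1) * t + 2 * ((1 + t) * t)"
  have D: "0 \<le> D" using t by (simp add: D_def)
  define e where "e = \<gamma> / (4 * (D + 1))"
  have e: "0 < e" using \<gamma> D by (simp add: e_def)
  have eD: "e * D \<le> \<gamma> / 4"
  proof -
    have "e * D \<le> e * (D + 1)" using e by simp
    also have "\<dots> = \<gamma> / 4" using D by (simp add: e_def field_simps)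
    finally show ?thesis .
  qed
  have cJ: "c / J \<le> \<gamma> / 4"
    using J J0 \<gamma> by (simp add: field_simps)
  have "(\<lambda>n. mesh n + t / real n) \<longlonglongrightarrow> 0 + 0"
    by (intro tendsto_add mesh_tendsto lim_const_over_n)
  then have "\<forall>\<^sub>F n in sequentially. mesh n + t / real n < \<gamma> / 4"
    using \<gamma> by (intro order_tendstoD(2)) auto
  then have "\<forall>\<^sub>F n in sequentially.
    t / real J + mesh n + real (J + 1) * e * t + t / real n + (1 + t) * t * (1 / real J + 2 * e) \<le> \<gamma>"
  proof eventually_elim
    case (elim n)
    have "t / real J + mesh n + real (J + 1) * e * t + t / real n + (1 + t) * t * (1 / real J + 2 * e)
        = c / J + e * D + (mesh n + t / real n)"
      unfolding c_def D_def by (simp add: add_divide_distrib algebra_simps)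
    also have "\<dots> \<le> \<gamma> / 4 + \<gamma> / 4 + \<gamma> / 4" using elim cJ eD by linarith
    finally show ?case using \<gamma> by linarith
  qed
  then show ?thesis using J0 e by (intro exI[of _ J] exI[of _ e]) auto
qed

lemma eventually_inverse_small:
  assumes "0 < (\<eta>::real)"
  shows "\<forall>\<^sub>F n in sequentially. c / real n \<le> \<eta>" "\<forall>\<^sub>F n in sequentially. c / sqrt (real n) \<le> \<eta>"
proof -
  have "(\<lambda>n. c / real n) \<longlonglongrightarrow> 0" by (rule lim_const_over_n)
  then have "\<forall>\<^sub>F n in sequentially. c / real n < \<eta>" using assms by (rule order_tendstoD)
  then show "\<forall>\<^sub>F n in sequentially. c / real n \<le> \<eta>" by eventually_elim simp
  have "filterlim (\<lambda>n. sqrt (real n)) at_top sequentially"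
    by (rule filterlim_compose[OF sqrt_at_top filterlim_real_sequentially])
  then have "(\<lambda>n. c / sqrt (real n)) \<longlonglongrightarrow> 0"
    by (rule real_tendsto_divide_at_top[OF tendsto_const])
  then have "\<forall>\<^sub>F n in sequentially. c / sqrt (real n) < \<eta>" using assms by (rule order_tendstoD)
  then show "\<forall>\<^sub>F n in sequentially. c / sqrt (real n) \<le> \<eta>" by eventually_elim simp
qed

text \<open>\<open>r\<close> is fixed first, such that survival for \<open>r\<close> generations is
  hardly more likely than survival forever. The number \<open>J\<close> of observations and their
  accuracy \<open>e\<close> are then chosen depending on \<open>r\<close>.\<close>

lemma eventually_upper:
  fixes t \<epsilon> \<kappa> \<eta> :: real
  assumes M: "real_distribution M" and t: "0 \<le> t" and pos: "0 < \<epsilon>" "0 < \<kappa>" "0 < \<eta>"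
  shows "\<exists>J e. 0 < J \<and> 0 < e \<and> (\<forall>\<^sub>F n in sequentially. \<forall>R. kept_graph (mesh n) t e n J R M (rate n) \<longrightarrow>
    random_subset.rex (rate n) (kept_set n t R)
      (\<lambda>H. of_bool ((real_distribution.rho M t + \<kappa>) * n < card (bigset \<epsilon> n (connected_in H)))) \<le> \<eta>)"
proof -
  interpret M: real_distribution M by (rule M)
  define k where "k = \<kappa> / 4"
  have k: "0 < k" using pos by (simp add: k_def)
  have "\<forall>\<^sub>F r in sequentially. M.beta t r < M.rho t + k"
    using M.beta_LIMSEQ[of t] by (rule order_tendstoD) (use k in simp)
  then have "\<forall>\<^sub>F r in sequentially. M.beta t r < M.rho t + k \<and> 0 < r"
    using eventually_gt_at_top[of 0] by eventually_elim simp
  then obtain r where r: "M.beta t r < M.rho t + k" "0 < r" by (auto simp: eventually_sequentially)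
  define P where "P = (\<Sum>i<r. t ^ i) + 1"
  have P: "0 < P" using t by (auto simp: P_def intro!: add_nonneg_pos sum_nonneg)
  obtain J e where Je: "0 < J" "0 < e" and ev: "\<forall>\<^sub>F n in sequentially.
    t / real J + mesh n + real (J + 1) * e * t + t / real n + (1 + t) * t * (1 / real J + 2 * e) \<le> k / P"
    using err_small[OF t, of "k / P"] k P by auto
  have h2: "0 < \<eta> / 2" using pos by simp
  have "\<forall>\<^sub>F n in sequentially. \<forall>R. kept_graph (mesh n) t e n J R M (rate n) \<longrightarrow>
    random_subset.rex (rate n) (kept_set n t R)
      (\<lambda>H. of_bool ((M.rho t + \<kappa>) * n < card (bigset \<epsilon> n (connected_in H)))) \<le> \<eta>"
    using ev eventually_inverse_small(2)[OF h2, of "(sqrt (varc t r) + biasc t r) / k"]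
      eventually_inverse_small(1)[OF h2, of "2 * hitc t r / (\<epsilon> * k)"]
      eventually_inverse_small(1)[OF zero_less_one, of "2 / \<epsilon>"] eventually_gt_at_top[of 0]
  proof (eventually_elim, intro allI impI)
    fix n R
    assume a: "t / real J + mesh n + real (J + 1) * e * t + t / real n + (1 + t) * t * (1 / real J + 2 * e) \<le> k / P"
      and b: "(sqrt (varc t r) + biasc t r) / k / sqrt (real n) \<le> \<eta> / 2"
      and c: "2 * hitc t r / (\<epsilon> * k) / real n \<le> \<eta> / 2"
      and d: "2 / \<epsilon> / real n \<le> 1" and n: "0 < n"
      and G: "kept_graph (mesh n) t e n J R M (rate n)"
    interpret K: kept_graph "mesh n" t e n J R M "rate n" by (rule G)
    have "K.err \<le> k / P" unfolding K.err_def using a .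
    then have err: "K.err * ((\<Sum>i<r. t ^ i) + 1) \<le> k" unfolding P_def[symmetric] using P by (simp add: field_simps)
    have en: "2 \<le> \<epsilon> * n" using d pos n by (simp add: field_simps)
    have "K.rex (kept_set n t R) (\<lambda>H. of_bool ((M.rho t + \<kappa>) * n < card (bigset \<epsilon> n (connected_in H))))
      \<le> K.rex (kept_set n t R) (\<lambda>H. of_bool ((M.beta t r + k + 2 * k) * n < card (bigset \<epsilon> n (connected_in H))))"
    proof (rule K.rex_mono)
      fix H
      have "(M.beta t r + k + 2 * k) * n \<le> (M.rho t + \<kappa>) * n"
        using r(1) by (intro mult_right_mono) (auto simp: k_def)
      then show "(of_bool ((M.rho t + \<kappa>) * n < card (bigset \<epsilon> n (connected_in H))) :: real)
        \<le> of_bool ((M.beta t r + k + 2 * k) * n < card (bigset \<epsilon> n (connected_in H)))"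
        by auto
    qed
    also have "\<dots> \<le> (sqrt (varc t r) + biasc t r) / (sqrt n * k) + 2 * hitc t r / (\<epsilon> * k * n)"
      unfolding kept_graph_kept[OF G, symmetric]
      by (rule K.prob_bigset_large[OF r(2) k err pos(1) en])
    also have "\<dots> \<le> \<eta> / 2 + \<eta> / 2" using b c by (intro add_mono) (simp_all add: mult_ac)
    finally show "K.rex (kept_set n t R)
      (\<lambda>H. of_bool ((M.rho t + \<kappa>) * n < card (bigset \<epsilon> n (connected_in H)))) \<le> \<eta>" by simp
  qed
  then show ?thesis using Je by blast
qed

text \<open>Here \<open>r\<close> only has to be so large that the number of splits, at most
  2^(n/(r+1)), loses against the factor exp(-c n) from sprinkling. Closeness of \<open>beta\<close>
  to \<open>rho\<close> is not an issue, since \<open>rho_le_beta\<close> points in the right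
  direction.\<close>

lemma eventually_sprinkled:
  fixes t \<kappa> \<eta> d :: real
  assumes M: "real_distribution M" and t: "0 \<le> t" and pos: "0 < \<kappa>" "0 < \<eta>" "0 < d"
  shows "\<exists>J e. 0 < J \<and> 0 < e \<and> (\<forall>\<^sub>F n in sequentially. \<forall>R B. kept_graph (mesh n) t e n J R M (rate n) \<longrightarrow>
    finite B \<longrightarrow>
    (\<forall>u v. R (slotn n t) u v \<longrightarrow> u < n \<longrightarrow> v < n \<longrightarrow> u \<noteq> v \<longrightarrow> d / n \<le> rate n * card (B \<inter> ebetween u v)) \<longrightarrow>
    random_subset.rex (rate n) (kept_set n t R) (\<lambda>H1. random_subset.rex (rate n) B (\<lambda>H2. of_bool
      (\<forall>v<n. card (component {..<n} (H1 \<union> H2) v) < (real_distribution.rho M t - \<kappa>) * n))) \<le> \<eta>)"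
proof -
  interpret M: real_distribution M by (rule M)
  define k where "k = \<kappa> / 4"
  have k: "0 < k" using pos by (simp add: k_def)
  define c where "c = d * (k / 3)\<^sup>2"
  have c: "0 < c" using pos k by (simp add: c_def)
  obtain r' :: nat where "2 * ln 2 / c < r'" using reals_Archimedean2 by blast
  define r where "r = Suc r'"
  have r: "0 < r" "ln 2 / Suc r \<le> c / 2"
  proof -
    have "2 * ln 2 / c < Suc r" using \<open>2 * ln 2 / c < r'\<close> by (simp add: r_def)
    then show "ln 2 / Suc r \<le> c / 2" using c by (simp add: field_simps)
  qed (simp add: r_def)
  define P where "P = (\<Sum>i<r. t ^ i) + 1"
  have P: "0 < P" using t by (auto simp: P_def intro!: add_nonneg_pos sum_nonneg)
  \<comment> \<open>The second bound makes e t / k small, since e t is dominated by a summand of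
    \<open>err\<close>.\<close>
  define g where "g = min (k / P) (\<eta> * k / 3)"
  have g: "0 < g" using k P pos by (simp add: g_def)
  obtain J e where Je: "0 < J" "0 < e" and ev: "\<forall>\<^sub>F n in sequentially.
    t / real J + mesh n + real (J + 1) * e * t + t / real n + (1 + t) * t * (1 / real J + 2 * e) \<le> g"
    using err_small[OF t g] by auto
  have h3: "0 < \<eta> / 3" using pos by simp
  have "(\<lambda>n. exp (- (c / 2) * real n)) \<longlonglongrightarrow> 0"
  proof (rule filterlim_compose[OF exp_at_bot])
    show "filterlim (\<lambda>n. - (c / 2) * real n) at_bot sequentially"
      using c by (intro filterlim_tendsto_neg_mult_at_bot[OF tendsto_const] filterlim_real_sequentially) auto
  qed
  then have ex: "\<forall>\<^sub>F n in sequentially. exp (- (c / 2) * real n) < \<eta> / 3"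
    using h3 by (rule order_tendstoD)
  have "\<forall>\<^sub>F n in sequentially. \<forall>R B. kept_graph (mesh n) t e n J R M (rate n) \<longrightarrow>
    finite B \<longrightarrow>
    (\<forall>u v. R (slotn n t) u v \<longrightarrow> u < n \<longrightarrow> v < n \<longrightarrow> u \<noteq> v \<longrightarrow> d / n \<le> rate n * card (B \<inter> ebetween u v)) \<longrightarrow>
    random_subset.rex (rate n) (kept_set n t R) (\<lambda>H1. random_subset.rex (rate n) B (\<lambda>H2. of_bool
      (\<forall>v<n. card (component {..<n} (H1 \<union> H2) v) < (M.rho t - \<kappa>) * n))) \<le> \<eta>"
    using ev ex eventually_inverse_small(2)[OF h3, of "(sqrt (varc t r) + biasc t r) / k"]
  proof (eventually_elim, intro allI impI)
    fix n R B
    assume a: "t / real J + mesh n + real (J + 1) * e * t + t / real n + (1 + t) * t * (1 / real J + 2 * e) \<le> g"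
      and x: "exp (- (c / 2) * real n) < \<eta> / 3"
      and b: "(sqrt (varc t r) + biasc t r) / k / sqrt (real n) \<le> \<eta> / 3"
      and G: "kept_graph (mesh n) t e n J R M (rate n)"
      and finB: "finite B"
      and rB: "\<forall>u v. R (slotn n t) u v \<longrightarrow> u < n \<longrightarrow> v < n \<longrightarrow> u \<noteq> v \<longrightarrow> d / n \<le> rate n * card (B \<inter> ebetween u v)"
    interpret K: kept_graph "mesh n" t e n J R M "rate n" by (rule G)
    have eg: "K.err \<le> g" unfolding K.err_def using a .
    then have "K.err \<le> k / P" by (simp add: g_def)
    then have err: "K.err * ((\<Sum>i<r. t ^ i) + 1) \<le> k" unfolding P_def[symmetric] using P by (simp add: field_simps)
    have "1 * (e * t) \<le> real (J + 1) * (e * t)" using Je t by (intro mult_right_mono) auto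
    also have "\<dots> \<le> K.err"
      unfolding K.err_def using Je t K.h by (simp add: add_increasing add_increasing2 mult.assoc)
    finally have et: "e * t / k \<le> \<eta> / 3"
      using eg k by (simp add: g_def field_simps)
    have sJ: "K.slot J = slotn n t" using Je by (simp add: K.slot_def slotn_def)
    have "K.rex (kept_set n t R) (\<lambda>H1. K.rex B (\<lambda>H2. of_bool
      (\<forall>v<n. card (component {..<n} (H1 \<union> H2) v) < (M.rho t - \<kappa>) * n)))
      \<le> K.rex (kept_set n t R) (\<lambda>H1. K.rex B (\<lambda>H2. of_bool
      (\<forall>v<n. card (component {..<n} (H1 \<union> H2) v) < (M.beta t r - k - 3 * k) * n)))"
    proof (intro K.rex_mono)
      fix H1 H2
      have "(M.rho t - \<kappa>) * n \<le> (M.beta t r - k - 3 * k) * n"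
        using M.rho_le_beta[of t r] by (intro mult_right_mono) (auto simp: k_def)
      then have "(\<forall>v<n. card (component {..<n} (H1 \<union> H2) v) < (M.rho t - \<kappa>) * n) \<longrightarrow>
         (\<forall>v<n. card (component {..<n} (H1 \<union> H2) v) < (M.beta t r - k - 3 * k) * n)"
        by (meson less_le_trans)
      then show "(of_bool (\<forall>v<n. card (component {..<n} (H1 \<union> H2) v) < (M.rho t - \<kappa>) * n) :: real) \<le>
         of_bool (\<forall>v<n. card (component {..<n} (H1 \<union> H2) v) < (M.beta t r - k - 3 * k) * n)"
        by (simp only: of_bool_def split: if_split) auto
    qed
    also have "\<dots> \<le> (sqrt (varc t r) + biasc t r) / (sqrt n * k) + e * t / k
      + 2 powr (n / Suc r) * exp (- d * (k / 3)\<^sup>2 * n)"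
      unfolding kept_graph_kept[OF G, symmetric]
    proof (rule K.prob_no_giant[OF r(1) k err finB])
      fix u v assume uv: "u \<in> K.L J" "v \<in> K.L J" "u \<noteq> v"
      then have "R (slotn n t) u v" using K.giant[of J] by (auto simp: giant_like_def K.L_def K.slot_def sJ[symmetric])
      then show "d / n \<le> rate n * card (B \<inter> ebetween u v)" using rB uv K.L_sub[of J] by auto
    qed (use pos in simp)
    also have "2 powr (n / Suc r) * exp (- d * (k / 3)\<^sup>2 * n) \<le> \<eta> / 3"
    proof -
      have "2 powr (n / Suc r) * exp (- d * (k / 3)\<^sup>2 * n) = exp (n * (ln 2 / Suc r) - c * n)"
      proof -
        have "2 powr (n / Suc r) = exp (n * (ln 2 / Suc r))" by (simp add: powr_def)
        moreover have "- d * (k / 3)\<^sup>2 * n = - (c * n)" by (simp add: c_def)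
        ultimately show ?thesis by (simp only: exp_add[symmetric] add_uminus_conv_diff)
      qed
      also have "\<dots> \<le> exp (n * (c / 2) - c * n)"
        using r(2) by (simp only: exp_le_cancel_iff) (intro diff_right_mono mult_left_mono, auto)
      also have "n * (c / 2) - c * n = - (c / 2) * n" by (simp add: field_simps)
      finally show ?thesis using x by simp
    qed
    also have "(sqrt (varc t r) + biasc t r) / (sqrt n * k) \<le> \<eta> / 3" using b by (simp add: mult.commute)
    also note et
    finally show "K.rex (kept_set n t R) (\<lambda>H1. K.rex B (\<lambda>H2. of_bool
      (\<forall>v<n. card (component {..<n} (H1 \<union> H2) v) < (M.rho t - \<kappa>) * n))) \<le> \<eta>" by simp
  qed
  then show ?thesis using Je by blast
qed

lemma kept_set_split:
  assumes "0 \<le> t1" "t1 \<le> t" "0 < n"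
  shows "kept_set n t R = kept_set n t1 R \<union> (kept_set n t R - kept_set n t1 R)"
proof -
  have "slotn n t1 \<le> slotn n t"
    unfolding slotn_def mesh_def using assms by (intro nat_mono floor_mono divide_right_mono) auto
  then have "kept_set n t1 R \<subseteq> kept_set n t R" by (auto simp: kept_set_def slots_def)
  then show ?thesis by auto
qed

text \<open>By left continuity there is t1 < t with \<rho> t1 close to \<rho> t. The graph is
  analysed up to t1, and the arrivals between t1 and t are the sprinkling: pairs related at t1 stay
  related, so each retains a rate of order (t - t1)/n.\<close>

lemma eventually_lower:
  fixes t \<kappa> \<eta> :: real
  assumes M: "real_distribution M" and t: "0 \<le> t" and pos: "0 < \<kappa>" "0 < \<eta>"
  shows "\<exists>J e t1. 0 < J \<and> 0 < e \<and> 0 \<le> t1 \<and> t1 \<le> t \<and> (\<forall>\<^sub>F n in sequentially. \<forall>R.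
    kept_graph (mesh n) t1 e n J R M (rate n) \<longrightarrow>
    random_subset.rex (rate n) (kept_set n t R) (\<lambda>H. of_bool
      (\<forall>v<n. card (component {..<n} H v) < (real_distribution.rho M t - \<kappa>) * n)) \<le> \<eta>)"
proof -
  interpret M: real_distribution M by (rule M)
  show ?thesis
  proof (cases "M.rho t = 0")
    \<comment> \<open>The threshold is negative then and no component can be smaller, so arbitrary
      witnesses do.\<close>
    case True
    have "\<forall>\<^sub>F n in sequentially. \<forall>R. kept_graph (mesh n) 0 1 n 1 R M (rate n) \<longrightarrow>
      random_subset.rex (rate n) (kept_set n t R) (\<lambda>H. of_bool
        (\<forall>v<n. card (component {..<n} H v) < (M.rho t - \<kappa>) * n)) \<le> \<eta>"
      using eventually_gt_at_top[of 0]
    proof (eventually_elim, intro allI impI)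
      fix n :: nat and R assume n: "0 < n"
      interpret random_subset "rate n" by (rule random_subset_rate)
      have no: "\<not> (\<forall>v<n. card (component {..<n} H v) < (M.rho t - \<kappa>) * n)" for H
      proof
        assume "\<forall>v<n. card (component {..<n} H v) < (M.rho t - \<kappa>) * n"
        then have "real (card (component {..<n} H 0)) < (M.rho t - \<kappa>) * n" using n by blast
        moreover have "(M.rho t - \<kappa>) * n \<le> 0" using True pos by (simp add: mult_nonpos_nonneg)
        ultimately show False by linarith
      qed
      have "rex (kept_set n t R) (\<lambda>H. of_bool (\<forall>v<n. card (component {..<n} H v) < (M.rho t - \<kappa>) * n))
          = rex (kept_set n t R) (\<lambda>H. 0)"
        by (rule rex_cong) (simp only: no of_bool_eq)
      then show "rex (kept_set n t R) (\<lambda>H. of_bool (\<forall>v<n. card (component {..<n} H v) < (M.rho t - \<kappa>) * n)) \<le> \<eta>"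
        using pos by (simp add: finite_kept_set)
    qed
    then show ?thesis using t by (intro exI[of _ 1] exI[of _ 1] exI[of _ 0]) auto
  next
    case False
    have t0: "0 < t" using False M.rho_zero[of t] by (cases "t \<le> 0") auto
    have k2: "0 < \<kappa> / 2" using pos by simp
    obtain \<delta> where \<delta>: "0 < \<delta>" "\<And>s. t - \<delta> < s \<Longrightarrow> s \<le> t \<Longrightarrow> M.rho t - \<kappa> / 2 \<le> M.rho s"
      using M.rho_left[OF k2, of t] by blast
    define t1 where "t1 = max 0 (t - \<delta> / 2)"
    have t1: "0 \<le> t1" "t1 < t" "t - \<delta> < t1" using t0 \<delta>(1) by (auto simp: t1_def)
    \<comment> \<open>Only half of the interval, so that the slot lost to rounding is absorbed once
      \<open>mesh n < d\<close>.\<close>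
    define d where "d = (t - t1) / 2"
    have d: "0 < d" using t1 by (simp add: d_def)
    have rho1: "M.rho t - \<kappa> \<le> M.rho t1 - \<kappa> / 2" using \<delta>(2)[of t1] t1 by simp
    obtain J e where Je: "0 < J" "0 < e" and ev: "\<forall>\<^sub>F n in sequentially. \<forall>R B. kept_graph (mesh n) t1 e n J R M (rate n) \<longrightarrow>
      finite B \<longrightarrow>
      (\<forall>u v. R (slotn n t1) u v \<longrightarrow> u < n \<longrightarrow> v < n \<longrightarrow> u \<noteq> v \<longrightarrow> d / n \<le> rate n * card (B \<inter> ebetween u v)) \<longrightarrow>
      random_subset.rex (rate n) (kept_set n t1 R) (\<lambda>H1. random_subset.rex (rate n) B (\<lambda>H2. of_bool
        (\<forall>v<n. card (component {..<n} (H1 \<union> H2) v) < (M.rho t1 - \<kappa> / 2) * n))) \<le> \<eta>"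
      using eventually_sprinkled[OF M t1(1) k2 pos(2) d] by blast
    have "\<forall>\<^sub>F n in sequentially. mesh n < d"
      using mesh_tendsto d by (rule order_tendstoD)
    with ev have "\<forall>\<^sub>F n in sequentially. \<forall>R. kept_graph (mesh n) t1 e n J R M (rate n) \<longrightarrow>
      random_subset.rex (rate n) (kept_set n t R) (\<lambda>H. of_bool
        (\<forall>v<n. card (component {..<n} H v) < (M.rho t - \<kappa>) * n)) \<le> \<eta>"
      using eventually_gt_at_top[of 0]
    proof (eventually_elim, intro allI impI)
      fix n :: nat and R
      assume a: "\<forall>R B. kept_graph (mesh n) t1 e n J R M (rate n) \<longrightarrow>
      finite B \<longrightarrow>
      (\<forall>u v. R (slotn n t1) u v \<longrightarrow> u < n \<longrightarrow> v < n \<longrightarrow> u \<noteq> v \<longrightarrow> d / n \<le> rate n * card (B \<inter> ebetween u v)) \<longrightarrow>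
      random_subset.rex (rate n) (kept_set n t1 R) (\<lambda>H1. random_subset.rex (rate n) B (\<lambda>H2. of_bool
        (\<forall>v<n. card (component {..<n} (H1 \<union> H2) v) < (M.rho t1 - \<kappa> / 2) * n))) \<le> \<eta>"
        and md: "mesh n < d" and n: "0 < n" and G: "kept_graph (mesh n) t1 e n J R M (rate n)"
      interpret K: kept_graph "mesh n" t1 e n J R M "rate n" by (rule G)
      define B where "B = kept_set n t R - kept_set n t1 R"
      have finB: "finite B" unfolding B_def using finite_kept_set by blast
      have hpos: "0 < mesh n" by (rule K.h)
      have rB: "d / n \<le> rate n * card (B \<inter> ebetween u v)"
        if uv: "R (slotn n t1) u v" "u < n" "v < n" "u \<noteq> v" for u v
      proof -
        have "Pair (min u v, max u v) ` {slotn n t1..<slotn n t} \<subseteq> B \<inter> ebetween u v"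
        proof
          fix x assume "x \<in> Pair (min u v, max u v) ` {slotn n t1..<slotn n t}"
          then obtain l where l: "slotn n t1 \<le> l" "l < slotn n t" "x = ((min u v, max u v), l)" by auto
          have "R l u v" using K.R_mono[OF l(1)] uv by blast
          then have "R l (min u v) (max u v)" using K.R_sym by (auto simp: min_def max_def)
          then show "x \<in> B \<inter> ebetween u v"
            using l uv by (auto simp: B_def kept_set_def slots_def ebetween_def min_def max_def)
        qed
        then have "card (Pair (min u v, max u v) ` {slotn n t1..<slotn n t}) \<le> card (B \<inter> ebetween u v)"
          using finB by (intro card_mono) auto
        then have "slotn n t - slotn n t1 \<le> card (B \<inter> ebetween u v)"
          by (simp add: card_image inj_on_def)
        moreover have "t / mesh n - 1 - t1 / mesh n \<le> real (slotn n t) - real (slotn n t1)"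
        proof -
          have "0 \<le> t / mesh n" "0 \<le> t1 / mesh n" using hpos t t1 by auto
          then show ?thesis unfolding slotn_def by linarith
        qed
        ultimately have "t / mesh n - 1 - t1 / mesh n \<le> card (B \<inter> ebetween u v)" by linarith
        then have "rate n * (t / mesh n - 1 - t1 / mesh n) \<le> rate n * card (B \<inter> ebetween u v)"
          using K.theta_nonneg by (rule mult_left_mono)
        moreover have "rate n * (t / mesh n - 1 - t1 / mesh n) = (t - mesh n - t1) / n"
          unfolding rate_def using hpos by (simp add: right_diff_distrib diff_divide_distrib)
        moreover have "d / n \<le> (t - mesh n - t1) / n"
          using md by (intro divide_right_mono) (auto simp: d_def field_simps)
        ultimately show ?thesis by linarith
      qed
      have "K.rex (kept_set n t R) (\<lambda>H. of_bool (\<forall>v<n. card (component {..<n} H v) < (M.rho t - \<kappa>) * n))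
          \<le> K.rex (kept_set n t R) (\<lambda>H. of_bool (\<forall>v<n. card (component {..<n} H v) < (M.rho t1 - \<kappa> / 2) * n))"
      proof (rule K.rex_mono)
        fix H
        have "(M.rho t - \<kappa>) * n \<le> (M.rho t1 - \<kappa> / 2) * n" using rho1 by (intro mult_right_mono) auto
        then have "(\<forall>v<n. card (component {..<n} H v) < (M.rho t - \<kappa>) * n) \<longrightarrow>
          (\<forall>v<n. card (component {..<n} H v) < (M.rho t1 - \<kappa> / 2) * n)"
          by (meson less_le_trans)
        then show "(of_bool (\<forall>v<n. card (component {..<n} H v) < (M.rho t - \<kappa>) * n) :: real)
          \<le> of_bool (\<forall>v<n. card (component {..<n} H v) < (M.rho t1 - \<kappa> / 2) * n)"
          by (simp only: of_bool_def split: if_split) auto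
      qed
      also have "\<dots> = K.rex (kept_set n t1 R) (\<lambda>H1. K.rex B (\<lambda>H2. of_bool
        (\<forall>v<n. card (component {..<n} (H1 \<union> H2) v) < (M.rho t1 - \<kappa> / 2) * n)))"
      proof -
        have split: "kept_set n t R = kept_set n t1 R \<union> B"
          unfolding B_def by (rule kept_set_split) (use t1 n in auto)
        have "kept_set n t1 R \<inter> B = {}" by (auto simp: B_def)
        then show ?thesis unfolding split by (intro K.rex_Un finite_kept_set finB)
      qed
      also have "\<dots> \<le> \<eta>"
        using a[rule_format, OF G finB] rB by blast
      finally show "K.rex (kept_set n t R) (\<lambda>H. of_bool
        (\<forall>v<n. card (component {..<n} H v) < (M.rho t - \<kappa>) * n)) \<le> \<eta>" .
    qed
    then show ?thesis using Je t1 by (intro exI[of _ J] exI[of _ e] exI[of _ t1]) auto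
  qed
qed

lemma evolves_eventually_grid:
  assumes ev: "evolves k \<rho>" and t: "0 \<le> t" and J: "0 < J" and e: "0 < e" and \<eta>: "0 < \<eta>"
  shows "\<forall>\<^sub>F n in sequentially. \<forall>N. (\<forall>m\<le>J. slotn n (real m * t / real J) \<le> N) \<longrightarrow>
    random_subset.rex (rate n) (slots n N) (\<lambda>S. of_bool (\<not> (\<forall>m\<le>J. giant_like e n (\<rho> (real m * t / real J))
      (level k S (slotn n (real m * t / real J)))))) \<le> \<eta>"
proof -
  have "\<forall>\<^sub>F n in sequentially. \<forall>m\<in>{..J}. \<forall>N\<ge>slotn n (real m * t / real J).
     random_subset.rex (rate n) (slots n N)
       (\<lambda>S. of_bool (\<not> giant_like e n (\<rho> (real m * t / real J)) (level k S (slotn n (real m * t / real J)))))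
         \<le> \<eta> / (J + 1)"
    using ev e \<eta> t unfolding evolves_def by (intro eventually_ball_finite ballI) auto
  then show ?thesis
  proof (eventually_elim, intro allI impI)
    fix n N
    assume a: "\<forall>m\<in>{..J}. \<forall>N\<ge>slotn n (real m * t / real J).
     random_subset.rex (rate n) (slots n N)
       (\<lambda>S. of_bool (\<not> giant_like e n (\<rho> (real m * t / real J)) (level k S (slotn n (real m * t / real J)))))
         \<le> \<eta> / (J + 1)"
      and N: "\<forall>m\<le>J. slotn n (real m * t / real J) \<le> N"
    interpret random_subset "rate n" by (rule random_subset_rate)
    let ?g = "\<lambda>m S. giant_like e n (\<rho> (real m * t / real J)) (level k S (slotn n (real m * t / real J)))"
    have "rex (slots n N) (\<lambda>S. of_bool (\<not> (\<forall>m\<le>J. ?g m S))) \<le> rex (slots n N) (\<lambda>S. \<Sum>m\<le>J. of_bool (\<not> ?g m S))"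
    proof (rule rex_mono)
      fix S
      show "of_bool (\<not> (\<forall>m\<le>J. ?g m S)) \<le> (\<Sum>m\<le>J. of_bool (\<not> ?g m S) :: real)"
      proof (cases "\<forall>m\<le>J. ?g m S")
        case True
        have "0 \<le> (\<Sum>m\<le>J. of_bool (\<not> ?g m S) :: real)" by (intro sum_nonneg) simp
        moreover have "of_bool (\<not> (\<forall>m\<le>J. ?g m S)) = (0 :: real)" using True by simp
        ultimately show ?thesis by linarith
      next
        case False
        then obtain m where m: "m \<le> J" "\<not> ?g m S" by auto
        have "of_bool (\<not> ?g m S) \<le> (\<Sum>m\<le>J. of_bool (\<not> ?g m S) :: real)"
          using m by (intro member_le_sum) auto
        then show ?thesis using m by simp
      qed
    qed
    also have "\<dots> = (\<Sum>m\<le>J. rex (slots n N) (\<lambda>S. of_bool (\<not> ?g m S)))" by (rule rex_sum)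
    also have "\<dots> \<le> (\<Sum>m\<le>J. \<eta> / (J + 1))" using a N by (intro sum_mono) auto
    also have "\<dots> = \<eta>" by simp
    finally show "rex (slots n N) (\<lambda>S. of_bool (\<not> (\<forall>m\<le>J. ?g m S))) \<le> \<eta>" .
  qed
qed

lemma slotn_mono: "0 < n \<Longrightarrow> s \<le> t \<Longrightarrow> slotn n s \<le> slotn n t"
  unfolding slotn_def mesh_def by (intro nat_mono floor_mono divide_right_mono) auto

lemma kept_graph_level:
  assumes "real_distribution M" "0 < n" "0 \<le> t" "0 < J" "0 < e"
    and "\<And>m. m \<le> J \<Longrightarrow> giant_like e n (cdf M (real m * t / real J)) (level k S (slotn n (real m * t / real J)))"
  shows "kept_graph (mesh n) t e n J (level k S) M (rate n)"
proof -
  have "0 < mesh n" using assms by (simp add: mesh_def)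
  then show ?thesis
  proof (intro kept_graph.intro related_slots.intro kept_graph_axioms.intro)
    show "level k S l' i j" if "l \<le> l'" "level k S l i j" for l l' i j
      using that by (rule level_mono)
    show "giant_like e n (cdf M (real m * t / real J)) (level k S (nat \<lfloor>real m * t / real J / mesh n\<rfloor>))"
      if "m \<le> J" for m
      using assms(6)[OF that] by (simp only: slotn_def)
  qed (use assms equivp_level random_subset_rate in \<open>simp_all add: rate_def\<close>)
qed

text \<open>\<open>rex_active\<close> replaces the arrivals of layer k + 1 by a fresh sample given
  layer \<open>k\<close>. On the event that layer \<open>k\<close> is close to its limit on two
  grids, up to \<open>t\<close> for the upper and up to t1 for the lower bound,
  \<open>giant_likeI\<close> combines the two bounds, each with error \<epsilon>/3.\<close>

lemma evolves_Suc:
  assumes M: "real_distribution M" and ev: "evolves k (cdf M)"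
  shows "evolves (Suc k) (real_distribution.rho M)"
  unfolding evolves_def
proof (intro allI impI)
  fix t \<epsilon> \<eta> :: real assume t: "0 \<le> t" and eps: "0 < \<epsilon>" and eta: "0 < \<eta>"
  interpret M: real_distribution M by (rule M)
  let ?c = "\<epsilon> / 3"
  have h: "0 < ?c" "0 < \<eta> / 4" using eps eta by auto
  obtain J e where J: "0 < J" "0 < e" and up: "\<forall>\<^sub>F n in sequentially. \<forall>R. kept_graph (mesh n) t e n J R M (rate n) \<longrightarrow>
    random_subset.rex (rate n) (kept_set n t R)
      (\<lambda>H. of_bool ((M.rho t + ?c) * n < card (bigset \<epsilon> n (connected_in H)))) \<le> \<eta> / 4"
    using eventually_upper[OF M t eps h] by blast
  obtain J1 e1 t1 where J1: "0 < J1" "0 < e1" "0 \<le> t1" "t1 \<le> t" and low: "\<forall>\<^sub>F n in sequentially. \<forall>R.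
    kept_graph (mesh n) t1 e1 n J1 R M (rate n) \<longrightarrow>
    random_subset.rex (rate n) (kept_set n t R) (\<lambda>H. of_bool
      (\<forall>v<n. card (component {..<n} H v) < (M.rho t - ?c) * n)) \<le> \<eta> / 4"
    using eventually_lower[OF M t h] by blast
  show "\<forall>\<^sub>F n in sequentially. \<forall>N\<ge>slotn n t. random_subset.rex (rate n) (slots n N)
       (\<lambda>S. of_bool (\<not> giant_like \<epsilon> n (M.rho t) (level (Suc k) S (slotn n t)))) \<le> \<eta>"
    using up low evolves_eventually_grid[OF ev t J h(2)] evolves_eventually_grid[OF ev J1(3,1,2) h(2)]
      eventually_gt_at_top[of 0]
  proof (eventually_elim, intro allI impI)
    fix n N
    assume up: "\<forall>R. kept_graph (mesh n) t e n J R M (rate n) \<longrightarrow>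
        random_subset.rex (rate n) (kept_set n t R)
          (\<lambda>H. of_bool ((M.rho t + ?c) * n < card (bigset \<epsilon> n (connected_in H)))) \<le> \<eta> / 4"
      and low: "\<forall>R. kept_graph (mesh n) t1 e1 n J1 R M (rate n) \<longrightarrow>
        random_subset.rex (rate n) (kept_set n t R) (\<lambda>H. of_bool
          (\<forall>v<n. card (component {..<n} H v) < (M.rho t - ?c) * n)) \<le> \<eta> / 4"
      and g: "\<forall>N. (\<forall>m\<le>J. slotn n (real m * t / real J) \<le> N) \<longrightarrow>
        random_subset.rex (rate n) (slots n N) (\<lambda>S. of_bool (\<not> (\<forall>m\<le>J. giant_like e n (cdf M (real m * t / real J))
          (level k S (slotn n (real m * t / real J)))))) \<le> \<eta> / 4"
      and g1: "\<forall>N. (\<forall>m\<le>J1. slotn n (real m * t1 / real J1) \<le> N) \<longrightarrow>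
        random_subset.rex (rate n) (slots n N) (\<lambda>S. of_bool (\<not> (\<forall>m\<le>J1. giant_like e1 n (cdf M (real m * t1 / real J1))
          (level k S (slotn n (real m * t1 / real J1)))))) \<le> \<eta> / 4"
      and n: "0 < n" and N: "slotn n t \<le> N"
    interpret random_subset "rate n" by (rule random_subset_rate)
    let ?I = "slots n N"
    define A where "A S \<longleftrightarrow> (\<forall>m\<le>J. giant_like e n (cdf M (real m * t / real J))
          (level k S (slotn n (real m * t / real J))))" for S
    define A1 where "A1 S \<longleftrightarrow> (\<forall>m\<le>J1. giant_like e1 n (cdf M (real m * t1 / real J1))
          (level k S (slotn n (real m * t1 / real J1))))" for S
    have frac: "real m * s / real K \<le> s" if "m \<le> K" "0 < K" "0 \<le> s" for m K :: nat and s :: real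
      using that by (simp add: divide_le_eq mult.commute mult_left_mono)
    have pA: "rex ?I (\<lambda>S. of_bool (\<not> A S)) \<le> \<eta> / 4"
    proof -
      have "slotn n (real m * t / real J) \<le> N" if "m \<le> J" for m
        using slotn_mono[OF n frac[OF that J(1) t]] N by simp
      then show ?thesis using g unfolding A_def by blast
    qed
    have pA1: "rex ?I (\<lambda>S. of_bool (\<not> A1 S)) \<le> \<eta> / 4"
    proof -
      have "slotn n (real m * t1 / real J1) \<le> N" if "m \<le> J1" for m
        using slotn_mono[OF n order_trans[OF frac[OF that J1(1,3)] J1(4)]] N by simp
      then show ?thesis using g1 unfolding A1_def by blast
    qed
    define F where "F T = (of_bool (\<not> giant_like \<epsilon> n (M.rho t)
        (connected_in {e \<in> T. snd e < slotn n t})) :: real)" for T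
    have inner: "rex (?I \<inter> active k S) F \<le> \<eta> / 2" if S: "A S" "A1 S" for S
    proof -
      have K: "kept_graph (mesh n) t e n J (level k S) M (rate n)"
        using S(1) by (intro kept_graph_level M n t J) (auto simp: A_def)
      have K1: "kept_graph (mesh n) t1 e1 n J1 (level k S) M (rate n)"
        using S(2) by (intro kept_graph_level M n J1) (auto simp: A1_def)
      let ?K = "kept_set n t (level k S)"
      have sub: "?K \<subseteq> ?I \<inter> active k S" using N by (auto simp: kept_set_def slots_def active_def)
      have "rex (?I \<inter> active k S) F = rex (?I \<inter> active k S)
          (\<lambda>T. of_bool (\<not> giant_like \<epsilon> n (M.rho t) (connected_in (T \<inter> ?K))))"
      proof (rule rex_cong)
        fix T assume "T \<subseteq> ?I \<inter> active k S"
        then have "{e \<in> T. snd e < slotn n t} = T \<inter> ?K"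
          by (auto simp: kept_set_def slots_def active_def)
        then show "F T = of_bool (\<not> giant_like \<epsilon> n (M.rho t) (connected_in (T \<inter> ?K)))"
          by (simp add: F_def)
      qed
      also have "\<dots> = rex ?K (\<lambda>H. of_bool (\<not> giant_like \<epsilon> n (M.rho t) (connected_in H)))"
        by (rule rex_restrict[OF _ sub]) (use finite_slots in blast)
      also have "\<dots> \<le> rex ?K (\<lambda>H. of_bool ((M.rho t + ?c) * n < card (bigset \<epsilon> n (connected_in H)))
          + of_bool (\<forall>v<n. card (component {..<n} H v) < (M.rho t - ?c) * n))"
      proof (rule rex_mono)
        fix H
        have "giant_like \<epsilon> n (M.rho t) (connected_in H)"
          if a: "\<not> (M.rho t + ?c) * n < card (bigset \<epsilon> n (connected_in H))"
            and b: "\<not> (\<forall>v<n. card (component {..<n} H v) < (M.rho t - ?c) * n)"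
        proof -
          obtain v where v: "v < n" "(M.rho t - ?c) * n \<le> card (component {..<n} H v)"
            using b by (auto simp: not_less)
          show ?thesis
            by (rule giant_likeI[OF equivp_connected_in n _ v(1), where r = "M.rho t" and a = ?c and b = ?c])
              (use a v(2) eps in \<open>auto simp: component_def\<close>)
        qed
        then show "of_bool (\<not> giant_like \<epsilon> n (M.rho t) (connected_in H))
          \<le> of_bool ((M.rho t + ?c) * n < card (bigset \<epsilon> n (connected_in H)))
          + (of_bool (\<forall>v<n. card (component {..<n} H v) < (M.rho t - ?c) * n) :: real)"
          by (simp only: of_bool_def split: if_split) auto
      qed
      also have "\<dots> \<le> \<eta> / 4 + \<eta> / 4"
        unfolding rex_add using up low K K1 by (intro add_mono) blast+
      finally show ?thesis by simp
    qed
    have lev: "level (Suc k) S (slotn n t) = connected_in {e \<in> S \<inter> active k S. snd e < slotn n t}" for S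
      by (rule level_Suc)
    have "rex ?I (\<lambda>S. of_bool (\<not> giant_like \<epsilon> n (M.rho t) (level (Suc k) S (slotn n t))))
        = rex ?I (\<lambda>S. F (S \<inter> active k S))"
      unfolding lev F_def ..
    also have "\<dots> = rex ?I (\<lambda>S. rex (?I \<inter> active k S) F)" by (rule rex_active[OF finite_slots])
    also have "\<dots> \<le> rex ?I (\<lambda>S. of_bool (\<not> A S) + of_bool (\<not> A1 S) + \<eta> / 2)"
    proof (rule rex_mono)
      fix S
      have "finite (?I \<inter> active k S)" using finite_slots by blast
      then have "rex (?I \<inter> active k S) F \<le> 1" by (rule rex_le_const) (simp add: F_def)
      then show "rex (?I \<inter> active k S) F \<le> of_bool (\<not> A S) + of_bool (\<not> A1 S) + \<eta> / 2"
        using inner[of S] eta by (cases "A S"; cases "A1 S") auto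
    qed
    also have "\<dots> \<le> \<eta> / 4 + \<eta> / 4 + \<eta> / 2"
      unfolding rex_add rex_const[OF finite_slots] by (intro add_mono pA pA1 order_refl)
    finally show "rex ?I (\<lambda>S. of_bool (\<not> giant_like \<epsilon> n (M.rho t) (level (Suc k) S (slotn n t)))) \<le> \<eta>"
      by simp
  qed
qed

lemma evolves_0:
  assumes "\<And>t. 0 \<le> t \<Longrightarrow> \<rho> t = 1"
  shows "evolves 0 \<rho>"
  unfolding evolves_def
proof (intro allI impI)
  fix t \<epsilon> \<eta> :: real assume t: "0 \<le> t" and eps: "0 < \<epsilon>" and eta: "0 < \<eta>"
  show "\<forall>\<^sub>F n in sequentially. \<forall>N\<ge>slotn n t. random_subset.rex (rate n) (slots n N)
       (\<lambda>S. of_bool (\<not> giant_like \<epsilon> n (\<rho> t) (level 0 S (slotn n t)))) \<le> \<eta>"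
    using eventually_gt_at_top[of 0]
  proof (eventually_elim, intro allI impI)
    fix n N :: nat assume n: "0 < n"
    interpret random_subset "rate n" by (rule random_subset_rate)
    have "giant_like \<epsilon> n (\<rho> t) (level 0 S (slotn n t))" for S
    proof -
      \<comment> \<open>For \<epsilon> \<ge> 1 no class is large, and the tolerance 2 \<epsilon>
        covers the distance from 0 to 1.\<close>
      have b: "bigset \<epsilon> n (\<lambda>i j. True) = (if \<epsilon> < 1 then {..<n} else {})"
        using n by (auto simp: bigset_def)
      show ?thesis unfolding giant_like_def level.simps b using assms[OF t] n eps by auto
    qed
    then show "rex (slots n N) (\<lambda>S. of_bool (\<not> giant_like \<epsilon> n (\<rho> t) (level 0 S (slotn n t)))) \<le> \<eta>"
      using eta by (simp add: finite_slots)
  qed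
qed

section \<open>Coupling with the Poisson model\<close>

text \<open>A configuration \<open>S\<close> of occupied slots is realised by the event that the waiting times of
  every pair, rounded up to multiples of the mesh, are the gaps between its occupied slots. Rounded
  exponential variables are geometric, so the configuration is a Bernoulli random subset.\<close>

definition occ :: "edge set \<Rightarrow> nat \<times> nat \<Rightarrow> nat set" where
  "occ S p = {l. (p, l) \<in> S}"

definition nthslot :: "edge set \<Rightarrow> nat \<times> nat \<Rightarrow> nat \<Rightarrow> nat" where
  "nthslot S p m = sorted_list_of_set (occ S p) ! m"

text \<open>The first slot still available for arrival \<open>m\<close>. A positive waiting time is
  rounded up to at least one slot, so a pair has at most one arrival per slot.\<close>

definition prevslot :: "edge set \<Rightarrow> nat \<times> nat \<Rightarrow> nat \<Rightarrow> nat" where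
  "prevslot S p m = (case m of 0 \<Rightarrow> 0 | Suc m' \<Rightarrow> Suc (nthslot S p m'))"

definition pairs :: "nat \<Rightarrow> (nat \<times> nat) set" where
  "pairs n = {p. fst p < snd p \<and> snd p < n}"

text \<open>The coordinate after the last occupied slot carries a one-sided condition: the next
  arrival falls beyond the horizon \<open>N\<close>.\<close>

definition gap_event :: "nat \<Rightarrow> nat \<Rightarrow> edge set \<Rightarrow> edge \<Rightarrow> real set" where
  "gap_event n N S e = (let p = fst e; m = snd e in
     if m < card (occ S p)
     then {mesh n * (real (nthslot S p m) - prevslot S p m) <.. mesh n * (real (Suc (nthslot S p m)) - prevslot S p m)}
     else {mesh n * (real N - prevslot S p m) <..})"

definition coords :: "nat \<Rightarrow> edge set \<Rightarrow> edge set" where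
  "coords n S = (SIGMA p:pairs n. {..card (occ S p)})"

definition gapbox :: "nat \<Rightarrow> nat \<Rightarrow> edge set \<Rightarrow> (edge \<Rightarrow> real) set" where
  "gapbox n N S = {\<omega>. \<forall>e\<in>coords n S. \<omega> e \<in> gap_event n N S e}"

lemma finite_pairs: "finite (pairs n)"
  by (rule finite_subset[of _ "{..<n} \<times> {..<n}"]) (auto simp: pairs_def)

lemma slots_eq: "slots n N = pairs n \<times> {..<N}"
  by (auto simp: slots_def pairs_def)

lemma finite_coords: "finite (coords n S)"
  unfolding coords_def by (intro finite_SigmaI finite_pairs) auto

lemma occ_sub: "S \<subseteq> slots n N \<Longrightarrow> occ S p \<subseteq> {..<N}"
  by (auto simp: occ_def slots_def)

lemma finite_occ: "S \<subseteq> slots n N \<Longrightarrow> finite (occ S p)"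
  using finite_subset[OF occ_sub] by simp

lemma nthslot_mem:
  assumes "S \<subseteq> slots n N" "m < card (occ S p)"
  shows "nthslot S p m \<in> occ S p"
  using assms finite_occ[OF assms(1), of p] nth_mem[of m "sorted_list_of_set (occ S p)"]
  by (simp add: nthslot_def)

lemma nthslot_lt: "S \<subseteq> slots n N \<Longrightarrow> m < card (occ S p) \<Longrightarrow> nthslot S p m < N"
  using nthslot_mem[of S n N m p] occ_sub[of S n N p] by auto

lemma nthslot_strict:
  assumes "S \<subseteq> slots n N" "m < m'" "m' < card (occ S p)"
  shows "nthslot S p m < nthslot S p m'"
  using assms strict_sorted_list_of_set[of "occ S p"] finite_occ[OF assms(1), of p]
  by (simp add: nthslot_def sorted_wrt_nth_less)

lemma nthslot_surj:
  assumes "S \<subseteq> slots n N" "l \<in> occ S p"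
  obtains m where "m < card (occ S p)" "nthslot S p m = l"
proof -
  have "l \<in> set (sorted_list_of_set (occ S p))" using assms finite_occ[OF assms(1), of p] by simp
  then obtain m where "m < length (sorted_list_of_set (occ S p))" "sorted_list_of_set (occ S p) ! m = l"
    by (auto simp: in_set_conv_nth)
  then show ?thesis using that by (simp add: nthslot_def)
qed

lemma prevslot_le:
  assumes "S \<subseteq> slots n N" "m < card (occ S p)"
  shows "prevslot S p m \<le> nthslot S p m"
proof (cases m)
  case (Suc m')
  then show ?thesis using nthslot_strict[OF assms(1), of m' m p] assms by (simp add: prevslot_def)
qed (simp add: prevslot_def)

lemma prevslot_Suc [simp]: "prevslot S p (Suc m) = Suc (nthslot S p m)"
  by (simp add: prevslot_def)

lemma prevslot_0 [simp]: "prevslot S p 0 = 0"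
  by (simp add: prevslot_def)

lemma prevslot_le_N:
  assumes "S \<subseteq> slots n N" "m \<le> card (occ S p)"
  shows "prevslot S p m \<le> N"
proof (cases m)
  case (Suc m')
  then show ?thesis using nthslot_lt[OF assms(1), of m' p] assms by simp
qed simp

lemma prevslot_ge:
  assumes "S \<subseteq> slots n N" "m \<le> card (occ S p)"
  shows "m \<le> prevslot S p m"
  using assms(2)
proof (induction m)
  case (Suc m)
  then show ?case using prevslot_le[OF assms(1), of m p] by simp
qed simp

section \<open>Law of the rounded waiting times\<close>

definition expo :: "nat \<Rightarrow> real measure" where
  "expo n = density lborel (exponential_density (1 / real n))"

lemma prob_space_expo: "0 < n \<Longrightarrow> prob_space (expo n)"
  unfolding expo_def by (rule prob_space_exponential_density) simp

lemma measure_expo_greater: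
  assumes "0 < n" "0 \<le> a"
  shows "measure (expo n) {a<..} = exp (- a / n)"
proof -
  interpret prob_space "expo n" by (rule prob_space_expo[OF assms(1)])
  have "distributed (expo n) lborel (\<lambda>x. x) (exponential_density (1 / real n))"
    unfolding distributed_def expo_def using assms
    by (auto simp: distr_id2 exponential_density_nonneg)
  then have "prob {x \<in> space (expo n). a < x} = exp (- a * (1 / real n))"
    using assms by (intro exponential_distributedD_gt) auto
  moreover have "{x \<in> space (expo n). a < x} = {a<..}" by (auto simp: expo_def)
  ultimately show ?thesis by simp
qed

lemma sets_expo [simp, measurable_cong]: "sets (expo n) = sets borel"
  by (simp add: expo_def)

lemma measure_expo_Ioc:
  assumes "0 < n" "0 \<le> a" "a \<le> b"
  shows "measure (expo n) {a<..b} = exp (- a / n) - exp (- b / n)"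
proof -
  interpret prob_space "expo n" by (rule prob_space_expo[OF assms(1)])
  have "{a<..b} = {a<..} - {b<..}" using assms by auto
  then have "prob {a<..b} = prob {a<..} - prob {b<..}"
    using assms finite_measure_Diff[of "{a<..}" "{b<..}"] by (simp add: subset_iff)
  then show ?thesis using assms by (simp add: measure_expo_greater)
qed

lemma measure_gap_event:
  assumes n: "0 < n" and S: "S \<subseteq> slots n N" and m: "m \<le> card (occ S p)"
  defines "q \<equiv> exp (- rate n)"
  shows "measure (expo n) (gap_event n N S (p, m)) =
    (if m < card (occ S p) then (1 - q) * q ^ (nthslot S p m - prevslot S p m) else q ^ (N - prevslot S p m))"
proof -
  have q: "exp (- (mesh n * real k) / n) = q ^ k" for k
  proof -
    have "- (mesh n * real k) / n = real k * (- rate n)" by (simp add: rate_def)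
    then show ?thesis unfolding q_def by (simp only: exp_of_nat_mult)
  qed
  have h: "0 < mesh n" using n by (simp add: mesh_def)
  show ?thesis
  proof (cases "m < card (occ S p)")
    case True
    let ?k = "nthslot S p m - prevslot S p m"
    have le: "prevslot S p m \<le> nthslot S p m" by (rule prevslot_le[OF S True])
    then have "gap_event n N S (p, m) = {mesh n * real ?k <.. mesh n * real (Suc ?k)}"
      using True by (simp add: gap_event_def of_nat_diff algebra_simps)
    then have "measure (expo n) (gap_event n N S (p, m)) = q ^ ?k - q ^ Suc ?k"
      using h by (simp only: measure_expo_Ioc[OF n] q mult_nonneg_nonneg less_imp_le of_nat_0_le_iff
        mult_left_mono of_nat_le_iff le_SucI order_refl)
    then show ?thesis using True by (simp add: algebra_simps)
  next
    case False
    then have "m = card (occ S p)" using m by simp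
    then have "prevslot S p m \<le> N" using prevslot_le_N[OF S] by simp
    then have "gap_event n N S (p, m) = {mesh n * real (N - prevslot S p m) <..}"
      using False by (simp add: gap_event_def of_nat_diff)
    then show ?thesis using h False
      by (simp only: measure_expo_greater[OF n] q mult_nonneg_nonneg less_imp_le of_nat_0_le_iff if_False)
  qed
qed

text \<open>The exponents telescope: the gaps and the final stretch together contain exactly the
  empty slots of the pair.\<close>

lemma prod_gap_events:
  assumes n: "0 < n" and S: "S \<subseteq> slots n N"
  defines "q \<equiv> exp (- rate n)"
  shows "(\<Prod>m\<le>card (occ S p). measure (expo n) (gap_event n N S (p, m)))
    = (1 - q) ^ card (occ S p) * q ^ (N - card (occ S p))"
proof -
  let ?k = "card (occ S p)"
  have pre: "(\<Prod>i<m. measure (expo n) (gap_event n N S (p, i))) = (1 - q) ^ m * q ^ (prevslot S p m - m)"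
    if "m \<le> ?k" for m
    using that
  proof (induction m)
    case (Suc m)
    have a: "prevslot S p m \<le> nthslot S p m" "m \<le> prevslot S p m"
      using prevslot_le[OF S, of m p] prevslot_ge[OF S, of m p] Suc.prems by auto
    have "(\<Prod>i<Suc m. measure (expo n) (gap_event n N S (p, i)))
        = (1 - q) ^ m * q ^ (prevslot S p m - m) * ((1 - q) * q ^ (nthslot S p m - prevslot S p m))"
      using Suc measure_gap_event[OF n S, of m p] by (simp add: q_def)
    also have "\<dots> = (1 - q) ^ Suc m * q ^ (prevslot S p m - m + (nthslot S p m - prevslot S p m))"
      by (simp add: power_add)
    also have "prevslot S p m - m + (nthslot S p m - prevslot S p m) = prevslot S p (Suc m) - Suc m"
      using a by simp
    finally show ?case .
  qed simp
  have b: "prevslot S p ?k \<le> N" "?k \<le> prevslot S p ?k"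
    using prevslot_le_N[OF S, of ?k p] prevslot_ge[OF S, of ?k p] by auto
  have "(\<Prod>m\<le>?k. measure (expo n) (gap_event n N S (p, m)))
      = (1 - q) ^ ?k * q ^ (prevslot S p ?k - ?k) * q ^ (N - prevslot S p ?k)"
    using pre[of ?k] measure_gap_event[OF n S, of ?k p]
    by (simp add: lessThan_Suc_atMost[symmetric] q_def)
  also have "\<dots> = (1 - q) ^ ?k * q ^ (prevslot S p ?k - ?k + (N - prevslot S p ?k))"
    by (simp add: power_add)
  also have "prevslot S p ?k - ?k + (N - prevslot S p ?k) = N - ?k" using b by simp
  finally show ?thesis .
qed

lemma poisson_model_eq: "poisson_model n = PiM UNIV (\<lambda>_. expo n)"
  by (simp add: poisson_model_def expo_def)

lemma space_poisson_model: "space (poisson_model n) = UNIV"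
  by (simp add: poisson_model_eq space_PiM expo_def PiE_def)

lemma prob_space_poisson_model: "0 < n \<Longrightarrow> prob_space (poisson_model n)"
  unfolding poisson_model_eq by (intro prob_space_PiM prob_space_expo)

lemma gap_event_borel [measurable]: "gap_event n N S e \<in> sets borel"
  by (simp add: gap_event_def Let_def)

lemma box_emb: "gapbox n N S = prod_emb UNIV (\<lambda>_. expo n) (coords n S) (Pi\<^sub>E (coords n S) (gap_event n N S))"
  by (auto simp: gapbox_def prod_emb_def PiE_def Pi_def extensional_def expo_def)

lemma box_sets: "gapbox n N S \<in> sets (poisson_model n)"
  unfolding box_emb poisson_model_eq using finite_coords by (intro sets_PiM_I) auto

lemma measure_box:
  assumes n: "0 < n" and S: "S \<subseteq> slots n N"
  shows "measure (poisson_model n) (gapbox n N S)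
    = (1 - exp (- rate n)) ^ card S * exp (- rate n) ^ card (slots n N - S)"
proof -
  let ?q = "exp (- rate n)"
  interpret product_prob_space "\<lambda>_::edge. expo n" UNIV
    by (intro product_prob_spaceI prob_space_expo n)
  have card_S: "card S = (\<Sum>p\<in>pairs n. card (occ S p))"
  proof -
    have "S = (SIGMA p:pairs n. occ S p)" using S by (auto simp: slots_eq occ_def)
    then show ?thesis using card_SigmaI[OF finite_pairs] finite_occ[OF S] by metis
  qed
  have le: "card (occ S p) \<le> N" for p
    using card_mono[OF _ occ_sub[OF S, of p]] by simp
  have fin: "finite S" using S finite_slots finite_subset by blast
  have card_C: "card (slots n N - S) = (\<Sum>p\<in>pairs n. N - card (occ S p))"
  proof -
    have "card (slots n N - S) = card (pairs n) * N - (\<Sum>p\<in>pairs n. card (occ S p))"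
      using fin S by (simp add: card_Diff_subset card_S slots_eq card_cartesian_product)
    also have "\<dots> = (\<Sum>p\<in>pairs n. N - card (occ S p))"
      using le by (simp add: sum_subtractf_nat)
    finally show ?thesis .
  qed
  have "measure (poisson_model n) (gapbox n N S) = (\<Prod>e\<in>coords n S. measure (expo n) (gap_event n N S e))"
    unfolding poisson_model_eq box_emb by (intro measure_PiM_emb finite_coords) auto
  also have "\<dots> = (\<Prod>p\<in>pairs n. \<Prod>m\<le>card (occ S p). measure (expo n) (gap_event n N S (p, m)))"
    unfolding coords_def by (subst prod.Sigma) (auto simp: finite_pairs case_prod_unfold)
  also have "\<dots> = (\<Prod>p\<in>pairs n. (1 - ?q) ^ card (occ S p) * ?q ^ (N - card (occ S p)))"
    by (intro prod.cong refl prod_gap_events n S)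
  also have "\<dots> = (1 - ?q) ^ card S * ?q ^ card (slots n N - S)"
    unfolding card_S card_C by (simp add: prod.distrib power_sum)
  finally show ?thesis .
qed

text \<open>Recovers the configuration from the waiting times; it serves to show that the boxes of
  different configurations are disjoint.\<close>

definition config :: "nat \<Rightarrow> nat \<Rightarrow> (edge \<Rightarrow> real) \<Rightarrow> edge set" where
  "config n N \<omega> = {e \<in> slots n N. \<exists>m. (\<Sum>i\<le>m. nat \<lceil>\<omega> (fst e, i) / mesh n\<rceil>) = Suc (snd e)}"

lemma config_box:
  assumes n: "0 < n" and S: "S \<subseteq> slots n N" and \<omega>: "\<omega> \<in> gapbox n N S"
  shows "config n N \<omega> = S"
proof -
  have h: "0 < mesh n" using n by (simp add: mesh_def)
  let ?c = "\<lambda>p i. nat \<lceil>\<omega> (p, i) / mesh n\<rceil>"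
  have c: "?c p m = Suc (nthslot S p m) - prevslot S p m" if p: "p \<in> pairs n" and m: "m < card (occ S p)" for p m
  proof -
    have "(p, m) \<in> coords n S" using p m by (simp add: coords_def)
    then have "\<omega> (p, m) \<in> gap_event n N S (p, m)" using \<omega> by (auto simp: gapbox_def)
    then have a: "mesh n * (real (nthslot S p m) - prevslot S p m) < \<omega> (p, m)"
      "\<omega> (p, m) \<le> mesh n * (real (Suc (nthslot S p m)) - prevslot S p m)"
      using m by (auto simp: gap_event_def)
    have le: "prevslot S p m \<le> nthslot S p m" by (rule prevslot_le[OF S m])
    have "\<lceil>\<omega> (p, m) / mesh n\<rceil> = int (Suc (nthslot S p m)) - int (prevslot S p m)"
      using a h by (intro ceiling_unique) (simp_all add: field_simps)
    then show ?thesis using le by simp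
  qed
  have part: "(\<Sum>i<m. ?c p i) = prevslot S p m" if "p \<in> pairs n" "m \<le> card (occ S p)" for p m
    using that(2)
  proof (induction m)
    case (Suc m)
    then show ?case using c[OF that(1), of m] prevslot_le[OF S, of m p] by simp
  qed simp
  have last: "Suc N - prevslot S p (card (occ S p)) \<le> ?c p (card (occ S p))" if p: "p \<in> pairs n" for p
  proof -
    let ?k = "card (occ S p)"
    have "(p, ?k) \<in> coords n S" using p by (simp add: coords_def)
    then have "\<omega> (p, ?k) \<in> gap_event n N S (p, ?k)" using \<omega> by (auto simp: gapbox_def)
    then have "mesh n * (real N - prevslot S p ?k) < \<omega> (p, ?k)" by (auto simp: gap_event_def)
    then have "real N - prevslot S p ?k < \<omega> (p, ?k) / mesh n" using h by (simp add: field_simps)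
    then have "int N - int (prevslot S p ?k) < \<lceil>\<omega> (p, ?k) / mesh n\<rceil>" by (simp add: less_ceiling_iff)
    then show ?thesis by linarith
  qed
  have iff: "(\<exists>m. (\<Sum>i\<le>m. ?c p i) = Suc l) \<longleftrightarrow> (p, l) \<in> S" if p: "p \<in> pairs n" and l: "l < N" for p l
  proof
    assume "(p, l) \<in> S"
    then obtain m where m: "m < card (occ S p)" "nthslot S p m = l"
      using nthslot_surj[OF S, of l p] by (auto simp: occ_def)
    then have "(\<Sum>i\<le>m. ?c p i) = Suc l"
      using part[OF p, of "Suc m"] by (simp add: lessThan_Suc_atMost[symmetric] del: sum.lessThan_Suc)
    then show "\<exists>m. (\<Sum>i\<le>m. ?c p i) = Suc l" by blast
  next
    assume "\<exists>m. (\<Sum>i\<le>m. ?c p i) = Suc l"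
    then obtain m where m: "(\<Sum>i\<le>m. ?c p i) = Suc l" by auto
    have "m < card (occ S p)"
    proof (rule ccontr)
      assume "\<not> m < card (occ S p)"
      then have "{..card (occ S p)} \<subseteq> {..m}" by auto
      then have "(\<Sum>i\<le>card (occ S p). ?c p i) \<le> (\<Sum>i\<le>m. ?c p i)" by (intro sum_mono2) auto
      moreover have "Suc N \<le> (\<Sum>i\<le>card (occ S p). ?c p i)"
        using part[OF p, of "card (occ S p)"] last[OF p] prevslot_le_N[OF S, of "card (occ S p)" p]
        by (simp add: lessThan_Suc_atMost[symmetric])
      ultimately show False using m l by simp
    qed
    then have "(\<Sum>i\<le>m. ?c p i) = Suc (nthslot S p m)" "nthslot S p m \<in> occ S p"
      using part[OF p, of "Suc m"] nthslot_mem[OF S]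
      by (simp_all add: lessThan_Suc_atMost[symmetric] del: sum.lessThan_Suc)
    then show "(p, l) \<in> S" using m by (simp add: occ_def)
  qed
  show ?thesis
  proof (rule set_eqI)
    fix e
    show "e \<in> config n N \<omega> \<longleftrightarrow> e \<in> S"
    proof (cases "e \<in> slots n N")
      case True
      then have "fst e \<in> pairs n" "snd e < N" by (auto simp: slots_eq)
      then show ?thesis using iff[of "fst e" "snd e"] True by (simp add: config_def)
    next
      case False
      then show ?thesis using S by (auto simp: config_def)
    qed
  qed
qed

text \<open>The event is the union of the disjoint boxes over all configurations with
  \<open>Q\<close>, cut down to positive waiting times. The cut costs no probability and makes the
  arrival times of each pair increase.\<close>

lemma ex_coupling_event:
  assumes n: "0 < n"
  shows "\<exists>B \<in> sets (poisson_model n).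
    measure (poisson_model n) B = random_subset.rex (rate n) (slots n N) (\<lambda>S. of_bool (Q S)) \<and>
    (\<forall>\<omega>\<in>B. (\<forall>e. 0 < \<omega> e) \<and> (\<exists>S\<subseteq>slots n N. Q S \<and> \<omega> \<in> gapbox n N S))"
proof -
  interpret P: prob_space "poisson_model n" by (rule prob_space_poisson_model[OF n])
  interpret random_subset "rate n" by (rule random_subset_rate)
  let ?G = "{S \<in> Pow (slots n N). Q S}"
  define U where "U = (\<Union>S\<in>?G. gapbox n N S)"
  define Pos where "Pos = {\<omega> :: edge \<Rightarrow> real. \<forall>e. 0 < \<omega> e}"
  have finG: "finite ?G" using finite_slots by simp
  have disj: "disjoint_family_on (gapbox n N) ?G"
    unfolding disjoint_family_on_def
  proof (intro ballI impI)
    fix S S' assume "S \<in> ?G" "S' \<in> ?G" "S \<noteq> S'"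
    then have "config n N \<omega> = S" if "\<omega> \<in> gapbox n N S" for \<omega>
      using that by (intro config_box[OF n]) auto
    moreover have "config n N \<omega> = S'" if "\<omega> \<in> gapbox n N S'" for \<omega>
      using that \<open>S' \<in> ?G\<close> by (intro config_box[OF n]) auto
    ultimately show "gapbox n N S \<inter> gapbox n N S' = {}" using \<open>S \<noteq> S'\<close> by (metis disjoint_iff)
  qed
  have "measure (poisson_model n) U = (\<Sum>S\<in>?G. measure (poisson_model n) (gapbox n N S))"
    unfolding U_def using finG disj box_sets by (intro P.finite_measure_finite_Union) auto
  also have "\<dots> = (\<Sum>S\<in>?G. (1 - exp (- rate n)) ^ card S * exp (- rate n) ^ card (slots n N - S))"
    using measure_box[OF n] by (intro sum.cong) auto
  also have "\<dots> = rex (slots n N) (\<lambda>S. of_bool (Q S))"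
    unfolding rex_def using finite_slots by (simp add: sum.inter_filter[symmetric] of_bool_def if_distrib cong: if_cong)
  finally have mU: "measure (poisson_model n) U = rex (slots n N) (\<lambda>S. of_bool (Q S))" .
  have PosS: "Pos \<in> sets (poisson_model n)"
  proof -
    have "Pos = (\<Inter>e. (\<lambda>\<omega>. \<omega> e) -` {0<..} \<inter> space (poisson_model n))"
      by (auto simp: Pos_def space_poisson_model)
    also have "\<dots> \<in> sets (poisson_model n)"
    proof (rule sets.countable_INT'')
      show "UNIV \<in> sets (poisson_model n)" using sets.top[of "poisson_model n"] by (simp add: space_poisson_model)
      fix e :: edge
      have "(\<lambda>\<omega>. \<omega> e) \<in> measurable (poisson_model n) (expo n)"
        unfolding poisson_model_eq by (rule measurable_component_singleton) simp
      then show "(\<lambda>\<omega>. \<omega> e) -` {0<..} \<inter> space (poisson_model n) \<in> sets (poisson_model n)"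
        by (rule measurable_sets) simp
    qed simp
    finally show ?thesis .
  qed
  have AEpos: "AE \<omega> in poisson_model n. \<omega> \<in> Pos"
  proof -
    have "AE x in expo n. 0 < x"
    proof -
      interpret E: prob_space "expo n" by (rule prob_space_expo[OF n])
      have "E.prob {0<..} = 1" using measure_expo_greater[OF n, of 0] by simp
      then have "AE x in expo n. x \<in> {0<..}" by (intro E.AE_prob_1)
      then show ?thesis by simp
    qed
    then have "AE \<omega> in poisson_model n. 0 < \<omega> e" for e
      unfolding poisson_model_eq by (intro AE_PiM_component prob_space_expo n) auto
    then show ?thesis unfolding Pos_def by (simp add: AE_all_countable)
  qed
  have US: "U \<in> sets (poisson_model n)" unfolding U_def using finG box_sets by (intro sets.finite_UN) auto
  have "measure (poisson_model n) (U \<inter> Pos) = measure (poisson_model n) U"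
  proof (rule P.finite_measure_eq_AE)
    show "AE x in poisson_model n. (x \<in> U \<inter> Pos) = (x \<in> U)" using AEpos by eventually_elim auto
  qed (use US PosS in auto)
  then show ?thesis using mU US PosS
    by (intro bexI[of _ "U \<inter> Pos"]) (auto simp: U_def Pos_def)
qed

text \<open>The rounding errors of the successive waiting times of a pair add up, at most one slot
  each. With at most two arrivals per pair, arrivals that are four slots apart therefore come in the
  order of their slots, and slots well before \<open>K\<close> belong to arrivals before the time of
  slot \<open>K\<close>.\<close>

definition spread :: "nat \<Rightarrow> edge set \<Rightarrow> bool" where
  "spread K S \<longleftrightarrow> (\<forall>p. card (occ S p) \<le> 2) \<and>
    (\<forall>e\<in>S. \<forall>e'\<in>S. e \<noteq> e' \<longrightarrow> snd e + 4 \<le> snd e' \<or> snd e' + 4 \<le> snd e) \<and>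
    (\<forall>e\<in>S. snd e + 4 < K)"

lemma adj_fst_mono: "fst ` E \<subseteq> fst ` F \<Longrightarrow> adj E \<subseteq> adj F"
proof
  fix x assume sub: "fst ` E \<subseteq> fst ` F" and "x \<in> adj E"
  then obtain e where e: "e \<in> E" "x = (fst (fst e), snd (fst e)) \<or> x = (snd (fst e), fst (fst e))"
    unfolding adj_def by blast
  then obtain f where "f \<in> F" "fst e = fst f" using sub by blast
  then have "x = (fst (fst f), snd (fst f)) \<or> x = (snd (fst f), fst (fst f))" using e by simp
  then show "x \<in> adj F" using \<open>f \<in> F\<close> unfolding adj_def by blast
qed

text \<open>Connectivity depends on vertex pairs only, so labels by arrival number and labels by
  slot are interchangeable.\<close>

lemma connected_in_fst: "fst ` E = fst ` F \<Longrightarrow> connected_in E = connected_in F"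
  using adj_fst_mono[of E F] adj_fst_mono[of F E] by (auto simp: connected_in_def fun_eq_iff)

section \<open>Order of the arrivals read off from their slots\<close>

context
  fixes n :: nat and t :: real and N :: nat and S :: "edge set" and \<omega> :: "edge \<Rightarrow> real"
  assumes n: "0 < n" and t: "0 \<le> t" and N: "N = slotn n t + 8" and S: "S \<subseteq> slots n N"
    and sp: "spread (slotn n t) S" and pos: "\<And>e. 0 < \<omega> e" and bx: "\<omega> \<in> gapbox n N S"
begin

definition ct :: "nat \<times> nat \<Rightarrow> nat" where "ct p = card (occ S p)"

lemma ct_le: "ct p \<le> 2"
  using sp unfolding spread_def ct_def by blast

lemma h_pos: "0 < mesh n"
  using n by (simp add: mesh_def)

lemma t_bounds: "mesh n * slotn n t \<le> t" "t < mesh n * (real (slotn n t) + 1)"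
proof -
  have "0 \<le> t / mesh n" using t h_pos by simp
  then have "real (slotn n t) \<le> t / mesh n" "t / mesh n < real (slotn n t) + 1"
    unfolding slotn_def by linarith+
  then show "mesh n * slotn n t \<le> t" "t < mesh n * (real (slotn n t) + 1)"
    using h_pos by (simp_all add: field_simps)
qed

lemma arr_eq: "arr \<omega> (p, m) = (\<Sum>l\<le>m. \<omega> (p, l))"
  by (simp add: arr_def)

text \<open>Each waiting time is rounded up by less than one slot, so after \<open>m\<close> of them
  the slot count is ahead of the true time by at most m slots.\<close>

lemma partial_sums:
  assumes p: "p \<in> pairs n" and m: "m \<le> ct p"
  shows "mesh n * (real (prevslot S p m) - m) \<le> (\<Sum>l<m. \<omega> (p, l))"
    and "(\<Sum>l<m. \<omega> (p, l)) \<le> mesh n * prevslot S p m"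
    and "0 < m \<Longrightarrow> mesh n * (real (prevslot S p m) - m) < (\<Sum>l<m. \<omega> (p, l))"
proof -
  have "mesh n * (real (prevslot S p m) - m) \<le> (\<Sum>l<m. \<omega> (p, l)) \<and>
    (\<Sum>l<m. \<omega> (p, l)) \<le> mesh n * prevslot S p m \<and>
    (0 < m \<longrightarrow> mesh n * (real (prevslot S p m) - m) < (\<Sum>l<m. \<omega> (p, l)))"
    using m
  proof (induction m)
    case (Suc m)
    have "(p, m) \<in> coords n S" using p Suc.prems by (simp add: coords_def ct_def)
    then have "\<omega> (p, m) \<in> gap_event n N S (p, m)" using bx by (auto simp: gapbox_def)
    then have a: "mesh n * (real (nthslot S p m) - prevslot S p m) < \<omega> (p, m)"
      "\<omega> (p, m) \<le> mesh n * (real (Suc (nthslot S p m)) - prevslot S p m)"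
      using Suc.prems by (auto simp: gap_event_def ct_def)
    then show ?case using Suc by (auto simp: algebra_simps)
  qed simp
  then show "mesh n * (real (prevslot S p m) - m) \<le> (\<Sum>l<m. \<omega> (p, l))"
    and "(\<Sum>l<m. \<omega> (p, l)) \<le> mesh n * prevslot S p m"
    and "0 < m \<Longrightarrow> mesh n * (real (prevslot S p m) - m) < (\<Sum>l<m. \<omega> (p, l))" by auto
qed

lemma arr_bounds:
  assumes p: "p \<in> pairs n" and m: "m < ct p"
  shows "mesh n * (real (nthslot S p m) - m) < arr \<omega> (p, m)" "arr \<omega> (p, m) \<le> mesh n * (real (nthslot S p m) + 1)"
  using partial_sums[OF p, of "Suc m"] m
  by (simp_all add: arr_eq lessThan_Suc_atMost[symmetric] algebra_simps)

lemma arr_late: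
  assumes p: "p \<in> pairs n" and m: "ct p \<le> m"
  shows "t < arr \<omega> (p, m)"
proof -
  let ?k = "ct p"
  have "(p, ?k) \<in> coords n S" using p by (simp add: coords_def ct_def)
  then have "\<omega> (p, ?k) \<in> gap_event n N S (p, ?k)" using bx by (auto simp: gapbox_def)
  then have a: "mesh n * (real N - prevslot S p ?k) < \<omega> (p, ?k)" by (auto simp: gap_event_def ct_def)
  have k2: "?k \<le> 2" by (rule ct_le)
  have "t < mesh n * (real (slotn n t) + 1)" by (rule t_bounds)
  \<comment> \<open>The margin of eight slots in \<open>N\<close> exceeds the accumulated rounding
    error of at most two slots.\<close>
  also have "\<dots> \<le> mesh n * (real N - ?k)" using h_pos k2 by (intro mult_left_mono) (auto simp: N)
  also have "\<dots> = mesh n * (real (prevslot S p ?k) - ?k) + mesh n * (real N - prevslot S p ?k)"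
    by (simp add: algebra_simps)
  also have "\<dots> \<le> (\<Sum>l<?k. \<omega> (p, l)) + \<omega> (p, ?k)"
    using partial_sums(1)[OF p, of ?k] a by simp
  also have "\<dots> = (\<Sum>l\<le>?k. \<omega> (p, l))" by (simp add: lessThan_Suc_atMost[symmetric])
  also have "\<dots> \<le> (\<Sum>l\<le>m. \<omega> (p, l))"
    using m less_imp_le[OF pos] by (intro sum_mono2) (simp_all add: subset_iff)
  finally show ?thesis by (simp add: arr_eq)
qed

text \<open>On the labels in \<open>early\<close>, which are the arrivals up to \<open>t\<close>,
  this is a bijection onto \<open>S\<close> that preserves the vertex pair and the order in
  time.\<close>

definition slot_of :: "edge \<Rightarrow> edge" where
  "slot_of e = (fst e, nthslot S (fst e) (snd e))"

definition early :: "edge set" where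
  "early = {e. fst e \<in> pairs n \<and> snd e < ct (fst e)}"

lemma fst_slot_of [simp]: "fst (slot_of e) = fst e"
  by (simp add: slot_of_def)

lemma all_edges_iff: "e \<in> all_edges n \<longleftrightarrow> fst e \<in> pairs n"
  unfolding all_edges_def pairs_def by (cases e) auto

lemma slot_of_mem: "e \<in> early \<Longrightarrow> slot_of e \<in> S"
  using nthslot_mem[OF S, of "snd e" "fst e"] by (auto simp: early_def slot_of_def occ_def ct_def)

lemma slot_of_image: "slot_of ` early = S"
proof
  show "slot_of ` early \<subseteq> S" using slot_of_mem by auto
  show "S \<subseteq> slot_of ` early"
  proof
    fix s assume s: "s \<in> S"
    then have "snd s \<in> occ S (fst s)" by (simp add: occ_def)
    then obtain m where m: "m < card (occ S (fst s))" "nthslot S (fst s) m = snd s"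
      by (rule nthslot_surj[OF S])
    have "fst s \<in> pairs n" using s S by (auto simp: slots_eq)
    then have "(fst s, m) \<in> early" "slot_of (fst s, m) = s"
      using m by (auto simp: early_def ct_def slot_of_def prod_eq_iff)
    then show "s \<in> slot_of ` early" by (metis image_eqI)
  qed
qed

lemma slot_of_inj: "inj_on slot_of early"
proof (rule inj_onI)
  fix e e' assume e: "e \<in> early" "e' \<in> early" "slot_of e = slot_of e'"
  then have f: "fst e = fst e'" "nthslot S (fst e) (snd e) = nthslot S (fst e) (snd e')"
    by (auto simp: slot_of_def)
  have "snd e = snd e'"
    using e f nthslot_strict[OF S, of "snd e" "snd e'" "fst e"] nthslot_strict[OF S, of "snd e'" "snd e" "fst e"]
    by (cases "snd e" "snd e'" rule: linorder_cases) (auto simp: early_def ct_def)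
  then show "e = e'" using f by (simp add: prod_eq_iff)
qed

lemma early_iff: "e \<in> all_edges n \<Longrightarrow> arr \<omega> e \<le> t \<longleftrightarrow> e \<in> early"
proof -
  assume "e \<in> all_edges n"
  then have p: "fst e \<in> pairs n" by (simp add: all_edges_iff)
  show ?thesis
  proof (cases "snd e < ct (fst e)")
    case True
    then have e: "e \<in> early" using p by (simp add: early_def)
    have "snd (slot_of e) + 4 < slotn n t" using slot_of_mem[OF e] sp by (auto simp: spread_def)
    then have "real (nthslot S (fst e) (snd e)) + 1 \<le> slotn n t" by (simp add: slot_of_def)
    then have "mesh n * (real (nthslot S (fst e) (snd e)) + 1) \<le> mesh n * slotn n t"
      using h_pos by (intro mult_left_mono) auto
    then have "arr \<omega> e \<le> t" using arr_bounds(2)[OF p True] t_bounds(1) by simp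
    then show ?thesis using e by simp
  next
    case False
    then have "t < arr \<omega> e" using arr_late[OF p, of "snd e"] by simp
    then show ?thesis using False by (simp add: early_def)
  qed
qed

lemma arr_less_iff:
  assumes e: "e \<in> early" "e' \<in> early"
  shows "arr \<omega> e < arr \<omega> e' \<longleftrightarrow> snd (slot_of e) < snd (slot_of e')"
proof -
  have lt: "arr \<omega> x < arr \<omega> y"
    if x: "x \<in> early" and y: "y \<in> early" and "snd (slot_of x) + 4 \<le> snd (slot_of y)" for x y
  proof -
    have y2: "ct (fst y) \<le> 2" by (rule ct_le)
    have px: "fst x \<in> pairs n" "snd x < ct (fst x)" and py: "fst y \<in> pairs n" "snd y < ct (fst y)"
      using x y by (auto simp: early_def)
    have "arr \<omega> x \<le> mesh n * (real (snd (slot_of x)) + 1)"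
      using arr_bounds(2)[OF px] by (simp add: slot_of_def)
    also have "\<dots> \<le> mesh n * (real (snd (slot_of y)) - snd y)"
      using that(3) py(2) y2 h_pos by (intro mult_left_mono) auto
    also have "\<dots> < arr \<omega> y" using arr_bounds(1)[OF py] by (simp add: slot_of_def)
    finally show ?thesis .
  qed
  show ?thesis
  proof (cases "e = e'")
    case False
    then have "slot_of e \<noteq> slot_of e'" using slot_of_inj e by (auto dest: inj_onD)
    then have "snd (slot_of e) + 4 \<le> snd (slot_of e') \<or> snd (slot_of e') + 4 \<le> snd (slot_of e)"
      using sp slot_of_mem[OF e(1)] slot_of_mem[OF e(2)] by (auto simp: spread_def)
    then show ?thesis using lt[OF e] lt[OF e(2,1)] by auto
  qed simp
qed

lemma Gall_sub: "Gall k \<tau> A \<subseteq> A"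
  by (induction k \<tau> A rule: Gall.induct) auto

text \<open>Induction over the layers. Both recursions see only the vertex pairs and the order of
  the arrivals, and \<open>slot_of\<close> preserves both.\<close>

lemma Gall_early:
  "e \<in> early \<Longrightarrow> e \<in> Gall (Suc k) (arr \<omega>) (all_edges n) \<longleftrightarrow> slot_of e \<in> active k S"
proof (induction k arbitrary: e)
  case 0
  then show ?case by (simp add: active_def early_def all_edges_iff)
next
  case (Suc k)
  let ?G = "Gall (Suc k) (arr \<omega>) (all_edges n)"
  have "fst ` {e' \<in> ?G. arr \<omega> e' < arr \<omega> e} = fst ` {s \<in> S \<inter> active k S. snd s < snd (slot_of e)}"
  proof
    show "fst ` {e' \<in> ?G. arr \<omega> e' < arr \<omega> e} \<subseteq> fst ` {s \<in> S \<inter> active k S. snd s < snd (slot_of e)}"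
    proof
      fix p assume "p \<in> fst ` {e' \<in> ?G. arr \<omega> e' < arr \<omega> e}"
      then obtain e' where e': "e' \<in> ?G" "arr \<omega> e' < arr \<omega> e" "p = fst e'" by auto
      have "e \<in> all_edges n" using Suc.prems by (simp add: early_def all_edges_iff)
      then have "arr \<omega> e \<le> t" using early_iff Suc.prems by simp
      then have E: "e' \<in> early" using e' Gall_sub early_iff[of e'] by auto
      then have "slot_of e' \<in> {s \<in> S \<inter> active k S. snd s < snd (slot_of e)}"
        using Suc.IH[OF E] slot_of_mem[OF E] arr_less_iff[OF E Suc.prems] e' by auto
      moreover have "p = fst (slot_of e')" using e' by simp
      ultimately show "p \<in> fst ` {s \<in> S \<inter> active k S. snd s < snd (slot_of e)}" by blast
    qed
    show "fst ` {s \<in> S \<inter> active k S. snd s < snd (slot_of e)} \<subseteq> fst ` {e' \<in> ?G. arr \<omega> e' < arr \<omega> e}"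
    proof
      fix p assume "p \<in> fst ` {s \<in> S \<inter> active k S. snd s < snd (slot_of e)}"
      then obtain s where s: "s \<in> S" "s \<in> active k S" "snd s < snd (slot_of e)" "p = fst s" by auto
      then obtain e' where E: "e' \<in> early" "s = slot_of e'" using slot_of_image by blast
      then have "e' \<in> {e' \<in> ?G. arr \<omega> e' < arr \<omega> e}"
        using Suc.IH[OF E(1)] arr_less_iff[OF E(1) Suc.prems] s by auto
      moreover have "p = fst e'" using s E by simp
      ultimately show "p \<in> fst ` {e' \<in> ?G. arr \<omega> e' < arr \<omega> e}" by blast
    qed
  qed
  then have "connected_in {e' \<in> ?G. arr \<omega> e' < arr \<omega> e} = level (Suc k) S (snd (slot_of e))"
    unfolding level_Suc by (rule connected_in_fst)
  then have "e \<in> Gall (Suc (Suc k)) (arr \<omega>) (all_edges n) \<longleftrightarrow>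
      e \<in> ?G \<and> level (Suc k) S (snd (slot_of e)) (fst (fst e)) (snd (fst e))"
    by simp
  also have "\<dots> \<longleftrightarrow> slot_of e \<in> active k S \<and> slot_of e \<in> active (Suc k) S"
    using Suc.IH[OF Suc.prems] by (simp add: active_def)
  also have "\<dots> \<longleftrightarrow> slot_of e \<in> active (Suc k) S" using active_Suc_subset by blast
  finally show ?case .
qed

lemma connected_in_Gt: "connected_in (Gt (Suc k) n \<omega> t) = level (Suc k) S (slotn n t)"
proof -
  have "fst ` Gt (Suc k) n \<omega> t = fst ` {s \<in> S \<inter> active k S. snd s < slotn n t}"
  proof
    show "fst ` Gt (Suc k) n \<omega> t \<subseteq> fst ` {s \<in> S \<inter> active k S. snd s < slotn n t}"
    proof
      fix p assume "p \<in> fst ` Gt (Suc k) n \<omega> t"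
      then obtain e where e: "e \<in> Gall (Suc k) (arr \<omega>) (all_edges n)" "arr \<omega> e \<le> t" "p = fst e"
        unfolding Gt_def by auto
      then have E: "e \<in> early" using Gall_sub early_iff[of e] by auto
      have "snd (slot_of e) + 4 < slotn n t" using slot_of_mem[OF E] sp by (auto simp: spread_def)
      then have "slot_of e \<in> {s \<in> S \<inter> active k S. snd s < slotn n t}"
        using Gall_early[OF E] e slot_of_mem[OF E] by auto
      moreover have "p = fst (slot_of e)" using e by simp
      ultimately show "p \<in> fst ` {s \<in> S \<inter> active k S. snd s < slotn n t}" by blast
    qed
    show "fst ` {s \<in> S \<inter> active k S. snd s < slotn n t} \<subseteq> fst ` Gt (Suc k) n \<omega> t"
    proof
      fix p assume "p \<in> fst ` {s \<in> S \<inter> active k S. snd s < slotn n t}"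
      then obtain s where s: "s \<in> S" "s \<in> active k S" "p = fst s" by auto
      then obtain e where E: "e \<in> early" "s = slot_of e" using slot_of_image by blast
      have "e \<in> all_edges n" using E by (simp add: early_def all_edges_iff)
      then have "e \<in> Gt (Suc k) n \<omega> t"
        using Gall_early[OF E(1), of k] early_iff[of e] E s by (simp add: Gt_def)
      moreover have "p = fst e" using s E by simp
      ultimately show "p \<in> fst ` Gt (Suc k) n \<omega> t" by blast
    qed
  qed
  then show ?thesis unfolding level_Suc by (rule connected_in_fst)
qed

end

section \<open>Union bounds for configurations that are not spread\<close>

lemma (in random_subset) prob_subset_le:
  assumes "finite A" "Q \<subseteq> A"
  shows "rex A (\<lambda>H. of_bool (Q \<subseteq> H)) \<le> \<theta> ^ card Q"
proof -
  have fin: "finite Q" using assms finite_subset by blast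
  have "rex A (\<lambda>H. of_bool (Q \<subseteq> H)) = rex A (\<lambda>H. of_bool (H \<inter> Q = Q))"
    by (rule rex_cong) auto
  also have "\<dots> = rex Q (\<lambda>H. of_bool (H = Q))" by (rule rex_restrict[OF assms])
  also have "\<dots> = (1 - exp (-\<theta>)) ^ card Q"
  proof -
    have "rex Q (\<lambda>H. of_bool (H = Q)) = (\<Sum>H\<in>{Q}. (1 - exp (-\<theta>)) ^ card H * exp (-\<theta>) ^ card (Q - H) * of_bool (H = Q))"
      unfolding rex_def using fin by (intro sum.mono_neutral_right) auto
    then show ?thesis by simp
  qed
  also have "\<dots> \<le> \<theta> ^ card Q"
    using theta_nonneg exp_ge_add_one_self[of "-\<theta>"] by (intro power_mono) auto
  finally show ?thesis .
qed

lemma (in random_subset) prob_family_le: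
  assumes "finite A" "finite F" "\<And>Q. Q \<in> F \<Longrightarrow> Q \<subseteq> A \<and> card Q = c"
    and "\<And>H. H \<subseteq> A \<Longrightarrow> P H \<Longrightarrow> \<exists>Q\<in>F. Q \<subseteq> H"
  shows "rex A (\<lambda>H. of_bool (P H)) \<le> card F * \<theta> ^ c"
proof -
  have "rex A (\<lambda>H. of_bool (P H)) \<le> rex A (\<lambda>H. \<Sum>Q\<in>F. of_bool (Q \<subseteq> H))"
  proof (rule rex_mono)
    fix H assume H: "H \<subseteq> A"
    show "of_bool (P H) \<le> (\<Sum>Q\<in>F. of_bool (Q \<subseteq> H) :: real)"
    proof (cases "P H")
      case True
      then obtain Q where Q: "Q \<in> F" "Q \<subseteq> H" using assms(4) H by blast
      have "of_bool (Q \<subseteq> H) \<le> (\<Sum>Q\<in>F. of_bool (Q \<subseteq> H) :: real)"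
        using Q assms(2) by (intro member_le_sum) auto
      then show ?thesis using Q by (simp only: True of_bool_eq)
    qed (auto intro!: sum_nonneg)
  qed
  also have "\<dots> = (\<Sum>Q\<in>F. rex A (\<lambda>H. of_bool (Q \<subseteq> H)))" by (rule rex_sum)
  also have "\<dots> \<le> (\<Sum>Q\<in>F. \<theta> ^ c)"
    using prob_subset_le[OF assms(1)] assms(3) by (intro sum_mono) metis
  finally show ?thesis by simp
qed

section \<open>Events of high probability\<close>

lemma card_pairs_le: "card (pairs n) \<le> n\<^sup>2"
proof -
  have "card (pairs n) \<le> card ({..<n} \<times> {..<n})" by (intro card_mono) (auto simp: pairs_def)
  then show ?thesis by (simp add: power2_eq_square)
qed

lemma slotn_le: "0 < n \<Longrightarrow> 0 \<le> t \<Longrightarrow> real (slotn n t + 8) \<le> (t + 8) * real n ^ 3"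
proof -
  assume n: "0 < n" and t: "0 \<le> t"
  have "0 \<le> t * real n ^ 3" using t by simp
  then have "real (slotn n t) \<le> t * real n ^ 3" unfolding slotn_def mesh_def by simp
  moreover have "1 \<le> real n ^ 3" using n by simp
  ultimately show ?thesis by (simp add: algebra_simps)
qed

text \<open>Expected numbers for the three ways to fail, with slot probability at most n^(-4): three
  arrivals at one pair, n^2 ((t+8) n^3)^3 n^(-12); two arrivals less than four slots apart, 4 n^4
  (t+8) n^3 n^(-8); an arrival in the last twelve slots, 12 n^2 n^(-4). Each is of order at most
  1/n.\<close>

lemma prob_not_spread:
  assumes n: "0 < n" and t: "0 \<le> t"
  shows "random_subset.rex (rate n) (slots n (slotn n t + 8)) (\<lambda>S. of_bool (\<not> spread (slotn n t) S))
    \<le> ((t + 8) ^ 3 + 4 * (t + 8) + 12) / n"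
proof -
  interpret random_subset "rate n" by (rule random_subset_rate)
  define K where "K = slotn n t"
  define N where "N = K + 8"
  let ?I = "slots n N" and ?P = "pairs n"
  define c where "c = t + 8"
  have Nc: "real N \<le> c * real n ^ 3" using slotn_le[OF n t] by (simp add: N_def K_def c_def)
  have c0: "0 \<le> c" using t by (simp add: c_def)
  have r: "rate n = 1 / real n ^ 4" using n by (simp add: rate_def mesh_def power_eq_if)
  have P2: "real (card ?P) \<le> (real n)\<^sup>2"
    using card_pairs_le[of n] by (metis of_nat_le_iff of_nat_power)
  define F1 where "F1 = {Q \<in> (\<lambda>(p, a, b, d). {(p, a), (p, b), (p, d)}) ` (?P \<times> {..<N} \<times> {..<N} \<times> {..<N}). Q \<subseteq> ?I \<and> card Q = 3}"
  define F2 where "F2 = {Q \<in> (\<lambda>(p, p', a, d). {(p, a), (p', a + d)}) ` (?P \<times> ?P \<times> {..<N} \<times> {..<4}). Q \<subseteq> ?I \<and> card Q = 2}"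
  \<comment> \<open>For K < 4 the truncated difference is 0, and twelve slots still reach beyond the
    last slot K + 7.\<close>
  define F3 where "F3 = {Q \<in> (\<lambda>(p, d). {(p, K - 4 + d)}) ` (?P \<times> {..<12}). Q \<subseteq> ?I \<and> card Q = 1}"
  have fin: "finite F1" "finite F2" "finite F3"
    unfolding F1_def F2_def F3_def by (auto intro!: finite_imageI finite_cartesian_product finite_pairs)
  have cF1: "real (card F1) \<le> (real n)\<^sup>2 * (c * real n ^ 3) ^ 3"
  proof -
    have "card F1 \<le> card ((\<lambda>(p, a, b, d). {(p, a), (p, b), (p, d)}) ` (?P \<times> {..<N} \<times> {..<N} \<times> {..<N}))"
      unfolding F1_def by (intro card_mono finite_imageI finite_cartesian_product finite_pairs) auto
    also have "\<dots> \<le> card (?P \<times> {..<N} \<times> {..<N} \<times> {..<N})"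
      by (intro card_image_le finite_cartesian_product finite_pairs) auto
    also have "\<dots> = card ?P * N ^ 3" by (simp add: card_cartesian_product power3_eq_cube)
    finally have "real (card F1) \<le> real (card ?P) * real N ^ 3" by (metis of_nat_le_iff of_nat_mult of_nat_power)
    also have "\<dots> \<le> (real n)\<^sup>2 * (c * real n ^ 3) ^ 3"
      using P2 Nc by (intro mult_mono power_mono) auto
    finally show ?thesis .
  qed
  have cF2: "real (card F2) \<le> (real n)\<^sup>2 * (real n)\<^sup>2 * (4 * (c * real n ^ 3))"
  proof -
    have "card F2 \<le> card ((\<lambda>(p, p', a, d). {(p, a), (p', a + d)}) ` (?P \<times> ?P \<times> {..<N} \<times> {..<4}))"
      unfolding F2_def by (intro card_mono finite_imageI finite_cartesian_product finite_pairs) auto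
    also have "\<dots> \<le> card (?P \<times> ?P \<times> {..<N} \<times> {..<4::nat})"
      by (intro card_image_le finite_cartesian_product finite_pairs) auto
    also have "\<dots> = card ?P * card ?P * (4 * N)" by (simp add: card_cartesian_product)
    finally have "real (card F2) \<le> real (card ?P) * real (card ?P) * (4 * real N)"
      by (metis of_nat_le_iff of_nat_mult of_nat_numeral)
    also have "\<dots> \<le> (real n)\<^sup>2 * (real n)\<^sup>2 * (4 * (c * real n ^ 3))"
      using P2 Nc by (intro mult_mono) auto
    finally show ?thesis .
  qed
  have cF3: "real (card F3) \<le> (real n)\<^sup>2 * 12"
  proof -
    have "card F3 \<le> card ((\<lambda>(p, d). {(p, K - 4 + d)}) ` (?P \<times> {..<12}))"
      unfolding F3_def by (intro card_mono finite_imageI finite_cartesian_product finite_pairs) auto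
    also have "\<dots> \<le> card (?P \<times> {..<12::nat})"
      by (intro card_image_le finite_cartesian_product finite_pairs) auto
    also have "\<dots> = card ?P * 12" by (simp add: card_cartesian_product)
    finally have "real (card F3) \<le> real (card ?P) * 12" by (metis of_nat_le_iff of_nat_mult of_nat_numeral)
    then show ?thesis using P2 by linarith
  qed
  define P1 where "P1 S \<longleftrightarrow> (\<exists>p. 2 < card (occ S p))" for S
  define P2 where "P2 S \<longleftrightarrow> (\<exists>e\<in>S. \<exists>e'\<in>S. e \<noteq> e' \<and> snd e \<le> snd e' \<and> snd e' < snd e + 4)" for S :: "edge set"
  define P3 where "P3 S \<longleftrightarrow> (\<exists>e\<in>S. K \<le> snd e + 4)" for S :: "edge set"
  have b1: "rex ?I (\<lambda>S. of_bool (P1 S)) \<le> card F1 * rate n ^ 3"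
  proof (rule prob_family_le[OF finite_slots fin(1)])
    fix S assume S: "S \<subseteq> ?I" "P1 S"
    then obtain p where "2 < card (occ S p)" unfolding P1_def by blast
    then have "3 \<le> card (occ S p)" by simp
    then obtain T where T: "T \<subseteq> occ S p" "card T = 3" by (rule obtain_subset_with_card_n)
    then obtain a b d where abd: "T = {a, b, d}" "a \<noteq> b" "b \<noteq> d" "a \<noteq> d" by (auto simp: card_3_iff)
    have mem: "(p, a) \<in> S" "(p, b) \<in> S" "(p, d) \<in> S" using T abd by (auto simp: occ_def)
    then have "p \<in> ?P" "a < N" "b < N" "d < N" using S(1) by (auto simp: slots_eq)
    then have "{(p, a), (p, b), (p, d)} \<in> F1"
      unfolding F1_def using mem S(1) abd by (auto intro!: image_eqI[of _ _ "(p, a, b, d)"])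
    then show "\<exists>Q\<in>F1. Q \<subseteq> S" by (rule bexI[rotated]) (use mem in simp)
  qed (auto simp: F1_def)
  have b2: "rex ?I (\<lambda>S. of_bool (P2 S)) \<le> card F2 * rate n ^ 2"
  proof (rule prob_family_le[OF finite_slots fin(2)])
    fix S assume S: "S \<subseteq> ?I" "P2 S"
    then obtain e e' where e: "e \<in> S" "e' \<in> S" "e \<noteq> e'" "snd e \<le> snd e'" "snd e' < snd e + 4"
      unfolding P2_def by blast
    have m: "fst e \<in> ?P" "fst e' \<in> ?P" "snd e < N" using e S(1) by (auto simp: slots_eq)
    have "{e, e'} \<in> (\<lambda>(p, p', a, d). {(p, a), (p', a + d)}) ` (?P \<times> ?P \<times> {..<N} \<times> {..<4})"
    proof (rule image_eqI)
      show "{e, e'} = (\<lambda>(p, p', a, d). {(p, a), (p', a + d)}) (fst e, fst e', snd e, snd e' - snd e)"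
        using e by simp
      show "(fst e, fst e', snd e, snd e' - snd e) \<in> ?P \<times> ?P \<times> {..<N} \<times> {..<4}"
        using e m by simp
    qed
    moreover have "{e, e'} \<subseteq> ?I" "card {e, e'} = 2" using e S(1) by auto
    ultimately have "{e, e'} \<in> F2" unfolding F2_def by blast
    then show "\<exists>Q\<in>F2. Q \<subseteq> S" by (rule bexI[rotated]) (use e in simp)
  qed (auto simp: F2_def)
  have b3: "rex ?I (\<lambda>S. of_bool (P3 S)) \<le> card F3 * rate n ^ 1"
  proof (rule prob_family_le[OF finite_slots fin(3)])
    fix S assume S: "S \<subseteq> ?I" "P3 S"
    then obtain e where e: "e \<in> S" "K \<le> snd e + 4" unfolding P3_def by blast
    have m: "fst e \<in> ?P" "snd e < K + 8" using e S(1) by (auto simp: slots_eq N_def)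
    have d: "K - 4 + (snd e - (K - 4)) = snd e" "snd e - (K - 4) < 12" using m(2) e(2) by arith+
    have "{e} \<in> (\<lambda>(p, d). {(p, K - 4 + d)}) ` (?P \<times> {..<12})"
    proof (rule image_eqI)
      show "{e} = (\<lambda>(p, d). {(p, K - 4 + d)}) (fst e, snd e - (K - 4))"
        using d(1) by simp
      show "(fst e, snd e - (K - 4)) \<in> ?P \<times> {..<12}" using m d(2) by simp
    qed
    moreover have "{e} \<subseteq> ?I" "card {e} = 1" using e S(1) by auto
    ultimately have "{e} \<in> F3" unfolding F3_def by blast
    then show "\<exists>Q\<in>F3. Q \<subseteq> S" by (rule bexI[rotated]) (use e in simp)
  qed (auto simp: F3_def)
  have "rex ?I (\<lambda>S. of_bool (\<not> spread K S)) \<le> rex ?I (\<lambda>S. of_bool (P1 S) + of_bool (P2 S) + of_bool (P3 S))"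
  proof (rule rex_mono)
    fix S
    have "P1 S \<or> P2 S \<or> P3 S" if "\<not> spread K S"
    proof (rule ccontr)
      assume no: "\<not> (P1 S \<or> P2 S \<or> P3 S)"
      have "snd e + 4 \<le> snd e' \<or> snd e' + 4 \<le> snd e" if "e \<in> S" "e' \<in> S" "e \<noteq> e'" for e e'
      proof (cases "snd e \<le> snd e'")
        case True
        then have "\<not> snd e' < snd e + 4" using no that unfolding P2_def by blast
        then show ?thesis by simp
      next
        case False
        then have "\<not> snd e < snd e' + 4" using no that unfolding P2_def by (metis nat_le_linear)
        then show ?thesis by simp
      qed
      moreover have "card (occ S p) \<le> 2" for p using no unfolding P1_def by (meson not_le)
      moreover have "snd e + 4 < K" if "e \<in> S" for e using no that unfolding P3_def by (meson not_le)
      ultimately have "spread K S" unfolding spread_def by blast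
      then show False using that by simp
    qed
    then show "of_bool (\<not> spread K S) \<le> of_bool (P1 S) + of_bool (P2 S) + (of_bool (P3 S) :: real)"
      by auto
  qed
  also have "\<dots> \<le> card F1 * rate n ^ 3 + card F2 * rate n ^ 2 + card F3 * rate n ^ 1"
    unfolding rex_add by (intro add_mono b1 b2 b3)
  also have "\<dots> \<le> (real n)\<^sup>2 * (c * real n ^ 3) ^ 3 * rate n ^ 3
      + (real n)\<^sup>2 * (real n)\<^sup>2 * (4 * (c * real n ^ 3)) * rate n ^ 2 + (real n)\<^sup>2 * 12 * rate n ^ 1"
    by (intro add_mono mult_right_mono cF1 cF2 cF3) (auto simp: r)
  also have "\<dots> = c ^ 3 / n + 4 * c / n + 12 / (real n)\<^sup>2"
    unfolding r using n by (simp add: power_divide power_mult_distrib power_mult[symmetric] field_simps eval_nat_numeral)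
  also have "\<dots> \<le> c ^ 3 / n + 4 * c / n + 12 / n"
    using n by (intro add_left_mono divide_left_mono) (auto simp: power2_eq_square)
  also have "\<dots> = ((t + 8) ^ 3 + 4 * (t + 8) + 12) / n"
    by (simp add: c_def add_divide_distrib)
  finally show ?thesis by (simp add: N_def K_def)
qed

text \<open>\<open>whp\<close> asks for one sequence of events that serves all \<eta>. For each n an
  inner event is chosen whose probability is within 1/(n+1) of the supremum.\<close>

lemma whpI:
  fixes M :: "nat \<Rightarrow> 'a measure"
  assumes ps: "\<forall>n>0. prob_space (M n)"
    and ev: "\<And>\<eta>. 0 < \<eta> \<Longrightarrow> \<forall>\<^sub>F n in sequentially. \<exists>B\<in>sets (M n). B \<subseteq> {\<omega> \<in> space (M n). P n \<omega>} \<and> 1 - \<eta> \<le> measure (M n) B"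
  shows "whp M P"
proof -
  define X where "X n = {measure (M n) B | B. B \<in> sets (M n) \<and> B \<subseteq> {\<omega> \<in> space (M n). P n \<omega>}}" for n
  have bdd: "bdd_above (X n)" if "0 < n" for n
  proof -
    interpret prob_space "M n" using ps that by blast
    show ?thesis by (rule bdd_aboveI[of _ 1]) (auto simp: X_def)
  qed
  have ne: "X n \<noteq> {}" for n
    unfolding X_def by (auto intro!: exI[of _ "{}"])
  \<comment> \<open>For n = 0 nothing is assumed about the measure; any measurable subset
    does.\<close>
  have "\<exists>B. B \<in> sets (M n) \<and> B \<subseteq> {\<omega> \<in> space (M n). P n \<omega>} \<and>
    (0 < n \<longrightarrow> Sup (X n) - 1 / real (Suc n) < measure (M n) B)" for n
  proof (cases "0 < n")
    case True
    have "Sup (X n) - 1 / real (Suc n) < Sup (X n)" by simp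
    then obtain x where "x \<in> X n" "Sup (X n) - 1 / real (Suc n) < x"
      using less_cSup_iff[OF ne bdd[OF True]] by blast
    then show ?thesis by (auto simp: X_def)
  qed auto
  then obtain B where B: "\<And>n. B n \<in> sets (M n)" "\<And>n. B n \<subseteq> {\<omega> \<in> space (M n). P n \<omega>}"
    "\<And>n. 0 < n \<Longrightarrow> Sup (X n) - 1 / real (Suc n) < measure (M n) (B n)" by metis
  have "(\<lambda>n. measure (M n) (B n)) \<longlonglongrightarrow> 1"
  proof (rule order_tendstoI)
    fix a :: real assume a: "a < 1"
    have h: "0 < (1 - a) / 2" using a by simp
    have "(\<lambda>n. 1 / real (Suc n)) \<longlonglongrightarrow> 0" by (rule LIMSEQ_Suc[OF lim_1_over_n])
    then have "\<forall>\<^sub>F n in sequentially. 1 / real (Suc n) < (1 - a) / 2" using h by (rule order_tendstoD)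
    then show "\<forall>\<^sub>F n in sequentially. a < measure (M n) (B n)"
      using ev[OF h] eventually_gt_at_top[of 0]
    proof eventually_elim
      case (elim n)
      then obtain C where C: "C \<in> sets (M n)" "C \<subseteq> {\<omega> \<in> space (M n). P n \<omega>}" "1 - (1 - a) / 2 \<le> measure (M n) C"
        by blast
      then have "measure (M n) C \<in> X n" by (auto simp: X_def)
      then have "measure (M n) C \<le> Sup (X n)" by (rule cSup_upper[OF _ bdd[OF elim(3)]])
      have gen: "a < b" if "c \<le> s" "1 - (1 - a) / 2 \<le> c" "s - d < b" "d < (1 - a) / 2" for b c d s :: real
        using that by (simp add: field_simps)
      show ?case by (rule gen[OF \<open>measure (M n) C \<le> Sup (X n)\<close> C(3) B(3)[OF elim(3)] elim(1)])
    qed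
  next
    fix a :: real assume a: "1 < a"
    show "\<forall>\<^sub>F n in sequentially. measure (M n) (B n) < a"
      using eventually_gt_at_top[of 0]
    proof eventually_elim
      case (elim n)
      interpret prob_space "M n" using ps elim by blast
      show ?case using prob_le_1[of "B n"] a by linarith
    qed
  qed
  then show ?thesis unfolding whp_def using B(1,2) by blast
qed

lemma whpD:
  assumes "whp M P" "0 < \<eta>"
  shows "\<forall>\<^sub>F n in sequentially. \<exists>B\<in>sets (M n). B \<subseteq> {\<omega> \<in> space (M n). P n \<omega>} \<and> 1 - \<eta> \<le> measure (M n) B"
proof -
  obtain B where B: "\<And>n. B n \<in> sets (M n) \<and> B n \<subseteq> {\<omega> \<in> space (M n). P n \<omega>}"
    "(\<lambda>n. measure (M n) (B n)) \<longlonglongrightarrow> 1" using assms(1) unfolding whp_def by blast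
  have "\<forall>\<^sub>F n in sequentially. 1 - \<eta> < measure (M n) (B n)"
    using B(2) by (rule order_tendstoD) (use assms in simp)
  then show ?thesis
  proof eventually_elim
    case (elim n)
    then show ?case using B(1)[of n] by (intro bexI[of _ "B n"]) auto
  qed
qed

lemma whp_conj:
  assumes ps: "\<forall>n>0. prob_space (M n)" and PQ: "whp M P" "whp M Q"
  shows "whp M (\<lambda>n \<omega>. P n \<omega> \<and> Q n \<omega>)"
proof (rule whpI[OF ps])
  fix \<eta> :: real assume "0 < \<eta>"
  then have h: "0 < \<eta> / 2" by simp
  show "\<forall>\<^sub>F n in sequentially. \<exists>B\<in>sets (M n). B \<subseteq> {\<omega> \<in> space (M n). P n \<omega> \<and> Q n \<omega>} \<and> 1 - \<eta> \<le> measure (M n) B"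
    using whpD[OF PQ(1) h] whpD[OF PQ(2) h] eventually_gt_at_top[of 0]
  proof eventually_elim
    case (elim n)
    interpret prob_space "M n" using ps elim(3) by blast
    obtain B C where B: "B \<in> sets (M n)" "B \<subseteq> {\<omega> \<in> space (M n). P n \<omega>}" "1 - \<eta> / 2 \<le> prob B"
      and C: "C \<in> sets (M n)" "C \<subseteq> {\<omega> \<in> space (M n). Q n \<omega>}" "1 - \<eta> / 2 \<le> prob C"
      using elim(1,2) by blast
    have "prob B \<le> prob (B \<inter> C) + prob (space (M n) - C)"
    proof -
      have "prob B \<le> prob ((B \<inter> C) \<union> (space (M n) - C))"
        using B C sets.sets_into_space[OF B(1)] by (intro finite_measure_mono) auto
      also have "\<dots> \<le> prob (B \<inter> C) + prob (space (M n) - C)"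
        using B C by (intro measure_Un_le) auto
      finally show ?thesis .
    qed
    then have "1 - \<eta> \<le> prob (B \<inter> C)" using B C prob_compl[OF C(1)] by simp
    then show ?case using B C by (intro bexI[of _ "B \<inter> C"]) auto
  qed
qed

lemma whp_mono:
  assumes ps: "\<forall>n>0. prob_space (M n)" and P: "whp M P"
    and imp: "\<forall>\<^sub>F n in sequentially. \<forall>\<omega>\<in>space (M n). P n \<omega> \<longrightarrow> Q n \<omega>"
  shows "whp M Q"
proof (rule whpI[OF ps])
  fix \<eta> :: real assume "0 < \<eta>"
  from whpD[OF P this] imp
  show "\<forall>\<^sub>F n in sequentially. \<exists>B\<in>sets (M n). B \<subseteq> {\<omega> \<in> space (M n). Q n \<omega>} \<and> 1 - \<eta> \<le> measure (M n) B"
    by eventually_elim blast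
qed

lemma whp_ball_finite:
  assumes ps: "\<forall>n>0. prob_space (M n)" and fin: "finite I"
    and P: "\<And>i. i \<in> I \<Longrightarrow> whp M (P i)"
  shows "whp M (\<lambda>n \<omega>. \<forall>i\<in>I. P i n \<omega>)"
  using fin P
proof (induction I rule: finite_induct)
  case empty
  show ?case
  proof (rule whpI[OF ps])
    fix \<eta> :: real assume eta: "0 < \<eta>"
    show "\<forall>\<^sub>F n in sequentially. \<exists>B\<in>sets (M n). B \<subseteq> {\<omega> \<in> space (M n). \<forall>i\<in>{}. P i n \<omega>} \<and> 1 - \<eta> \<le> measure (M n) B"
      using eventually_gt_at_top[of 0]
    proof eventually_elim
      case (elim n)
      interpret prob_space "M n" using ps elim by blast
      show ?case using eta prob_space by (intro bexI[of _ "space (M n)"]) auto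
    qed
  qed
next
  case (insert i I)
  have "whp M (\<lambda>n \<omega>. P i n \<omega> \<and> (\<forall>j\<in>I. P j n \<omega>))"
    using insert by (intro whp_conj[OF ps]) auto
  then show ?case by simp
qed

lemma prob_space_poisson_models: "\<forall>n>0. prob_space (poisson_model n)"
  using prob_space_poisson_model by blast

text \<open>The coupling event is built from configurations that are spread and have the desired
  property. The former fails with probability O(1/n), the latter is supplied by
  \<open>evolves\<close> with a horizon eight slots beyond the slot of \<open>t\<close>.\<close>

lemma whp_giant_like:
  assumes ev: "evolves (Suc k) \<rho>" and t: "0 \<le> t" and eps: "0 < \<epsilon>"
  shows "whp poisson_model (\<lambda>n \<omega>. giant_like \<epsilon> n (\<rho> t) (connected_in (Gt (Suc k) n \<omega> t)))"
proof (rule whpI[OF prob_space_poisson_models])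
  fix \<eta> :: real assume "0 < \<eta>"
  then have h: "0 < \<eta> / 2" by simp
  have "\<forall>\<^sub>F n in sequentially. \<forall>N\<ge>slotn n t. random_subset.rex (rate n) (slots n N)
       (\<lambda>S. of_bool (\<not> giant_like \<epsilon> n (\<rho> t) (level (Suc k) S (slotn n t)))) \<le> \<eta> / 2"
    using ev t eps h unfolding evolves_def by blast
  then show "\<forall>\<^sub>F n in sequentially. \<exists>B\<in>sets (poisson_model n).
    B \<subseteq> {\<omega> \<in> space (poisson_model n). giant_like \<epsilon> n (\<rho> t) (connected_in (Gt (Suc k) n \<omega> t))} \<and>
    1 - \<eta> \<le> measure (poisson_model n) B"
    using eventually_inverse_small(1)[OF h, of "(t + 8) ^ 3 + 4 * (t + 8) + 12"] eventually_gt_at_top[of 0]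
  proof eventually_elim
    case (elim n)
    interpret random_subset "rate n" by (rule random_subset_rate)
    let ?N = "slotn n t + 8"
    define Q where "Q S \<longleftrightarrow> spread (slotn n t) S \<and> giant_like \<epsilon> n (\<rho> t) (level (Suc k) S (slotn n t))" for S
    obtain B where B: "B \<in> sets (poisson_model n)"
      "measure (poisson_model n) B = rex (slots n ?N) (\<lambda>S. of_bool (Q S))"
      "\<And>\<omega>. \<omega> \<in> B \<Longrightarrow> (\<forall>e. 0 < \<omega> e) \<and> (\<exists>S\<subseteq>slots n ?N. Q S \<and> \<omega> \<in> gapbox n ?N S)"
      using ex_coupling_event[OF elim(3), of ?N Q] by blast
    have "1 - (\<eta> / 2 + \<eta> / 2) \<le> 1 - (rex (slots n ?N) (\<lambda>S. of_bool (\<not> spread (slotn n t) S))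
        + rex (slots n ?N) (\<lambda>S. of_bool (\<not> giant_like \<epsilon> n (\<rho> t) (level (Suc k) S (slotn n t)))))"
      using elim(1) order_trans[OF prob_not_spread[OF elim(3) t] elim(2)]
      by (intro diff_left_mono add_mono) auto
    also have "\<dots> = rex (slots n ?N) (\<lambda>S. 1 - (of_bool (\<not> spread (slotn n t) S)
        + of_bool (\<not> giant_like \<epsilon> n (\<rho> t) (level (Suc k) S (slotn n t)))))"
      by (simp only: rex_diff rex_add rex_const[OF finite_slots])
    also have "\<dots> \<le> rex (slots n ?N) (\<lambda>S. of_bool (Q S))"
      by (rule rex_mono) (simp add: Q_def of_bool_def)
    finally have "1 - \<eta> \<le> measure (poisson_model n) B" unfolding B(2) by simp
    moreover have "giant_like \<epsilon> n (\<rho> t) (connected_in (Gt (Suc k) n \<omega> t))" if om: "\<omega> \<in> B" for \<omega>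
    proof -
      obtain S where S: "S \<subseteq> slots n ?N" "Q S" "\<omega> \<in> gapbox n ?N S" and pos: "\<And>e. 0 < \<omega> e"
        using B(3)[OF om] by blast
      have "connected_in (Gt (Suc k) n \<omega> t) = level (Suc k) S (slotn n t)"
        by (rule connected_in_Gt[OF elim(3) t refl S(1) _ pos S(3)]) (use S(2) in \<open>simp add: Q_def\<close>)
      then show ?thesis using S(2) by (simp only: Q_def)
    qed
    ultimately show ?case using B(1) by (intro bexI[of _ B]) (auto simp: space_poisson_model)
  qed
qed

text \<open>The exponential tail is part of the induction because it turns the next
  \<open>rho\<close> into a distribution function. Layer 0 is connected from the start, so its
  joining times are 0 and its law is the point mass there.\<close>

lemma ex_limit_law:
  "\<exists>M b B. real_distribution M \<and> evolves k (cdf M) \<and> 0 < b \<and> 0 \<le> B \<and>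
    (\<forall>t\<ge>0. 1 - cdf M t \<le> B * exp (- b * t))"
proof (induction k)
  case 0
  have rd: "real_distribution (return borel (0 :: real))"
    by (auto simp: real_distribution_def real_distribution_axioms_def intro: prob_space_return)
  have c: "cdf (return borel 0) t = 1" if "0 \<le> t" for t :: real
    using that by (simp add: cdf_def measure_return)
  show ?case
  proof (intro exI conjI allI impI)
    show "real_distribution (return borel (0 :: real))" by (rule rd)
    show "evolves 0 (cdf (return borel 0))" by (rule evolves_0[OF c])
    show "1 - cdf (return borel 0) t \<le> 1 * exp (- 1 * t)" if "0 \<le> t" for t :: real
      using c[OF that] by simp
  qed auto
next
  case (Suc k)
  then obtain M b B where M: "real_distribution M" "evolves k (cdf M)" "0 < b" "0 \<le> B"
    "\<And>t. 0 \<le> t \<Longrightarrow> 1 - cdf M t \<le> B * exp (- b * t)" by blast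
  interpret M: real_distribution M by (rule M(1))
  obtain N where N: "real_distribution N" "cdf N = M.rho"
    using M.ex_next_distribution[OF M(3,4,5)] by blast
  obtain b' B' where b': "0 < b'" "0 < B'" "\<And>t. 0 \<le> t \<Longrightarrow> 1 - M.rho t \<le> B' * exp (- b' * t)"
    using M.rho_exp_tail[OF M(3,4,5)] by blast
  have "evolves (Suc k) (cdf N)" unfolding N(2) by (rule evolves_Suc[OF M(1,2)])
  then show ?case using N b' by (intro exI[of _ N] exI[of _ b'] exI[of _ B']) auto
qed

section \<open>Component sizes\<close>

text \<open>\<open>Csize\<close> sees only the multiset of sizes. The list names components behind
  the sizes, which keeps ties harmless.\<close>

lemma Csize_list:
  assumes "finite V"
  obtains cs where "distinct cs" "set cs = components V E"
    "\<And>i j. i \<le> j \<Longrightarrow> j < length cs \<Longrightarrow> card (cs ! j) \<le> card (cs ! i)"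
    "\<And>i. Csize i V E = (if 1 \<le> i \<and> i \<le> length cs then card (cs ! (i - 1)) else 0)"
proof -
  have "finite (components V E)" using assms by (simp add: components_def)
  then obtain l where l: "set l = components V E" "distinct l" using finite_distinct_list by blast
  define cs where "cs = rev (sort_key card l)"
  have "mset_set (components V E) = mset l" using mset_set_set[OF l(2)] l(1) by simp
  then have "sorted_list_of_multiset (image_mset card (mset_set (components V E))) = sort (map card l)"
    by (simp add: sorted_list_of_multiset_mset flip: mset_map)
  also have "\<dots> = map card (sort_key card l)"
    by (rule properties_for_sort) simp_all
  finally have xs: "rev (sorted_list_of_multiset (image_mset card (mset_set (components V E)))) = map card cs"
    by (simp add: cs_def rev_map)
  show ?thesis
  proof (rule that[of cs])
    show "distinct cs" "set cs = components V E" using l by (simp_all add: cs_def)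
    show "card (cs ! j) \<le> card (cs ! i)" if "i \<le> j" "j < length cs" for i j
    proof -
      have "sorted (rev (map card cs))" by (simp add: cs_def rev_map)
      then have "map card cs ! j \<le> map card cs ! i"
        using that by (intro sorted_rev_nth_mono) auto
      then show ?thesis using that by simp
    qed
    show "Csize i V E = (if 1 \<le> i \<and> i \<le> length cs then card (cs ! (i - 1)) else 0)" for i
      unfolding Csize_def xs Let_def by auto
  qed
qed

lemma card_component_le_Csize:
  assumes "finite V" "D \<in> components V E"
  shows "card D \<le> Csize 1 V E"
proof -
  obtain cs where cs: "distinct cs" "set cs = components V E"
    "\<And>i j. i \<le> j \<Longrightarrow> j < length cs \<Longrightarrow> card (cs ! j) \<le> card (cs ! i)"
    "\<And>i. Csize i V E = (if 1 \<le> i \<and> i \<le> length cs then card (cs ! (i - 1)) else 0)"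
    using Csize_list[OF assms(1), of E] by blast
  obtain i where "i < length cs" "cs ! i = D" using assms cs(2) by (metis in_set_conv_nth)
  then show ?thesis using cs(3)[of 0 i] cs(4)[of 1] by auto
qed

lemma Csize_1_attained:
  assumes "finite V" "V \<noteq> {}"
  shows "\<exists>v\<in>V. card (component V E v) = Csize 1 V E"
proof -
  obtain cs where cs: "distinct cs" "set cs = components V E"
    "\<And>i j. i \<le> j \<Longrightarrow> j < length cs \<Longrightarrow> card (cs ! j) \<le> card (cs ! i)"
    "\<And>i. Csize i V E = (if 1 \<le> i \<and> i \<le> length cs then card (cs ! (i - 1)) else 0)"
    using Csize_list[OF assms(1), of E] by blast
  have "set cs \<noteq> {}" unfolding cs(2) components_def using assms by auto
  then have len: "0 < length cs" by auto
  then have "cs ! 0 \<in> components V E" using cs(2) nth_mem by blast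
  then show ?thesis using cs(4)[of 1] len by (auto simp: components_def)
qed

lemma Csize_2_pair:
  assumes "finite V" "D \<in> components V E" "D' \<in> components V E" "D \<noteq> D'"
  shows "card D \<le> Csize 2 V E \<or> card D' \<le> Csize 2 V E"
proof -
  obtain cs where cs: "distinct cs" "set cs = components V E"
    "\<And>i j. i \<le> j \<Longrightarrow> j < length cs \<Longrightarrow> card (cs ! j) \<le> card (cs ! i)"
    "\<And>i. Csize i V E = (if 1 \<le> i \<and> i \<le> length cs then card (cs ! (i - 1)) else 0)"
    using Csize_list[OF assms(1), of E] by blast
  obtain i j where ij: "i < length cs" "cs ! i = D" "j < length cs" "cs ! j = D'"
    using assms(2,3) cs(2) by (metis in_set_conv_nth)
  then have "i \<noteq> j" using assms(4) by auto
  then have "1 \<le> i \<or> 1 \<le> j" by auto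
  then show ?thesis using cs(3)[of 1 i] cs(3)[of 1 j] cs(4)[of 2] ij by auto
qed

lemma Csize_2_witness:
  assumes "finite V" "Csize 2 V E \<noteq> 0"
  shows "\<exists>D\<in>components V E. \<exists>D'\<in>components V E. D \<noteq> D' \<and> card D = Csize 1 V E \<and> card D' = Csize 2 V E"
proof -
  obtain cs where cs: "distinct cs" "set cs = components V E"
    "\<And>i j. i \<le> j \<Longrightarrow> j < length cs \<Longrightarrow> card (cs ! j) \<le> card (cs ! i)"
    "\<And>i. Csize i V E = (if 1 \<le> i \<and> i \<le> length cs then card (cs ! (i - 1)) else 0)"
    using Csize_list[OF assms(1), of E] by blast
  have len: "2 \<le> length cs" using assms(2) cs(4)[of 2] by (auto split: if_splits)
  have "cs ! 0 \<noteq> cs ! 1"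
  proof
    assume "cs ! 0 = cs ! 1"
    then have "(0::nat) = 1" using nth_eq_iff_index_eq[OF cs(1), of 0 1] len by linarith
    then show False by simp
  qed
  moreover have "cs ! 0 \<in> components V E" "cs ! 1 \<in> components V E"
    unfolding cs(2)[symmetric] using len by (auto intro!: nth_mem)
  moreover have "card (cs ! 0) = Csize 1 V E" "card (cs ! 1) = Csize 2 V E"
    using cs(4)[of 1] cs(4)[of 2] len by auto
  ultimately show ?thesis by blast
qed

lemma components_disjoint:
  "C \<in> components V E \<Longrightarrow> D \<in> components V E \<Longrightarrow> C \<noteq> D \<Longrightarrow> C \<inter> D = {}"
  unfolding components_def by (rule component_disjoint)

lemma Csize_1_add_2_le:
  assumes "finite V" "V \<noteq> {}"
  shows "Csize 1 V E + Csize 2 V E \<le> card V"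
proof (cases "Csize 2 V E = 0")
  case True
  obtain v where "v \<in> V" "card (component V E v) = Csize 1 V E" using Csize_1_attained[OF assms] by blast
  then show ?thesis using True card_mono[OF assms(1) component_subset[of V E v]] by simp
next
  case False
  obtain D D' where D: "D \<in> components V E" "D' \<in> components V E" "D \<noteq> D'"
    "card D = Csize 1 V E" "card D' = Csize 2 V E"
    using Csize_2_witness[OF assms(1) False] by blast
  have sub: "D \<subseteq> V" "D' \<subseteq> V" using D component_subset by (auto simp: components_def)
  have "card D + card D' = card (D \<union> D')"
    using components_disjoint[OF D(1,2,3)] finite_subset[OF sub(1) assms(1)] finite_subset[OF sub(2) assms(1)]
    by (intro card_Un_disjoint[symmetric])
  also have "\<dots> \<le> card V" using sub assms by (intro card_mono) auto
  finally show ?thesis using D by simp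
qed

lemma bigset_connected_in:
  "bigset \<epsilon> n (connected_in E) = {v \<in> {..<n}. \<epsilon> * n < card (component {..<n} E v)}"
  by (simp add: bigset_def component_def)

lemma Csize_2_le_1:
  assumes "finite V" "V \<noteq> {}"
  shows "Csize 2 V E \<le> Csize 1 V E"
proof (cases "Csize 2 V E = 0")
  case False
  then obtain D' where "D' \<in> components V E" "card D' = Csize 2 V E"
    using Csize_2_witness[OF assms(1)] by blast
  then show ?thesis using card_component_le_Csize[OF assms(1)] by metis
qed simp

text \<open>If the largest component has more than \<epsilon> n vertices, it is the whole large set.
  Otherwise that set is empty, so r is at most 2 \<epsilon> and the largest component adds at most
  \<epsilon>.\<close>

lemma giant_like_Csize_1:
  fixes \<epsilon> r :: real
  assumes g: "giant_like \<epsilon> n r (connected_in E)" and n: "0 < n" and eps: "0 < \<epsilon>"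
  shows "\<bar>Csize 1 {..<n} E / n - r\<bar> \<le> 3 * \<epsilon>"
proof -
  let ?V = "{..<n}" and ?B = "bigset \<epsilon> n (connected_in E)"
  have V: "finite ?V" "?V \<noteq> {}" using n by auto
  obtain v where v: "v \<in> ?V" "card (component ?V E v) = Csize 1 ?V E" using Csize_1_attained[OF V] by blast
  show ?thesis
  proof (cases "\<epsilon> * n < Csize 1 ?V E")
    case True
    then have vB: "v \<in> ?B" using v by (simp add: bigset_connected_in)
    have "?B = component ?V E v"
    proof
      show "?B \<subseteq> component ?V E v"
      proof
        fix u assume u: "u \<in> ?B"
        have "connected_in E v u" using g vB u unfolding giant_like_def by blast
        moreover have "u \<in> ?V" using u by (simp add: bigset_def)
        ultimately show "u \<in> component ?V E v" by (simp add: component_def)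
      qed
      show "component ?V E v \<subseteq> ?B"
      proof
        fix u assume u: "u \<in> component ?V E v"
        then have "u \<in> ?V" "connected_in E v u" by (auto simp: component_def)
        then have "component ?V E u = component ?V E v" using v(1) component_eq_iff[of v ?V u E] by simp
        then show "u \<in> ?B" using \<open>u \<in> ?V\<close> v True by (simp add: bigset_connected_in)
      qed
    qed
    then have "card ?B = Csize 1 ?V E" using v by simp
    then show ?thesis using g eps by (simp add: giant_like_def)
  next
    case False
    have "?B = {}"
    proof (rule ccontr)
      assume "?B \<noteq> {}"
      then obtain u where u: "u \<in> ?V" "\<epsilon> * n < card (component ?V E u)" by (auto simp: bigset_connected_in)
      then have "card (component ?V E u) \<le> Csize 1 ?V E"
        using card_component_le_Csize[OF V(1), of "component ?V E u"] by (auto simp: components_def)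
      then show False using u False by linarith
    qed
    then have "\<bar>r\<bar> \<le> 2 * \<epsilon>" using g by (simp add: giant_like_def)
    moreover have "0 \<le> Csize 1 ?V E / real n" by simp
    moreover have "Csize 1 ?V E / real n \<le> \<epsilon>" using False n by (simp add: divide_le_eq)
    ultimately show ?thesis by linarith
  qed
qed

lemma component_mono: "E \<subseteq> F \<Longrightarrow> component V E v \<subseteq> component V F v"
  unfolding component_def using connected_in_mono by blast

lemma Csize_1_mono:
  assumes "finite V" "V \<noteq> {}" "E \<subseteq> F"
  shows "Csize 1 V E \<le> Csize 1 V F"
proof -
  obtain v where v: "v \<in> V" "card (component V E v) = Csize 1 V E" using Csize_1_attained[OF assms(1,2)] by blast
  have "finite (component V F v)" using component_subset finite_subset assms(1) by metis
  then have "card (component V E v) \<le> card (component V F v)" by (intro card_mono component_mono assms)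
  also have "\<dots> \<le> Csize 1 V F"
    using v(1) by (intro card_component_le_Csize assms) (simp add: components_def)
  finally show ?thesis using v by simp
qed

text \<open>If the second component exceeds \<epsilon> n, then both it and the largest one end up in
  the large set of the later graph, hence in one component. The growth of the largest component thus
  bounds the second one at times where nothing is known directly.\<close>

lemma Csize_1_add_2_le_later:
  fixes \<epsilon> r :: real
  assumes g: "giant_like \<epsilon> n r (connected_in F)" and n: "0 < n" and eps: "0 < \<epsilon>" and EF: "E \<subseteq> F"
    and big: "\<epsilon> * n < Csize 2 {..<n} E"
  shows "Csize 1 {..<n} E + Csize 2 {..<n} E \<le> Csize 1 {..<n} F"
proof -
  let ?V = "{..<n}"
  have V: "finite ?V" "?V \<noteq> {}" using n by auto
  have "0 \<le> \<epsilon> * n" using eps by simp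
  then have "Csize 2 ?V E \<noteq> 0" using big by auto
  then obtain D D' where D: "D \<in> components ?V E" "D' \<in> components ?V E" "D \<noteq> D'"
    "card D = Csize 1 ?V E" "card D' = Csize 2 ?V E"
    using Csize_2_witness[OF V(1)] by blast
  obtain u v where uv: "u \<in> ?V" "v \<in> ?V" "D = component ?V E u" "D' = component ?V E v"
    using D by (auto simp: components_def)
  have fin: "finite (component ?V X w)" for X w using component_subset finite_subset V(1) by metis
  have "card D \<le> card (component ?V F u)" "card D' \<le> card (component ?V F v)"
    unfolding uv by (intro card_mono fin component_mono EF)+
  then have "u \<in> bigset \<epsilon> n (connected_in F)" "v \<in> bigset \<epsilon> n (connected_in F)"
    using uv D big Csize_2_le_1[OF V, of E] by (auto simp: bigset_connected_in)
  then have "connected_in F u v" using g unfolding giant_like_def by blast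
  then have "component ?V F u = component ?V F v" using component_eq_iff uv by metis
  then have "D \<union> D' \<subseteq> component ?V F u" unfolding uv using component_mono[OF EF] by blast
  then have "card (D \<union> D') \<le> card (component ?V F u)" by (intro card_mono fin)
  also have "\<dots> \<le> Csize 1 ?V F" using uv by (intro card_component_le_Csize V) (simp add: components_def)
  also have "card (D \<union> D') = card D + card D'"
    using components_disjoint[OF D(1,2,3)] uv fin by (intro card_Un_disjoint) auto
  finally show ?thesis using D by simp
qed

section \<open>Unique and permanent giants\<close>

lemma ugiant_eqI:
  assumes V: "finite V" and v: "v \<in> V" and gt: "Csize 2 V E < card (component V E v)"
  shows "ugiant V E = component V E v"
proof -
  let ?C = "component V E v"
  have C: "?C \<in> components V E" using v by (simp add: components_def)
  have lt: "card D < card ?C" if "D \<in> components V E" "D \<noteq> ?C" for D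
    using Csize_2_pair[OF V that(1) C that(2)] gt by auto
  have U: "is_ugiant V E ?C" unfolding is_ugiant_def using C lt by blast
  have "C' = ?C" if "is_ugiant V E C'" for C'
  proof (rule ccontr)
    assume "C' \<noteq> ?C"
    then have "card ?C < card C'" "card C' < card ?C" using that C lt by (auto simp: is_ugiant_def)
    then show False by simp
  qed
  with U have "(THE C. is_ugiant V E C) = ?C" by (intro the_equality)
  then show ?thesis unfolding ugiant_def using U by auto
qed

lemma card_ugiant_le:
  assumes "finite V"
  shows "card (ugiant V E) \<le> Csize 1 V E"
proof (cases "\<exists>C. is_ugiant V E C")
  case True
  then obtain C where C: "is_ugiant V E C" by blast
  have "C' = C" if "is_ugiant V E C'" for C'
    using that C unfolding is_ugiant_def by (metis less_asym)
  with C have "(THE C. is_ugiant V E C) = C" by (intro the_equality)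
  then have "ugiant V E = C" unfolding ugiant_def using True by simp
  then show ?thesis using C card_component_le_Csize[OF assms] by (simp add: is_ugiant_def)
qed (simp add: ugiant_def)

lemma card_perm_giant_le:
  "finite V \<Longrightarrow> card (perm_giant G V t) \<le> Csize 1 V (G t)"
  unfolding perm_giant_def Let_def using card_ugiant_le[of V "G t"] by auto

text \<open>The largest component at \<open>t\<close> exceeds the second one of every later time, so
  the later component that contains it is the unique giant.\<close>

lemma perm_giant_nonempty:
  assumes V: "finite V" "V \<noteq> {}" and mono: "\<And>u. t \<le> u \<Longrightarrow> G t \<subseteq> G u"
    and C2: "\<And>u. t \<le> u \<Longrightarrow> Csize 2 V (G u) < Csize 1 V (G t)"
  shows "perm_giant G V t \<noteq> {}" "card (perm_giant G V t) = Csize 1 V (G t)"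
proof -
  obtain v where v: "v \<in> V" "card (component V (G t) v) = Csize 1 V (G t)" using Csize_1_attained[OF V] by blast
  have fin: "finite (component V E w)" for E w using component_subset finite_subset V(1) by metis
  have U: "ugiant V (G u) = component V (G u) v" "component V (G t) v \<subseteq> component V (G u) v" if "t \<le> u" for u
  proof -
    show sub: "component V (G t) v \<subseteq> component V (G u) v" by (rule component_mono[OF mono[OF that]])
    have "Csize 2 V (G u) < card (component V (G t) v)" using C2[OF that] v by simp
    also have "\<dots> \<le> card (component V (G u) v)" by (rule card_mono[OF fin sub])
    finally show "ugiant V (G u) = component V (G u) v" by (rule ugiant_eqI[OF V(1) v(1)])
  qed
  have "v \<in> component V (G t) v" using v by (simp add: component_def)
  then have "perm_giant G V t = component V (G t) v"
    unfolding perm_giant_def Let_def using U by auto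
  then show "perm_giant G V t \<noteq> {}" "card (perm_giant G V t) = Csize 1 V (G t)"
    using v \<open>v \<in> component V (G t) v\<close> by auto
qed

lemma Gt_mono: "t \<le> u \<Longrightarrow> Gt k n \<omega> t \<subseteq> Gt k n \<omega> u"
  unfolding Gt_def by auto

text \<open>Monotonicity in time turns control at finitely many times into uniform control.\<close>

lemma Csize_uniform:
  fixes \<rho> :: "real \<Rightarrow> real" and \<delta> T :: real and G :: "real \<Rightarrow> edge set" and m n :: nat
  assumes n: "0 < n" and \<delta>: "0 < \<delta>" and T: "0 < T" and m: "0 < m"
    and mono: "\<And>t u. t \<le> u \<Longrightarrow> \<rho> t \<le> \<rho> u" and le1: "\<And>t. \<rho> t \<le> 1"
    and osc: "\<And>j. j < m \<Longrightarrow> \<rho> (real (Suc j) * T / m) - \<rho> (real j * T / m) \<le> \<delta>" and tail: "1 - \<rho> T \<le> \<delta>"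
    and G: "\<And>t u. t \<le> u \<Longrightarrow> G t \<subseteq> G u"
    and g: "\<And>j. j \<le> m \<Longrightarrow> giant_like \<delta> n (\<rho> (real j * T / m)) (connected_in (G (real j * T / m)))"
    and t: "0 \<le> t"
  shows "\<bar>Csize 1 {..<n} (G t) / n - \<rho> t\<bar> \<le> 8 * \<delta> \<and> Csize 2 {..<n} (G t) / n \<le> 8 * \<delta>"
proof -
  let ?V = "{..<n}"
  let ?c1 = "\<lambda>t. real (Csize 1 ?V (G t)) / n" and ?c2 = "\<lambda>t. real (Csize 2 ?V (G t)) / n"
  define s where "s j = real j * T / m" for j
  have V: "finite ?V" "?V \<noteq> {}" using n by auto
  have c1mono: "?c1 a \<le> ?c1 b" if "a \<le> b" for a b
    using Csize_1_mono[OF V G[OF that]] by (intro divide_right_mono) auto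
  have pt: "\<bar>?c1 (s j) - \<rho> (s j)\<bar> \<le> 3 * \<delta>" if "j \<le> m" for j
    unfolding s_def by (rule giant_like_Csize_1[OF g[OF that] n \<delta>])
  show ?thesis
  proof (cases "T \<le> t")
    case True
    have sm: "s m = T" using m by (simp add: s_def)
    \<comment> \<open>From T on the largest component leaves at most 4 \<delta> n vertices for the
      second one.\<close>
    have "1 - 4 * \<delta> \<le> ?c1 T" using pt[of m] tail unfolding sm by simp
    then have low: "1 - 4 * \<delta> \<le> ?c1 t" using c1mono[OF True] by linarith
    have "?c1 t + ?c2 t \<le> 1"
    proof -
      have "real (Csize 1 ?V (G t)) + real (Csize 2 ?V (G t)) \<le> real n"
        using Csize_1_add_2_le[OF V, of "G t"] by simp
      then show ?thesis using n by (simp add: add_divide_distrib[symmetric] divide_le_eq)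
    qed
    moreover have "0 \<le> ?c2 t" by simp
    moreover have "1 - \<delta> \<le> \<rho> t" using mono[OF True] tail by linarith
    ultimately show ?thesis using low le1[of t] \<delta> by linarith
  next
    case False
    define j where "j = nat \<lfloor>t * m / T\<rfloor>"
    have q: "0 \<le> t * m / T" using t T by simp
    have jb: "real j \<le> t * m / T" "t * m / T < real (Suc j)" unfolding j_def using q by linarith+
    have "t * m / T < m" using False T m by (simp add: divide_less_eq)
    then have jm: "j < m" using jb by linarith
    have st: "s j \<le> t" "t \<le> s (Suc j)"
      using jb T m unfolding s_def by (simp_all add: field_simps)
    have o: "\<rho> (s (Suc j)) - \<rho> (s j) \<le> \<delta>" using osc[OF jm] by (simp add: s_def)
    have p1: "\<bar>?c1 (s j) - \<rho> (s j)\<bar> \<le> 3 * \<delta>" and p2: "\<bar>?c1 (s (Suc j)) - \<rho> (s (Suc j))\<bar> \<le> 3 * \<delta>"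
      using pt[of j] pt[of "Suc j"] jm by auto
    have r: "\<rho> (s j) \<le> \<rho> t" "\<rho> t \<le> \<rho> (s (Suc j))" using mono st by auto
    have c: "?c1 (s j) \<le> ?c1 t" "?c1 t \<le> ?c1 (s (Suc j))" using c1mono st by auto
    \<comment> \<open>A large second component is bounded by the growth of the largest one up to the
      next grid point: 3 \<delta> for each of the two approximations and \<delta> for the
      oscillation of \<rho>.\<close>
    have "?c2 t \<le> 8 * \<delta>"
    proof (cases "\<delta> * n < Csize 2 ?V (G t)")
      case True
      have "Csize 1 ?V (G t) + Csize 2 ?V (G t) \<le> Csize 1 ?V (G (s (Suc j)))"
        using Csize_1_add_2_le_later[OF g[of "Suc j"] n \<delta> G True] jm st(2) by (simp add: s_def)
      then have "real (Csize 1 ?V (G t)) + real (Csize 2 ?V (G t)) \<le> Csize 1 ?V (G (s (Suc j)))" by linarith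
      then have "?c1 t + ?c2 t \<le> ?c1 (s (Suc j))"
        unfolding add_divide_distrib[symmetric] by (rule divide_right_mono) simp
      then show ?thesis using c o p1 p2 by linarith
    next
      case False
      then have "?c2 t \<le> \<delta>" using n by (simp add: divide_le_eq)
      then show ?thesis using \<delta> by linarith
    qed
    moreover have "\<bar>?c1 t - \<rho> t\<bar> \<le> 8 * \<delta>" using c o p1 p2 r \<delta> by linarith
    ultimately show ?thesis by blast
  qed
qed

lemma ex_time_grid:
  fixes \<rho> :: "real \<Rightarrow> real"
  assumes cont: "continuous_on {0..} \<rho>" and lim: "(\<rho> \<longlongrightarrow> 1) at_top" and \<delta>: "0 < \<delta>"
  shows "\<exists>T m. 0 < T \<and> 0 < (m :: nat) \<and> 1 - \<rho> T \<le> \<delta> \<and>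
    (\<forall>j<m. \<rho> (real (Suc j) * T / m) - \<rho> (real j * T / m) \<le> \<delta>)"
proof -
  have "\<forall>\<^sub>F t in at_top. 1 - \<delta> < \<rho> t" using lim by (rule order_tendstoD) (use \<delta> in simp)
  then have "\<forall>\<^sub>F t in at_top. 1 - \<delta> < \<rho> t \<and> 0 < t" using eventually_gt_at_top[of 0] by eventually_elim simp
  then obtain T where T: "1 - \<delta> < \<rho> T" "0 < T" by (auto simp: eventually_at_top_linorder)
  have "uniformly_continuous_on {0..T} \<rho>"
    by (rule compact_uniformly_continuous[OF continuous_on_subset[OF cont]]) auto
  then obtain d where d: "0 < d" "\<And>x y. x \<in> {0..T} \<Longrightarrow> y \<in> {0..T} \<Longrightarrow> dist y x < d \<Longrightarrow> dist (\<rho> y) (\<rho> x) < \<delta>"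
    unfolding uniformly_continuous_on_def using \<delta> by blast
  obtain m :: nat where m: "T / d < m" using reals_Archimedean2 by blast
  have "0 < T / d" using T d by simp
  then have m0: "0 < real m" using m by linarith
  have step: "T / m < d" using m d m0 by (simp add: field_simps)
  have "\<rho> (real (Suc j) * T / m) - \<rho> (real j * T / m) \<le> \<delta>" if "j < m" for j
  proof -
    have "real (Suc j) * T / m - real j * T / m = T / m"
      by (simp add: diff_divide_distrib[symmetric] left_diff_distrib[symmetric])
    then have "dist (real (Suc j) * T / m) (real j * T / m) < d"
      using step T m0 by (simp add: dist_real_def)
    moreover have "real (Suc j) * T / m \<in> {0..T}" "real j * T / m \<in> {0..T}"
      using that T m0 by (auto simp: divide_le_eq mult.commute mult_left_mono)
    ultimately have "dist (\<rho> (real (Suc j) * T / m)) (\<rho> (real j * T / m)) < \<delta>" using d(2) by blast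
    then show ?thesis by (simp add: dist_real_def)
  qed
  then show ?thesis using T m0 by (intro exI[of _ T] exI[of _ m]) auto
qed

theorem theorem2p1:
  fixes k :: nat
  assumes "k \<ge> 1"
  shows "\<exists>(\<rho>::real \<Rightarrow> real) (\<sigma>::real) (b::real) (B::real).
    continuous_on {0..} \<rho> \<and> mono_on {0..} \<rho> \<and> (\<forall>t\<ge>0. 0 \<le> \<rho> t \<and> \<rho> t \<le> 1) \<and>
    (\<forall>\<epsilon>>0. whp poisson_model (\<lambda>n \<omega>. \<forall>t\<ge>0.
        \<rho> t - \<epsilon> \<le> real (Csize 1 {..<n} (Gt k n \<omega> t)) / real n \<and>
        real (Csize 1 {..<n} (Gt k n \<omega> t)) / real n \<le> \<rho> t + \<epsilon>)) \<and>
    (\<forall>\<epsilon>>0. whp poisson_model (\<lambda>n \<omega>. \<forall>t\<ge>0.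
        real (Csize 2 {..<n} (Gt k n \<omega> t)) / real n \<le> \<epsilon>)) \<and>
    \<sigma> > 0 \<and> (\<forall>t. 0 \<le> t \<and> t \<le> \<sigma> \<longrightarrow> \<rho> t = 0) \<and> (\<forall>t>\<sigma>. \<rho> t > 0) \<and>
    strict_mono_on {\<sigma>..} \<rho> \<and>
    b > 0 \<and> B > 0 \<and> (\<forall>t\<ge>0. 1 - \<rho> t \<le> B * exp (- b * t)) \<and> (\<rho> \<longlongrightarrow> 1) at_top \<and>
    (\<forall>t>\<sigma>. whp poisson_model (\<lambda>n \<omega>. perm_giant (Gt k n \<omega>) {..<n} t \<noteq> {})) \<and>
    (\<forall>t\<ge>0. \<forall>\<epsilon>>0. whp poisson_model (\<lambda>n \<omega>.
        \<bar>real (card (perm_giant (Gt k n \<omega>) {..<n} t)) / real n - \<rho> t\<bar> \<le> \<epsilon>))"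
proof -
  obtain k' where k: "k = Suc k'" using assms by (cases k) auto
  obtain M b0 B0 where M: "real_distribution M" "evolves k' (cdf M)" "0 < b0" "0 \<le> B0"
    "\<And>t. 0 \<le> t \<Longrightarrow> 1 - cdf M t \<le> B0 * exp (- b0 * t)"
    using ex_limit_law[of k'] by blast
  interpret M: real_distribution M by (rule M(1))
  have ev: "evolves (Suc k') M.rho" by (rule evolves_Suc[OF M(1,2)])
  obtain b B where bB: "0 < b" "0 < B" "\<And>t. 0 \<le> t \<Longrightarrow> 1 - M.rho t \<le> B * exp (- b * t)"
    using M.rho_exp_tail[OF M(3,4,5)] by blast
  have lim: "(M.rho \<longlongrightarrow> 1) at_top" using M.ex_next_distribution[OF M(3,4,5)] by blast
  obtain \<sigma> where \<sigma>: "0 < \<sigma>" "\<And>t. t \<le> \<sigma> \<Longrightarrow> M.rho t = 0" "\<And>t. \<sigma> < t \<Longrightarrow> 0 < M.rho t"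
    using M.ex_threshold by blast
  have cont: "continuous_on {0..} M.rho"
    using M.isCont_rho by (simp add: continuous_at_imp_continuous_on)
  let ?c1 = "\<lambda>n \<omega> t. real (Csize 1 {..<n} (Gt k n \<omega> t)) / real n"
  let ?c2 = "\<lambda>n \<omega> t. real (Csize 2 {..<n} (Gt k n \<omega> t)) / real n"
  \<comment> \<open>Serves (i), (ii) and (v) together: control on a finite grid holds with high
    probability, and the passage to all times is deterministic.\<close>
  have unif: "whp poisson_model (\<lambda>n \<omega>. \<forall>t\<ge>0. \<bar>?c1 n \<omega> t - M.rho t\<bar> \<le> \<epsilon> \<and> ?c2 n \<omega> t \<le> \<epsilon>)"
    if eps: "0 < \<epsilon>" for \<epsilon> :: real
  proof -
    define \<delta> where "\<delta> = \<epsilon> / 8"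
    have \<delta>: "0 < \<delta>" using eps by (simp add: \<delta>_def)
    obtain T m where T: "0 < T" "0 < (m :: nat)" "1 - M.rho T \<le> \<delta>"
      "\<And>j. j < m \<Longrightarrow> M.rho (real (Suc j) * T / m) - M.rho (real j * T / m) \<le> \<delta>"
      using ex_time_grid[OF cont lim \<delta>] by blast
    have "whp poisson_model (\<lambda>n \<omega>. \<forall>j\<in>{..m}. giant_like \<delta> n (M.rho (real j * T / m))
        (connected_in (Gt k n \<omega> (real j * T / m))))"
      unfolding k using T(1,2) \<delta>
      by (intro whp_ball_finite[OF prob_space_poisson_models] whp_giant_like[OF ev]) auto
    then show ?thesis
    proof (rule whp_mono[OF prob_space_poisson_models])
      show "\<forall>\<^sub>F n in sequentially. \<forall>\<omega>\<in>space (poisson_model n).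
        (\<forall>j\<in>{..m}. giant_like \<delta> n (M.rho (real j * T / m)) (connected_in (Gt k n \<omega> (real j * T / m)))) \<longrightarrow>
        (\<forall>t\<ge>0. \<bar>?c1 n \<omega> t - M.rho t\<bar> \<le> \<epsilon> \<and> ?c2 n \<omega> t \<le> \<epsilon>)"
        using eventually_gt_at_top[of 0]
      proof (eventually_elim, intro ballI impI allI)
        fix n :: nat and \<omega> and t :: real
        assume n: "0 < n" and t: "0 \<le> t"
          and g: "\<forall>j\<in>{..m}. giant_like \<delta> n (M.rho (real j * T / m)) (connected_in (Gt k n \<omega> (real j * T / m)))"
        have "\<bar>?c1 n \<omega> t - M.rho t\<bar> \<le> 8 * \<delta> \<and> ?c2 n \<omega> t \<le> 8 * \<delta>"
          by (rule Csize_uniform[OF n \<delta> T(1,2) M.rho_mono M.rho_bounds(2) T(4,3) Gt_mono _ t]) (use g in auto)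
        then show "\<bar>?c1 n \<omega> t - M.rho t\<bar> \<le> \<epsilon> \<and> ?c2 n \<omega> t \<le> \<epsilon>" by (simp add: \<delta>_def)
      qed
    qed
  qed
  \<comment> \<open>With accuracy \<rho>(t)/3 the second component has at most \<rho>(t) n / 3
    vertices at all times, fewer than the at least 2 \<rho>(t) n / 3 of the largest one at time
    t.\<close>
  have perm: "perm_giant (Gt k n \<omega>) {..<n} t \<noteq> {}"
    "card (perm_giant (Gt k n \<omega>) {..<n} t) = Csize 1 {..<n} (Gt k n \<omega> t)"
    if n: "0 < n" and t: "\<sigma> < t" and e: "e \<le> M.rho t / 3"
      and u: "\<forall>t\<ge>0. \<bar>?c1 n \<omega> t - M.rho t\<bar> \<le> e \<and> ?c2 n \<omega> t \<le> e" for n \<omega> t e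
  proof -
    have C2: "Csize 2 {..<n} (Gt k n \<omega> s) < Csize 1 {..<n} (Gt k n \<omega> t)" if "t \<le> s" for s
    proof -
      have "?c2 n \<omega> s \<le> e" "\<bar>?c1 n \<omega> t - M.rho t\<bar> \<le> e" using u that t \<sigma>(1) by auto
      then have "?c2 n \<omega> s < ?c1 n \<omega> t" using e \<sigma>(3)[OF t] by linarith
      then show ?thesis using n by (simp add: divide_less_cancel)
    qed
    show "perm_giant (Gt k n \<omega>) {..<n} t \<noteq> {}"
      "card (perm_giant (Gt k n \<omega>) {..<n} t) = Csize 1 {..<n} (Gt k n \<omega> t)"
      using perm_giant_nonempty[of "{..<n}" t "Gt k n \<omega>", OF _ _ Gt_mono C2] n by auto
  qed
  show ?thesis
  proof (intro exI conjI allI impI)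
    show "continuous_on {0..} M.rho" by (rule cont)
    show "mono_on {0..} M.rho" using M.rho_mono by (simp add: mono_on_def)
    show "0 \<le> M.rho t" "M.rho t \<le> 1" for t by (rule M.rho_bounds)+
    show "whp poisson_model (\<lambda>n \<omega>. \<forall>t\<ge>0. M.rho t - \<epsilon> \<le> ?c1 n \<omega> t \<and> ?c1 n \<omega> t \<le> M.rho t + \<epsilon>)"
      if "0 < \<epsilon>" for \<epsilon>
      using unif[OF that]
      by (rule whp_mono[OF prob_space_poisson_models]) (intro always_eventually allI ballI impI conjI; force simp: abs_le_iff)
    show "whp poisson_model (\<lambda>n \<omega>. \<forall>t\<ge>0. ?c2 n \<omega> t \<le> \<epsilon>)" if "0 < \<epsilon>" for \<epsilon>
      using unif[OF that]
      by (rule whp_mono[OF prob_space_poisson_models]) (intro always_eventually allI ballI impI; blast)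
    show "0 < \<sigma>" by (rule \<sigma>)
    show "M.rho t = 0" if "0 \<le> t \<and> t \<le> \<sigma>" for t using that \<sigma>(2) by blast
    show "0 < M.rho t" if "\<sigma> < t" for t by (rule \<sigma>(3)[OF that])
    show "strict_mono_on {\<sigma>..} M.rho"
    proof (rule strict_mono_onI)
      fix x y assume xy: "x \<in> {\<sigma>..}" "y \<in> {\<sigma>..}" "x < y"
      show "M.rho x < M.rho y"
      \<comment> \<open>At \<sigma> itself \<rho> vanishes, so \<open>rho_strict\<close> is
        available only to the right of it.\<close>
      proof (cases "x = \<sigma>")
        case True
        then show ?thesis using \<sigma>(2)[of x] \<sigma>(3)[of y] xy by simp
      next
        case False
        then show ?thesis using M.rho_strict[OF xy(3)] \<sigma>(3)[of x] xy by simp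
      qed
    qed
    show "0 < b" "0 < B" by (rule bB)+
    show "1 - M.rho t \<le> B * exp (- b * t)" if "0 \<le> t" for t by (rule bB(3)[OF that])
    show "(M.rho \<longlongrightarrow> 1) at_top" by (rule lim)
    show "whp poisson_model (\<lambda>n \<omega>. perm_giant (Gt k n \<omega>) {..<n} t \<noteq> {})" if t: "\<sigma> < t" for t
    proof -
      have "0 < M.rho t / 3" using \<sigma>(3)[OF t] by simp
      from unif[OF this] show ?thesis
      proof (rule whp_mono[OF prob_space_poisson_models])
        show "\<forall>\<^sub>F n in sequentially. \<forall>\<omega>\<in>space (poisson_model n).
          (\<forall>s\<ge>0. \<bar>?c1 n \<omega> s - M.rho s\<bar> \<le> M.rho t / 3 \<and> ?c2 n \<omega> s \<le> M.rho t / 3) \<longrightarrow>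
          perm_giant (Gt k n \<omega>) {..<n} t \<noteq> {}"
          using eventually_gt_at_top[of 0]
          by (eventually_elim, intro ballI impI) (rule perm(1)[OF _ t order_refl])
      qed
    qed
    show "whp poisson_model (\<lambda>n \<omega>. \<bar>real (card (perm_giant (Gt k n \<omega>) {..<n} t)) / real n - M.rho t\<bar> \<le> \<epsilon>)"
      if t: "0 \<le> t" and eps: "0 < \<epsilon>" for t \<epsilon>
    proof (cases "\<sigma> < t")
      case True
      define e where "e = min \<epsilon> (M.rho t / 3)"
      have e: "0 < e" "e \<le> \<epsilon>" "e \<le> M.rho t / 3" using eps \<sigma>(3)[OF True] by (auto simp: e_def)
      from unif[OF e(1)] show ?thesis
      proof (rule whp_mono[OF prob_space_poisson_models])
        show "\<forall>\<^sub>F n in sequentially. \<forall>\<omega>\<in>space (poisson_model n).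
          (\<forall>s\<ge>0. \<bar>?c1 n \<omega> s - M.rho s\<bar> \<le> e \<and> ?c2 n \<omega> s \<le> e) \<longrightarrow>
          \<bar>real (card (perm_giant (Gt k n \<omega>) {..<n} t)) / real n - M.rho t\<bar> \<le> \<epsilon>"
          using eventually_gt_at_top[of 0]
        proof (eventually_elim, intro ballI impI)
          fix n :: nat and \<omega>
          assume n: "0 < n" and u: "\<forall>s\<ge>0. \<bar>?c1 n \<omega> s - M.rho s\<bar> \<le> e \<and> ?c2 n \<omega> s \<le> e"
          have "\<bar>?c1 n \<omega> t - M.rho t\<bar> \<le> e" using u t by blast
          then show "\<bar>real (card (perm_giant (Gt k n \<omega>) {..<n} t)) / real n - M.rho t\<bar> \<le> \<epsilon>"
            unfolding perm(2)[OF n True e(3) u] using e(2) by linarith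
        qed
      qed
    next
      case False
      \<comment> \<open>Up to the threshold the permanent giant, empty or not, is no larger than the
        largest component, which has at most \<epsilon> n vertices.\<close>
      then have rho0: "M.rho t = 0" using \<sigma>(2) by simp
      from unif[OF eps] show ?thesis
      proof (rule whp_mono[OF prob_space_poisson_models])
        show "\<forall>\<^sub>F n in sequentially. \<forall>\<omega>\<in>space (poisson_model n).
          (\<forall>s\<ge>0. \<bar>?c1 n \<omega> s - M.rho s\<bar> \<le> \<epsilon> \<and> ?c2 n \<omega> s \<le> \<epsilon>) \<longrightarrow>
          \<bar>real (card (perm_giant (Gt k n \<omega>) {..<n} t)) / real n - M.rho t\<bar> \<le> \<epsilon>"
        proof (intro always_eventually allI ballI impI)
          fix n :: nat and \<omega>
          assume u: "\<forall>s\<ge>0. \<bar>?c1 n \<omega> s - M.rho s\<bar> \<le> \<epsilon> \<and> ?c2 n \<omega> s \<le> \<epsilon>"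
          have "?c1 n \<omega> t \<le> \<epsilon>" using u t rho0 by fastforce
          moreover have "real (card (perm_giant (Gt k n \<omega>) {..<n} t)) / real n \<le> ?c1 n \<omega> t"
            using card_perm_giant_le[of "{..<n}" "Gt k n \<omega>" t] by (intro divide_right_mono) auto
          moreover have "0 \<le> real (card (perm_giant (Gt k n \<omega>) {..<n} t)) / real n" by simp
          ultimately show "\<bar>real (card (perm_giant (Gt k n \<omega>) {..<n} t)) / real n - M.rho t\<bar> \<le> \<epsilon>"
            unfolding rho0 by linarith
        qed
      qed
    qed
  qed
qed

end
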